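(* Let $K$ be a finite-dimensional ribbon Hopf algebra over $\mathbb F$ and $\Gamma$ a ciliated ribbon graph with vertex set $V$ and edge set $E$. Assign to each vertex $v\in V$ an $R$-matrix $R_v$ of $K$, and let $\rho$ be a map that selects for each edge $e\in E$ one of its two edge ends $s(e),t(e)$. Let $\mathcal A_v^*$ be the associated vertex algebras and $G^*:K^{*\otimes E}\to\bigotimes_{v\in V}\mathcal A_v^*$ the injective linear map given by $$G^*\big((\alpha^1\otimes\cdots\otimes\alpha^{E})_{e_1\ldots e_{E}}\big)=(\alpha^1_{(1)}\otimes\alpha^1_{(2)}\otimes\cdots\otimes\alpha^{E}_{(1)}\otimes\alpha^{E}_{(2)})_{t(e_1)s(e_1)\ldots t(e_{E})s(e_{E})}.$$ Then the image of $G^*$ is a subalgebra and a $K^{\otimes V}$-submodule of $\bigotimes_{v\in V}\mathcal A_v^*$, and pulling back the algebra and $K^{\otimes V}$-module structure along $G^*$ equips $K^{*\otimes E}$ with the structure of the algebra of functions of a local $K$-valued Hopf algebra gauge theory on $\Gamma$.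
   Context: $\mathbb F$ is a field of characteristic zero; Sweedler notation without summation signs is used. $\langle\,,\rangle$ is the pairing of $K^*$ with $K$, extended to tensor powers. An $R$-matrix of $K$ is an invertible $R=R_{(1)}\otimes R_{(2)}\in K\otimes K$ with $R\,\Delta(h)=\Delta^{op}(h)\,R$, $(\Delta\otimes\mathrm{id})(R)=R_{13}R_{23}$, $(\mathrm{id}\otimes\Delta)(R)=R_{13}R_{12}$. With $u=S(R_{(2)})R_{(1)}$, $K$ is ribbon if there is a central invertible $\nu\in K$ with $uS(u)=\nu^2$, $\epsilon(\nu)=1$, $S(\nu)=\nu$, $\Delta(\nu)=R^{-1}R_{21}^{-1}(\nu\otimes\nu)$. For a finite set $X$, $W^{\otimes X}$ is the tensor power with one factor for each element of $X$; $(w^1\otimes\cdots\otimes w^k)_{x_1\ldots x_k}$ denotes the element with $w^j$ in the factor $x_j$ and $1$ in all others; $\pi_x$ denotes projection to the factor $x$, applying the counit to all others; $\iota_x(w)=(w)_x$, $\iota_{xy}(w\otimes w')=(w\otimes w')_{xy}$. A ciliated ribbon graph is a finite directed graph (loops and multiple edges allowed, vertices of valence $\ge1$) with a linear order of the incident edge ends at each vertex. An edge $e$ has starting vertex $\mathbf s(e)$, target vertex $\mathbf t(e)$, a starting end $s(e)$ at $\mathbf s(e)$ (outgoing) and a target end $t(e)$ at $\mathbf t(e)$ (incoming). Vertex algebras: for a vertex $v$ with $n$ incident edge ends numbered $1<\dots<n$, put $\tau(i)=0$ if the $i$th end is incoming, $\tau(i)=1$ if outgoing, $\sigma(i)=0$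 if the $i$th end is in the image of $\rho$ and $\sigma(i)=1$ otherwise, and $R=R_v$. $\mathcal A^*_v$ is $K^{*\otimes n}$ with unit $1^{\otimes n}$ and the associative multiplication determined by $\alpha^1\otimes\cdots\otimes\alpha^n=(\alpha^1)_1\cdots(\alpha^n)_n$; $(\alpha)_i\cdot(\beta)_i$ equals $\langle\beta_{(1)}\otimes\alpha_{(1)},R\rangle(\beta_{(2)}\alpha_{(2)})_i$ if $\sigma(i)=\tau(i)=0$, $\langle\beta_{(2)}\otimes\alpha_{(2)},R\rangle(\alpha_{(1)}\beta_{(1)})_i$ if $\sigma(i)=0,\tau(i)=1$, $(\alpha\beta)_i$ if $\sigma(i)=1,\tau(i)=0$, $(\beta\alpha)_i$ if $\sigma(i)=\tau(i)=1$; $(\alpha)_i\cdot(\beta)_j=(\alpha\otimes\beta)_{ij}$ for $i<j$ and $(\alpha)_i\cdot(\beta)_j=\langle\beta_{(1+\tau(j))}\otimes\alpha_{(1+\tau(i))},(S^{\tau(j)}\otimes S^{\tau(i)})(R)\rangle(\alpha_{(2-\tau(i))}\otimes\beta_{(2-\tau(j))})_{ij}$ for $i>j$. Its right $K$-module structure is $(\alpha^1\otimes\cdots\otimes\alpha^n)\lhd^*h=\langle S^{\tau(1)}(\alpha^1_{(1+\tau(1))})\cdots S^{\tau(n)}(\alpha^n_{(1+\tau(n))}),h\rangle\,\alpha^1_{(2-\tau(1))}\otimes\cdots\otimes\alpha^n_{(2-\tau(n))}$. Each $\mathcal A_v^*$ is a $K$-right module algebra, and $\bigotimes_v\mathcal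 A^*_v$ (tensor factors indexed by all edge ends) is the tensor product algebra with the induced $K^{\otimes V}$-right module algebra structure. A $K$-valued Hopf algebra gauge theory on $\Gamma$ consists of (1) the vector space $K^{\otimes E}$ and the Hopf algebra $K^{\otimes V}$; (2) an algebra structure on $K^{*\otimes E}$ (the algebra of functions) with unit $1^{\otimes E}$ such that $(\alpha)_e(\beta)_e\in\iota_e(K^* )$, $(\alpha)_e(\beta)_f\in\iota_{ef}(K^*\otimes K^* )$ for all $\alpha,\beta\in K^*$, $e,f\in E$, and $(\alpha)_e(\beta)_f=(\beta)_f(\alpha)_e=(\alpha\otimes\beta)_{ef}$ if $e,f$ have no common vertex; (3) a $K^{\otimes V}$-left module structure $\rhd$ on $K^{\otimes E}$ whose dual right module structure $\lhd^*$ on $K^{*\otimes E}$ ($\langle\alpha\lhd^*h,k\rangle=\langle\alpha,h\rhd k\rangle$) makes $K^{*\otimes E}$ a $K^{\otimes V}$-right module algebra, and such that for every $e$ with $\mathbf s(e)\neq\mathbf t(e)$, $v\notin\{\mathbf s(e),\mathbf t(e)\}$, $h,k\in K$: $\pi_e((h)_v\rhd(k)_e)=\epsilon(h)k$, $\pi_e((h)_{\mathbf t(e)}\rhd(k)_e)=hk$, $\pi_e((h)_{\mathbf s(e)}\rhd(k)_e)=kS(h)$. It is local if there are $K$-valued Hopf algebra gauge theories on all vertex neighbourhoods $\Gamma_v$ (the vertex $v$ with its edge ends, a univalent vertex placed at the free end of each, gauge transformations only at $v$), with function algebras $\mathcal A_v^*$ on $K^{*\otimes v}$, such that $G^*:K^{*\otimes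 E}\to\bigotimes_v\mathcal A^*_v$ is a homomorphism of $K^{\otimes V}$-module algebras. *)

theory Defs
  imports
    "HOL-Library.FuncSet"
    "HOL-Library.Function_Algebras"
    "Graph_Theory.Digraph"
begin

section \<open>Tensor powers of a finite-dimensional vector space and of its dual\<close>

text \<open>
  The underlying algebra of $K$ is given by the ring structure of the type
  \<^typ>\<open>'k\<close> together with the scalar multiplication; a basis is part of the
  data because the library locale \<^locale>\<open>finite_dimensional_vector_space\<close>
  carries one. The coproduct takes values in $K \otimes K$, which is
  $K^{\otimes\{1,2\}}$.

  For a finite set $X$ both $K^{\otimes X}$ and $K^{*\otimes X}$ are modelled as
  the free vector space on the families $b : X \to B$, with $B$ the basis of $K$;
  the family $b$ stands for $\bigotimes_x b_x$ in the first case and for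
  $\bigotimes_x b_x^*$, the product of elements of the dual basis, in the second.
  In this way the pairing of the two is the standard bilinear form, and an
  element of $K^{*\otimes X}$ is the restriction to the basis of the multilinear
  form on $K^X$ that it represents. The universal property is recorded
  in the lemmas \<open>klift_kten\<close> and \<open>dlift_dten\<close> below.
\<close>

type_synonym ('x, 'k, 'f) tensor = "('x \<Rightarrow> 'k) \<Rightarrow> 'f"

record ('f, 'k) hopf_data =
  smult :: "'f \<Rightarrow> 'k \<Rightarrow> 'k"
  basis :: "'k set"
  comult :: "'k \<Rightarrow> (nat, 'k, 'f) tensor"
  counit :: "'k \<Rightarrow> 'f"
  antipode :: "'k \<Rightarrow> 'k"

definition fscale :: "'f::times \<Rightarrow> ('a \<Rightarrow> 'f) \<Rightarrow> 'a \<Rightarrow> 'f" where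
  "fscale c f = (\<lambda>x. c * f x)"

definition coord :: "('f::field, 'k::ab_group_add) hopf_data \<Rightarrow> 'k \<Rightarrow> 'k \<Rightarrow> 'f" where
  "coord H w b = module.representation (smult H) (basis H) w b"

definition dual_space :: "('f::field, 'k::ab_group_add) hopf_data \<Rightarrow> ('k \<Rightarrow> 'f) set" where
  "dual_space H = {\<alpha>. Vector_Spaces.linear (smult H) (*) \<alpha>}"

definition dual_basis :: "('f::field, 'k::ab_group_add) hopf_data \<Rightarrow> 'k \<Rightarrow> 'k \<Rightarrow> 'f" where
  "dual_basis H b = (\<lambda>w. coord H w b)"

definition multi_idx :: "('f, 'k) hopf_data \<Rightarrow> 'x set \<Rightarrow> ('x \<Rightarrow> 'k) set" where
  "multi_idx H X = (X \<rightarrow>\<^sub>E basis H)"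

definition tpow :: "('f::zero, 'k) hopf_data \<Rightarrow> 'x set \<Rightarrow> ('x, 'k, 'f) tensor set" where
  "tpow H X = {T. \<forall>b. b \<notin> multi_idx H X \<longrightarrow> T b = 0}"

definition btens :: "('x \<Rightarrow> 'k) \<Rightarrow> ('x, 'k, 'f::zero_neq_one) tensor" where
  "btens b = (\<lambda>b'. if b' = b then 1 else 0)"

text \<open>Pure tensors $\bigotimes_x \alpha_x$ with $\alpha_x \in K^*$, respectively
  $\bigotimes_x w_x$ with $w_x \in K$.\<close>

definition dten :: "('f::field, 'k) hopf_data \<Rightarrow> 'x set \<Rightarrow> ('x \<Rightarrow> 'k \<Rightarrow> 'f) \<Rightarrow> ('x, 'k, 'f) tensor" where
  "dten H X \<alpha> = (\<lambda>b. if b \<in> multi_idx H X then \<Prod>x\<in>X. \<alpha> x (b x) else 0)"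

definition kten :: "('f::field, 'k::ab_group_add) hopf_data \<Rightarrow> 'x set \<Rightarrow> ('x \<Rightarrow> 'k) \<Rightarrow> ('x, 'k, 'f) tensor" where
  "kten H X w = dten H X (\<lambda>x. coord H (w x))"

text \<open>The linear map on $K^{\otimes X}$, respectively on $K^{*\otimes X}$, that is induced
  by the multilinear map \<open>F\<close>; the target is a vector space with scalar multiplication \<open>sc\<close>.\<close>

definition klift :: "('f::field, 'k::ab_group_add) hopf_data \<Rightarrow> 'x set \<Rightarrow> ('f \<Rightarrow> 'c \<Rightarrow> 'c)
    \<Rightarrow> (('x \<Rightarrow> 'k) \<Rightarrow> 'c::comm_monoid_add) \<Rightarrow> ('x, 'k, 'f) tensor \<Rightarrow> 'c" where
  "klift H X sc F T = (\<Sum>b\<in>multi_idx H X. sc (T b) (F b))"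

definition dlift :: "('f::field, 'k::ab_group_add) hopf_data \<Rightarrow> 'x set \<Rightarrow> ('f \<Rightarrow> 'c \<Rightarrow> 'c)
    \<Rightarrow> (('x \<Rightarrow> 'k \<Rightarrow> 'f) \<Rightarrow> 'c::comm_monoid_add) \<Rightarrow> ('x, 'k, 'f) tensor \<Rightarrow> 'c" where
  "dlift H X sc F T = (\<Sum>b\<in>multi_idx H X. sc (T b) (F (\<lambda>x. dual_basis H (b x))))"

definition pairing :: "('f::field, 'k) hopf_data \<Rightarrow> 'x set \<Rightarrow> ('x, 'k, 'f) tensor \<Rightarrow> ('x, 'k, 'f) tensor \<Rightarrow> 'f" where
  "pairing H X A T = (\<Sum>b\<in>multi_idx H X. A b * T b)"

lemma multilinear_expand:
  fixes F :: "('x \<Rightarrow> 'w::comm_monoid_add) \<Rightarrow> 'c::comm_monoid_add" and sc :: "'f::field \<Rightarrow> 'c \<Rightarrow> 'c"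
  assumes B: "finite B" and X: "finite X"
    and e: "\<And>b. b \<in> B \<Longrightarrow> e b \<in> D"
    and rep: "\<And>u. u \<in> D \<Longrightarrow> u = (\<Sum>b\<in>B. s (co u b) (e b))"
    and lin: "\<And>x w c. x \<in> X \<Longrightarrow> \<forall>y\<in>X. w y \<in> D \<Longrightarrow>
        F (w(x := \<Sum>b\<in>B. s (c b) (e b))) = (\<Sum>b\<in>B. sc (c b) (F (w(x := e b))))"
    and ext: "\<And>w w'. \<forall>x\<in>X. w x = w' x \<Longrightarrow> F w = F w'"
    and sc1: "\<And>z. sc 1 z = z" and scm: "\<And>a b z. sc (a * b) z = sc a (sc b z)"
    and scs: "\<And>a g (S::('x \<Rightarrow> 'k) set). sc a (\<Sum>i\<in>S. g i) = (\<Sum>i\<in>S. sc a (g i))"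
    and w: "\<forall>x\<in>X. w x \<in> D"
  shows "F w = (\<Sum>b\<in>X \<rightarrow>\<^sub>E B. sc (\<Prod>x\<in>X. co (w x) (b x)) (F (\<lambda>x. e ((b::'x \<Rightarrow> 'k) x))))"
proof -
  have "F w = (\<Sum>b\<in>Y \<rightarrow>\<^sub>E B. sc (\<Prod>x\<in>Y. co (w x) (b x)) (F (\<lambda>x. if x \<in> Y then e (b x) else w x)))"
    if "finite Y" "Y \<subseteq> X" "\<forall>x\<in>X. w x \<in> D" for Y w
    using that
  proof (induction Y arbitrary: w)
    case empty
    then show ?case by (simp add: sc1)
  next
    case (insert a Y)
    have aX: "a \<in> X" using insert by auto
    have w': "\<forall>x\<in>X. (w(a := e b)) x \<in> D" if "b \<in> B" for b
      using insert.prems that e by auto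
    have "F w = F (w(a := \<Sum>b\<in>B. s (co (w a) b) (e b)))"
      using rep[of "w a"] insert.prems aX by simp
    also have "\<dots> = (\<Sum>b\<in>B. sc (co (w a) b) (F (w(a := e b))))"
      using lin aX insert.prems by blast
    also have "\<dots> = (\<Sum>b\<in>B. \<Sum>g\<in>Y \<rightarrow>\<^sub>E B.
        sc (\<Prod>x\<in>insert a Y. co (w x) ((g(a := b)) x))
          (F (\<lambda>x. if x \<in> insert a Y then e ((g(a := b)) x) else w x)))"
    proof (rule sum.cong[OF refl])
      fix b assume b: "b \<in> B"
      have "F (w(a := e b)) = (\<Sum>g\<in>Y \<rightarrow>\<^sub>E B. sc (\<Prod>x\<in>Y. co ((w(a := e b)) x) (g x))
          (F (\<lambda>x. if x \<in> Y then e (g x) else (w(a := e b)) x)))"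
        by (rule insert.IH[OF _ w'[OF b]]) (use insert.prems in auto)
      also have "\<dots> = (\<Sum>g\<in>Y \<rightarrow>\<^sub>E B. sc (\<Prod>x\<in>Y. co (w x) (g x))
          (F (\<lambda>x. if x \<in> insert a Y then e ((g(a := b)) x) else w x)))"
      proof (rule sum.cong[OF refl])
        fix g
        have "(\<Prod>x\<in>Y. co ((w(a := e b)) x) (g x)) = (\<Prod>x\<in>Y. co (w x) (g x))"
          using insert.hyps by (intro prod.cong) auto
        moreover have "(\<lambda>x. if x \<in> Y then e (g x) else (w(a := e b)) x)
            = (\<lambda>x. if x \<in> insert a Y then e ((g(a := b)) x) else w x)"
          using insert.hyps by auto
        ultimately show "sc (\<Prod>x\<in>Y. co ((w(a := e b)) x) (g x))
            (F (\<lambda>x. if x \<in> Y then e (g x) else (w(a := e b)) x)) =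
          sc (\<Prod>x\<in>Y. co (w x) (g x)) (F (\<lambda>x. if x \<in> insert a Y then e ((g(a := b)) x) else w x))"
          by simp
      qed
      finally have *: "F (w(a := e b)) = \<dots>" .
      show "sc (co (w a) b) (F (w(a := e b))) = (\<Sum>g\<in>Y \<rightarrow>\<^sub>E B.
        sc (\<Prod>x\<in>insert a Y. co (w x) ((g(a := b)) x))
          (F (\<lambda>x. if x \<in> insert a Y then e ((g(a := b)) x) else w x)))"
        unfolding * scs
      proof (rule sum.cong[OF refl])
        fix g
        have "(\<Prod>x\<in>insert a Y. co (w x) ((g(a := b)) x)) = co (w a) b * (\<Prod>x\<in>Y. co (w x) (g x))"
        proof -
          have "(\<Prod>x\<in>Y. co (w x) ((g(a := b)) x)) = (\<Prod>x\<in>Y. co (w x) (g x))"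
            using insert.hyps by (intro prod.cong) auto
          then show ?thesis using insert.hyps by simp
        qed
        then show "sc (co (w a) b) (sc (\<Prod>x\<in>Y. co (w x) (g x))
            (F (\<lambda>x. if x \<in> insert a Y then e ((g(a := b)) x) else w x))) =
          sc (\<Prod>x\<in>insert a Y. co (w x) ((g(a := b)) x))
            (F (\<lambda>x. if x \<in> insert a Y then e ((g(a := b)) x) else w x))"
          by (simp only: scm)
      qed
    qed
    also have "\<dots> = (\<Sum>(b, g)\<in>B \<times> (Y \<rightarrow>\<^sub>E B).
        sc (\<Prod>x\<in>insert a Y. co (w x) ((g(a := b)) x))
          (F (\<lambda>x. if x \<in> insert a Y then e ((g(a := b)) x) else w x)))"
      by (rule sum.cartesian_product)
    also have "\<dots> = (\<Sum>b\<in>insert a Y \<rightarrow>\<^sub>E B. sc (\<Prod>x\<in>insert a Y. co (w x) (b x))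
        (F (\<lambda>x. if x \<in> insert a Y then e (b x) else w x)))"
      unfolding PiE_insert_eq
      by (subst sum.reindex[OF inj_combinator[OF insert.hyps(2)]])
        (simp add: case_prod_unfold)
    finally show ?case .
  qed
  from this[OF X subset_refl w]
  have "F w = (\<Sum>b\<in>X \<rightarrow>\<^sub>E B. sc (\<Prod>x\<in>X. co (w x) (b x)) (F (\<lambda>x. if x \<in> X then e (b x) else w x)))" .
  also have "\<dots> = (\<Sum>b\<in>X \<rightarrow>\<^sub>E B. sc (\<Prod>x\<in>X. co (w x) (b x)) (F (\<lambda>x. e (b x))))"
    by (intro sum.cong refl arg_cong2[where f = sc] ext) auto
  finally show ?thesis .
qed

lemma (in finite_dimensional_vector_space) sum_representation_Basis:
  "(\<Sum>b\<in>Basis. scale (representation Basis v b) b) = v"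
  using sum_representation_eq[OF independent_Basis _ finite_Basis subset_refl] span_Basis by simp

lemma linear_map_sum:
  assumes "vector_space sc" and "finite B"
    and "\<And>u v. L (u + v) = L u + L v" and "\<And>c u. L (s c u) = sc c (L u)"
    and "(L :: 'w::ab_group_add \<Rightarrow> 'c::ab_group_add) 0 = 0"
  shows "L (\<Sum>b\<in>B. s (c b) (e b)) = (\<Sum>b\<in>B. sc (c b) (L (e b)))"
  using assms(2) by (induction B rule: finite_induct) (simp_all add: assms)

lemma klift_kten:
  fixes H :: "('f::field, 'k::ab_group_add) hopf_data" and sc :: "'f \<Rightarrow> 'c::ab_group_add \<Rightarrow> 'c"
  assumes H: "finite_dimensional_vector_space (smult H) (basis H)" and sc: "vector_space sc"
    and X: "finite X"
    and add: "\<And>x w u v. x \<in> X \<Longrightarrow> F (w(x := u + v)) = F (w(x := u)) + F (w(x := v))"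
    and scale: "\<And>x w c u. x \<in> X \<Longrightarrow> F (w(x := smult H c u)) = sc c (F (w(x := u)))"
    and ext: "\<And>w w'. \<forall>x\<in>X. w x = w' x \<Longrightarrow> F w = F w'"
  shows "klift H X sc F (kten H X w) = F w"
proof -
  interpret K: finite_dimensional_vector_space "smult H" "basis H" by (rule H)
  interpret C: vector_space sc by (rule sc)
  have "F w = (\<Sum>b\<in>X \<rightarrow>\<^sub>E basis H. sc (\<Prod>x\<in>X. coord H (w x) (b x)) (F (\<lambda>x. b x)))"
  proof (rule multilinear_expand[where D = UNIV and s = "smult H"])
    show "F (w(x := \<Sum>b\<in>basis H. smult H (c b) b)) = (\<Sum>b\<in>basis H. sc (c b) (F (w(x := b))))"
      if x: "x \<in> X" for x w c
    proof (rule linear_map_sum[OF sc K.finite_Basis])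
      show "F (w(x := 0)) = 0" using add[OF x, of w 0 0] by simp
    qed (use add scale x in blast)+
  qed (use X ext C.scale_sum_right K.finite_Basis in
      \<open>auto simp: coord_def K.sum_representation_Basis\<close>)
  then show ?thesis
    unfolding klift_def kten_def dten_def multi_idx_def by simp
qed

lemma vector_space_field: "vector_space ((*) :: 'f::field \<Rightarrow> 'f \<Rightarrow> 'f)"
  by unfold_locales (simp_all add: algebra_simps)

lemma dlift_dten:
  fixes H :: "('f::field, 'k::ab_group_add) hopf_data" and sc :: "'f \<Rightarrow> 'c::ab_group_add \<Rightarrow> 'c"
  assumes H: "finite_dimensional_vector_space (smult H) (basis H)" and sc: "vector_space sc"
    and X: "finite X"
    and add: "\<And>x \<alpha> \<beta> \<gamma>. x \<in> X \<Longrightarrow> F (\<alpha>(x := \<beta> + \<gamma>)) = F (\<alpha>(x := \<beta>)) + F (\<alpha>(x := \<gamma>))"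
    and scale: "\<And>x \<alpha> c \<beta>. x \<in> X \<Longrightarrow> F (\<alpha>(x := fscale c \<beta>)) = sc c (F (\<alpha>(x := \<beta>)))"
    and ext: "\<And>\<alpha> \<alpha>'. \<forall>x\<in>X. \<alpha> x = \<alpha>' x \<Longrightarrow> F \<alpha> = F \<alpha>'"
    and \<alpha>: "\<forall>x\<in>X. \<alpha> x \<in> dual_space H"
  shows "dlift H X sc F (dten H X \<alpha>) = F \<alpha>"
proof -
  interpret K: finite_dimensional_vector_space "smult H" "basis H" by (rule H)
  interpret C: vector_space sc by (rule sc)
  have rep: "\<beta> = (\<Sum>b\<in>basis H. fscale (\<beta> b) (dual_basis H b))" if "\<beta> \<in> dual_space H" for \<beta>
  proof
    fix h
    interpret L: Vector_Spaces.linear "smult H" "(*)" \<beta>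
      using that by (simp add: dual_space_def)
    have "\<beta> h = \<beta> (\<Sum>b\<in>basis H. smult H (coord H h b) b)"
      by (simp add: coord_def K.sum_representation_Basis)
    also have "\<dots> = (\<Sum>b\<in>basis H. coord H h b * \<beta> b)"
      by (simp add: L.sum L.scale)
    also have "\<dots> = (\<Sum>b\<in>basis H. fscale (\<beta> b) (dual_basis H b)) h"
    proof -
      have "(\<Sum>b\<in>S. fscale (\<beta> b) (dual_basis H b)) h = (\<Sum>b\<in>S. fscale (\<beta> b) (dual_basis H b) h)"
        if "finite S" for S
        using that by (induction S rule: finite_induct) simp_all
      from this[OF K.finite_Basis] show ?thesis
        by (simp add: fscale_def dual_basis_def mult.commute)
    qed
    finally show "\<beta> h = \<dots>" .
  qed
  have dual: "dual_basis H b \<in> dual_space H" for b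
    unfolding dual_space_def dual_basis_def coord_def mem_Collect_eq
    using K.vector_space_axioms vector_space_field K.independent_Basis K.span_Basis
    by (auto simp: Vector_Spaces.linear_def module_hom_def module_hom_axioms_def
        module_iff_vector_space K.representation_add K.representation_scale)
  have "F \<alpha> = (\<Sum>b\<in>X \<rightarrow>\<^sub>E basis H. sc (\<Prod>x\<in>X. \<alpha> x (b x)) (F (\<lambda>x. dual_basis H (b x))))"
  proof (rule multilinear_expand[where D = "dual_space H" and s = fscale and co = "\<lambda>\<beta> b. \<beta> b"])
    show "F (\<alpha>(x := \<Sum>b\<in>basis H. fscale (c b) (dual_basis H b)))
        = (\<Sum>b\<in>basis H. sc (c b) (F (\<alpha>(x := dual_basis H b))))"
      if x: "x \<in> X" for x \<alpha> c
    proof (rule linear_map_sum[OF sc K.finite_Basis, where L = "\<lambda>\<beta>. F (\<alpha>(x := \<beta>))"])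
      show "F (\<alpha>(x := 0)) = 0" using add[OF x, of \<alpha> 0 0] by simp
    qed (use add scale x in blast)+
  qed (use X ext C.scale_sum_right K.finite_Basis rep dual \<alpha> in auto)
  then show ?thesis
    unfolding dlift_def dten_def multi_idx_def by simp
qed

text \<open>\<open>legs [a, b, \<dots>]\<close> is the family indexed by $1, 2, \dots$\<close>

definition legs :: "'a list \<Rightarrow> nat \<Rightarrow> 'a" where
  "legs xs i = xs ! (i - 1)"

section \<open>The algebra structure of tensor powers of K\<close>

definition kmult :: "('f::field, 'k::ring_1) hopf_data \<Rightarrow> 'x set
    \<Rightarrow> ('x, 'k, 'f) tensor \<Rightarrow> ('x, 'k, 'f) tensor \<Rightarrow> ('x, 'k, 'f) tensor" where
  "kmult H X S T =
     klift H X fscale (\<lambda>s. klift H X fscale (\<lambda>t. kten H X (\<lambda>x. s x * t x)) T) S"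

definition kunit :: "('f::field, 'k::ring_1) hopf_data \<Rightarrow> 'x set \<Rightarrow> ('x, 'k, 'f) tensor" where
  "kunit H X = kten H X (\<lambda>x. 1)"

definition kinverse :: "('f::field, 'k::ring_1) hopf_data \<Rightarrow> 'x set \<Rightarrow> ('x, 'k, 'f) tensor \<Rightarrow> ('x, 'k, 'f) tensor" where
  "kinverse H X T = (THE T'. T' \<in> tpow H X \<and> kmult H X T T' = kunit H X \<and> kmult H X T' T = kunit H X)"

text \<open>$\iota_x(h) = (h)_x$ and $\iota_{xy}(T)$ for $T \in K\otimes K$; the projection $\pi_x$;
  the counit of $K^{\otimes X}$.\<close>

definition kemb1 :: "('f::field, 'k::ring_1) hopf_data \<Rightarrow> 'x set \<Rightarrow> 'x \<Rightarrow> 'k \<Rightarrow> ('x, 'k, 'f) tensor" where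
  "kemb1 H X x h = kten H X (\<lambda>z. if z = x then h else 1)"

definition kemb2 :: "('f::field, 'k::ring_1) hopf_data \<Rightarrow> 'x set \<Rightarrow> 'x \<Rightarrow> 'x
    \<Rightarrow> (nat, 'k, 'f) tensor \<Rightarrow> ('x, 'k, 'f) tensor" where
  "kemb2 H X x y T =
     klift H {1,2} fscale (\<lambda>w. kten H X (\<lambda>z. if z = x then w 1 else if z = y then w 2 else 1)) T"

definition kproj :: "('f::field, 'k::ring_1) hopf_data \<Rightarrow> 'x set \<Rightarrow> 'x \<Rightarrow> ('x, 'k, 'f) tensor \<Rightarrow> 'k" where
  "kproj H X x T = klift H X (smult H) (\<lambda>w. smult H (\<Prod>y\<in>X - {x}. counit H (w y)) (w x)) T"

definition kcounit :: "('f::field, 'k::ring_1) hopf_data \<Rightarrow> 'x set \<Rightarrow> ('x, 'k, 'f) tensor \<Rightarrow> 'f" where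
  "kcounit H X T = klift H X (*) (\<lambda>w. \<Prod>x\<in>X. counit H (w x)) T"

text \<open>The coproduct of $K^{\otimes X}$: the coefficient of
  $\bigotimes_x p_x \otimes \bigotimes_x q_x$ in $\Delta(T)$, for basis families \<open>p\<close> and \<open>q\<close>.\<close>

definition kcomult_coeff :: "('f::field, 'k::ring_1) hopf_data \<Rightarrow> 'x set \<Rightarrow> ('x, 'k, 'f) tensor
    \<Rightarrow> ('x \<Rightarrow> 'k) \<Rightarrow> ('x \<Rightarrow> 'k) \<Rightarrow> 'f" where
  "kcomult_coeff H X T p q =
     klift H X (*) (\<lambda>w. \<Prod>x\<in>X. comult H (w x) (restrict (legs [p x, q x]) {1,2})) T"

section \<open>Ribbon Hopf algebras\<close>

text \<open>$\Delta\otimes\mathrm{id}$ and $\mathrm{id}\otimes\Delta$ as maps from $K\otimes K$ to $K\otimes K\otimes K$.\<close>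

definition comult_id :: "('f::field, 'k::ring_1) hopf_data \<Rightarrow> (nat, 'k, 'f) tensor \<Rightarrow> (nat, 'k, 'f) tensor" where
  "comult_id H T = klift H {1,2} fscale (\<lambda>w.
     klift H {1,2} fscale (\<lambda>d. kten H {1,2,3} (legs [d 1, d 2, w 2])) (comult H (w 1))) T"

definition id_comult :: "('f::field, 'k::ring_1) hopf_data \<Rightarrow> (nat, 'k, 'f) tensor \<Rightarrow> (nat, 'k, 'f) tensor" where
  "id_comult H T = klift H {1,2} fscale (\<lambda>w.
     klift H {1,2} fscale (\<lambda>d. kten H {1,2,3} (legs [w 1, d 1, d 2])) (comult H (w 2))) T"

locale hopf_algebra =
  finite_dimensional_vector_space "smult H" "basis H"
  for H :: "('f::field_char_0, 'k::ring_1) hopf_data" +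
  assumes smult_mult_left: "smult H c x * y = smult H c (x * y)"
    and smult_mult_right: "x * smult H c y = smult H c (x * y)"
    and comult_tpow: "comult H h \<in> tpow H {1,2}"
    and comult_add: "comult H (g + h) = comult H g + comult H h"
    and comult_smult: "comult H (smult H c h) = fscale c (comult H h)"
    and counit_linear: "counit H \<in> dual_space H"
    and antipode_linear: "Vector_Spaces.linear (smult H) (smult H) (antipode H)"
    and coassoc: "comult_id H (comult H h) = id_comult H (comult H h)"
    and counit_left: "klift H {1,2} (smult H) (\<lambda>w. smult H (counit H (w 1)) (w 2)) (comult H h) = h"
    and counit_right: "klift H {1,2} (smult H) (\<lambda>w. smult H (counit H (w 2)) (w 1)) (comult H h) = h"
    and comult_mult: "comult H (g * h) = kmult H {1,2} (comult H g) (comult H h)"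
    and comult_one: "comult H 1 = kunit H {1,2}"
    and counit_mult: "counit H (g * h) = counit H g * counit H h"
    and counit_one: "counit H 1 = 1"
    and antipode_left:
      "klift H {1,2} (smult H) (\<lambda>w. antipode H (w 1) * w 2) (comult H h) = smult H (counit H h) 1"
    and antipode_right:
      "klift H {1,2} (smult H) (\<lambda>w. w 1 * antipode H (w 2)) (comult H h) = smult H (counit H h) 1"

definition R_matrix :: "('f::field, 'k::ring_1) hopf_data \<Rightarrow> (nat, 'k, 'f) tensor \<Rightarrow> bool" where
  "R_matrix H R \<longleftrightarrow>
     R \<in> tpow H {1,2} \<and>
     (\<exists>R' \<in> tpow H {1,2}. kmult H {1,2} R R' = kunit H {1,2} \<and> kmult H {1,2} R' R = kunit H {1,2}) \<and>
     (\<forall>h. kmult H {1,2} R (comult H h) = kmult H {1,2} (kemb2 H {1,2} 2 1 (comult H h)) R) \<and>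
     comult_id H R = kmult H {1,2,3} (kemb2 H {1,2,3} 1 3 R) (kemb2 H {1,2,3} 2 3 R) \<and>
     id_comult H R = kmult H {1,2,3} (kemb2 H {1,2,3} 1 3 R) (kemb2 H {1,2,3} 1 2 R)"

definition drinfeld_element :: "('f::field, 'k::ring_1) hopf_data \<Rightarrow> (nat, 'k, 'f) tensor \<Rightarrow> 'k" where
  "drinfeld_element H R = klift H {1,2} (smult H) (\<lambda>w. antipode H (w 2) * w 1) R"

definition ribbon_element :: "('f::field, 'k::ring_1) hopf_data \<Rightarrow> (nat, 'k, 'f) tensor \<Rightarrow> 'k \<Rightarrow> bool" where
  "ribbon_element H R \<nu> \<longleftrightarrow>
     (\<forall>h. \<nu> * h = h * \<nu>) \<and> (\<exists>\<mu>. \<nu> * \<mu> = 1 \<and> \<mu> * \<nu> = 1) \<and>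
     drinfeld_element H R * antipode H (drinfeld_element H R) = \<nu> * \<nu> \<and>
     counit H \<nu> = 1 \<and> antipode H \<nu> = \<nu> \<and>
     comult H \<nu> =
       kmult H {1,2} (kmult H {1,2} (kinverse H {1,2} R) (kinverse H {1,2} (kemb2 H {1,2} 2 1 R)))
         (kten H {1,2} (legs [\<nu>, \<nu>]))"

definition ribbon_hopf_algebra :: "('f::field_char_0, 'k::ring_1) hopf_data \<Rightarrow> bool" where
  "ribbon_hopf_algebra H \<longleftrightarrow> hopf_algebra H \<and> (\<exists>R \<nu>. R_matrix H R \<and> ribbon_element H R \<nu>)"

section \<open>The dual Hopf algebra and its tensor powers\<close>

definition dmult :: "('f::field, 'k::ring_1) hopf_data \<Rightarrow> ('k \<Rightarrow> 'f) \<Rightarrow> ('k \<Rightarrow> 'f) \<Rightarrow> 'k \<Rightarrow> 'f" where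
  "dmult H \<alpha> \<beta> = (\<lambda>h. pairing H {1,2} (dten H {1,2} (legs [\<alpha>, \<beta>])) (comult H h))"

definition dcomult :: "('f::field, 'k::ring_1) hopf_data \<Rightarrow> ('k \<Rightarrow> 'f) \<Rightarrow> (nat, 'k, 'f) tensor" where
  "dcomult H \<alpha> = (\<lambda>b. if b \<in> multi_idx H {1,2} then \<alpha> (b 1 * b 2) else 0)"

definition dantipode :: "('f, 'k) hopf_data \<Rightarrow> ('k \<Rightarrow> 'f) \<Rightarrow> 'k \<Rightarrow> 'f" where
  "dantipode H \<alpha> = \<alpha> \<circ> antipode H"

text \<open>The unit of $K^*$ is the counit of $K$.\<close>

definition dunit :: "('f::field, 'k) hopf_data \<Rightarrow> 'x set \<Rightarrow> ('x, 'k, 'f) tensor" where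
  "dunit H X = dten H X (\<lambda>x. counit H)"

definition demb1 :: "('f::field, 'k) hopf_data \<Rightarrow> 'x set \<Rightarrow> 'x \<Rightarrow> ('k \<Rightarrow> 'f) \<Rightarrow> ('x, 'k, 'f) tensor" where
  "demb1 H X x \<alpha> = dten H X (\<lambda>z. if z = x then \<alpha> else counit H)"

definition demb2 :: "('f::field, 'k::ab_group_add) hopf_data \<Rightarrow> 'x set \<Rightarrow> 'x \<Rightarrow> 'x
    \<Rightarrow> (nat, 'k, 'f) tensor \<Rightarrow> ('x, 'k, 'f) tensor" where
  "demb2 H X x y T =
     dlift H {1,2} fscale (\<lambda>\<alpha>. dten H X (\<lambda>z. if z = x then \<alpha> 1 else if z = y then \<alpha> 2 else counit H)) T"

text \<open>Sweedler notation in $K^*$: \<open>sweedler H F \<alpha>\<close> is $F(\alpha_{(1)}, \alpha_{(2)})$, where the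
  argument \<open>a\<close> of the bilinear map \<open>F\<close> has \<open>a 1\<close> $= \alpha_{(1)}$ and \<open>a 2\<close> $= \alpha_{(2)}$. In
  \<open>sweedler_family\<close> this is done for all members of a family, with \<open>a x i\<close> $= \alpha^x_{(i)}$.\<close>

definition sweedler :: "('f::field, 'k::ring_1) hopf_data
    \<Rightarrow> ((nat \<Rightarrow> 'k \<Rightarrow> 'f) \<Rightarrow> ('x, 'k, 'f) tensor) \<Rightarrow> ('k \<Rightarrow> 'f) \<Rightarrow> ('x, 'k, 'f) tensor" where
  "sweedler H F \<alpha> = dlift H {1,2} fscale F (dcomult H \<alpha>)"

definition sweedler_family :: "('f::field, 'k::ring_1) hopf_data \<Rightarrow> 'y set
    \<Rightarrow> (('y \<Rightarrow> nat \<Rightarrow> 'k \<Rightarrow> 'f) \<Rightarrow> ('x, 'k, 'f) tensor) \<Rightarrow> ('y \<Rightarrow> 'k \<Rightarrow> 'f) \<Rightarrow> ('x, 'k, 'f) tensor" where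
  "sweedler_family H Y F \<alpha> =
     (\<Sum>p\<in>multi_idx H Y. \<Sum>q\<in>multi_idx H Y.
        fscale (\<Prod>y\<in>Y. dcomult H (\<alpha> y) (restrict (legs [p y, q y]) {1,2}))
          (F (\<lambda>y. legs [dual_basis H (p y), dual_basis H (q y)])))"

section \<open>Algebras and modules on tensor powers\<close>

definition linear_on :: "('a \<Rightarrow> 'f::field) set \<Rightarrow> (('a \<Rightarrow> 'f) \<Rightarrow> ('b \<Rightarrow> 'f)) \<Rightarrow> bool" where
  "linear_on A f \<longleftrightarrow>
     (\<forall>S\<in>A. \<forall>T\<in>A. f (S + T) = f S + f T) \<and> (\<forall>c. \<forall>S\<in>A. f (fscale c S) = fscale c (f S))"

definition bilinear_on :: "('a \<Rightarrow> 'f::field) set \<Rightarrow> ('b \<Rightarrow> 'f) set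
    \<Rightarrow> (('a \<Rightarrow> 'f) \<Rightarrow> ('b \<Rightarrow> 'f) \<Rightarrow> ('c \<Rightarrow> 'f)) \<Rightarrow> bool" where
  "bilinear_on A B m \<longleftrightarrow> (\<forall>S\<in>A. linear_on B (m S)) \<and> (\<forall>T\<in>B. linear_on A (\<lambda>S. m S T))"

text \<open>An associative algebra structure on $K^{*\otimes X}$ with unit $1^{\otimes X}$.\<close>

definition dual_algebra :: "('f::field, 'k) hopf_data \<Rightarrow> 'x set
    \<Rightarrow> (('x, 'k, 'f) tensor \<Rightarrow> ('x, 'k, 'f) tensor \<Rightarrow> ('x, 'k, 'f) tensor) \<Rightarrow> bool" where
  "dual_algebra H X m \<longleftrightarrow>
     (\<forall>S\<in>tpow H X. \<forall>T\<in>tpow H X. m S T \<in> tpow H X) \<and>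
     bilinear_on (tpow H X) (tpow H X) m \<and>
     (\<forall>S\<in>tpow H X. \<forall>T\<in>tpow H X. \<forall>U\<in>tpow H X. m (m S T) U = m S (m T U)) \<and>
     (\<forall>S\<in>tpow H X. m (dunit H X) S = S \<and> m S (dunit H X) = S)"

definition left_module :: "('f::field, 'k::ring_1) hopf_data \<Rightarrow> 'v set \<Rightarrow> 'x set
    \<Rightarrow> (('v, 'k, 'f) tensor \<Rightarrow> ('x, 'k, 'f) tensor \<Rightarrow> ('x, 'k, 'f) tensor) \<Rightarrow> bool" where
  "left_module H U X act \<longleftrightarrow>
     (\<forall>h\<in>tpow H U. \<forall>k\<in>tpow H X. act h k \<in> tpow H X) \<and>
     bilinear_on (tpow H U) (tpow H X) act \<and>
     (\<forall>g\<in>tpow H U. \<forall>h\<in>tpow H U. \<forall>k\<in>tpow H X. act (kmult H U g h) k = act g (act h k)) \<and>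
     (\<forall>k\<in>tpow H X. act (kunit H U) k = k)"

definition right_module :: "('f::field, 'k::ring_1) hopf_data \<Rightarrow> 'v set \<Rightarrow> 'x set
    \<Rightarrow> (('x, 'k, 'f) tensor \<Rightarrow> ('v, 'k, 'f) tensor \<Rightarrow> ('x, 'k, 'f) tensor) \<Rightarrow> bool" where
  "right_module H U X act \<longleftrightarrow>
     (\<forall>S\<in>tpow H X. \<forall>h\<in>tpow H U. act S h \<in> tpow H X) \<and>
     bilinear_on (tpow H X) (tpow H U) act \<and>
     (\<forall>S\<in>tpow H X. \<forall>g\<in>tpow H U. \<forall>h\<in>tpow H U. act S (kmult H U g h) = act (act S g) h) \<and>
     (\<forall>S\<in>tpow H X. act S (kunit H U) = S)"

text \<open>A right module algebra: $(ST)\lhd h = (S\lhd h_{(1)})(T\lhd h_{(2)})$ and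
  $1 \lhd h = \epsilon(h) 1$.\<close>

definition right_module_algebra :: "('f::field, 'k::ring_1) hopf_data \<Rightarrow> 'v set \<Rightarrow> 'x set
    \<Rightarrow> (('x, 'k, 'f) tensor \<Rightarrow> ('x, 'k, 'f) tensor \<Rightarrow> ('x, 'k, 'f) tensor)
    \<Rightarrow> (('x, 'k, 'f) tensor \<Rightarrow> ('v, 'k, 'f) tensor \<Rightarrow> ('x, 'k, 'f) tensor) \<Rightarrow> bool" where
  "right_module_algebra H U X m act \<longleftrightarrow>
     dual_algebra H X m \<and> right_module H U X act \<and>
     (\<forall>S\<in>tpow H X. \<forall>T\<in>tpow H X. \<forall>h\<in>tpow H U.
        act (m S T) h = (\<Sum>p\<in>multi_idx H U. \<Sum>q\<in>multi_idx H U.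
          fscale (kcomult_coeff H U h p q) (m (act S (btens p)) (act T (btens q))))) \<and>
     (\<forall>h\<in>tpow H U. act (dunit H X) h = fscale (kcounit H U h) (dunit H X))"

text \<open>The right module structure on $K^{*\otimes X}$ dual to a left module structure on
  $K^{\otimes X}$, characterised by $\langle S\lhd h, k\rangle = \langle S, h\rhd k\rangle$.\<close>

definition dual_action :: "('f::field, 'k) hopf_data \<Rightarrow> 'x set
    \<Rightarrow> (('v, 'k, 'f) tensor \<Rightarrow> ('x, 'k, 'f) tensor \<Rightarrow> ('x, 'k, 'f) tensor)
    \<Rightarrow> ('x, 'k, 'f) tensor \<Rightarrow> ('v, 'k, 'f) tensor \<Rightarrow> ('x, 'k, 'f) tensor" where
  "dual_action H X act S h = (\<lambda>b. if b \<in> multi_idx H X then pairing H X S (act h (btens b)) else 0)"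

section \<open>Tensor products over a family of index sets\<close>

text \<open>The tensor product of the algebras $(K^{*\otimes P_v}, m_v)$ for disjoint $P_v$, on
  $K^{*\otimes\bigcup_v P_v}$, and the action of $K^{\otimes V}$ on it that is induced by actions
  of $K$ on the factors.\<close>

definition family_tensor :: "('f::field, 'k) hopf_data \<Rightarrow> 'v set \<Rightarrow> ('v \<Rightarrow> 'x set)
    \<Rightarrow> ('v \<Rightarrow> ('x, 'k, 'f) tensor) \<Rightarrow> ('x, 'k, 'f) tensor" where
  "family_tensor H V P T =
     (\<lambda>b. if b \<in> multi_idx H (\<Union>v\<in>V. P v) then \<Prod>v\<in>V. T v (restrict b (P v)) else 0)"

definition family_mult :: "('f::field, 'k) hopf_data \<Rightarrow> 'v set \<Rightarrow> ('v \<Rightarrow> 'x set)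
    \<Rightarrow> ('v \<Rightarrow> ('x, 'k, 'f) tensor \<Rightarrow> ('x, 'k, 'f) tensor \<Rightarrow> ('x, 'k, 'f) tensor)
    \<Rightarrow> ('x, 'k, 'f) tensor \<Rightarrow> ('x, 'k, 'f) tensor \<Rightarrow> ('x, 'k, 'f) tensor" where
  "family_mult H V P m S T =
     (\<Sum>c\<in>multi_idx H (\<Union>v\<in>V. P v). \<Sum>d\<in>multi_idx H (\<Union>v\<in>V. P v).
        fscale (S c * T d)
          (family_tensor H V P (\<lambda>v. m v (btens (restrict c (P v))) (btens (restrict d (P v))))))"

definition family_action :: "('f::field, 'k) hopf_data \<Rightarrow> 'v set \<Rightarrow> ('v \<Rightarrow> 'x set)
    \<Rightarrow> ('v \<Rightarrow> ('x, 'k, 'f) tensor \<Rightarrow> 'k \<Rightarrow> ('x, 'k, 'f) tensor)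
    \<Rightarrow> ('x, 'k, 'f) tensor \<Rightarrow> ('v, 'k, 'f) tensor \<Rightarrow> ('x, 'k, 'f) tensor" where
  "family_action H V P act S h =
     (\<Sum>c\<in>multi_idx H (\<Union>v\<in>V. P v). \<Sum>g\<in>multi_idx H V.
        fscale (S c * h g) (family_tensor H V P (\<lambda>v. act v (btens (restrict c (P v))) (g v))))"

section \<open>Ciliated ribbon graphs\<close>

datatype 'e edge_end = Src 'e | Tgt 'e

definition ends_at :: "('v, 'e) pre_digraph \<Rightarrow> 'v \<Rightarrow> 'e edge_end set" where
  "ends_at G v = Src ` {e \<in> arcs G. tail G e = v} \<union> Tgt ` {e \<in> arcs G. head G e = v}"

definition all_ends :: "('v, 'e) pre_digraph \<Rightarrow> 'e edge_end set" where
  "all_ends G = (\<Union>v\<in>verts G. ends_at G v)"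

text \<open>The linear order of the edge ends at \<open>v\<close> is given by their enumeration \<open>cil v\<close>.\<close>

definition ciliated_ribbon_graph :: "('v, 'e) pre_digraph \<Rightarrow> ('v \<Rightarrow> 'e edge_end list) \<Rightarrow> bool" where
  "ciliated_ribbon_graph G cil \<longleftrightarrow> fin_digraph G \<and>
     (\<forall>v\<in>verts G. ends_at G v \<noteq> {} \<and> distinct (cil v) \<and> set (cil v) = ends_at G v)"

text \<open>The vertex neighbourhood of \<open>v\<close>: the vertex \<open>None\<close> is \<open>v\<close>, its edges are the edge ends at \<open>v\<close>,
  and \<open>Some x\<close> is the univalent vertex at the free end of \<open>x\<close>.\<close>

definition vertex_nbhd :: "('v, 'e) pre_digraph \<Rightarrow> 'v \<Rightarrow> ('e edge_end option, 'e edge_end) pre_digraph" where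
  "vertex_nbhd G v =
     \<lparr> verts = insert None (Some ` ends_at G v),
       arcs = ends_at G v,
       tail = (\<lambda>x. case x of Src e \<Rightarrow> None | Tgt e \<Rightarrow> Some x),
       head = (\<lambda>x. case x of Src e \<Rightarrow> Some x | Tgt e \<Rightarrow> None) \<rparr>"

section \<open>Vertex algebras\<close>

fun end_tau :: "'e edge_end \<Rightarrow> nat" where
  "end_tau (Tgt e) = 0"
| "end_tau (Src e) = 1"

definition end_sigma :: "('v, 'e) pre_digraph \<Rightarrow> ('e \<Rightarrow> 'e edge_end) \<Rightarrow> 'e edge_end \<Rightarrow> nat" where
  "end_sigma G \<rho> x = (if x \<in> \<rho> ` arcs G then 0 else 1)"

text \<open>$(S^a\otimes S^b)(R)$\<close>

definition R_twist :: "('f::field, 'k::ring_1) hopf_data \<Rightarrow> nat \<Rightarrow> nat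
    \<Rightarrow> (nat, 'k, 'f) tensor \<Rightarrow> (nat, 'k, 'f) tensor" where
  "R_twist H a b R =
     klift H {1,2} fscale (\<lambda>w. kten H {1,2} (legs [(antipode H ^^ a) (w 1), (antipode H ^^ b) (w 2)])) R"

definition pairing2 :: "('f::field, 'k) hopf_data \<Rightarrow> ('k \<Rightarrow> 'f) \<Rightarrow> ('k \<Rightarrow> 'f) \<Rightarrow> (nat, 'k, 'f) tensor \<Rightarrow> 'f" where
  "pairing2 H \<alpha> \<beta> T = pairing H {1,2} (dten H {1,2} (legs [\<alpha>, \<beta>])) T"

text \<open>\<open>es\<close> lists the edge ends at the vertex in their linear order. Outside of the tensor power
  \<open>m\<close> is fixed to be 0 to make it unique as a total function.\<close>

definition is_vertex_mult :: "('f::field, 'k::ring_1) hopf_data \<Rightarrow> (nat, 'k, 'f) tensor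
    \<Rightarrow> 'x list \<Rightarrow> ('x \<Rightarrow> nat) \<Rightarrow> ('x \<Rightarrow> nat)
    \<Rightarrow> (('x, 'k, 'f) tensor \<Rightarrow> ('x, 'k, 'f) tensor \<Rightarrow> ('x, 'k, 'f) tensor) \<Rightarrow> bool" where
  "is_vertex_mult H R es \<tau> \<sigma> m \<longleftrightarrow>
     (let X = set es in
      dual_algebra H X m \<and>
      (\<forall>S T. S \<notin> tpow H X \<or> T \<notin> tpow H X \<longrightarrow> m S T = 0) \<and>
      (\<forall>\<alpha>. (\<forall>x\<in>X. \<alpha> x \<in> dual_space H) \<longrightarrow>
         dten H X \<alpha> = foldr m (map (\<lambda>x. demb1 H X x (\<alpha> x)) es) (dunit H X)) \<and>
      (\<forall>\<alpha>\<in>dual_space H. \<forall>\<beta>\<in>dual_space H. \<forall>x\<in>X.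
         m (demb1 H X x \<alpha>) (demb1 H X x \<beta>) =
           (if \<sigma> x = 0 \<and> \<tau> x = 0 then
              sweedler H (\<lambda>a. sweedler H (\<lambda>b.
                fscale (pairing2 H (b 1) (a 1) R) (demb1 H X x (dmult H (b 2) (a 2)))) \<beta>) \<alpha>
            else if \<sigma> x = 0 \<and> \<tau> x = 1 then
              sweedler H (\<lambda>a. sweedler H (\<lambda>b.
                fscale (pairing2 H (b 2) (a 2) R) (demb1 H X x (dmult H (a 1) (b 1)))) \<beta>) \<alpha>
            else if \<tau> x = 0 then demb1 H X x (dmult H \<alpha> \<beta>)
            else demb1 H X x (dmult H \<beta> \<alpha>))) \<and>
      (\<forall>\<alpha>\<in>dual_space H. \<forall>\<beta>\<in>dual_space H. \<forall>i<length es. \<forall>j<length es.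
         let x = es ! i; y = es ! j in
         (i < j \<longrightarrow>
            m (demb1 H X x \<alpha>) (demb1 H X y \<beta>) = demb2 H X x y (dten H {1,2} (legs [\<alpha>, \<beta>]))) \<and>
         (j < i \<longrightarrow>
            m (demb1 H X x \<alpha>) (demb1 H X y \<beta>) =
              sweedler H (\<lambda>a. sweedler H (\<lambda>b.
                fscale (pairing2 H (b (1 + \<tau> y)) (a (1 + \<tau> x)) (R_twist H (\<tau> y) (\<tau> x) R))
                  (demb2 H X x y (dten H {1,2} (legs [a (2 - \<tau> x), b (2 - \<tau> y)])))) \<beta>) \<alpha>)))"

definition vertex_mult :: "('f::field, 'k::ring_1) hopf_data \<Rightarrow> (nat, 'k, 'f) tensor
    \<Rightarrow> 'x list \<Rightarrow> ('x \<Rightarrow> nat) \<Rightarrow> ('x \<Rightarrow> nat)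
    \<Rightarrow> ('x, 'k, 'f) tensor \<Rightarrow> ('x, 'k, 'f) tensor \<Rightarrow> ('x, 'k, 'f) tensor" where
  "vertex_mult H R es \<tau> \<sigma> = (THE m. is_vertex_mult H R es \<tau> \<sigma> m)"

definition vertex_action :: "('f::field, 'k::ring_1) hopf_data \<Rightarrow> 'x list \<Rightarrow> ('x \<Rightarrow> nat)
    \<Rightarrow> ('x, 'k, 'f) tensor \<Rightarrow> 'k \<Rightarrow> ('x, 'k, 'f) tensor" where
  "vertex_action H es \<tau> T h =
     dlift H (set es) fscale (sweedler_family H (set es) (\<lambda>a.
       fscale (foldr (dmult H) (map (\<lambda>x. (dantipode H ^^ \<tau> x) (a x (1 + \<tau> x))) es) (counit H) h)
         (dten H (set es) (\<lambda>x. a x (2 - \<tau> x))))) T"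

section \<open>Hopf algebra gauge theories\<close>

text \<open>\<open>U\<close> is the set of vertices at which gauge transformations act: all vertices in a gauge
  theory on a graph, but only the central vertex in a gauge theory on a vertex neighbourhood.
  \<open>m\<close> is the multiplication of the algebra of functions on $K^{*\otimes E}$ and \<open>rhd\<close>
  the action of gauge transformations on $K^{\otimes E}$.\<close>

definition hopf_gauge_theory :: "('f::field, 'k::ring_1) hopf_data \<Rightarrow> ('v, 'e) pre_digraph \<Rightarrow> 'v set
    \<Rightarrow> (('e, 'k, 'f) tensor \<Rightarrow> ('e, 'k, 'f) tensor \<Rightarrow> ('e, 'k, 'f) tensor)
    \<Rightarrow> (('v, 'k, 'f) tensor \<Rightarrow> ('e, 'k, 'f) tensor \<Rightarrow> ('e, 'k, 'f) tensor) \<Rightarrow> bool" where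
  "hopf_gauge_theory H G U m rhd \<longleftrightarrow>
     (let E = arcs G in
      dual_algebra H E m \<and>
      (\<forall>\<alpha>\<in>dual_space H. \<forall>\<beta>\<in>dual_space H. \<forall>e\<in>E.
         m (demb1 H E e \<alpha>) (demb1 H E e \<beta>) \<in> demb1 H E e ` dual_space H) \<and>
      (\<forall>\<alpha>\<in>dual_space H. \<forall>\<beta>\<in>dual_space H. \<forall>e\<in>E. \<forall>f\<in>E. e \<noteq> f \<longrightarrow>
         m (demb1 H E e \<alpha>) (demb1 H E f \<beta>) \<in> demb2 H E e f ` tpow H {1,2} \<and>
         ({tail G e, head G e} \<inter> {tail G f, head G f} = {} \<longrightarrow>
            m (demb1 H E e \<alpha>) (demb1 H E f \<beta>) = m (demb1 H E f \<beta>) (demb1 H E e \<alpha>) \<and>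
            m (demb1 H E e \<alpha>) (demb1 H E f \<beta>) = demb2 H E e f (dten H {1,2} (legs [\<alpha>, \<beta>])))) \<and>
      left_module H U E rhd \<and>
      right_module_algebra H U E m (dual_action H E rhd) \<and>
      (\<forall>e\<in>E. tail G e \<noteq> head G e \<longrightarrow> (\<forall>h k.
         (\<forall>v\<in>U - {tail G e, head G e}.
            kproj H E e (rhd (kemb1 H U v h) (kemb1 H E e k)) = smult H (counit H h) k) \<and>
         (head G e \<in> U \<longrightarrow>
            kproj H E e (rhd (kemb1 H U (head G e) h) (kemb1 H E e k)) = h * k) \<and>
         (tail G e \<in> U \<longrightarrow>
            kproj H E e (rhd (kemb1 H U (tail G e) h) (kemb1 H E e k)) = k * antipode H h))))"

definition Gstar :: "('f::field, 'k::ring_1) hopf_data \<Rightarrow> ('v, 'e) pre_digraph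
    \<Rightarrow> ('e, 'k, 'f) tensor \<Rightarrow> ('e edge_end, 'k, 'f) tensor" where
  "Gstar H G T =
     dlift H (arcs G) fscale (sweedler_family H (arcs G) (\<lambda>a.
       dten H (all_ends G) (\<lambda>x. case x of Tgt e \<Rightarrow> a e 1 | Src e \<Rightarrow> a e 2))) T"

text \<open>Locality with respect to given multiplications \<open>A v\<close> and \<open>K\<close>-right module structures
  \<open>act v\<close> on $K^{*\otimes v}$: these are the algebras of functions of gauge theories on the vertex
  neighbourhoods, and $G^*$ is a homomorphism of module algebras.\<close>

definition local_wrt :: "('f::field, 'k::ring_1) hopf_data \<Rightarrow> ('v, 'e) pre_digraph
    \<Rightarrow> (('e, 'k, 'f) tensor \<Rightarrow> ('e, 'k, 'f) tensor \<Rightarrow> ('e, 'k, 'f) tensor)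
    \<Rightarrow> (('v, 'k, 'f) tensor \<Rightarrow> ('e, 'k, 'f) tensor \<Rightarrow> ('e, 'k, 'f) tensor)
    \<Rightarrow> ('v \<Rightarrow> ('e edge_end, 'k, 'f) tensor \<Rightarrow> ('e edge_end, 'k, 'f) tensor \<Rightarrow> ('e edge_end, 'k, 'f) tensor)
    \<Rightarrow> ('v \<Rightarrow> ('e edge_end, 'k, 'f) tensor \<Rightarrow> 'k \<Rightarrow> ('e edge_end, 'k, 'f) tensor) \<Rightarrow> bool" where
  "local_wrt H G m rhd A act \<longleftrightarrow>
     (\<forall>v\<in>verts G. \<exists>rhdv.
        hopf_gauge_theory H (vertex_nbhd G v) {None} (A v) rhdv \<and>
        (\<forall>S\<in>tpow H (ends_at G v). \<forall>h.
           dual_action H (ends_at G v) rhdv S (kemb1 H {None} None h) = act v S h)) \<and>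
     Gstar H G (dunit H (arcs G)) = dunit H (all_ends G) \<and>
     (\<forall>S\<in>tpow H (arcs G). \<forall>T\<in>tpow H (arcs G).
        Gstar H G (m S T) = family_mult H (verts G) (ends_at G) A (Gstar H G S) (Gstar H G T)) \<and>
     (\<forall>S\<in>tpow H (arcs G). \<forall>h\<in>tpow H (verts G).
        Gstar H G (dual_action H (arcs G) rhd S h) =
          family_action H (verts G) (ends_at G) act (Gstar H G S) h)"

definition local_hopf_gauge_theory :: "('f::field, 'k::ring_1) hopf_data \<Rightarrow> ('v, 'e) pre_digraph
    \<Rightarrow> (('e, 'k, 'f) tensor \<Rightarrow> ('e, 'k, 'f) tensor \<Rightarrow> ('e, 'k, 'f) tensor)
    \<Rightarrow> (('v, 'k, 'f) tensor \<Rightarrow> ('e, 'k, 'f) tensor \<Rightarrow> ('e, 'k, 'f) tensor) \<Rightarrow> bool" where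
  "local_hopf_gauge_theory H G m rhd \<longleftrightarrow>
     hopf_gauge_theory H G (verts G) m rhd \<and> (\<exists>A act. local_wrt H G m rhd A act)"

definition pullback_mult :: "('f::field, 'k::ring_1) hopf_data \<Rightarrow> ('v, 'e) pre_digraph
    \<Rightarrow> (('e edge_end, 'k, 'f) tensor \<Rightarrow> ('e edge_end, 'k, 'f) tensor \<Rightarrow> ('e edge_end, 'k, 'f) tensor)
    \<Rightarrow> ('e, 'k, 'f) tensor \<Rightarrow> ('e, 'k, 'f) tensor \<Rightarrow> ('e, 'k, 'f) tensor" where
  "pullback_mult H G M S T =
     the_inv_into (tpow H (arcs G)) (Gstar H G) (M (Gstar H G S) (Gstar H G T))"

definition pullback_action :: "('f::field, 'k::ring_1) hopf_data \<Rightarrow> ('v, 'e) pre_digraph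
    \<Rightarrow> (('e edge_end, 'k, 'f) tensor \<Rightarrow> ('v, 'k, 'f) tensor \<Rightarrow> ('e edge_end, 'k, 'f) tensor)
    \<Rightarrow> ('e, 'k, 'f) tensor \<Rightarrow> ('v, 'k, 'f) tensor \<Rightarrow> ('e, 'k, 'f) tensor" where
  "pullback_action H G L S h =
     the_inv_into (tpow H (arcs G)) (Gstar H G) (L (Gstar H G S) h)"

end

theory Submission
  imports Defs
begin

text \<open>The idea is to read a tensor in \<open>K\<^sup>*\<^sup>\<otimes>\<^sup>X\<close> as the multilinear form on \<open>K\<^sup>X\<close> that it
represents (\<open>ev\<close>). Products and actions then become operations that are dual to coproducts
and to multiplication in \<open>K\<close>, and every identity can be checked by evaluating both sides on
elements of \<open>K\<close>, where it is an identity between nested Sweedler sums.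

At a single vertex each edge end carries a copy of \<open>K\<close> with a coproduct \<open>dl\<close>, which
is \<open>\<Delta>\<close> or its opposite, multiplied by the flipped \<open>R\<close>-matrix if \<open>\<rho>\<close> selects the end, and with the
left action \<open>ac\<close> of \<open>K\<close> by \<open>h p\<close> or \<open>p S(h)\<close>. This is a \<open>K\<close>-module coalgebra
(\<open>dl_coassoc\<close>, \<open>dl_counit\<close>, \<open>dl_ac\<close>). The vertex algebra is dual to the braided tensor product
of these coalgebras: \<open>vm\<close> inserts one end after the other, and in
each step the \<open>R\<close>-matrix acts with one leg on the new end and with the other leg on all later
ends. For such a recursive definition the module algebra axiom \<open>vact_vm\<close> and
associativity \<open>vm_assoc\<close> follow by induction over the list of ends from the hexagon
identities and from \<open>R \<Delta> = \<Delta>\<^sup>o\<^sup>p R\<close>. The defining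
relations of \<open>\<A>\<^sub>v\<^sup>*\<close> determine its multiplication, since they allow one to sort every product of
generators (\<open>vertex_mult_unique\<close>), so it is the multiplication defined by \<open>vm\<close>
(\<open>vertex_mult_eq\<close>).

Why the image of \<open>G\<^sup>*\<close> is closed: evaluated on \<open>w\<close>, the form of \<open>G\<^sup>* T\<close>
depends only on the products \<open>w(t(e)) w(s(e))\<close> (\<open>ev_Gstar\<close>). Expanding all \<open>R\<close>-matrices, a product
of two pure tensors in the vertex algebras is a finite sum of products over the edge ends, in
which each end contributes a coproduct of its argument and each of its two legs is multiplied by
a fixed element of \<open>K\<close>, from the left for incoming and from the right for outgoing ends
(\<open>vm_span2\<close>). Exactly one of the two ends of an edge is selected by \<open>\<rho>\<close>, and this makes the
coproduct used at both ends the same one, either \<open>\<Delta>\<close> or \<open>\<Delta>\<^sup>o\<^sup>p\<close>. As it is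
multiplicative, the contributions of the two ends combine to a function of \<open>w(t(e)) w(s(e))\<close>
(\<open>edge_contract\<close>). So the product lies again in the image, and it is even a sum of pure tensors
whose factors at the single edges are explicit (\<open>M_Gstar\<close>); the same holds for the action
(\<open>L_Gstar\<close>). The conditions on a gauge theory are read off from these formulas.

Closure makes the pulled back structures well defined, and injectivity of \<open>G\<^sup>*\<close> transports all
axioms of a module algebra (\<open>pullback_right_module_algebra\<close>). The action on \<open>K\<^sup>\<otimes>\<^sup>E\<close> is the
transpose of the pulled back action. The gauge theory on a vertex neighbourhood is the special
case of a tensor product over one single vertex.\<close>

section \<open>Hopf algebra identities evaluated on multilinear forms\<close>

text \<open>The legs of a tensor are indexed by \<open>1\<close> and \<open>2\<close>; the numeral \<open>1\<close> must not turn into \<open>Suc 0\<close>.\<close>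

declare One_nat_def [simp del]

lemma sum_fun_apply: "(\<Sum>i\<in>S. f i) x = (\<Sum>i\<in>S. f i x)"
  by (induction S rule: infinite_finite_induct) simp_all

lemma legs_simps [simp]:
  "legs [a, b] 1 = a" "legs [a, b] (Suc 0) = a" "legs [a, b] 2 = b"
  "legs [a, b, c] 1 = a" "legs [a, b, c] (Suc 0) = a" "legs [a, b, c] 2 = b" "legs [a, b, c] 3 = c"
  by (simp_all add: legs_def numeral_eq_Suc)

context hopf_algebra
begin

text \<open>Predicates for forms with values in the field. They replace membership in \<open>dual_space H\<close> so that the simplifier can prove multilinearity of nested expressions argument by argument.\<close>

definition lin :: "('k \<Rightarrow> 'f) \<Rightarrow> bool" where
  "lin f \<longleftrightarrow> (\<forall>a b. f (a + b) = f a + f b) \<and> (\<forall>c a. f (smult H c a) = c * f a)"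

definition bil :: "('k \<Rightarrow> 'k \<Rightarrow> 'f) \<Rightarrow> bool" where
  "bil f \<longleftrightarrow> (\<forall>b. lin (\<lambda>a. f a b)) \<and> (\<forall>a. lin (\<lambda>b. f a b))"

definition tril :: "('k \<Rightarrow> 'k \<Rightarrow> 'k \<Rightarrow> 'f) \<Rightarrow> bool" where
  "tril f \<longleftrightarrow> (\<forall>b c. lin (\<lambda>a. f a b c)) \<and> (\<forall>a c. lin (\<lambda>b. f a b c)) \<and> (\<forall>a b. lin (\<lambda>c. f a b c))"

text \<open>Multilinear forms that depend only on the arguments in \<open>X\<close>, so that total functions \<open>w\<close> may have junk values elsewhere.\<close>

definition ml :: "'x set \<Rightarrow> (('x \<Rightarrow> 'k) \<Rightarrow> 'f) \<Rightarrow> bool" where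
  "ml X F \<longleftrightarrow> (\<forall>x\<in>X. \<forall>w. lin (\<lambda>a. F (w(x := a))))
     \<and> (\<forall>w w'. (\<forall>x\<in>X. w x = w' x) \<longrightarrow> F w = F w')"

lemma lin_dual: "f \<in> dual_space H \<longleftrightarrow> lin f"
  using vector_space_axioms vector_space_field
  by (auto simp: dual_space_def lin_def Vector_Spaces.linear_def module_hom_def
      module_hom_axioms_def module_iff_vector_space)

lemma lin_coord: "lin (\<lambda>h. coord H h b)"
  unfolding coord_def lin_def
  using independent_Basis span_Basis by (simp add: representation_add representation_scale)

lemma coord_basis: "b \<in> basis H \<Longrightarrow> coord H b b' = (if b' = b then 1 else 0)"
  by (simp add: coord_def representation_basis independent_Basis)

lemma sum_coord: "(\<Sum>b\<in>basis H. smult H (coord H h b) b) = h"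
  by (simp add: coord_def sum_representation_Basis)

lemma lin_zero: "lin f \<Longrightarrow> f 0 = 0"
  unfolding lin_def by (metis mult_zero_left scale_zero_left)

lemma lin_sum:
  assumes "lin f" "finite S"
  shows "f (\<Sum>i\<in>S. g i) = (\<Sum>i\<in>S. f (g i))"
  using assms(2) by (induction S rule: finite_induct) (use assms(1) in \<open>auto simp: lin_zero lin_def\<close>)

lemma lin_expand:
  assumes "lin f" shows "f h = (\<Sum>b\<in>basis H. coord H h b * f b)"
proof -
  have "f h = f (\<Sum>b\<in>basis H. smult H (coord H h b) b)" by (simp add: sum_coord)
  also have "\<dots> = (\<Sum>b\<in>basis H. f (smult H (coord H h b) b))"
    by (rule lin_sum[OF assms finite_Basis])
  finally show ?thesis using assms by (simp add: lin_def)
qed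

text \<open>Linear forms separate the elements of \<open>K\<close>, which reduces the equations of the antipode below to scalar ones.\<close>

lemma lin_ext_K:
  assumes "\<And>f. lin f \<Longrightarrow> f a = f b"
  shows "a = b"
proof -
  have "(\<Sum>i\<in>basis H. smult H (coord H a i) i) = (\<Sum>i\<in>basis H. smult H (coord H b i) i)"
    using assms[OF lin_coord] by simp
  then show ?thesis by (simp only: sum_coord)
qed

lemma finite_multi [simp]: "finite X \<Longrightarrow> finite (multi_idx H X)"
  unfolding multi_idx_def by (intro finite_PiE) (simp_all add: finite_Basis)

lemma multi_idx_in: "b \<in> multi_idx H X \<Longrightarrow> x \<in> X \<Longrightarrow> b x \<in> basis H"
  by (auto simp: multi_idx_def)

lemma multi_idx_out: "b \<in> multi_idx H X \<Longrightarrow> x \<notin> X \<Longrightarrow> b x = undefined"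
  by (auto simp: multi_idx_def)

text \<open>The partially applied forms are needed where a form occurs eta-contracted.\<close>

lemma bil_eqs:
  assumes "bil f"
  shows "f (a + b) = (\<lambda>c. f a c + f b c)" "f c (a + b) = f c a + f c b"
    "f (smult H r a) = (\<lambda>c. r * f a c)" "f c (smult H r a) = r * f c a"
  using assms by (simp_all add: bil_def lin_def fun_eq_iff)

lemma tril_eqs:
  assumes "tril f"
  shows "f (a + b) = (\<lambda>c d. f a c d + f b c d)" "f c (a + b) = (\<lambda>d. f c a d + f c b d)"
    "f c d (a + b) = f c d a + f c d b"
    "f (smult H r a) = (\<lambda>c d. r * f a c d)" "f c (smult H r a) = (\<lambda>d. r * f c a d)"
    "f c d (smult H r a) = r * f c d a"
  using assms by (simp_all add: tril_def lin_def fun_eq_iff)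

lemma lin_eqs:
  assumes "lin f"
  shows "f (a + b) = f a + f b" "f (smult H r a) = r * f a"
  using assms by (simp_all add: lin_def)

lemma ml_lin: "ml X F \<Longrightarrow> x \<in> X \<Longrightarrow> lin (\<lambda>a. F (w(x := a)))"
  by (simp add: ml_def)

lemma ml_cong: "ml X F \<Longrightarrow> (\<And>x. x \<in> X \<Longrightarrow> w x = w' x) \<Longrightarrow> F w = F w'"
  by (auto simp: ml_def)

subsection \<open>Sums over tensors\<close>

text \<open>The universal property of the tensor power for forms: this is what turns equations between tensors in \<open>K\<^sup>\<otimes>\<^sup>X\<close> into equations between numbers.\<close>

lemma klift_kten_field:
  assumes "ml X F" "finite X"
  shows "klift H X (*) F (kten H X w) = F w"
  by (rule klift_kten[OF finite_dimensional_vector_space_axioms vector_space_field \<open>finite X\<close>])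
    (use assms in \<open>auto simp: ml_def lin_def\<close>)

lemma klift_field_add: "klift H X (*) F (S + T) = klift H X (*) F S + klift H X (*) F T"
  for F :: "('x \<Rightarrow> 'k) \<Rightarrow> 'f"
  by (simp add: klift_def sum.distrib distrib_right)

lemma klift_field_fscale: "klift H X (*) F (fscale c T) = c * klift H X (*) F T"
  for F :: "('x \<Rightarrow> 'k) \<Rightarrow> 'f"
  by (simp add: klift_def fscale_def sum_distrib_left mult.assoc)

lemma klift_field_klift:
  "klift H X (*) F (klift H Y fscale G T) = klift H Y (*) (\<lambda>w. klift H X (*) F (G w)) T"
  for F :: "('x \<Rightarrow> 'k) \<Rightarrow> 'f" and G :: "('y \<Rightarrow> 'k) \<Rightarrow> ('x, 'k, 'f) tensor"
proof -
  have "klift H X (*) F (klift H Y fscale G T)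
      = (\<Sum>b\<in>multi_idx H X. \<Sum>c\<in>multi_idx H Y. T c * G c b * F b)"
    unfolding klift_def by (simp add: sum_fun_apply fscale_def sum_distrib_right)
  also have "\<dots> = (\<Sum>c\<in>multi_idx H Y. \<Sum>b\<in>multi_idx H X. T c * G c b * F b)"
    by (rule sum.swap)
  finally show ?thesis
    unfolding klift_def by (simp add: sum_distrib_left mult.assoc)
qed

text \<open>Sweedler notation for scalars: \<open>sw2 T f\<close> is \<open>f(T\<^sub>(\<^sub>1\<^sub>), T\<^sub>(\<^sub>2\<^sub>))\<close>. Nested sums are nested applications, so that Fubini (\<open>sw2_swap\<close>) is a rewriting step.\<close>

definition sw2 :: "(nat, 'k, 'f) tensor \<Rightarrow> ('k \<Rightarrow> 'k \<Rightarrow> 'f) \<Rightarrow> 'f" where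
  "sw2 T f = klift H {1,2} (*) (\<lambda>w. f (w 1) (w 2)) T"

definition sw3 :: "(nat, 'k, 'f) tensor \<Rightarrow> ('k \<Rightarrow> 'k \<Rightarrow> 'k \<Rightarrow> 'f) \<Rightarrow> 'f" where
  "sw3 T f = klift H {1,2,3} (*) (\<lambda>w. f (w 1) (w 2) (w 3)) T"

lemma sw2_sum: "sw2 T f = (\<Sum>b\<in>multi_idx H {1,2}. T b * f (b 1) (b 2))"
  by (simp add: sw2_def klift_def)

lemma sw2_add [simp]: "sw2 T (\<lambda>a b. f a b + g a b) = sw2 T f + sw2 T g"
  by (simp add: sw2_sum sum.distrib distrib_left)

lemma sw2_cmult [simp]: "sw2 T (\<lambda>a b. c * f a b) = c * sw2 T f"
  by (simp add: sw2_sum sum_distrib_left mult_ac)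

lemma sw2_cmult_right [simp]: "sw2 T (\<lambda>a b. f a b * c) = sw2 T f * c"
  by (simp add: sw2_sum sum_distrib_right mult_ac)

lemma sw2_cmult_mid [simp]: "sw2 T (\<lambda>a b. f a b * (c * g a b)) = c * sw2 T (\<lambda>a b. f a b * g a b)"
  by (simp add: sw2_sum sum_distrib_left mult_ac)

lemma sw2_setsum: "sw2 T (\<lambda>a b. \<Sum>i\<in>S. f i a b) = (\<Sum>i\<in>S. sw2 T (f i))"
  unfolding sw2_sum sum_distrib_left by (rule sum.swap)

lemma sw2_tadd [simp]: "sw2 (S + T) f = sw2 S f + sw2 T f"
  by (simp add: sw2_def klift_field_add)

lemma sw2_fscale [simp]: "sw2 (fscale c T) f = c * sw2 T f"
  by (simp add: sw2_def klift_field_fscale)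

lemma sw2_swap: "sw2 S (\<lambda>a b. sw2 T (f a b)) = sw2 T (\<lambda>c d. sw2 S (\<lambda>a b. f a b c d))"
proof -
  have "sw2 S (\<lambda>a b. sw2 T (f a b)) =
     (\<Sum>b\<in>multi_idx H {1,2}. \<Sum>c\<in>multi_idx H {1,2}. S b * (T c * f (b 1) (b 2) (c 1) (c 2)))"
    by (simp add: sw2_sum sum_distrib_left)
  also have "\<dots> = (\<Sum>c\<in>multi_idx H {1,2}. \<Sum>b\<in>multi_idx H {1,2}. S b * (T c * f (b 1) (b 2) (c 1) (c 2)))"
    by (rule sum.swap)
  finally show ?thesis by (simp add: sw2_sum sum_distrib_left mult_ac)
qed

lemma bil_ml: "bil f \<Longrightarrow> ml {1,2} (\<lambda>w::nat\<Rightarrow>'k. f (w 1) (w 2))"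
  by (auto simp: ml_def bil_def lin_def)

lemma tril_ml: "tril f \<Longrightarrow> ml {1,2,3} (\<lambda>w::nat\<Rightarrow>'k. f (w 1) (w 2) (w 3))"
  by (auto simp: ml_def tril_def lin_def)

lemma sw2_kten: "bil f \<Longrightarrow> sw2 (kten H {1,2} w) f = f (w 1) (w 2)"
  unfolding sw2_def by (subst klift_kten_field[OF bil_ml]) simp_all

lemma sw3_kten: "tril f \<Longrightarrow> sw3 (kten H {1,2,3} w) f = f (w 1) (w 2) (w 3)"
  unfolding sw3_def by (subst klift_kten_field[OF tril_ml]) simp_all

lemma sw2_klift: "sw2 (klift H Y fscale G T) f = klift H Y (*) (\<lambda>w. sw2 (G w) f) T"
  by (simp add: sw2_def klift_field_klift)

lemma sw3_klift: "sw3 (klift H Y fscale G T) f = klift H Y (*) (\<lambda>w. sw3 (G w) f) T"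
  by (simp add: sw3_def klift_field_klift)

lemma sw3_comult_id:
  "tril f \<Longrightarrow> sw3 (comult_id H T) f = sw2 T (\<lambda>a b. sw2 (comult H a) (\<lambda>c d. f c d b))"
  by (simp add: comult_id_def sw3_klift sw3_kten) (simp add: sw2_def)

lemma sw3_id_comult:
  "tril f \<Longrightarrow> sw3 (id_comult H T) f = sw2 T (\<lambda>a b. sw2 (comult H b) (\<lambda>c d. f a c d))"
  by (simp add: id_comult_def sw3_klift sw3_kten) (simp add: sw2_def)

lemma sw2_kmult:
  "bil f \<Longrightarrow> sw2 (kmult H {1,2} S T) f = sw2 S (\<lambda>a b. sw2 T (\<lambda>c d. f (a * c) (b * d)))"
  by (simp add: kmult_def sw2_klift sw2_kten) (simp add: sw2_def)

lemma sw3_kmult: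
  "tril f \<Longrightarrow> sw3 (kmult H {1,2,3} S T) f
     = sw3 S (\<lambda>a b c. sw3 T (\<lambda>a' b' c'. f (a * a') (b * b') (c * c')))"
  by (simp add: kmult_def sw3_klift sw3_kten) (simp add: sw3_def)

lemma sw2_kemb2_21: "bil f \<Longrightarrow> sw2 (kemb2 H {1,2} 2 1 T) f = sw2 T (\<lambda>a b. f b a)"
  by (simp add: kemb2_def sw2_klift sw2_kten) (simp add: sw2_def)

lemma sw3_kemb2:
  assumes "tril f"
  shows "sw3 (kemb2 H {1,2,3} 1 3 T) f = sw2 T (\<lambda>a b. f a 1 b)"
    "sw3 (kemb2 H {1,2,3} 2 3 T) f = sw2 T (\<lambda>a b. f 1 a b)"
    "sw3 (kemb2 H {1,2,3} 1 2 T) f = sw2 T (\<lambda>a b. f a b 1)"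
  using assms by (simp_all add: kemb2_def sw3_klift sw3_kten) (simp_all add: sw2_def)

lemma sw2_kunit: "bil f \<Longrightarrow> sw2 (kunit H {1,2}) f = f 1 1"
  by (simp add: kunit_def sw2_kten)

subsection \<open>The Hopf algebra axioms in scalar form\<close>

abbreviation cop :: "'k \<Rightarrow> ('k \<Rightarrow> 'k \<Rightarrow> 'f) \<Rightarrow> 'f" where
  "cop h \<equiv> sw2 (comult H h)"

abbreviation eps :: "'k \<Rightarrow> 'f" where "eps \<equiv> counit H"
abbreviation anti :: "'k \<Rightarrow> 'k" where "anti \<equiv> antipode H"

lemma lin_eps: "lin eps"
  using counit_linear by (simp add: lin_dual)

lemma anti_add [simp]: "anti (a + b) = anti a + anti b"
  and anti_smult [simp]: "anti (smult H c a) = smult H c (anti a)"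
  using antipode_linear by (simp_all add: Vector_Spaces.linear_iff)

lemmas alg_lin = distrib_left distrib_right smult_mult_left smult_mult_right
  comult_add comult_smult lin_eqs[OF lin_eps] 

lemma sw2_cong: "(\<And>a b. f a b = g a b) \<Longrightarrow> sw2 T f = sw2 T g"
  by presburger

lemma coassoc_cop:
  assumes "tril f"
  shows "cop h (\<lambda>a b. cop a (\<lambda>c d. f c d b)) = cop h (\<lambda>a b. cop b (\<lambda>c d. f a c d))"
  using arg_cong[OF coassoc, of "\<lambda>T. sw3 T f" h]
  by (simp add: sw3_comult_id sw3_id_comult assms)

lemma lin_klift_smult:
  assumes "lin f" "finite X"
  shows "f (klift H X (smult H) F T) = klift H X (*) (\<lambda>w. f (F w)) T"
  unfolding klift_def using assms by (simp add: lin_sum) (simp add: lin_def)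

lemma counit_cop:
  assumes "lin f"
  shows "cop h (\<lambda>a b. eps a * f b) = f h" "cop h (\<lambda>a b. eps b * f a) = f h"
    "cop h (\<lambda>a b. f b * eps a) = f h" "cop h (\<lambda>a b. f a * eps b) = f h"
  using arg_cong[OF counit_left, of f h] arg_cong[OF counit_right, of f h] assms
  by (simp_all add: lin_klift_smult sw2_def lin_eqs mult.commute)

lemma antipode_cop:
  assumes "lin f"
  shows "cop h (\<lambda>a b. f (anti a * b)) = eps h * f 1" "cop h (\<lambda>a b. f (a * anti b)) = eps h * f 1"
  using arg_cong[OF antipode_left, of f h] arg_cong[OF antipode_right, of f h] assms
  by (simp_all add: lin_klift_smult sw2_def lin_eqs)

lemma cop_mult: "bil f \<Longrightarrow> cop (g * h) f = cop g (\<lambda>a b. cop h (\<lambda>c d. f (a * c) (b * d)))"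
  by (simp add: comult_mult sw2_kmult)

lemma cop_one: "bil f \<Longrightarrow> cop 1 f = f 1 1"
  by (simp add: comult_one sw2_kunit)

lemma anti_one: "anti 1 = 1"
proof (rule lin_ext_K)
  fix f assume f: "lin f"
  have "bil (\<lambda>a b. f (anti a * b))" using f by (simp add: bil_def lin_def alg_lin)
  then show "f (anti 1) = f 1"
    using antipode_cop(1)[OF f, of 1] by (simp add: cop_one counit_one)
qed

lemma eps_anti: "eps (anti h) = eps h"
proof -
  have "eps h = cop h (\<lambda>a b. eps (anti a * b))"
    using antipode_cop(1)[OF lin_eps, of h] by (simp add: counit_one)
  also have "\<dots> = cop h (\<lambda>a b. eps (anti a) * eps b)" by (simp add: counit_mult)
  also have "\<dots> = eps (anti h)"
    using counit_cop(4)[of "\<lambda>a. eps (anti a)" h] by (simp add: lin_def alg_lin)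
  finally show ?thesis by simp
qed

lemma lin_mult:
  assumes "lin f"
  shows "lin (\<lambda>a. f (a * b))" "lin (\<lambda>a. f (b * a))" "lin (\<lambda>a. f (anti a))"
  using assms by (simp_all add: lin_def alg_lin)

text \<open>The classical argument: \<open>S(gh)\<close> and \<open>S(h)S(g)\<close> are both convolution inverse to the multiplication of \<open>K\<close>, so \<open>S(gh)\<close> is inserted next to a product that collapses to the counit.\<close>

lemma anti_mult: "anti (g * h) = anti h * anti g"
proof (rule lin_ext_K)
  fix f assume f: "lin f"
  note L = lin_eqs[OF f]
  have 1: "cop h (\<lambda>c d. eps d * f (x * anti (a * c) * y)) = f (x * anti (a * h) * y)" for a x y h
    by (rule counit_cop) (simp add: lin_def alg_lin L)
  have 2: "cop g (\<lambda>c d. eps d * f (anti (c * h))) = f (anti (g * h))" for g h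
    by (rule counit_cop) (simp add: lin_def alg_lin L)
  have 3: "cop d (\<lambda>r s. f (y * (p * (r * anti s) * q))) = eps d * f (y * (p * q))" for d y p q
    using antipode_cop(2)[OF lin_mult(1)[OF lin_mult(2)[OF lin_mult(2)[OF f]]], of d y p q]
    by (simp add: mult.assoc)
  have 4: "cop b (\<lambda>p q. f (y * (p * anti q))) = eps b * f y" for b y
    using antipode_cop(2)[OF lin_mult(2)[OF f], of b y] by simp
  let ?F = "\<lambda>a p q c r s. f (anti (a * c) * (p * r * (anti s * anti q)))"
  have "f (anti (g * h)) = cop g (\<lambda>a b. eps b * cop h (\<lambda>c d. eps d * f (anti (a * c))))"
    using 1[of h 1 _ 1] 2 by simp
  also have "\<dots> = cop g (\<lambda>a b. cop b (\<lambda>p q. cop h (\<lambda>c d. cop d (\<lambda>r s. ?F a p q c r s))))"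
  proof (rule sw2_cong)
    fix a b
    have "cop b (\<lambda>p q. cop h (\<lambda>c d. cop d (\<lambda>r s. ?F a p q c r s)))
        = cop b (\<lambda>p q. cop h (\<lambda>c d. eps d * f (anti (a * c) * (p * anti q))))"
      using 3 by (simp add: mult.assoc)
    also have "\<dots> = cop h (\<lambda>c d. eps d * cop b (\<lambda>p q. f (anti (a * c) * (p * anti q))))"
      by (subst sw2_swap) simp
    also have "\<dots> = eps b * cop h (\<lambda>c d. eps d * f (anti (a * c)))"
      by (simp only: 4 mult.left_commute[of _ "eps b"] sw2_cmult)
    finally show "eps b * cop h (\<lambda>c d. eps d * f (anti (a * c)))
        = cop b (\<lambda>p q. cop h (\<lambda>c d. cop d (\<lambda>r s. ?F a p q c r s)))" by simp
  qed
  also have "\<dots> = cop g (\<lambda>b q. cop b (\<lambda>a p. cop h (\<lambda>c d. cop d (\<lambda>r s. ?F a p q c r s))))"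
    by (rule coassoc_cop[symmetric]) (simp add: tril_def lin_def alg_lin L)
  also have "\<dots> = cop g (\<lambda>b q. cop b (\<lambda>a p. cop h (\<lambda>d s. cop d (\<lambda>c r. ?F a p q c r s))))"
    by (intro sw2_cong coassoc_cop[symmetric]) (simp add: tril_def lin_def alg_lin L)
  also have "\<dots> = cop g (\<lambda>b q. cop h (\<lambda>d s. cop b (\<lambda>a p. cop d (\<lambda>c r. ?F a p q c r s))))"
    by (rule sw2_cong, rule sw2_swap)
  also have "\<dots> = cop g (\<lambda>b q. cop h (\<lambda>d s. cop (b * d) (\<lambda>u v. f (anti u * v * (anti s * anti q)))))"
    by (intro sw2_cong, subst cop_mult) (simp_all add: bil_def lin_def alg_lin L mult.assoc)
  also have "\<dots> = cop g (\<lambda>b q. eps b * cop h (\<lambda>d s. eps d * f (anti s * anti q)))"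
    by (simp only: antipode_cop(1)[OF lin_mult(1)[OF f]] counit_mult mult_1_left mult.assoc[of "eps _"] sw2_cmult)
  also have "\<dots> = cop g (\<lambda>b q. eps b * f (anti h * anti q))"
    by (intro sw2_cong arg_cong2[where f = "(*)"] refl counit_cop) (simp add: lin_def alg_lin L)
  also have "\<dots> = f (anti h * anti g)"
    by (rule counit_cop) (simp add: lin_def alg_lin L)
  finally show "f (anti (g * h)) = f (anti h * anti g)" .
qed

text \<open>Both sides are convolution inverse to the coproduct.\<close>

lemma cop_anti:
  assumes f: "bil f"
  shows "cop (anti h) f = cop h (\<lambda>a b. f (anti b) (anti a))"
proof -
  note L = bil_eqs[OF f]
  note S = bil_def lin_def tril_def alg_lin L
  let ?F = "\<lambda>u v p1 p2 q1 q2. f (u * p1 * anti q2) (v * p2 * anti q1)"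
  (* the product of Delta(b) with the candidate for Delta(S(b)) collapses to the counit *)
  have 1: "cop b (\<lambda>p q. cop p (\<lambda>p1 p2. cop q (\<lambda>q1 q2. ?F u v p1 p2 q1 q2))) = eps b * f u v" for b u v
  proof -
    have "cop b (\<lambda>p q. cop p (\<lambda>p1 p2. cop q (\<lambda>q1 q2. ?F u v p1 p2 q1 q2)))
      = cop b (\<lambda>p1 q. cop q (\<lambda>p2 q. cop q (\<lambda>q1 q2. ?F u v p1 p2 q1 q2)))"
      by (rule coassoc_cop) (simp add: S)
    also have "\<dots> = cop b (\<lambda>p1 q. cop q (\<lambda>q q2. cop q (\<lambda>p2 q1. ?F u v p1 p2 q1 q2)))"
      by (rule sw2_cong, rule coassoc_cop[symmetric]) (simp add: S)
    also have "\<dots> = cop b (\<lambda>p1 q. cop q (\<lambda>q q2. eps q * f (u * p1 * anti q2) v))"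
    proof (intro sw2_cong)
      fix p1 q2 q
      have "lin (\<lambda>x. f (u * p1 * anti q2) (v * x))" by (simp add: S)
      from antipode_cop(2)[OF this, of q]
      show "cop q (\<lambda>p2 q1. ?F u v p1 p2 q1 q2) = eps q * f (u * p1 * anti q2) v"
        by (simp add: mult.assoc)
    qed
    also have "\<dots> = cop b (\<lambda>p1 q. f (u * p1 * anti q) v)"
      by (rule sw2_cong, rule counit_cop) (simp add: S)
    also have "\<dots> = eps b * f u v"
      using antipode_cop(2)[of "\<lambda>x. f (u * x) v" b] by (simp add: S mult.assoc)
    finally show ?thesis .
  qed
  have "cop (anti h) f = cop h (\<lambda>a b. eps b * cop (anti a) f)"
    by (rule counit_cop(2)[symmetric]) (simp add: S)
  also have "\<dots> = cop h (\<lambda>a b. cop (anti a) (\<lambda>u v. cop b (\<lambda>p q. cop p (\<lambda>p1 p2. cop q (\<lambda>q1 q2. ?F u v p1 p2 q1 q2)))))"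
    by (simp only: 1 sw2_cmult)
  also have "\<dots> = cop h (\<lambda>a b. cop b (\<lambda>p q. cop (anti a) (\<lambda>u v. cop p (\<lambda>p1 p2. cop q (\<lambda>q1 q2. ?F u v p1 p2 q1 q2)))))"
    by (rule sw2_cong, rule sw2_swap)
  also have "\<dots> = cop h (\<lambda>b q. cop b (\<lambda>a p. cop (anti a) (\<lambda>u v. cop p (\<lambda>p1 p2. cop q (\<lambda>q1 q2. ?F u v p1 p2 q1 q2)))))"
    by (rule coassoc_cop[symmetric]) (simp add: S)
  also have "\<dots> = cop h (\<lambda>b q. cop b (\<lambda>a p. cop (anti a * p) (\<lambda>u v. cop q (\<lambda>q1 q2. f (u * anti q2) (v * anti q1)))))"
    by (intro sw2_cong, subst cop_mult) (simp_all add: S)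
  also have "\<dots> = cop h (\<lambda>b q. eps b * cop 1 (\<lambda>u v. cop q (\<lambda>q1 q2. f (u * anti q2) (v * anti q1))))"
    by (rule sw2_cong, rule antipode_cop) (simp add: S)
  also have "\<dots> = cop h (\<lambda>b q. eps b * cop q (\<lambda>q1 q2. f (anti q2) (anti q1)))"
    by (subst cop_one) (simp_all add: S)
  also have "\<dots> = cop h (\<lambda>a b. f (anti b) (anti a))"
    by (rule counit_cop) (simp add: S)
  finally show ?thesis .
qed

end

section \<open>R-matrices and the coalgebra of an edge end\<close>

context hopf_algebra
begin

text \<open>Multiplication by \<open>g\<close> on the side that belongs to the direction of an edge end: on the left for incoming ends and on the right for outgoing ones.\<close>

definition om :: "bool \<Rightarrow> 'k \<Rightarrow> 'k \<Rightarrow> 'k" where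
  "om out g a = (if out then a * g else g * a)"

text \<open>The gauge transformation of a single edge end; the antipode turns the right multiplication at outgoing ends into a left action.\<close>

definition ac :: "bool \<Rightarrow> 'k \<Rightarrow> 'k \<Rightarrow> 'k" where
  "ac out h = om out (if out then anti h else h)"

definition flip :: "bool \<Rightarrow> 'k \<Rightarrow> (nat, 'k, 'f) tensor" where
  "flip fl p = (if fl then kemb2 H {1,2} 2 1 (comult H p) else comult H p)"

lemma sw2_flip: "bil f \<Longrightarrow> sw2 (flip fl p) f = cop p (\<lambda>a b. if fl then f b a else f a b)"
  by (simp add: flip_def sw2_kemb2_21)

lemma om_lin: "om out g (a + b) = om out g a + om out g b"
  "om out g (smult H c a) = smult H c (om out g a)"
  "om out (g + h) a = om out g a + om out h a" "om out (smult H c g) a = smult H c (om out g a)"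
  by (simp_all add: om_def alg_lin)

lemma ac_lin: "ac out g (a + b) = ac out g a + ac out g b"
  "ac out g (smult H c a) = smult H c (ac out g a)"
  "ac out (g + h) a = ac out g a + ac out h a" "ac out (smult H c g) a = smult H c (ac out g a)"
  by (simp_all add: ac_def om_lin)

lemma ac_mult: "ac out (g * h) a = ac out g (ac out h a)"
  by (simp add: ac_def om_def anti_mult mult.assoc)

lemma ac_one: "ac out 1 a = a"
  by (simp add: ac_def om_def anti_one)

lemma eps_ac: "eps (ac out h a) = eps h * eps a"
  by (simp add: ac_def om_def eps_anti counit_mult)

end

locale quasitriangular = hopf_algebra H for H :: "('f::field_char_0, 'k::ring_1) hopf_data" +
  fixes R :: "(nat, 'k, 'f) tensor"
  assumes R_matrix: "R_matrix H R"
begin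

abbreviation rr :: "('k \<Rightarrow> 'k \<Rightarrow> 'f) \<Rightarrow> 'f" where "rr \<equiv> sw2 R"

text \<open>The intertwining property \<open>R \<Delta>(h) = \<Delta>\<^sup>o\<^sup>p(h) R\<close>.\<close>

lemma rr_cop:
  assumes f: "bil f"
  shows "rr (\<lambda>a b. cop h (\<lambda>c d. f (a * c) (b * d))) = cop h (\<lambda>c d. rr (\<lambda>a b. f (d * a) (c * b)))"
proof -
  have "kmult H {1,2} R (comult H h) = kmult H {1,2} (kemb2 H {1,2} 2 1 (comult H h)) R"
    using R_matrix by (simp add: R_matrix_def)
  from arg_cong[OF this, of "\<lambda>T. sw2 T f"]
  have "rr (\<lambda>a b. cop h (\<lambda>c d. f (a * c) (b * d)))
      = sw2 (kemb2 H {1,2} 2 1 (comult H h)) (\<lambda>a b. rr (\<lambda>c d. f (a * c) (b * d)))"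
    by (simp only: sw2_kmult[OF f])
  also have "\<dots> = cop h (\<lambda>c d. rr (\<lambda>a b. f (d * a) (c * b)))"
    by (rule sw2_kemb2_21) (simp add: bil_def lin_def alg_lin bil_eqs[OF f])
  finally show ?thesis .
qed

lemma sw2_rotate:
  "sw2 A (\<lambda>a b. sw2 B (\<lambda>c d. sw2 C (\<lambda>e g. f a b c d e g)))
    = sw2 C (\<lambda>e g. sw2 A (\<lambda>a b. sw2 B (\<lambda>c d. f a b c d e g)))"
  by (rule trans[OF sw2_cong[OF sw2_swap] sw2_swap])

lemma rr_comult_left:
  assumes f: "tril f"
  shows "rr (\<lambda>a b. cop a (\<lambda>c d. f c d b)) = rr (\<lambda>a b. rr (\<lambda>c d. f a c (b * d)))"
proof -
  have "comult_id H R = kmult H {1,2,3} (kemb2 H {1,2,3} 1 3 R) (kemb2 H {1,2,3} 2 3 R)"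
    using R_matrix by (simp add: R_matrix_def)
  from arg_cong[OF this, of "\<lambda>T. sw3 T f"] have
    "rr (\<lambda>a b. cop a (\<lambda>c d. f c d b)) = sw3 (kemb2 H {1,2,3} 1 3 R) (\<lambda>a b c. rr (\<lambda>a' b'. f a (b * a') (c * b')))"
    by (simp only: sw3_kmult[OF f] sw3_comult_id[OF f])
      (subst sw3_kemb2(2), simp_all add: tril_def lin_def alg_lin tril_eqs[OF f])
  also have "\<dots> = rr (\<lambda>a b. rr (\<lambda>c d. f a c (b * d)))"
    by (subst sw3_kemb2(1)) (simp_all add: tril_def lin_def alg_lin tril_eqs[OF f])
  finally show ?thesis .
qed

lemma rr_comult_right:
  assumes f: "tril f"
  shows "rr (\<lambda>a b. cop b (\<lambda>c d. f a c d)) = rr (\<lambda>a b. rr (\<lambda>c d. f (a * c) d b))"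
proof -
  have "id_comult H R = kmult H {1,2,3} (kemb2 H {1,2,3} 1 3 R) (kemb2 H {1,2,3} 1 2 R)"
    using R_matrix by (simp add: R_matrix_def)
  from arg_cong[OF this, of "\<lambda>T. sw3 T f"] have
    "rr (\<lambda>a b. cop b (\<lambda>c d. f a c d)) = sw3 (kemb2 H {1,2,3} 1 3 R) (\<lambda>a b c. rr (\<lambda>a' b'. f (a * a') (b * b') c))"
    by (simp only: sw3_kmult[OF f] sw3_id_comult[OF f])
      (subst sw3_kemb2(3), simp_all add: tril_def lin_def alg_lin tril_eqs[OF f])
  also have "\<dots> = rr (\<lambda>a b. rr (\<lambda>c d. f (a * c) d b))"
    by (subst sw3_kemb2(1)) (simp_all add: tril_def lin_def alg_lin tril_eqs[OF f])
  finally show ?thesis .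
qed

lemma rr_inverse:
  "\<exists>R'. \<forall>f. bil f \<longrightarrow> rr (\<lambda>a b. sw2 R' (\<lambda>c d. f (a * c) (b * d))) = f 1 1"
proof -
  obtain R' where "kmult H {1,2} R R' = kunit H {1,2}"
    using R_matrix by (auto simp: R_matrix_def)
  then show ?thesis by (metis sw2_kmult sw2_kunit)
qed

text \<open>\<open>(\<epsilon> \<otimes> id)(R)\<close> is idempotent by the hexagon identity, and invertible because \<open>R\<close> is, hence it equals 1; in the same way for the other leg.\<close>

lemma rr_counit:
  assumes g: "lin g"
  shows "rr (\<lambda>a b. eps a * g b) = g 1" "rr (\<lambda>a b. eps b * g a) = g 1"
proof -
  obtain R' where R': "\<And>f. bil f \<Longrightarrow> rr (\<lambda>a b. sw2 R' (\<lambda>c d. f (a * c) (b * d))) = f 1 1"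
    using rr_inverse by blast
  note L = lin_eqs[OF g]
  note S = bil_def tril_def lin_def alg_lin L mult_1_left mult_1_right counit_one
    mult.assoc counit_mult
  let ?f1 = "\<lambda>a b. sw2 R' (\<lambda>c d. eps (a * c) * g (b * d))"
  have "g 1 = rr ?f1"
    using R'[of "\<lambda>a b. eps a * g b"] by (simp add: S)
  also have "\<dots> = rr (\<lambda>a b. cop a (\<lambda>c d. eps c * ?f1 d b))"
    by (rule sw2_cong, rule counit_cop(1)[symmetric]) (simp add: S)
  also have "\<dots> = rr (\<lambda>a b. rr (\<lambda>c d. eps a * ?f1 c (b * d)))"
    by (rule rr_comult_left) (simp add: S)
  also have "\<dots> = rr (\<lambda>a b. eps a * g b)"
  proof (rule sw2_cong)
    fix a b
    show "rr (\<lambda>c d. eps a * ?f1 c (b * d)) = eps a * g b"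
      using R'[of "\<lambda>c d. eps c * g (b * d)"] by (simp add: S)
  qed
  finally show "rr (\<lambda>a b. eps a * g b) = g 1" ..
  let ?f2 = "\<lambda>a b. sw2 R' (\<lambda>c d. eps (b * d) * g (a * c))"
  have "g 1 = rr ?f2"
    using R'[of "\<lambda>a b. eps b * g a"] by (simp add: S)
  also have "\<dots> = rr (\<lambda>a b. cop b (\<lambda>c d. eps d * ?f2 a c))"
    by (rule sw2_cong, rule counit_cop(2)[symmetric]) (simp add: S)
  also have "\<dots> = rr (\<lambda>a b. rr (\<lambda>c d. eps b * ?f2 (a * c) d))"
    by (rule rr_comult_right) (simp add: S)
  also have "\<dots> = rr (\<lambda>a b. eps b * g a)"
  proof (rule sw2_cong)
    fix a b
    show "rr (\<lambda>c d. eps b * ?f2 (a * c) d) = eps b * g a"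
      using R'[of "\<lambda>c d. eps d * g (a * c)"] by (simp add: S)
  qed
  finally show "rr (\<lambda>a b. eps b * g a) = g 1" ..
qed

text \<open>The usual proof: one hexagon identity combines the last two \<open>R\<close>-matrices into a coproduct, which the first one then flips.\<close>

lemma yang_baxter:
  assumes f: "tril f"
  shows "rr (\<lambda>a b. rr (\<lambda>c d. rr (\<lambda>e g. f (a * c) (b * e) (d * g))))
       = rr (\<lambda>a b. rr (\<lambda>c d. rr (\<lambda>e g. f (c * e) (a * g) (b * d))))"
proof -
  note S = bil_def tril_def lin_def alg_lin tril_eqs[OF f] mult.assoc
  have "rr (\<lambda>a b. rr (\<lambda>c d. rr (\<lambda>e g. f (a * c) (b * e) (d * g))))
      = rr (\<lambda>a b. rr (\<lambda>x y. cop x (\<lambda>c e. f (a * c) (b * e) y)))"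
    by (rule sw2_cong, rule rr_comult_left[symmetric]) (simp add: S)
  also have "\<dots> = rr (\<lambda>x y. rr (\<lambda>a b. cop x (\<lambda>c e. f (a * c) (b * e) y)))"
    by (rule sw2_swap)
  also have "\<dots> = rr (\<lambda>x y. cop x (\<lambda>c e. rr (\<lambda>a b. f (e * a) (c * b) y)))"
    by (rule sw2_cong, rule rr_cop) (simp add: S)
  also have "\<dots> = rr (\<lambda>a b. rr (\<lambda>c d. rr (\<lambda>e g. f (c * e) (a * g) (b * d))))"
    by (rule rr_comult_left) (simp add: S)
  finally show ?thesis .
qed

subsection \<open>The module coalgebra at an edge end\<close>

text \<open>The coproduct at an edge end that is dual to the multiplication of \<open>\<A>\<^sub>v\<^sup>*\<close> restricted to this end. It is \<open>\<Delta>\<close> for incoming and \<open>\<Delta>\<^sup>o\<^sup>p\<close> for outgoing ends, but for ends in the image of \<open>\<rho>\<close> the opposite of that, twisted by the flipped \<open>R\<close>-matrix.\<close>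

definition dl :: "bool \<Rightarrow> bool \<Rightarrow> 'k \<Rightarrow> (nat, 'k, 'f) tensor" where
  "dl out sel p = (if sel then
     klift H {1,2} fscale (\<lambda>r. klift H {1,2} fscale (\<lambda>d.
       kten H {1,2} (legs [om out (r 2) (d 1), om out (r 1) (d 2)])) (flip (\<not> out) p)) R
     else flip out p)"

lemma sw2_dl_general:
  assumes "bil f"
  shows "sw2 (dl out sel p) f = (if sel then
    rr (\<lambda>r s. sw2 (flip (\<not> out) p) (\<lambda>a b. f (om out s a) (om out r b))) else sw2 (flip out p) f)"
  using assms by (simp add: dl_def sw2_klift sw2_kten) (simp add: sw2_def)

lemma sw2_dl:
  assumes "bil f"
  shows "sw2 (dl False True p) f = rr (\<lambda>r s. cop p (\<lambda>a b. f (s * b) (r * a)))"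
    "sw2 (dl True True p) f = rr (\<lambda>r s. cop p (\<lambda>a b. f (a * s) (b * r)))"
    "sw2 (dl False False p) f = cop p f"
    "sw2 (dl True False p) f = cop p (\<lambda>a b. f b a)"
  using assms by (simp_all add: sw2_dl_general sw2_flip bil_def lin_def om_def alg_lin)

lemma dl_lin [simp]:
  "sw2 (dl out sel (a + b)) f = sw2 (dl out sel a) f + sw2 (dl out sel b) f"
  "sw2 (dl out sel (smult H c a)) f = c * sw2 (dl out sel a) f"
proof -
  have 1: "flip fl (a + b) = flip fl a + flip fl b" "flip fl (smult H c a) = fscale c (flip fl a)" for fl
    by (simp_all add: flip_def kemb2_def klift_def comult_add comult_smult fun_eq_iff sum_fun_apply fscale_def
        sum.distrib distrib_right sum_distrib_left mult.assoc)
  show "sw2 (dl out sel (a + b)) f = sw2 (dl out sel a) f + sw2 (dl out sel b) f"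
    "sw2 (dl out sel (smult H c a)) f = c * sw2 (dl out sel a) f"
    unfolding dl_def 1
    by (auto simp: sw2_klift klift_field_add klift_field_fscale) (auto simp: klift_def sum.distrib distrib_left sum_distrib_left mult_ac)
qed

text \<open>At ends in the image of \<open>\<rho>\<close> the coproduct is twisted by \<open>R\<close>. Moving both \<open>R\<close>-matrices out of the iterated coproduct with the hexagon identities leaves a product of three \<open>R\<close>-matrices, in which the two sides differ by the Yang-Baxter equation.\<close>

lemma dl_coassoc:
  assumes f: "tril f"
  shows "sw2 (dl out sel p) (\<lambda>a b. sw2 (dl out sel a) (\<lambda>c d. f c d b))
       = sw2 (dl out sel p) (\<lambda>a b. sw2 (dl out sel b) (\<lambda>c d. f a c d))"
proof -
  note S = bil_def tril_def lin_def alg_lin tril_eqs[OF f] mult.assoc[of "_::'k"]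
  have B: "bil (\<lambda>a b. sw2 (dl o' s' a) (\<lambda>c d. f c d b))" "bil (\<lambda>a b. sw2 (dl o' s' b) (\<lambda>c d. f a c d))"
    "bil (\<lambda>c d. f c d b)" "bil (\<lambda>c d. f b c d)" for o' s' b
    by (simp_all add: S)
  consider "\<not> out" "\<not> sel" | "out" "\<not> sel" | "\<not> out" sel | out sel by blast
  then show ?thesis
  proof cases
    case 1
    then show ?thesis by (simp add: dl_def flip_def coassoc_cop[OF f])
  next
    case 2
    have "sw2 (dl True False p) (\<lambda>a b. sw2 (dl True False a) (\<lambda>c d. f c d b))
        = cop p (\<lambda>a b. sw2 (dl True False b) (\<lambda>c d. f c d a))"
      by (rule sw2_dl(4)[OF B(1)])
    also have "\<dots> = cop p (\<lambda>a b. cop b (\<lambda>c d. f d c a))"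
      by (rule sw2_cong, rule sw2_dl(4)[OF B(3)])
    also have "\<dots> = cop p (\<lambda>a b. cop a (\<lambda>c d. f b d c))"
      by (rule coassoc_cop[symmetric]) (simp add: S)
    also have "\<dots> = cop p (\<lambda>a b. sw2 (dl True False a) (\<lambda>c d. f b c d))"
      by (rule sw2_cong, rule sw2_dl(4)[OF B(4), symmetric])
    also have "\<dots> = sw2 (dl True False p) (\<lambda>a b. sw2 (dl True False b) (\<lambda>c d. f a c d))"
      by (rule sw2_dl(4)[OF B(2), symmetric])
    finally show ?thesis using 2 by simp
  next
    case 3
    have "sw2 (dl False True p) (\<lambda>a b. sw2 (dl False True a) (\<lambda>c d. f c d b)) =
      rr (\<lambda>r s. cop p (\<lambda>a b. rr (\<lambda>r' s'. cop (s * b) (\<lambda>u v. f (s' * v) (r' * u) (r * a)))))"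
      by (rule trans[OF sw2_dl(1)[OF B(1)]], rule sw2_cong, rule sw2_cong, rule sw2_dl(1)[OF B(3)])
    also have "\<dots> = rr (\<lambda>r s. cop p (\<lambda>a b. rr (\<lambda>r' s'. cop s (\<lambda>s1 s2. cop b (\<lambda>b1 b2. f (s' * (s2 * b2)) (r' * (s1 * b1)) (r * a))))))"
      by (intro sw2_cong cop_mult) (simp add: S)
    also have "\<dots> = rr (\<lambda>r s. cop s (\<lambda>s1 s2. cop p (\<lambda>a b. rr (\<lambda>r' s'. cop b (\<lambda>b1 b2. f (s' * (s2 * b2)) (r' * (s1 * b1)) (r * a))))))"
      by (intro sw2_cong, subst sw2_swap[of R], rule sw2_swap)
    also have "\<dots> = rr (\<lambda>r s. rr (\<lambda>c d. cop p (\<lambda>a b. rr (\<lambda>r' s'. cop b (\<lambda>b1 b2. f (s' * (s * b2)) (r' * (d * b1)) (r * c * a))))))"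
      by (rule rr_comult_right) (simp add: S)
    also have "\<dots> = cop p (\<lambda>a b. cop b (\<lambda>b1 b2. rr (\<lambda>r s. rr (\<lambda>c d. rr (\<lambda>r' s'. f (s' * s * b2) (r' * d * b1) (r * c * a))))))"
      by (simp only: sw2_swap[of R "comult H y" for y] mult.assoc[of "_::'k"])
    also have "\<dots> = cop p (\<lambda>a b. cop b (\<lambda>b1 b2. rr (\<lambda>r' s'. rr (\<lambda>r s. rr (\<lambda>c d. f (s' * s * b2) (r' * d * b1) (r * c * a))))))"
      by (rule sw2_cong, rule sw2_cong, rule sw2_rotate)
    also have "\<dots> = cop p (\<lambda>a b. cop b (\<lambda>b1 b2. rr (\<lambda>r' s'. rr (\<lambda>r s. rr (\<lambda>c d. f (s * d * b2) (s' * c * b1) (r' * r * a))))))"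
      by (rule sw2_cong, rule sw2_cong, rule yang_baxter[symmetric]) (simp add: S)
    also have "\<dots> = cop p (\<lambda>a b. cop a (\<lambda>a1 a2. rr (\<lambda>r' s'. rr (\<lambda>r s. rr (\<lambda>c d. f (s * d * b) (s' * c * a2) (r' * r * a1))))))"
      by (rule coassoc_cop[symmetric]) (simp add: S)
    also have "\<dots> = cop p (\<lambda>a b. cop a (\<lambda>a1 a2. rr (\<lambda>r s. rr (\<lambda>c d. rr (\<lambda>r' s'. f (s * d * b) (s' * c * a2) (r' * r * a1))))))"
      by (rule sw2_cong, rule sw2_cong, rule sw2_rotate[symmetric])
    also have "\<dots> = rr (\<lambda>r s. rr (\<lambda>c d. cop p (\<lambda>a b. rr (\<lambda>r' s'. cop a (\<lambda>a1 a2. f (s * d * b) (s' * (c * a2)) (r' * (r * a1)))))))"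
      by (simp only: sw2_swap[of R "comult H y" for y] mult.assoc[of "_::'k"])
    also have "\<dots> = rr (\<lambda>r s. cop r (\<lambda>r1 r2. cop p (\<lambda>a b. rr (\<lambda>r' s'. cop a (\<lambda>a1 a2. f (s * b) (s' * (r2 * a2)) (r' * (r1 * a1)))))))"
      by (rule rr_comult_left[symmetric]) (simp add: S)
    also have "\<dots> = rr (\<lambda>r s. cop p (\<lambda>a b. rr (\<lambda>r' s'. cop r (\<lambda>r1 r2. cop a (\<lambda>a1 a2. f (s * b) (s' * (r2 * a2)) (r' * (r1 * a1)))))))"
      by (intro sw2_cong, subst sw2_swap[of R], rule sw2_swap)
    also have "\<dots> = rr (\<lambda>r s. cop p (\<lambda>a b. rr (\<lambda>r' s'. cop (r * a) (\<lambda>u v. f (s * b) (s' * v) (r' * u)))))"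
      by (intro sw2_cong cop_mult[symmetric]) (simp add: S)
    also have "\<dots> = sw2 (dl False True p) (\<lambda>a b. sw2 (dl False True b) (\<lambda>c d. f a c d))"
      by (rule trans[OF _ sw2_dl(1)[OF B(2), symmetric]], rule sw2_cong, rule sw2_cong, rule sw2_dl(1)[OF B(4), symmetric])
    finally show ?thesis using 3 by simp
  next
    case 4
    have "sw2 (dl True True p) (\<lambda>a b. sw2 (dl True True a) (\<lambda>c d. f c d b)) =
      rr (\<lambda>r s. cop p (\<lambda>a b. rr (\<lambda>r' s'. cop (a * s) (\<lambda>u v. f (u * s') (v * r') (b * r)))))"
      by (rule trans[OF sw2_dl(2)[OF B(1)]], rule sw2_cong, rule sw2_cong, rule sw2_dl(2)[OF B(3)])
    also have "\<dots> = rr (\<lambda>r s. cop p (\<lambda>a b. rr (\<lambda>r' s'. cop a (\<lambda>a1 a2. cop s (\<lambda>s1 s2. f (a1 * s1 * s') (a2 * s2 * r') (b * r))))))"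
      by (intro sw2_cong cop_mult) (simp add: S)
    also have "\<dots> = rr (\<lambda>r s. cop s (\<lambda>s1 s2. cop p (\<lambda>a b. rr (\<lambda>r' s'. cop a (\<lambda>a1 a2. f (a1 * s1 * s') (a2 * s2 * r') (b * r))))))"
      by (intro sw2_cong, subst sw2_rotate, rule sw2_swap)
    also have "\<dots> = rr (\<lambda>r s. rr (\<lambda>c d. cop p (\<lambda>a b. rr (\<lambda>r' s'. cop a (\<lambda>a1 a2. f (a1 * d * s') (a2 * s * r') (b * (r * c)))))))"
      by (rule rr_comult_right) (simp add: S)
    also have "\<dots> = cop p (\<lambda>a b. cop a (\<lambda>a1 a2. rr (\<lambda>r s. rr (\<lambda>c d. rr (\<lambda>r' s'. f (a1 * (d * s')) (a2 * (s * r')) (b * (r * c)))))))"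
      by (simp only: sw2_swap[of R "comult H y" for y] mult.assoc[of "_::'k"])
    also have "\<dots> = cop p (\<lambda>a b. cop a (\<lambda>a1 a2. rr (\<lambda>r s. rr (\<lambda>c d. rr (\<lambda>r' s'. f (a1 * (s * d)) (a2 * (r * s')) (b * (c * r')))))))"
      by (rule sw2_cong, rule sw2_cong, rule yang_baxter) (simp add: S)
    also have "\<dots> = cop p (\<lambda>a b. cop b (\<lambda>b1 b2. rr (\<lambda>r s. rr (\<lambda>c d. rr (\<lambda>r' s'. f (a * (s * d)) (b1 * (r * s')) (b2 * (c * r')))))))"
      by (rule coassoc_cop) (simp add: S)
    also have "\<dots> = rr (\<lambda>r s. rr (\<lambda>c d. cop p (\<lambda>a b. rr (\<lambda>r' s'. cop b (\<lambda>b1 b2. f (a * (s * d)) (b1 * r * s') (b2 * c * r'))))))"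
      by (simp only: sw2_swap[of R "comult H y" for y] mult.assoc[of "_::'k"])
    also have "\<dots> = rr (\<lambda>r s. cop r (\<lambda>r1 r2. cop p (\<lambda>a b. rr (\<lambda>r' s'. cop b (\<lambda>b1 b2. f (a * s) (b1 * r1 * s') (b2 * r2 * r'))))))"
      by (rule rr_comult_left[symmetric]) (simp add: S)
    also have "\<dots> = rr (\<lambda>r s. cop p (\<lambda>a b. rr (\<lambda>r' s'. cop b (\<lambda>b1 b2. cop r (\<lambda>r1 r2. f (a * s) (b1 * r1 * s') (b2 * r2 * r'))))))"
      by (rule sw2_cong, rule trans[OF sw2_swap], rule sw2_cong, rule trans[OF sw2_swap], rule sw2_cong, rule sw2_swap)
    also have "\<dots> = rr (\<lambda>r s. cop p (\<lambda>a b. rr (\<lambda>r' s'. cop (b * r) (\<lambda>u v. f (a * s) (u * s') (v * r')))))"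
      by (intro sw2_cong cop_mult[symmetric]) (simp add: S)
    also have "\<dots> = sw2 (dl True True p) (\<lambda>a b. sw2 (dl True True b) (\<lambda>c d. f a c d))"
      by (rule trans[OF _ sw2_dl(2)[OF B(2), symmetric]], rule sw2_cong, rule sw2_cong, rule sw2_dl(2)[OF B(4), symmetric])
    finally show ?thesis using 4 by simp
  qed
qed

lemma dl_counit:
  assumes f: "lin f"
  shows "sw2 (dl out sel p) (\<lambda>a b. eps a * f b) = f p" "sw2 (dl out sel p) (\<lambda>a b. eps b * f a) = f p"
proof -
  note S = bil_def tril_def lin_def alg_lin lin_eqs[OF f] counit_mult counit_one mult.assoc
  have 1: "rr (\<lambda>r s. eps s * f (r * p)) = f p" "rr (\<lambda>r s. eps s * f (p * r)) = f p"
    "rr (\<lambda>r s. eps r * f (s * p)) = f p" "rr (\<lambda>r s. eps r * f (p * s)) = f p" for p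
    using rr_counit[of "\<lambda>x. f (x * p)"] rr_counit[of "\<lambda>x. f (p * x)"] by (simp_all add: S)
  have 2: "cop p (\<lambda>a b. eps b * f (r * a)) = f (r * p)" "cop p (\<lambda>a b. eps b * f (a * r)) = f (p * r)"
    "cop p (\<lambda>a b. eps a * f (r * b)) = f (r * p)" "cop p (\<lambda>a b. eps a * f (b * r)) = f (p * r)" for p r
    by (rule counit_cop, simp add: S)+
  have B: "bil (\<lambda>a b. eps a * f b)" "bil (\<lambda>a b. eps b * f a)" by (simp_all add: S)
  show "sw2 (dl out sel p) (\<lambda>a b. eps a * f b) = f p"
    using 1 2 counit_cop[OF f, of p]
    by (cases out; cases sel) (simp_all add: sw2_dl[OF B(1)] counit_mult mult.assoc)
  show "sw2 (dl out sel p) (\<lambda>a b. eps b * f a) = f p"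
    using 1 2 counit_cop[OF f, of p]
    by (cases out; cases sel) (simp_all add: sw2_dl[OF B(2)] counit_mult mult.assoc)
qed

text \<open>The coproduct is a module map. For selected ends this is where \<open>R \<Delta> = \<Delta>\<^sup>o\<^sup>p R\<close> turns the opposite coproduct of the acting element into the ordinary one.\<close>

lemma dl_ac:
  assumes f: "bil f"
  shows "sw2 (dl out sel (ac out h p)) f
      = cop h (\<lambda>g k. sw2 (dl out sel p) (\<lambda>a b. f (ac out g a) (ac out k b)))"
proof -
  note S = bil_def tril_def lin_def alg_lin bil_eqs[OF f] counit_mult counit_one mult.assoc[of "_::'k"] ac_lin
  have B: "bil (\<lambda>a b. f (ac out g a) (ac out k b))" for g k
    by (simp add: S)
  consider "\<not> out" "\<not> sel" | "out" "\<not> sel" | "\<not> out" sel | out sel by blast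
  then show ?thesis
  proof cases
    case 1
    then show ?thesis using B
      by (simp add: sw2_dl f cop_mult ac_def om_def)
  next
    case 2
    have "sw2 (dl True False (ac True h p)) f = cop p (\<lambda>a b. cop (anti h) (\<lambda>u v. f (b * v) (a * u)))"
      by (simp add: sw2_dl f ac_def om_def) (rule cop_mult, simp add: S)
    also have "\<dots> = cop p (\<lambda>a b. cop h (\<lambda>g k. f (b * anti g) (a * anti k)))"
      by (rule sw2_cong, rule cop_anti) (simp add: S)
    also have "\<dots> = cop h (\<lambda>g k. cop p (\<lambda>a b. f (b * anti g) (a * anti k)))"
      by (rule sw2_swap)
    finally show ?thesis using 2 B by (simp add: sw2_dl) (simp add: ac_def om_def)
  next
    case 3
    have "sw2 (dl False True (ac False h p)) f = rr (\<lambda>r s. cop h (\<lambda>u v. cop p (\<lambda>a b. f (s * (v * b)) (r * (u * a)))))"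
      by (simp add: sw2_dl f ac_def om_def) (intro sw2_cong cop_mult, simp add: S)
    also have "\<dots> = rr (\<lambda>r s. cop h (\<lambda>u v. cop p (\<lambda>a b. f (s * v * b) (r * u * a))))"
      by (simp add: mult.assoc)
    also have "\<dots> = cop h (\<lambda>u v. rr (\<lambda>r s. cop p (\<lambda>a b. f (u * s * b) (v * r * a))))"
      by (rule rr_cop) (simp add: S)
    finally show ?thesis using 3 B by (simp add: sw2_dl) (simp add: ac_def om_def mult.assoc)
  next
    case 4
    have "sw2 (dl True True (ac True h p)) f = rr (\<lambda>r s. cop p (\<lambda>a b. cop (anti h) (\<lambda>u v. f (a * u * s) (b * v * r))))"
      by (simp add: sw2_dl f ac_def om_def) (intro sw2_cong cop_mult, simp add: S)
    also have "\<dots> = cop p (\<lambda>a b. cop (anti h) (\<lambda>u v. rr (\<lambda>r s. f (a * (u * s)) (b * (v * r)))))"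
      by (simp only: sw2_swap[of R "comult H y" for y] mult.assoc[of "_::'k"])
    also have "\<dots> = cop p (\<lambda>a b. rr (\<lambda>r s. cop (anti h) (\<lambda>u v. f (a * (s * v)) (b * (r * u)))))"
      by (rule sw2_cong, rule rr_cop[symmetric]) (simp add: S)
    also have "\<dots> = cop p (\<lambda>a b. rr (\<lambda>r s. cop h (\<lambda>g k. f (a * (s * anti g)) (b * (r * anti k)))))"
      by (intro sw2_cong cop_anti) (simp add: S)
    also have "\<dots> = cop h (\<lambda>g k. rr (\<lambda>r s. cop p (\<lambda>a b. f (a * s * anti g) (b * r * anti k))))"
      by (subst sw2_rotate, intro sw2_cong, simp only: sw2_swap[of R "comult H y" for y] mult.assoc[of "_::'k"])
    finally show ?thesis using 4 B by (simp add: sw2_dl) (simp add: ac_def om_def)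
  qed
qed

end

section \<open>The braided product and the gauge action at a vertex\<close>

locale vertex = quasitriangular H R for H :: "('f::field_char_0, 'k::ring_1) hopf_data" and R +
  fixes out sel :: "'x \<Rightarrow> bool"
begin

text \<open>The action of \<open>h\<close> on forms: the iterated coproduct of \<open>h\<close> is distributed over the ends in their linear order. The recursion takes off the first end, so later proofs are inductions over the list of ends.\<close>

primrec vact :: "'x list \<Rightarrow> (('x \<Rightarrow> 'k) \<Rightarrow> 'f) \<Rightarrow> 'k \<Rightarrow> ('x \<Rightarrow> 'k) \<Rightarrow> 'f" where
  "vact [] \<phi> h = (\<lambda>w. eps h * \<phi> w)"
| "vact (x # xs) \<phi> h = (\<lambda>w. cop h (\<lambda>a b. vact xs (\<lambda>u. \<phi> (u(x := ac (out x) a (w x)))) b w))"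

text \<open>The product of forms that is dual to the braided tensor product of the coalgebras \<open>dl\<close> of the single ends. To bring the second factor at the first end \<open>x\<close> in front of the first factor at the later ends, they have to be exchanged by the braiding, that is, by letting the first leg of \<open>R\<close> act at \<open>x\<close> and the second leg on the later ends.\<close>

primrec vm :: "'x list \<Rightarrow> (('x \<Rightarrow> 'k) \<Rightarrow> 'f) \<Rightarrow> (('x \<Rightarrow> 'k) \<Rightarrow> 'f) \<Rightarrow> ('x \<Rightarrow> 'k) \<Rightarrow> 'f" where
  "vm [] \<phi> \<psi> = (\<lambda>w. \<phi> w * \<psi> w)"
| "vm (x # xs) \<phi> \<psi> = (\<lambda>w. sw2 (dl (out x) (sel x) (w x)) (\<lambda>a b. rr (\<lambda>r s.
     vm xs (vact xs (\<lambda>u. \<phi> (u(x := a))) s) (\<lambda>u. \<psi> (u(x := ac (out x) r b))) w)))"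

lemma vact_add: "vact xs (\<lambda>w. \<phi> w + \<psi> w) h = (\<lambda>w. vact xs \<phi> h w + vact xs \<psi> h w)"
  by (induction xs arbitrary: \<phi> \<psi> h) (simp_all add: distrib_left)

lemma vact_cmult: "vact xs (\<lambda>w. c * \<phi> w) h = (\<lambda>w. c * vact xs \<phi> h w)"
  by (induction xs arbitrary: \<phi> h) (simp_all add: mult.left_commute)

lemma vact_sw2: "vact xs (\<lambda>w. sw2 T (\<lambda>a b. \<Phi> a b w)) h = (\<lambda>w. sw2 T (\<lambda>a b. vact xs (\<Phi> a b) h w))"
proof (induction xs arbitrary: \<Phi> h)
  case (Cons x xs)
  show ?case
    by (rule ext) (simp add: Cons.IH, rule sw2_swap)
qed simp

lemma vact_add_arg: "vact xs \<phi> (g + h) = (\<lambda>w. vact xs \<phi> g w + vact xs \<phi> h w)"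
  by (cases xs) (simp_all add: alg_lin)

lemma vact_smult_arg: "vact xs \<phi> (smult H c h) = (\<lambda>w. c * vact xs \<phi> h w)"
  by (cases xs) (simp_all add: alg_lin mult.assoc)

lemma vm_add_left: "vm xs (\<lambda>w. \<phi> w + \<phi>' w) \<psi> = (\<lambda>w. vm xs \<phi> \<psi> w + vm xs \<phi>' \<psi> w)"
  by (induction xs arbitrary: \<phi> \<phi>' \<psi>) (simp_all add: distrib_right vact_add)

lemma vm_add_right: "vm xs \<phi> (\<lambda>w. \<psi> w + \<psi>' w) = (\<lambda>w. vm xs \<phi> \<psi> w + vm xs \<phi> \<psi>' w)"
  by (induction xs arbitrary: \<phi> \<psi> \<psi>') (simp_all add: distrib_left)

lemma vm_cmult_left: "vm xs (\<lambda>w. c * \<phi> w) \<psi> = (\<lambda>w. c * vm xs \<phi> \<psi> w)"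
  by (induction xs arbitrary: \<phi> \<psi>) (simp_all add: vact_cmult mult.assoc)

lemma vm_cmult_right: "vm xs \<phi> (\<lambda>w. c * \<psi> w) = (\<lambda>w. c * vm xs \<phi> \<psi> w)"
  by (induction xs arbitrary: \<phi> \<psi>) (simp_all add: mult_ac)

lemma vm_sw2_left: "vm xs (\<lambda>w. sw2 T (\<lambda>a b. \<Phi> a b w)) \<psi> = (\<lambda>w. sw2 T (\<lambda>a b. vm xs (\<Phi> a b) \<psi> w))"
proof (induction xs arbitrary: \<Phi> \<psi>)
  case (Cons x xs)
  show ?case
    by (rule ext) (simp add: Cons.IH vact_sw2, rule sw2_rotate)
qed simp

lemma vm_sw2_right: "vm xs \<phi> (\<lambda>w. sw2 T (\<lambda>a b. \<Psi> a b w)) = (\<lambda>w. sw2 T (\<lambda>a b. vm xs \<phi> (\<Psi> a b) w))"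
proof (induction xs arbitrary: \<phi> \<Psi>)
  case (Cons x xs)
  show ?case
    by (rule ext) (simp add: Cons.IH, rule sw2_rotate)
qed simp

lemmas v_lin = vact_add vact_cmult vact_add_arg vact_smult_arg vm_add_left vm_add_right
  vm_cmult_left vm_cmult_right ac_lin

lemma ml_upd:
  fixes \<phi> :: "('x \<Rightarrow> 'k) \<Rightarrow> 'f"
  assumes "ml (set (x # xs)) \<phi>"
  shows "\<phi> (u(x := a + b)) = \<phi> (u(x := a)) + \<phi> (u(x := b))" "\<phi> (u(x := smult H c a)) = c * \<phi> (u(x := a))"
  using assms by (simp_all add: ml_def lin_def)

lemma ml_Cons:
  fixes \<phi> :: "('x \<Rightarrow> 'k) \<Rightarrow> 'f"
  assumes "ml (set (x # xs)) \<phi>" "x \<notin> set xs"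
  shows "ml (set xs) (\<lambda>u. \<phi> (u(x := a)))"
  unfolding ml_def
proof (intro conjI ballI allI impI)
  fix y w assume y: "y \<in> set xs"
  then have "w(y := b, x := a) = w(x := a, y := b)" for b
    using assms(2) by (intro fun_upd_twist) auto
  then show "lin (\<lambda>b. \<phi> (w(y := b, x := a)))"
    using ml_lin[OF assms(1), of y "w(x := a)"] y by simp
next
  fix w w' :: "'x \<Rightarrow> 'k" assume "\<forall>y\<in>set xs. w y = w' y"
  then show "\<phi> (w(x := a)) = \<phi> (w'(x := a))"
    by (intro ml_cong[OF assms(1)]) auto
qed

lemma vact_ml: "distinct xs \<Longrightarrow> ml (set xs) \<phi> \<Longrightarrow> ml (set xs) (vact xs \<phi> h)"
proof (induction xs arbitrary: \<phi> h)
  case Nil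
  then show ?case by (auto simp: ml_def)
next
  case (Cons x xs)
  note IH = Cons.IH[OF _ ml_Cons[OF Cons.prems(2)]]
  have upd: "vact xs (\<lambda>u. \<phi> (u(x := a))) b (w(x := c)) = vact xs (\<lambda>u. \<phi> (u(x := a))) b w" for a b c w
    using Cons.prems(1) by (intro ml_cong[OF IH]) auto
  note L = ml_upd[OF Cons.prems(2)]
  show ?case
    unfolding ml_def
  proof (intro conjI ballI allI impI)
    fix y w assume y: "y \<in> set (x # xs)"
    show "lin (\<lambda>c. vact (x # xs) \<phi> h (w(y := c)))"
    proof (cases "y = x")
      case True
      then show ?thesis by (simp add: upd) (simp add: lin_def ac_lin L v_lin del: fun_upd_apply)
    next
      case False
      with y have y: "y \<in> set xs" by auto
      have "lin (\<lambda>c. vact xs (\<lambda>u. \<phi> (u(x := a))) b (w(y := c)))" for a b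
        using Cons.prems(1) y by (intro ml_lin[OF IH]) auto
      then show ?thesis using False by (simp add: lin_def)
    qed
  next
    fix w w' :: "'x \<Rightarrow> 'k" assume w: "\<forall>y\<in>set (x # xs). w y = w' y"
    have "vact xs (\<lambda>u. \<phi> (u(x := a))) b w = vact xs (\<lambda>u. \<phi> (u(x := a))) b w'" for a b
      using Cons.prems(1) w by (intro ml_cong[OF IH]) auto
    then show "vact (x # xs) \<phi> h w = vact (x # xs) \<phi> h w'" using w by simp
  qed
qed

lemma vm_ml: "distinct xs \<Longrightarrow> ml (set xs) \<phi> \<Longrightarrow> ml (set xs) \<psi> \<Longrightarrow> ml (set xs) (vm xs \<phi> \<psi>)"
proof (induction xs arbitrary: \<phi> \<psi>)
  case Nil
  have "\<phi> w = \<phi> w'" "\<psi> w = \<psi> w'" for w w'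
    using ml_cong[OF Nil(2)] ml_cong[OF Nil(3)] by simp_all
  then have "vm [] \<phi> \<psi> w = vm [] \<phi> \<psi> w'" for w w' by (metis vm.simps(1))
  then show ?case by (auto simp: ml_def)
next
  case (Cons x xs)
  have d: "distinct xs" "x \<notin> set xs" using Cons.prems by auto
  note IH = Cons.IH[OF d(1) vact_ml[OF d(1) ml_Cons[OF Cons.prems(2) d(2)]] ml_Cons[OF Cons.prems(3) d(2)]]
  let ?B = "\<lambda>a b s. vm xs (vact xs (\<lambda>u. \<phi> (u(x := a))) s) (\<lambda>u. \<psi> (u(x := b)))"
  have upd: "?B a b s (w(x := c)) = ?B a b s w" for a b c s w
    using d by (intro ml_cong[OF IH]) auto
  note L = ml_upd[OF Cons.prems(2)] ml_upd[OF Cons.prems(3)]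
  show ?case
    unfolding ml_def
  proof (intro conjI ballI allI impI)
    fix y w assume y: "y \<in> set (x # xs)"
    show "lin (\<lambda>c. vm (x # xs) \<phi> \<psi> (w(y := c)))"
    proof (cases "y = x")
      case True
      then show ?thesis by (simp add: upd) (simp add: lin_def)
    next
      case False
      with y have y: "y \<in> set xs" by auto
      have "lin (\<lambda>c. ?B a b s (w(y := c)))" for a b s
        using y by (intro ml_lin[OF IH]) auto
      then show ?thesis using False by (simp add: lin_def)
    qed
  next
    fix w w' :: "'x \<Rightarrow> 'k" assume w: "\<forall>y\<in>set (x # xs). w y = w' y"
    have "?B a b s w = ?B a b s w'" for a b s
      using w by (intro ml_cong[OF IH]) auto
    then show "vm (x # xs) \<phi> \<psi> w = vm (x # xs) \<phi> \<psi> w'" using w by simp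
  qed
qed

lemma vact_vact:
  "distinct xs \<Longrightarrow> ml (set xs) \<phi> \<Longrightarrow> vact xs (vact xs \<phi> g) h w = vact xs \<phi> (g * h) w"
proof (induction xs arbitrary: \<phi> g h w)
  case Nil
  then show ?case by (simp add: counit_mult mult_ac)
next
  case (Cons x xs)
  have d: "distinct xs" "x \<notin> set xs" using Cons.prems by auto
  note m = ml_Cons[OF Cons.prems(2) d(2)]
  note L = ml_upd[OF Cons.prems(2)]
  have upd: "vact xs (\<lambda>u. \<phi> (u(x := a))) b (w(x := c)) = vact xs (\<lambda>u. \<phi> (u(x := a))) b w" for a b c w
    using d by (intro ml_cong[OF vact_ml[OF d(1) m]]) auto
  have "vact (x # xs) (vact (x # xs) \<phi> g) h w
    = cop h (\<lambda>a b. cop g (\<lambda>c d. vact xs (vact xs (\<lambda>u. \<phi> (u(x := ac (out x) c (ac (out x) a (w x))))) d) b w))"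
    by (simp add: upd vact_sw2) (rule sw2_swap)
  also have "\<dots> = cop g (\<lambda>c d. cop h (\<lambda>a b. vact xs (\<lambda>u. \<phi> (u(x := ac (out x) (c * a) (w x)))) (d * b) w))"
    by (subst sw2_swap) (simp add: Cons.IH[OF d(1) m] ac_mult del: fun_upd_apply)
  also have "\<dots> = vact (x # xs) \<phi> (g * h) w"
    by simp (rule cop_mult[symmetric], simp add: bil_def lin_def L v_lin del: fun_upd_apply)
  finally show ?case .
qed

lemma vact_one: "distinct xs \<Longrightarrow> ml (set xs) \<phi> \<Longrightarrow> vact xs \<phi> 1 w = \<phi> w"
proof (induction xs arbitrary: \<phi> w)
  case Nil
  then show ?case by (simp add: counit_one)
next
  case (Cons x xs)
  have d: "distinct xs" "x \<notin> set xs" using Cons.prems by auto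
  note L = ml_upd[OF Cons.prems(2)]
  show ?case
    by simp (subst cop_one, simp add: bil_def lin_def L v_lin del: fun_upd_apply, simp add: Cons.IH[OF d(1) ml_Cons[OF Cons.prems(2) d(2)]] ac_one)
qed

text \<open>The module algebra axiom. The coproduct of \<open>h\<close> is distributed over the first end and the remaining ones; the leg that acts in the first factor at the later ends and the leg that acts in the second factor at \<open>x\<close> appear in the wrong order, which \<open>R \<Delta> = \<Delta>\<^sup>o\<^sup>p R\<close> corrects.\<close>

lemma vact_vm:
  "distinct xs \<Longrightarrow> ml (set xs) \<phi> \<Longrightarrow> ml (set xs) \<psi> \<Longrightarrow>
    vact xs (vm xs \<phi> \<psi>) h w = cop h (\<lambda>a b. vm xs (vact xs \<phi> a) (vact xs \<psi> b) w)"
proof (induction xs arbitrary: \<phi> \<psi> h w)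
  case Nil
  then show ?case by (simp add: counit_cop(1)[of eps] lin_eps mult_ac)
next
  case (Cons x xs)
  have d: "distinct xs" "x \<notin> set xs" using Cons.prems by auto
  note m = ml_Cons[OF Cons.prems(2) d(2)] ml_Cons[OF Cons.prems(3) d(2)]
  note L = ml_upd[OF Cons.prems(2)] ml_upd[OF Cons.prems(3)]
  let ?P = "\<lambda>a u. \<phi> (u(x := a))" and ?Q = "\<lambda>a u. \<psi> (u(x := a))"
  let ?D = "dl (out x) (sel x)"
  let ?a = "ac (out x)"
  have upd: "vm xs (vact xs (?P a) s) (?Q b) (w(x := c)) = vm xs (vact xs (?P a) s) (?Q b) w" for a b c s w
    using d by (intro ml_cong[OF vm_ml[OF d(1) vact_ml[OF d(1) m(1)] m(2)]]) auto
  have upd': "vact xs (?P a) b (w(x := c)) = vact xs (?P a) b w" "vact xs (?Q a) b (w(x := c)) = vact xs (?Q a) b w" for a b c w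
    using d by (auto intro!: ml_cong[OF vact_ml[OF d(1) m(1)]] ml_cong[OF vact_ml[OF d(1) m(2)]])
  have upd'': "(\<lambda>u. vact (x # xs) \<phi> a (u(x := c))) = (\<lambda>u. cop a (\<lambda>g b. vact xs (?P (?a g c)) b u))"
    "(\<lambda>u. vact (x # xs) \<psi> a (u(x := c))) = (\<lambda>u. cop a (\<lambda>g b. vact xs (?Q (?a g c)) b u))" for a c
    by (simp_all add: upd')
  let ?G = "\<lambda>c g x d k y. vm xs (vact xs (?P (?a g c)) x) (vact xs (?Q (?a k d)) y) w"
  have vv: "vact xs (vact xs (?P c) s) t = vact xs (?P c) (s * t)" for c s t
    by (rule ext) (rule vact_vact[OF d(1) m(1)])
  have "vact (x # xs) (vm (x # xs) \<phi> \<psi>) h w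
    = cop h (\<lambda>a b. sw2 (?D (?a a (w x))) (\<lambda>c d. rr (\<lambda>r s. vact xs (vm xs (vact xs (?P c) s) (?Q (?a r d))) b w)))"
    by (simp add: upd vact_sw2)
  also have "\<dots> = cop h (\<lambda>a b. cop a (\<lambda>g k. sw2 (?D (w x)) (\<lambda>c d. rr (\<lambda>r s. vact xs (vm xs (vact xs (?P (?a g c)) s) (?Q (?a r (?a k d)))) b w))))"
    by (rule sw2_cong, rule dl_ac) (simp add: bil_def lin_def L v_lin del: fun_upd_apply)
  also have "\<dots> = cop h (\<lambda>a b. cop a (\<lambda>g k. sw2 (?D (w x)) (\<lambda>c d. rr (\<lambda>r s. cop b (\<lambda>b1 b2. ?G c g (s * b1) d (r * k) b2)))))"
    by (simp only: Cons.IH[OF d(1) vact_ml[OF d(1) m(1)] m(2)] vv ac_mult)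
  also have "\<dots> = sw2 (?D (w x)) (\<lambda>c d. cop h (\<lambda>a b. cop a (\<lambda>g k. cop b (\<lambda>b1 b2. rr (\<lambda>r s. ?G c g (s * b1) d (r * k) b2)))))"
    by (simp only: sw2_swap[of "comult H y" "?D (w x)" for y] sw2_swap[of R "comult H y" for y])
  (* regroup the four legs of the coproduct of h so that the two inner ones form the coproduct of m *)
  also have "\<dots> = sw2 (?D (w x)) (\<lambda>c d. cop h (\<lambda>g b. cop b (\<lambda>k b. cop b (\<lambda>b1 b2. rr (\<lambda>r s. ?G c g (s * b1) d (r * k) b2)))))"
    by (rule sw2_cong, rule coassoc_cop) (simp add: tril_def lin_def L v_lin alg_lin del: fun_upd_apply)
  also have "\<dots> = sw2 (?D (w x)) (\<lambda>c d. cop h (\<lambda>g b. cop b (\<lambda>m b2. cop m (\<lambda>k b1. rr (\<lambda>r s. ?G c g (s * b1) d (r * k) b2)))))"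
    by (rule sw2_cong, rule sw2_cong, rule coassoc_cop[symmetric]) (simp add: tril_def lin_def L v_lin alg_lin del: fun_upd_apply)
  also have "\<dots> = sw2 (?D (w x)) (\<lambda>c d. cop h (\<lambda>g b. cop b (\<lambda>m b2. cop m (\<lambda>b1 k. rr (\<lambda>r s. ?G c g (b1 * s) d (k * r) b2)))))"
  (* exchange the legs of m *)
  proof (rule sw2_cong, rule sw2_cong, rule sw2_cong)
    fix c d g b m b2
    have "bil (\<lambda>p q. ?G c g q d p b2)"
      by (simp add: bil_def lin_def L v_lin alg_lin del: fun_upd_apply)
    from trans[OF sw2_swap rr_cop[OF this, of m]]
    show "cop m (\<lambda>k b1. rr (\<lambda>r s. ?G c g (s * b1) d (r * k) b2)) = cop m (\<lambda>b1 k. rr (\<lambda>r s. ?G c g (b1 * s) d (k * r) b2))" .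
  qed
  also have "\<dots> = sw2 (?D (w x)) (\<lambda>c d. cop h (\<lambda>g b. cop b (\<lambda>b1 e. cop e (\<lambda>k b2. rr (\<lambda>r s. ?G c g (b1 * s) d (k * r) b2)))))"
    by (rule sw2_cong, rule sw2_cong, rule coassoc_cop) (simp add: tril_def lin_def L v_lin alg_lin del: fun_upd_apply)
  also have "\<dots> = sw2 (?D (w x)) (\<lambda>c d. cop h (\<lambda>a b. cop a (\<lambda>g b1. cop b (\<lambda>k b2. rr (\<lambda>r s. ?G c g (b1 * s) d (k * r) b2)))))"
    by (rule sw2_cong, rule coassoc_cop[symmetric]) (simp add: tril_def lin_def L v_lin alg_lin del: fun_upd_apply)
  also have "\<dots> = cop h (\<lambda>a b. sw2 (?D (w x)) (\<lambda>c d. rr (\<lambda>r s. cop a (\<lambda>g b1. cop b (\<lambda>k b2. ?G c g (b1 * s) d (k * r) b2)))))"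
    by (simp only: sw2_swap[of "comult H y" "?D (w x)" for y] sw2_swap[of R "comult H y" for y])
  also have "\<dots> = cop h (\<lambda>a b. vm (x # xs) (vact (x # xs) \<phi> a) (vact (x # xs) \<psi> b) w)"
    by (simp only: vm.simps(2)[of x xs "vact (x # xs) \<phi> a" for a] upd'' vact_sw2 vm_sw2_left vm_sw2_right vact_vact[OF d(1) m(1)] ac_mult)
  finally show ?case .
qed

text \<open>Associativity of a braided tensor product. In the induction step coassociativity at the first end is combined with both hexagon identities: one of them splits the action on a product of forms at the later ends, the other one splits the action at the first end on the legs of its coproduct.\<close>

lemma vm_assoc:
  "distinct xs \<Longrightarrow> ml (set xs) \<phi> \<Longrightarrow> ml (set xs) \<psi> \<Longrightarrow> ml (set xs) \<chi> \<Longrightarrow>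
    vm xs (vm xs \<phi> \<psi>) \<chi> w = vm xs \<phi> (vm xs \<psi> \<chi>) w"
proof (induction xs arbitrary: \<phi> \<psi> \<chi> w)
  case Nil
  then show ?case by (simp add: mult_ac)
next
  case (Cons x xs)
  have d: "distinct xs" "x \<notin> set xs" using Cons.prems by auto
  note m = ml_Cons[OF Cons.prems(2) d(2)] ml_Cons[OF Cons.prems(3) d(2)] ml_Cons[OF Cons.prems(4) d(2)]
  note L = ml_upd[OF Cons.prems(2)] ml_upd[OF Cons.prems(3)] ml_upd[OF Cons.prems(4)]
  let ?P = "\<lambda>a u. \<phi> (u(x := a))" and ?Q = "\<lambda>a u. \<psi> (u(x := a))" and ?X = "\<lambda>a u. \<chi> (u(x := a))"
  let ?D = "dl (out x) (sel x)"
  let ?a = "ac (out x)"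
  have upd: "vm xs (vact xs (?P a) s) (?Q b) (w(x := c)) = vm xs (vact xs (?P a) s) (?Q b) w"
    "vm xs (vact xs (?Q a) s) (?X b) (w(x := c)) = vm xs (vact xs (?Q a) s) (?X b) w" for a b c s w
    using d by (auto intro!: ml_cong[OF vm_ml[OF d(1) vact_ml[OF d(1) m(1)] m(2)]]
        ml_cong[OF vm_ml[OF d(1) vact_ml[OF d(1) m(2)] m(3)]])
  have upd': "(\<lambda>u. vm (x # xs) \<phi> \<psi> (u(x := a)))
      = (\<lambda>u. sw2 (?D a) (\<lambda>c d. rr (\<lambda>r s. vm xs (vact xs (?P c) s) (?Q (?a r d)) u)))"
    "(\<lambda>u. vm (x # xs) \<psi> \<chi> (u(x := a)))
      = (\<lambda>u. sw2 (?D a) (\<lambda>c d. rr (\<lambda>r s. vm xs (vact xs (?Q c) s) (?X (?a r d)) u)))" for a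
    by (simp_all add: upd)
  let ?G = "\<lambda>c p d q e. vm xs (vm xs (vact xs (?P c) p) (vact xs (?Q d) q)) (?X e) w"
  have "vm (x # xs) (vm (x # xs) \<phi> \<psi>) \<chi> w
    = sw2 (?D (w x)) (\<lambda>a b. rr (\<lambda>r s. sw2 (?D a) (\<lambda>c d. rr (\<lambda>r' s'.
        vm xs (vact xs (vm xs (vact xs (?P c) s') (?Q (?a r' d))) s) (?X (?a r b)) w))))"
    by (simp only: vm.simps(2)[of x xs "vm (x # xs) \<phi> \<psi>"] upd' vact_sw2 vm_sw2_left)
  also have "\<dots> = sw2 (?D (w x)) (\<lambda>a b. rr (\<lambda>r s. sw2 (?D a) (\<lambda>c d. rr (\<lambda>r' s'.
        cop s (\<lambda>s1 s2. ?G c (s' * s1) (?a r' d) s2 (?a r b))))))"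
  proof -
    have "vact xs (vm xs (vact xs (?P c) s') (?Q e)) s
      = (\<lambda>w. cop s (\<lambda>s1 s2. vm xs (vact xs (?P c) (s' * s1)) (vact xs (?Q e) s2) w))" for c s' e s
    proof
      fix w
      have "vact xs (vact xs (?P c) s') s1 = vact xs (?P c) (s' * s1)" for s1
        by (rule ext) (rule vact_vact[OF d(1) m(1)])
      then show "vact xs (vm xs (vact xs (?P c) s') (?Q e)) s w
        = cop s (\<lambda>s1 s2. vm xs (vact xs (?P c) (s' * s1)) (vact xs (?Q e) s2) w)"
        by (simp only: vact_vm[OF d(1) vact_ml[OF d(1) m(1)] m(2)])
    qed
    then show ?thesis by (simp only: vm_sw2_left)
  qed
  also have "\<dots> = sw2 (?D (w x)) (\<lambda>a b. sw2 (?D a) (\<lambda>c d. rr (\<lambda>r' s'. rr (\<lambda>r s.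
        cop s (\<lambda>s1 s2. ?G c (s' * s1) (?a r' d) s2 (?a r b))))))"
    by (rule sw2_cong, rule trans[OF sw2_swap], rule sw2_cong, rule sw2_swap)
  also have "\<dots> = sw2 (?D (w x)) (\<lambda>a b. sw2 (?D b) (\<lambda>d b. rr (\<lambda>r' s'. rr (\<lambda>r s.
        cop s (\<lambda>s1 s2. ?G a (s' * s1) (?a r' d) s2 (?a r b))))))"
    by (rule dl_coassoc) (simp add: tril_def lin_def L v_lin alg_lin del: fun_upd_apply)
  (* the hexagon identity for the coproduct of the second leg *)
  also have "\<dots> = sw2 (?D (w x)) (\<lambda>a b. sw2 (?D b) (\<lambda>d b. rr (\<lambda>r' s'. rr (\<lambda>r s. rr (\<lambda>k t.
        ?G a (s' * t) (?a r' d) s (?a (r * k) b))))))"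
    by (rule sw2_cong, rule sw2_cong, rule sw2_cong, rule rr_comult_right) (simp add: tril_def lin_def L v_lin alg_lin del: fun_upd_apply)
  also have "\<dots> = sw2 (?D (w x)) (\<lambda>a b. sw2 (?D b) (\<lambda>d b. rr (\<lambda>r s. rr (\<lambda>r' s'. rr (\<lambda>k t.
        ?G a (s' * t) (?a r' d) s (?a r (?a k b)))))))"
    by (rule sw2_cong, rule sw2_cong, rule trans[OF sw2_swap]) (simp only: ac_mult)
  (* the hexagon identity for the coproduct of the first leg, read backwards *)
  also have "\<dots> = sw2 (?D (w x)) (\<lambda>a b. sw2 (?D b) (\<lambda>d b. rr (\<lambda>r s. rr (\<lambda>r' s'. cop r' (\<lambda>g k.
        ?G a s' (?a g d) s (?a r (?a k b)))))))"
    by (rule sw2_cong, rule sw2_cong, rule sw2_cong, rule rr_comult_left[symmetric]) (simp add: tril_def lin_def L v_lin alg_lin del: fun_upd_apply)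
  also have "\<dots> = sw2 (?D (w x)) (\<lambda>a b. rr (\<lambda>r' s'. cop r' (\<lambda>g k. sw2 (?D b) (\<lambda>d b. rr (\<lambda>r s.
        ?G a s' (?a g d) s (?a r (?a k b)))))))"
    by (rule sw2_cong, rule trans[OF sw2_cong[OF sw2_swap] ], rule trans[OF sw2_swap], rule sw2_cong,
      rule trans[OF sw2_cong[OF sw2_swap]], rule sw2_swap)
  also have "\<dots> = sw2 (?D (w x)) (\<lambda>a b. rr (\<lambda>r' s'. sw2 (?D (?a r' b)) (\<lambda>d b. rr (\<lambda>r s.
        ?G a s' d s (?a r b)))))"
    by (rule sw2_cong, rule sw2_cong, rule dl_ac[symmetric]) (simp add: bil_def lin_def L v_lin alg_lin del: fun_upd_apply)
  also have "\<dots> = vm (x # xs) \<phi> (vm (x # xs) \<psi> \<chi>) w"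
    by (simp only: vm.simps(2)[of x xs \<phi> "vm (x # xs) \<psi> \<chi>"] upd' vact_sw2 vm_sw2_right Cons.IH[OF d(1) vact_ml[OF d(1) m(1)] vact_ml[OF d(1) m(2)] m(3)])
  finally show ?case .
qed

end

section \<open>The vertex product on pure tensors\<close>

context vertex
begin

text \<open>Pure tensors as forms.\<close>

definition pf :: "'x set \<Rightarrow> ('x \<Rightarrow> 'k \<Rightarrow> 'f) \<Rightarrow> ('x \<Rightarrow> 'k) \<Rightarrow> 'f" where
  "pf X \<alpha> w = (\<Prod>x\<in>X. \<alpha> x (w x))"

lemma pf_upd_head:
  "x \<notin> set xs \<Longrightarrow> pf (set (x # xs)) \<alpha> (u(x := a)) = \<alpha> x a * pf (set xs) \<alpha> u"
  by (auto simp: pf_def intro!: arg_cong2[where f = "(*)"] prod.cong)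

lemma pf_head: "x \<notin> set xs \<Longrightarrow> pf (set (x # xs)) \<alpha> u = \<alpha> x (u x) * pf (set xs) \<alpha> u"
  by (simp add: pf_def)

lemma pf_ml:
  assumes "finite X" "\<And>x. x \<in> X \<Longrightarrow> lin (\<alpha> x)"
  shows "ml X (pf X \<alpha>)"
  unfolding ml_def
proof (intro conjI ballI allI impI)
  fix x w assume x: "x \<in> X"
  have "pf X \<alpha> (w(x := a)) = \<alpha> x a * (\<Prod>y\<in>X - {x}. \<alpha> y (w y))" for a
    using assms(1) x by (simp add: pf_def prod.remove)
  then show "lin (\<lambda>a. pf X \<alpha> (w(x := a)))"
    using assms(2)[OF x] by (simp add: lin_def algebra_simps)
next
  fix w w' :: "'x \<Rightarrow> 'k" assume "\<forall>x\<in>X. w x = w' x"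
  then show "pf X \<alpha> w = pf X \<alpha> w'" by (simp add: pf_def)
qed

lemma vact_pf_Cons:
  assumes "distinct (x # xs)"
  shows "vact (x # xs) (pf (set (x # xs)) \<alpha>) h w
    = cop h (\<lambda>a b. \<alpha> x (ac (out x) a (w x)) * vact xs (pf (set xs) \<alpha>) b w)"
  using assms by (simp only: vact.simps(2) pf_upd_head distinct.simps vact_cmult simp_thms)

lemma vm_pf_Cons:
  assumes "distinct (x # xs)"
  shows "vm (x # xs) (pf (set (x # xs)) \<alpha>) (pf (set (x # xs)) \<beta>) w
    = sw2 (dl (out x) (sel x) (w x)) (\<lambda>a b. rr (\<lambda>r s. \<alpha> x a * \<beta> x (ac (out x) r b) *
        vm xs (vact xs (pf (set xs) \<alpha>) s) (pf (set xs) \<beta>) w))"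
  using assms by (simp only: vm.simps(2) pf_upd_head distinct.simps vact_cmult vm_cmult_left vm_cmult_right simp_thms mult.assoc)

lemma vact_unit:
  "distinct xs \<Longrightarrow> (\<And>x. x \<in> set xs \<Longrightarrow> \<alpha> x = eps) \<Longrightarrow>
    vact xs (pf (set xs) \<alpha>) h = (\<lambda>w. eps h * pf (set xs) \<alpha> w)"
proof (induction xs arbitrary: h)
  case (Cons x xs)
  then have d: "distinct (x # xs)" "x \<notin> set xs" "\<alpha> x = eps" by simp_all
  have IH: "vact xs (pf (set xs) \<alpha>) b = (\<lambda>w. eps b * pf (set xs) \<alpha> w)" for b
    using Cons by simp
  show ?case
  proof
    fix w
    let ?c = "eps (w x) * pf (set xs) \<alpha> w"
    have "vact (x # xs) (pf (set (x # xs)) \<alpha>) h w = cop h (\<lambda>a b. eps a * (eps b * ?c))"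
      by (simp only: vact_pf_Cons[OF d(1)] IH d(3) eps_ac mult_ac)
    also have "\<dots> = eps h * ?c"
      by (rule counit_cop) (use lin_eps in \<open>simp add: lin_def algebra_simps\<close>)
    finally show "vact (x # xs) (pf (set (x # xs)) \<alpha>) h w = eps h * pf (set (x # xs)) \<alpha> w"
      by (simp only: pf_head[OF d(2)] d(3))
  qed
qed simp

lemma vact_single:
  assumes "distinct xs" "y \<in> set xs" "\<And>x. x \<in> set xs \<Longrightarrow> x \<noteq> y \<Longrightarrow> \<alpha> x = eps" "lin (\<alpha> y)"
  shows "vact xs (pf (set xs) \<alpha>) h w = pf (set xs) (\<alpha>(y := (\<lambda>a. \<alpha> y (ac (out y) h a)))) w"
  using assms
proof (induction xs arbitrary: h)
  case (Cons x xs)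
  then have d: "distinct xs" "x \<notin> set xs" by simp_all
  show ?case
  proof (cases "x = y")
    case True
    have "vact (x # xs) (pf (set (x # xs)) \<alpha>) h w
      = cop h (\<lambda>a b. \<alpha> y (ac (out y) a (w y)) * eps b) * pf (set xs) \<alpha> w"
    proof -
      have "vact xs (pf (set xs) \<alpha>) b = (\<lambda>w. eps b * pf (set xs) \<alpha> w)" for b
        using Cons.prems True d by (intro vact_unit) auto
      then show ?thesis
        by (simp only: vact_pf_Cons[OF Cons.prems(1)[unfolded True]] True sw2_cmult_right[symmetric] mult.assoc)
    qed
    also have "cop h (\<lambda>a b. \<alpha> y (ac (out y) a (w y)) * eps b) = \<alpha> y (ac (out y) h (w y))"
      by (rule counit_cop) (use Cons.prems(4) in \<open>simp add: lin_def ac_lin\<close>)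
    also have "pf (set xs) \<alpha> w = pf (set xs) (\<alpha>(y := (\<lambda>a. \<alpha> y (ac (out y) h a)))) w"
      unfolding pf_def using True d by (intro prod.cong) auto
    also have "\<alpha> y (ac (out y) h (w y)) * \<dots> = pf (set (x # xs)) (\<alpha>(y := (\<lambda>a. \<alpha> y (ac (out y) h a)))) w"
      by (simp only: True pf_head[OF d(2)[unfolded True]] fun_upd_same)
    finally show ?thesis .
  next
    case False
    then have y: "y \<in> set xs" using Cons.prems by simp
    have "\<alpha> x = eps" using Cons.prems False by simp
    then have "vact (x # xs) (pf (set (x # xs)) \<alpha>) h w
      = cop h (\<lambda>a b. eps a * (eps (w x) * vact xs (pf (set xs) \<alpha>) b w))"
      using Cons.prems by (subst vact_pf_Cons) (simp_all add: eps_ac mult.assoc)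
    also have "\<dots> = eps (w x) * vact xs (pf (set xs) \<alpha>) h w"
      by (rule counit_cop) (simp add: lin_def v_lin algebra_simps)
    also have "\<dots> = eps (w x) * pf (set xs) (\<alpha>(y := (\<lambda>a. \<alpha> y (ac (out y) h a)))) w"
    proof -
      have "vact xs (pf (set xs) \<alpha>) h w = pf (set xs) (\<alpha>(y := (\<lambda>a. \<alpha> y (ac (out y) h a)))) w"
        by (rule Cons.IH[OF d(1) y]) (use Cons.prems in auto)
      then show ?thesis by (simp only:)
    qed
    also have "\<dots> = pf (set (x # xs)) (\<alpha>(y := (\<lambda>a. \<alpha> y (ac (out y) h a)))) w"
      by (simp only: pf_head[OF d(2)] fun_upd_other[OF False] \<open>\<alpha> x = eps\<close>)
    finally show ?thesis .
  qed
qed simp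

lemma vm_unit_left:
  "distinct xs \<Longrightarrow> (\<And>x. x \<in> set xs \<Longrightarrow> \<alpha> x = eps) \<Longrightarrow> ml (set xs) \<psi> \<Longrightarrow>
    vm xs (pf (set xs) \<alpha>) \<psi> w = \<psi> w"
proof (induction xs arbitrary: \<psi> w)
  case Nil
  then show ?case by (simp add: pf_def)
next
  case (Cons x xs)
  then have d: "distinct xs" "x \<notin> set xs" by simp_all
  note m = ml_Cons[OF Cons.prems(3) d(2)]
  note L = ml_upd[OF Cons.prems(3)]
  have "vm (x # xs) (pf (set (x # xs)) \<alpha>) \<psi> w = sw2 (dl (out x) (sel x) (w x)) (\<lambda>a b.
     eps a * rr (\<lambda>r s. eps s * \<psi> (w(x := ac (out x) r b))))"
    using Cons.prems(1,2) Cons.IH[OF d(1) _ m]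
    by (simp only: vm.simps(2) pf_upd_head[OF d(2)] vact_cmult vm_cmult_left vact_unit[OF d(1)]
        list.set_intros sw2_cmult)
  also have "\<dots> = sw2 (dl (out x) (sel x) (w x)) (\<lambda>a b. eps a * \<psi> (w(x := ac (out x) 1 b)))"
    by (rule sw2_cong, subst rr_counit) (simp_all add: lin_def L ac_lin del: fun_upd_apply)
  also have "\<dots> = \<psi> (w(x := w x))"
    unfolding ac_one by (rule dl_counit) (simp add: lin_def L del: fun_upd_apply)
  finally show ?case by simp
qed

lemma vm_unit_right:
  "distinct xs \<Longrightarrow> (\<And>x. x \<in> set xs \<Longrightarrow> \<beta> x = eps) \<Longrightarrow> ml (set xs) \<phi> \<Longrightarrow>
    vm xs \<phi> (pf (set xs) \<beta>) w = \<phi> w"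
proof (induction xs arbitrary: \<phi> w)
  case Nil
  then show ?case by (simp add: pf_def)
next
  case (Cons x xs)
  then have d: "distinct xs" "x \<notin> set xs" by simp_all
  note m = ml_Cons[OF Cons.prems(3) d(2)]
  note L = ml_upd[OF Cons.prems(3)]
  have "vm (x # xs) \<phi> (pf (set (x # xs)) \<beta>) w = sw2 (dl (out x) (sel x) (w x)) (\<lambda>a b.
     eps b * rr (\<lambda>r s. eps r * vact xs (\<lambda>u. \<phi> (u(x := a))) s w))"
    using Cons.prems(1,2) Cons.IH[OF d(1) _ vact_ml[OF d(1) m]]
    by (simp only: vm.simps(2) pf_upd_head[OF d(2)] vm_cmult_right eps_ac
        list.set_intros sw2_cmult sw2_cmult_mid mult.assoc)
  also have "\<dots> = sw2 (dl (out x) (sel x) (w x)) (\<lambda>a b. eps b * vact xs (\<lambda>u. \<phi> (u(x := a))) 1 w)"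
    by (rule sw2_cong, subst rr_counit) (simp_all add: lin_def v_lin del: fun_upd_apply)
  also have "\<dots> = \<phi> (w(x := w x))"
    unfolding vact_one[OF d(1) m] by (rule dl_counit) (simp add: lin_def L del: fun_upd_apply)
  finally show ?case by simp
qed

text \<open>If the second factor is trivial at the first end, then so is the braiding there.\<close>

lemma vm_strip:
  assumes "distinct (x # xs)" "\<beta> x = eps" "\<And>y. y \<in> set (x # xs) \<Longrightarrow> lin (\<alpha> y)"
  shows "vm (x # xs) (pf (set (x # xs)) \<alpha>) (pf (set (x # xs)) \<beta>) w
    = \<alpha> x (w x) * vm xs (pf (set xs) \<alpha>) (pf (set xs) \<beta>) w"
proof -
  have one: "vact xs (pf (set xs) \<alpha>) 1 = pf (set xs) \<alpha>"
    using assms by (intro ext vact_one pf_ml) auto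
  have "vm (x # xs) (pf (set (x # xs)) \<alpha>) (pf (set (x # xs)) \<beta>) w
    = sw2 (dl (out x) (sel x) (w x)) (\<lambda>a b. eps b * (\<alpha> x a *
        rr (\<lambda>r s. eps r * vm xs (vact xs (pf (set xs) \<alpha>) s) (pf (set xs) \<beta>) w)))"
    by (simp only: vm_pf_Cons[OF assms(1)] assms(2) eps_ac sw2_cmult[symmetric] mult_ac)
  also have "\<dots> = sw2 (dl (out x) (sel x) (w x)) (\<lambda>a b. eps b * (\<alpha> x a * vm xs (pf (set xs) \<alpha>) (pf (set xs) \<beta>) w))"
    by (rule sw2_cong, subst rr_counit) (simp_all add: lin_def v_lin one)
  also have "\<dots> = \<alpha> x (w x) * vm xs (pf (set xs) \<alpha>) (pf (set xs) \<beta>) w"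
    by (rule dl_counit) (use assms(3)[of x] in \<open>simp add: lin_def algebra_simps\<close>)
  finally show ?thesis .
qed

lemma vm_ordered:
  assumes "distinct (ys @ zs)" "\<And>x. x \<in> set ys \<Longrightarrow> \<beta> x = eps" "\<And>x. x \<in> set zs \<Longrightarrow> \<alpha> x = eps"
    and "\<And>x. x \<in> set (ys @ zs) \<Longrightarrow> lin (\<alpha> x)" "\<And>x. x \<in> set (ys @ zs) \<Longrightarrow> lin (\<beta> x)"
  shows "vm (ys @ zs) (pf (set (ys @ zs)) \<alpha>) (pf (set (ys @ zs)) \<beta>) w
    = pf (set (ys @ zs)) (\<lambda>x. if x \<in> set ys then \<alpha> x else \<beta> x) w"
  using assms
proof (induction ys)
  case Nil
  then show ?case by (simp add: vm_unit_left pf_ml)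
next
  case (Cons y ys)
  have y: "y \<notin> set (ys @ zs)" using Cons.prems by simp
  have "vm ((y # ys) @ zs) (pf (set ((y # ys) @ zs)) \<alpha>) (pf (set ((y # ys) @ zs)) \<beta>) w
    = \<alpha> y (w y) * pf (set (ys @ zs)) (\<lambda>x. if x \<in> set ys then \<alpha> x else \<beta> x) w"
    using Cons.prems Cons.IH vm_strip[of y "ys @ zs" \<beta> \<alpha>] by simp
  also have "pf (set (ys @ zs)) (\<lambda>x. if x \<in> set ys then \<alpha> x else \<beta> x) w
    = pf (set (ys @ zs)) (\<lambda>x. if x \<in> set (y # ys) then \<alpha> x else \<beta> x) w"
    unfolding pf_def using y by (intro prod.cong) auto
  finally show ?case by (simp only: append_Cons pf_head[OF y]) simp
qed

lemma vm_same:
  assumes "distinct xs" "y \<in> set xs" "\<And>x. x \<in> set xs \<Longrightarrow> x \<noteq> y \<Longrightarrow> \<alpha> x = eps \<and> \<beta> x = eps"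
    and "lin (\<alpha> y)" "lin (\<beta> y)"
  shows "vm xs (pf (set xs) \<alpha>) (pf (set xs) \<beta>) w
    = pf (set xs) (\<lambda>x. if x = y then (\<lambda>p. sw2 (dl (out y) (sel y) p) (\<lambda>a b. \<alpha> y a * \<beta> y b)) else eps) w"
  using assms
proof (induction xs)
  case (Cons x xs)
  then have d: "distinct xs" "x \<notin> set xs" by simp_all
  show ?case
  proof (cases "x = y")
    case True
    have u: "pf (set xs) \<alpha> w = pf (set xs) (\<lambda>x. if x = y then (\<lambda>p. sw2 (dl (out y) (sel y) p) (\<lambda>a b. \<alpha> y a * \<beta> y b)) else eps) w"
      unfolding pf_def using True d Cons.prems by (intro prod.cong) auto
    have v: "vm xs (pf (set xs) \<alpha>) (pf (set xs) \<beta>) w = pf (set xs) \<alpha> w"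
    proof (intro vm_unit_right pf_ml)
      show "lin (\<alpha> z)" if "z \<in> set xs" for z
        using Cons.prems(3)[of z] that True d lin_eps by (cases "z = y") auto
    qed (use Cons.prems True d in auto)
    have "vm (x # xs) (pf (set (x # xs)) \<alpha>) (pf (set (x # xs)) \<beta>) w
      = sw2 (dl (out y) (sel y) (w y)) (\<lambda>a b. (\<alpha> y a * rr (\<lambda>r s. eps s * \<beta> y (ac (out y) r b))) * pf (set xs) \<alpha> w)"
    proof -
      have "vact xs (pf (set xs) \<alpha>) s = (\<lambda>w. eps s * pf (set xs) \<alpha> w)" for s
        using Cons.prems True d by (intro vact_unit) auto
      then show ?thesis
        by (simp only: vm_pf_Cons[OF Cons.prems(1)[unfolded True]] True vm_cmult_left v sw2_cmult[symmetric] sw2_cmult_right[symmetric] mult_ac)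
    qed
    also have "\<dots> = sw2 (dl (out y) (sel y) (w y)) (\<lambda>a b. \<alpha> y a * \<beta> y b * pf (set xs) \<alpha> w)"
      by (rule sw2_cong, subst rr_counit) (use Cons.prems(5) in \<open>simp_all add: lin_def ac_lin ac_one\<close>)
    also have "\<dots> = pf (set (x # xs)) (\<lambda>x. if x = y then (\<lambda>p. sw2 (dl (out y) (sel y) p) (\<lambda>a b. \<alpha> y a * \<beta> y b)) else eps) w"
      by (simp only: u sw2_cmult_right True pf_head[OF d(2)[unfolded True]] simp_thms if_True)
    finally show ?thesis .
  next
    case False
    then have "y \<in> set xs" using Cons.prems by simp
    let ?g = "\<lambda>x. if x = y then (\<lambda>p. sw2 (dl (out y) (sel y) p) (\<lambda>a b. \<alpha> y a * \<beta> y b)) else eps"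
    have e: "\<alpha> x = eps" "\<beta> x = eps" using Cons.prems False by auto
    have "lin (\<alpha> z)" if "z \<in> set (x # xs)" for z
      using Cons.prems(3)[OF that] Cons.prems(4) lin_eps by (cases "z = y") auto
    then have "vm (x # xs) (pf (set (x # xs)) \<alpha>) (pf (set (x # xs)) \<beta>) w
      = eps (w x) * vm xs (pf (set xs) \<alpha>) (pf (set xs) \<beta>) w"
      by (subst e(1)[symmetric], intro vm_strip) (use Cons.prems e in auto)
    also have "vm xs (pf (set xs) \<alpha>) (pf (set xs) \<beta>) w = pf (set xs) ?g w"
      by (rule Cons.IH) (use Cons.prems \<open>y \<in> set xs\<close> in auto)
    also have "eps (w x) * \<dots> = pf (set (x # xs)) ?g w"
      by (simp only: pf_head[OF d(2)] False if_False)
    finally show ?thesis .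
  qed
qed simp

text \<open>The generators at \<open>x\<close> and at \<open>y\<close> are in the wrong order here, so one \<open>R\<close>-matrix is left over from the braiding at \<open>y\<close>, with its second leg acting at \<open>x\<close>.\<close>

lemma vm_reversed:
  assumes "distinct (ys @ y # zs)" "x \<in> set zs"
    and "\<And>z. z \<in> set (ys @ y # zs) \<Longrightarrow> z \<noteq> x \<Longrightarrow> \<alpha> z = eps"
    and "\<And>z. z \<in> set (ys @ y # zs) \<Longrightarrow> z \<noteq> y \<Longrightarrow> \<beta> z = eps" and "lin (\<alpha> x)" "lin (\<beta> y)"
  shows "vm (ys @ y # zs) (pf (set (ys @ y # zs)) \<alpha>) (pf (set (ys @ y # zs)) \<beta>) w
    = rr (\<lambda>r s. pf (set (ys @ y # zs)) (\<lambda>z. if z = y then (\<lambda>a. \<beta> y (ac (out y) r a))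
        else if z = x then (\<lambda>a. \<alpha> x (ac (out x) s a)) else eps) w)"
  using assms
proof (induction ys)
  case Nil
  then have d: "distinct zs" "y \<notin> set zs" "distinct (y # zs)" "x \<noteq> y" by auto
  let ?g = "\<lambda>r s z. if z = y then (\<lambda>a. \<beta> y (ac (out y) r a))
        else if z = x then (\<lambda>a. \<alpha> x (ac (out x) s a)) else eps"
  have la: "lin (\<alpha> z)" if "z \<in> set zs" for z
    using Nil.prems(3)[of z] Nil.prems(5) that lin_eps by (cases "z = x") auto
  have 1: "vm zs (vact zs (pf (set zs) \<alpha>) s) (pf (set zs) \<beta>) w = pf (set zs) (?g r s) w" for r s
  proof -
    have "vm zs (vact zs (pf (set zs) \<alpha>) s) (pf (set zs) \<beta>) w = vact zs (pf (set zs) \<alpha>) s w"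
      using Nil.prems d la by (intro vm_unit_right vact_ml pf_ml) auto
    also have "\<dots> = pf (set zs) (\<alpha>(x := (\<lambda>a. \<alpha> x (ac (out x) s a)))) w"
      using Nil.prems d by (intro vact_single) auto
    also have "\<dots> = pf (set zs) (?g r s) w"
      unfolding pf_def using Nil.prems d by (intro prod.cong) auto
    finally show ?thesis .
  qed
  have l: "lin (\<lambda>s. pf (set zs) (?g r s) w)" for r
    unfolding 1[symmetric] by (simp add: lin_def v_lin)
  have "vm (y # zs) (pf (set (y # zs)) \<alpha>) (pf (set (y # zs)) \<beta>) w
    = sw2 (dl (out y) (sel y) (w y)) (\<lambda>a b. rr (\<lambda>r s. eps a * (\<beta> y (ac (out y) r b) * pf (set zs) (?g r s) w)))"
    using Nil.prems d by (simp only: vm_pf_Cons[OF d(3)] 1[symmetric]) (simp add: mult.assoc)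
  also have "\<dots> = sw2 (dl (out y) (sel y) (w y)) (\<lambda>a b. eps a * rr (\<lambda>r s. \<beta> y (ac (out y) r b) * pf (set zs) (?g r s) w))"
    by simp
  also have "\<dots> = rr (\<lambda>r s. \<beta> y (ac (out y) r (w y)) * pf (set zs) (?g r s) w)"
    by (rule dl_counit) (use Nil.prems(6) in \<open>simp add: lin_def ac_lin distrib_right mult.assoc\<close>)
  also have "\<dots> = rr (\<lambda>r s. pf (set (y # zs)) (?g r s) w)"
    by (simp only: pf_head[OF d(2)]) simp
  finally show ?case by simp
next
  case (Cons y' ys)
  let ?xs = "ys @ y # zs"
  let ?g = "\<lambda>r s z. if z = y then (\<lambda>a. \<beta> y (ac (out y) r a))
        else if z = x then (\<lambda>a. \<alpha> x (ac (out x) s a)) else eps"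
  have d: "distinct (y' # ?xs)" "y' \<notin> set ?xs" "y' \<noteq> y" "y' \<noteq> x" using Cons.prems by auto
  have e: "\<alpha> y' = eps" "\<beta> y' = eps" using Cons.prems d by auto
  have la: "lin (\<alpha> z)" if "z \<in> set (y' # ?xs)" for z
    using Cons.prems(3)[of z] Cons.prems(5) that lin_eps by (cases "z = x") auto
  have "vm (y' # ?xs) (pf (set (y' # ?xs)) \<alpha>) (pf (set (y' # ?xs)) \<beta>) w
    = eps (w y') * vm ?xs (pf (set ?xs) \<alpha>) (pf (set ?xs) \<beta>) w"
    by (subst e(1)[symmetric], rule vm_strip) (use d e la in auto)
  also have "vm ?xs (pf (set ?xs) \<alpha>) (pf (set ?xs) \<beta>) w = rr (\<lambda>r s. pf (set ?xs) (?g r s) w)"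
    by (rule Cons.IH) (use Cons.prems in auto)
  also have "eps (w y') * \<dots> = rr (\<lambda>r s. pf (set (y' # ?xs)) (?g r s) w)"
    by (simp only: pf_head[OF d(2)] d(3,4) if_False sw2_cmult)
  finally show ?case by (simp only: append_Cons)
qed

text \<open>Multiplies the argument at each end by a fixed element, on the side of its direction.\<close>

definition twist :: "('x \<Rightarrow> 'k) \<Rightarrow> ('x \<Rightarrow> 'k \<Rightarrow> 'f) \<Rightarrow> 'x \<Rightarrow> 'k \<Rightarrow> 'f" where
  "twist g \<alpha> = (\<lambda>x a. \<alpha> x (om (out x) (g x) a))"

text \<open>The product that is left when all \<open>R\<close>-matrices are dropped from \<open>vm\<close>. The flip at an end depends on whether it is outgoing or selected, but not both; it is the same at the two ends of an edge if exactly one of them is selected.\<close>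

definition base2 :: "'x set \<Rightarrow> ('x \<Rightarrow> 'k \<Rightarrow> 'f) \<Rightarrow> ('x \<Rightarrow> 'k \<Rightarrow> 'f) \<Rightarrow> ('x \<Rightarrow> 'k) \<Rightarrow> 'f" where
  "base2 X \<alpha> \<beta> w = (\<Prod>x\<in>X. sw2 (flip (out x \<noteq> sel x) (w x)) (\<lambda>a b. \<alpha> x a * \<beta> x b))"

text \<open>Maps that are finite sums of twists, with elements of \<open>K\<close> that do not depend on the form. Only this shape matters for the image of \<open>G\<^sup>*\<close>, not the elements that occur.\<close>

definition span1 :: "'x set \<Rightarrow> (('x \<Rightarrow> 'k \<Rightarrow> 'f) \<Rightarrow> ('x \<Rightarrow> 'k) \<Rightarrow> 'f) \<Rightarrow> bool" where
  "span1 X A \<longleftrightarrow> (\<exists>L. \<forall>\<alpha> w. (\<forall>x\<in>X. lin (\<alpha> x)) \<longrightarrow>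
     A \<alpha> w = (\<Sum>(\<kappa>, g)\<leftarrow>L. \<kappa> * pf X (twist g \<alpha>) w))"

definition span2 :: "'x set \<Rightarrow> (('x \<Rightarrow> 'k \<Rightarrow> 'f) \<Rightarrow> ('x \<Rightarrow> 'k \<Rightarrow> 'f) \<Rightarrow> ('x \<Rightarrow> 'k) \<Rightarrow> 'f) \<Rightarrow> bool" where
  "span2 X B \<longleftrightarrow> (\<exists>L. \<forall>\<alpha> \<beta> w. (\<forall>x\<in>X. lin (\<alpha> x) \<and> lin (\<beta> x)) \<longrightarrow>
     B \<alpha> \<beta> w = (\<Sum>(\<kappa>, g, k)\<leftarrow>L. \<kappa> * base2 X (twist g \<alpha>) (twist k \<beta>) w))"

lemma om_om: "om t g (om t g' a) = om t (om t g g') a"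
  by (simp add: om_def mult.assoc)

lemma om_one: "om t 1 a = a"
  by (simp add: om_def)

lemma lin_om: "lin f \<Longrightarrow> lin (\<lambda>a. f (om t g a))"
  by (simp add: lin_def om_lin)

lemma twist_lin: "lin (\<alpha> x) \<Longrightarrow> lin (twist g \<alpha> x)"
  by (simp add: twist_def lin_om)

lemma twist_twist: "twist g (twist g' \<alpha>) = twist (\<lambda>x. om (out x) (g' x) (g x)) \<alpha>"
  by (simp add: twist_def om_om)

lemma sum_list_cmult: "c * (\<Sum>x\<leftarrow>L. f x) = (\<Sum>x\<leftarrow>L. c * f x)" for c :: 'f
  by (induction L) (simp_all add: distrib_left)

lemma span1_zero: "span1 X (\<lambda>_ _. 0)"
  unfolding span1_def by (intro exI[of _ "[]"]) simp

lemma span1_add: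
  assumes "span1 X A" "span1 X A'"
  shows "span1 X (\<lambda>\<alpha> w. A \<alpha> w + A' \<alpha> w)"
proof -
  obtain L L' where "\<forall>\<alpha> w. (\<forall>x\<in>X. lin (\<alpha> x)) \<longrightarrow>
     A \<alpha> w = (\<Sum>(\<kappa>, g)\<leftarrow>L. \<kappa> * pf X (twist g \<alpha>) w)"
    "\<forall>\<alpha> w. (\<forall>x\<in>X. lin (\<alpha> x)) \<longrightarrow> A' \<alpha> w = (\<Sum>(\<kappa>, g)\<leftarrow>L'. \<kappa> * pf X (twist g \<alpha>) w)"
    using assms unfolding span1_def by blast
  then show ?thesis unfolding span1_def by (intro exI[of _ "L @ L'"]) simp
qed

lemma span1_cmult:
  assumes "span1 X A"
  shows "span1 X (\<lambda>\<alpha> w. c * A \<alpha> w)"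
proof -
  obtain L where "\<forall>\<alpha> w. (\<forall>x\<in>X. lin (\<alpha> x)) \<longrightarrow> A \<alpha> w = (\<Sum>(\<kappa>, g)\<leftarrow>L. \<kappa> * pf X (twist g \<alpha>) w)"
    using assms unfolding span1_def by blast
  then show ?thesis unfolding span1_def
    by (intro exI[of _ "map (\<lambda>(\<kappa>, g). (c * \<kappa>, g)) L"])
      (simp add: sum_list_cmult comp_def case_prod_unfold mult.assoc)
qed

lemma span1_sw2:
  assumes "\<And>a b. span1 X (A a b)"
  shows "span1 X (\<lambda>\<alpha> w. sw2 T (\<lambda>a b. A a b \<alpha> w))"
proof -
  have "span1 X (\<lambda>\<alpha> w. \<Sum>i\<in>S. T i * A (i 1) (i 2) \<alpha> w)" if "finite S" for S
    using that by (induction S rule: finite_induct)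
      (simp_all add: span1_zero span1_add span1_cmult assms)
  from this[of "multi_idx H {1,2}"] show ?thesis by (simp add: sw2_sum)
qed

lemma span2_zero: "span2 X (\<lambda>_ _ _. 0)"
  unfolding span2_def by (intro exI[of _ "[]"]) simp

lemma span2_add:
  assumes "span2 X B" "span2 X B'"
  shows "span2 X (\<lambda>\<alpha> \<beta> w. B \<alpha> \<beta> w + B' \<alpha> \<beta> w)"
proof -
  obtain L L' where "\<forall>\<alpha> \<beta> w. (\<forall>x\<in>X. lin (\<alpha> x) \<and> lin (\<beta> x)) \<longrightarrow>
     B \<alpha> \<beta> w = (\<Sum>(\<kappa>, g, k)\<leftarrow>L. \<kappa> * base2 X (twist g \<alpha>) (twist k \<beta>) w)"
    "\<forall>\<alpha> \<beta> w. (\<forall>x\<in>X. lin (\<alpha> x) \<and> lin (\<beta> x)) \<longrightarrow>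
     B' \<alpha> \<beta> w = (\<Sum>(\<kappa>, g, k)\<leftarrow>L'. \<kappa> * base2 X (twist g \<alpha>) (twist k \<beta>) w)"
    using assms unfolding span2_def by metis
  then show ?thesis unfolding span2_def by (intro exI[of _ "L @ L'"]) simp
qed

lemma span2_cmult:
  assumes "span2 X B"
  shows "span2 X (\<lambda>\<alpha> \<beta> w. c * B \<alpha> \<beta> w)"
proof -
  obtain L where "\<forall>\<alpha> \<beta> w. (\<forall>x\<in>X. lin (\<alpha> x) \<and> lin (\<beta> x)) \<longrightarrow>
     B \<alpha> \<beta> w = (\<Sum>(\<kappa>, g, k)\<leftarrow>L. \<kappa> * base2 X (twist g \<alpha>) (twist k \<beta>) w)"
    using assms unfolding span2_def by blast
  then show ?thesis unfolding span2_def
    by (intro exI[of _ "map (\<lambda>(\<kappa>, g, k). (c * \<kappa>, g, k)) L"])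
      (simp add: sum_list_cmult comp_def case_prod_unfold mult.assoc)
qed

lemma span2_sw2:
  assumes "\<And>a b. span2 X (B a b)"
  shows "span2 X (\<lambda>\<alpha> \<beta> w. sw2 T (\<lambda>a b. B a b \<alpha> \<beta> w))"
proof -
  have "span2 X (\<lambda>\<alpha> \<beta> w. \<Sum>i\<in>S. T i * B (i 1) (i 2) \<alpha> \<beta> w)" if "finite S" for S
    using that by (induction S rule: finite_induct)
      (simp_all add: span2_zero span2_add span2_cmult assms)
  from this[of "multi_idx H {1,2}"] show ?thesis by (simp add: sw2_sum)
qed

lemma span2_sum_list:
  assumes "\<And>i. i \<in> set L \<Longrightarrow> span2 X (B i)"
  shows "span2 X (\<lambda>\<alpha> \<beta> w. \<Sum>i\<leftarrow>L. B i \<alpha> \<beta> w)"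
  using assms by (induction L) (simp_all add: span2_zero span2_add)

lemma span2_twist:
  assumes "span2 X B"
  shows "span2 X (\<lambda>\<alpha> \<beta>. B (twist g \<alpha>) (twist k \<beta>))"
proof -
  obtain L where "\<forall>\<alpha> \<beta> w. (\<forall>x\<in>X. lin (\<alpha> x) \<and> lin (\<beta> x)) \<longrightarrow>
     B \<alpha> \<beta> w = (\<Sum>(\<kappa>, g, k)\<leftarrow>L. \<kappa> * base2 X (twist g \<alpha>) (twist k \<beta>) w)"
    using assms unfolding span2_def by blast
  then show ?thesis unfolding span2_def
    by (intro exI[of _ "map (\<lambda>(\<kappa>, g', k'). (\<kappa>, \<lambda>x. om (out x) (g x) (g' x), \<lambda>x. om (out x) (k x) (k' x))) L"])
      (simp add: comp_def case_prod_unfold twist_twist twist_lin)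
qed

lemma span1_Cons:
  assumes "span1 (set xs) A" "x \<notin> set xs"
  shows "span1 (set (x # xs)) (\<lambda>\<alpha> w. \<alpha> x (om (out x) g (w x)) * A \<alpha> w)"
proof -
  obtain L where L: "\<And>\<alpha> w. (\<forall>x\<in>set xs. lin (\<alpha> x)) \<Longrightarrow> A \<alpha> w = (\<Sum>(\<kappa>, g)\<leftarrow>L. \<kappa> * pf (set xs) (twist g \<alpha>) w)"
    using assms(1) unfolding span1_def by blast
  have eq: "pf (set (x # xs)) (twist (g'(x := g)) \<alpha>) w
      = \<alpha> x (om (out x) g (w x)) * pf (set xs) (twist g' \<alpha>) w" for g' \<alpha> w
  proof -
    have "pf (set xs) (twist (g'(x := g)) \<alpha>) w = pf (set xs) (twist g' \<alpha>) w"
      unfolding pf_def twist_def using assms(2) by (intro prod.cong) auto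
    then show ?thesis using pf_head[OF assms(2)] by (simp add: twist_def)
  qed
  show ?thesis unfolding span1_def
  proof (intro exI allI impI)
    fix \<alpha> :: "'x \<Rightarrow> 'k \<Rightarrow> 'f" and w assume lin: "\<forall>y\<in>set (x # xs). lin (\<alpha> y)"
    show "\<alpha> x (om (out x) g (w x)) * A \<alpha> w
      = (\<Sum>(\<kappa>, g)\<leftarrow>map (\<lambda>(\<kappa>, g'). (\<kappa>, g'(x := g))) L. \<kappa> * pf (set (x # xs)) (twist g \<alpha>) w)"
      using lin by (simp only: L list.set_intros sum_list_cmult map_map comp_def case_prod_unfold eq prod.sel)
        (simp only: L[OF ballI] list.set_intros lin sum_list_cmult case_prod_unfold mult.left_commute bspec[OF lin])
  qed
qed

lemma span2_Cons:
  assumes "span2 (set xs) B" "x \<notin> set xs"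
  shows "span2 (set (x # xs)) (\<lambda>\<alpha> \<beta> w. sw2 (flip (out x \<noteq> sel x) (w x))
    (\<lambda>a b. \<alpha> x (om (out x) g a) * \<beta> x (om (out x) k b)) * B \<alpha> \<beta> w)"
proof -
  obtain L where L: "\<And>\<alpha> \<beta> w. (\<forall>x\<in>set xs. lin (\<alpha> x) \<and> lin (\<beta> x)) \<Longrightarrow>
     B \<alpha> \<beta> w = (\<Sum>(\<kappa>, g, k)\<leftarrow>L. \<kappa> * base2 (set xs) (twist g \<alpha>) (twist k \<beta>) w)"
    using assms(1) unfolding span2_def by blast
  have eq: "base2 (set (x # xs)) (twist (g'(x := g)) \<alpha>) (twist (k'(x := k)) \<beta>) w
      = sw2 (flip (out x \<noteq> sel x) (w x)) (\<lambda>a b. \<alpha> x (om (out x) g a) * \<beta> x (om (out x) k b))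
        * base2 (set xs) (twist g' \<alpha>) (twist k' \<beta>) w" for g' k' \<alpha> \<beta> w
    unfolding base2_def twist_def using assms(2)
    by (auto intro!: arg_cong2[where f = "(*)"] prod.cong)
  show ?thesis unfolding span2_def
  proof (intro exI allI impI)
    fix \<alpha> \<beta> :: "'x \<Rightarrow> 'k \<Rightarrow> 'f" and w assume lin: "\<forall>y\<in>set (x # xs). lin (\<alpha> y) \<and> lin (\<beta> y)"
    have "B \<alpha> \<beta> w = (\<Sum>(\<kappa>, g, k)\<leftarrow>L. \<kappa> * base2 (set xs) (twist g \<alpha>) (twist k \<beta>) w)"
      by (rule L) (use lin in auto)
    then show "sw2 (flip (out x \<noteq> sel x) (w x)) (\<lambda>a b. \<alpha> x (om (out x) g a) * \<beta> x (om (out x) k b)) * B \<alpha> \<beta> w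
      = (\<Sum>(\<kappa>, g, k)\<leftarrow>map (\<lambda>(\<kappa>, g', k'). (\<kappa>, g'(x := g), k'(x := k))) L.
          \<kappa> * base2 (set (x # xs)) (twist g \<alpha>) (twist k \<beta>) w)"
      by (simp only: sum_list_cmult map_map comp_def case_prod_unfold eq prod.sel mult.left_commute)
  qed
qed

lemma ac_om: "ac (out x) h a = om (out x) (if out x then anti h else h) a"
  by (simp add: ac_def)

lemma span_cong:
  "span1 X A \<Longrightarrow> (\<And>\<alpha> w. (\<forall>x\<in>X. lin (\<alpha> x)) \<Longrightarrow> A' \<alpha> w = A \<alpha> w) \<Longrightarrow> span1 X A'"
  "span2 X B \<Longrightarrow> (\<And>\<alpha> \<beta> w. (\<forall>x\<in>X. lin (\<alpha> x) \<and> lin (\<beta> x)) \<Longrightarrow> B' \<alpha> \<beta> w = B \<alpha> \<beta> w) \<Longrightarrow> span2 X B'"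
  unfolding span1_def span2_def by simp_all

lemma vact_span1: "distinct xs \<Longrightarrow> span1 (set xs) (\<lambda>\<alpha>. vact xs (pf (set xs) \<alpha>) h)"
proof (induction xs arbitrary: h)
  case Nil
  show ?case unfolding span1_def by (intro exI[of _ "[(eps h, \<lambda>_. 0)]"]) (simp add: pf_def)
next
  case (Cons x xs)
  then have d: "distinct xs" "x \<notin> set xs" by simp_all
  have "span1 (set (x # xs)) (\<lambda>\<alpha> w. cop h (\<lambda>a b. \<alpha> x (om (out x) (if out x then anti a else a) (w x))
      * vact xs (pf (set xs) \<alpha>) b w))"
    by (intro span1_sw2 span1_Cons Cons.IH d)
  then show ?case
    by (rule span_cong(1)) (simp only: vact_pf_Cons[OF Cons.prems] ac_om)
qed

text \<open>Every \<open>R\<close>-matrix in \<open>vm\<close> is a sum of pairs of elements that multiply the arguments of the two forms on the side given by the direction of the end: those from the braiding and those from the twist in \<open>dl\<close> alike.\<close>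

lemma vm_span2: "distinct xs \<Longrightarrow> span2 (set xs) (\<lambda>\<alpha> \<beta>. vm xs (pf (set xs) \<alpha>) (pf (set xs) \<beta>))"
proof (induction xs)
  case Nil
  show ?case unfolding span2_def by (intro exI[of _ "[(1, \<lambda>_. 0, \<lambda>_. 0)]"]) (simp add: pf_def base2_def)
next
  case (Cons x xs)
  then have d: "distinct xs" "x \<notin> set xs" by simp_all
  let ?C = "\<lambda>s \<alpha> \<beta>. vm xs (vact xs (pf (set xs) \<alpha>) s) (pf (set xs) \<beta>)"
  have C: "span2 (set xs) (?C s)" for s
  proof -
    obtain L where L: "\<And>\<alpha> w. (\<forall>x\<in>set xs. lin (\<alpha> x)) \<Longrightarrow>
        vact xs (pf (set xs) \<alpha>) s w = (\<Sum>(\<kappa>, g)\<leftarrow>L. \<kappa> * pf (set xs) (twist g \<alpha>) w)"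
      using vact_span1[OF d(1), of s] unfolding span1_def by blast
    have lin_left: "vm xs (\<lambda>w. \<Sum>i\<leftarrow>K. f i w) \<psi> w = (\<Sum>i\<leftarrow>K. vm xs (f i) \<psi> w)" for K f \<psi> w
    proof (induction K)
      case Nil
      show ?case using vm_cmult_left[of xs 0 "\<lambda>_. 0" \<psi>] by (simp add: fun_eq_iff)
    qed (simp add: vm_add_left)
    have t: "twist (\<lambda>_. 1) \<beta> = \<beta>" for \<beta> by (simp add: twist_def om_one)
    have "span2 (set xs) (\<lambda>\<alpha> \<beta> w. \<Sum>i\<leftarrow>L. fst i * vm xs (pf (set xs) (twist (snd i) \<alpha>)) (pf (set xs) (twist (\<lambda>_. 1) \<beta>)) w)"
      by (intro span2_sum_list span2_cmult span2_twist[where B = "\<lambda>\<alpha> \<beta>. vm xs (pf (set xs) \<alpha>) (pf (set xs) \<beta>)"] Cons.IH d)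
    then show ?thesis
    proof (rule span_cong(2))
      fix \<alpha> \<beta> w assume "\<forall>x\<in>set xs. lin (\<alpha> x) \<and> lin (\<beta> x)"
      then have "vact xs (pf (set xs) \<alpha>) s = (\<lambda>w. \<Sum>i\<leftarrow>L. fst i * pf (set xs) (twist (snd i) \<alpha>) w)"
        using L by (auto simp: case_prod_unfold)
      then show "?C s \<alpha> \<beta> w = (\<Sum>i\<leftarrow>L. fst i * vm xs (pf (set xs) (twist (snd i) \<alpha>)) (pf (set xs) (twist (\<lambda>_. 1) \<beta>)) w)"
        by (simp only: lin_left vm_cmult_left t)
    qed
  qed
  let ?t = "\<lambda>r. if out x then anti r else r"
  let ?fl = "\<lambda>w g k \<alpha> \<beta>. sw2 (flip (out x \<noteq> sel x) (w x)) (\<lambda>a b. \<alpha> x (om (out x) g a) * \<beta> x (om (out x) k b))"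
  have "span2 (set (x # xs)) (\<lambda>\<alpha> \<beta> w. rr (\<lambda>r s. if sel x then
      rr (\<lambda>r' s'. ?fl w s' (om (out x) (?t r) r') \<alpha> \<beta> * ?C s \<alpha> \<beta> w) else ?fl w 1 (?t r) \<alpha> \<beta> * ?C s \<alpha> \<beta> w))"
  proof (cases "sel x")
    case True
    have "span2 (set (x # xs)) (\<lambda>\<alpha> \<beta> w. rr (\<lambda>r s. rr (\<lambda>r' s'.
        ?fl w s' (om (out x) (?t r) r') \<alpha> \<beta> * ?C s \<alpha> \<beta> w)))"
      by (intro span2_sw2 span2_Cons C d)
    then show ?thesis by (simp only: True if_True)
  next
    case False
    have "span2 (set (x # xs)) (\<lambda>\<alpha> \<beta> w. rr (\<lambda>r s. ?fl w 1 (?t r) \<alpha> \<beta> * ?C s \<alpha> \<beta> w))"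
      by (intro span2_sw2 span2_Cons C d)
    then show ?thesis by (simp only: False if_False)
  qed
  then show ?case
  proof (rule span_cong(2))
    fix \<alpha> \<beta> w assume l: "\<forall>y\<in>set (x # xs). lin (\<alpha> y) \<and> lin (\<beta> y)"
    have bl: "bil (\<lambda>a b. \<alpha> x a * \<beta> x (ac (out x) r b))" for r
      using l by (simp add: bil_def lin_def ac_lin algebra_simps)
    have "vm (x # xs) (pf (set (x # xs)) \<alpha>) (pf (set (x # xs)) \<beta>) w
      = rr (\<lambda>r s. sw2 (dl (out x) (sel x) (w x)) (\<lambda>a b. \<alpha> x a * \<beta> x (ac (out x) r b)) * ?C s \<alpha> \<beta> w)"
      by (simp only: vm_pf_Cons[OF Cons.prems] sw2_cmult_right[symmetric]) (rule sw2_swap)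
    also have "\<dots> = rr (\<lambda>r s. if sel x then
      rr (\<lambda>r' s'. ?fl w s' (om (out x) (?t r) r') \<alpha> \<beta> * ?C s \<alpha> \<beta> w) else ?fl w 1 (?t r) \<alpha> \<beta> * ?C s \<alpha> \<beta> w)"
    proof (rule sw2_cong)
      fix r s
      show "sw2 (dl (out x) (sel x) (w x)) (\<lambda>a b. \<alpha> x a * \<beta> x (ac (out x) r b)) * ?C s \<alpha> \<beta> w
        = (if sel x then rr (\<lambda>r' s'. ?fl w s' (om (out x) (?t r) r') \<alpha> \<beta> * ?C s \<alpha> \<beta> w)
            else ?fl w 1 (?t r) \<alpha> \<beta> * ?C s \<alpha> \<beta> w)"
        unfolding sw2_dl_general[OF bl] by (cases "sel x") (simp_all only: ac_om om_om om_one if_True if_False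
            not_True_eq_False not_False_eq_True simp_thms sw2_cmult_right)
    qed
    finally show "vm (x # xs) (pf (set (x # xs)) \<alpha>) (pf (set (x # xs)) \<beta>) w = \<dots>" .
  qed
qed

end

section \<open>Tensors as multilinear forms\<close>

text \<open>Sums of forms are kept as functions; with these rules unapplied sums would be expanded by extensionality.\<close>

declare plus_fun_apply [simp del] zero_fun_apply [simp del]

context hopf_algebra
begin

text \<open>The multilinear form represented by a tensor, and its inverse \<open>tn\<close> below.\<close>

definition ev :: "'x set \<Rightarrow> ('x, 'k, 'f) tensor \<Rightarrow> ('x \<Rightarrow> 'k) \<Rightarrow> 'f" where
  "ev X T w = (\<Sum>b\<in>multi_idx H X. T b * (\<Prod>x\<in>X. coord H (w x) (b x)))"

definition tn :: "'x set \<Rightarrow> (('x \<Rightarrow> 'k) \<Rightarrow> 'f) \<Rightarrow> ('x, 'k, 'f) tensor" where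
  "tn X \<phi> = (\<lambda>b. if b \<in> multi_idx H X then \<phi> b else 0)"

lemma tpow_zero: "0 \<in> tpow H X"
  and tpow_add: "S \<in> tpow H X \<Longrightarrow> T \<in> tpow H X \<Longrightarrow> S + T \<in> tpow H X"
  and tpow_fscale: "S \<in> tpow H X \<Longrightarrow> fscale c S \<in> tpow H X"
  by (auto simp: tpow_def fscale_def plus_fun_apply zero_fun_apply)

lemma tpow_sum: "(\<And>i. i \<in> I \<Longrightarrow> f i \<in> tpow H X) \<Longrightarrow> (\<Sum>i\<in>I. f i) \<in> tpow H X"
  by (induction I rule: infinite_finite_induct) (simp_all add: tpow_zero tpow_add)

lemma tn_tpow: "tn X \<phi> \<in> tpow H X"
  by (simp add: tn_def tpow_def)

lemma dten_tpow: "dten H X \<alpha> \<in> tpow H X"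
  by (simp add: dten_def tpow_def)

lemma btens_tpow: "b \<in> multi_idx H X \<Longrightarrow> btens b \<in> tpow H X"
  by (auto simp: btens_def tpow_def)

lemma ev_add: "ev X (S + T) = (\<lambda>w. ev X S w + ev X T w)"
  by (simp add: fun_eq_iff ev_def plus_fun_apply zero_fun_apply distrib_right sum.distrib)

lemma ev_fscale: "ev X (fscale c T) = (\<lambda>w. c * ev X T w)"
  by (simp add: fun_eq_iff ev_def plus_fun_apply zero_fun_apply fscale_def sum_distrib_left mult.assoc)

lemma ev_zero: "ev X 0 = (\<lambda>w. 0)"
  by (simp add: fun_eq_iff ev_def plus_fun_apply zero_fun_apply)

lemma ev_sum: "ev X (\<Sum>i\<in>I. f i) w = (\<Sum>i\<in>I. ev X (f i) w)"
  by (induction I rule: infinite_finite_induct) (simp_all add: ev_zero ev_add)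

lemma prod_coord_basis:
  assumes "finite X" "b \<in> multi_idx H X" "c \<in> multi_idx H X"
  shows "(\<Prod>x\<in>X. coord H (b x) (c x)) = (if c = b then 1 else 0)"
proof (cases "c = b")
  case True
  then show ?thesis using assms by (simp add: coord_basis multi_idx_in)
next
  case False
  then obtain x where x: "x \<in> X" "c x \<noteq> b x"
    using assms by (metis multi_idx_out ext)
  then have "coord H (b x) (c x) = 0" using assms by (simp add: coord_basis multi_idx_in)
  then show ?thesis using False assms(1) x by (auto intro: prod_zero)
qed

lemma ev_basis:
  assumes "finite X" "b \<in> multi_idx H X"
  shows "ev X T b = T b"
proof -
  have "ev X T b = (\<Sum>c\<in>multi_idx H X. if c = b then T c else 0)"
    unfolding ev_def using assms by (intro sum.cong) (simp_all add: prod_coord_basis)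
  then show ?thesis using assms by simp
qed

lemma ev_ml: "finite X \<Longrightarrow> ml X (ev X T)" for X :: "'a set"
  unfolding ml_def
proof (intro conjI ballI allI impI)
  fix x w assume X: "finite X" and x: "x \<in> X"
  have "ev X T (w(x := a)) = (\<Sum>b\<in>multi_idx H X. T b * (coord H a (b x) * (\<Prod>y\<in>X - {x}. coord H (w y) (b y))))" for a
    using X x by (simp add: ev_def prod.remove)
  then show "lin (\<lambda>a. ev X T (w(x := a)))"
    using lin_coord by (simp add: lin_def distrib_left distrib_right sum.distrib sum_distrib_left mult_ac)
next
  fix w w' :: "'a \<Rightarrow> 'k" assume "\<forall>x\<in>X. w x = w' x"
  then show "ev X T w = ev X T w'" by (simp add: ev_def)
qed

lemma ev_tn: "finite X \<Longrightarrow> ml X \<phi> \<Longrightarrow> ev X (tn X \<phi>) = \<phi>"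
proof
  fix w assume X: "finite X" "ml X \<phi>"
  have "ev X (tn X \<phi>) w = klift H X (*) \<phi> (kten H X w)"
    unfolding ev_def tn_def klift_def kten_def dten_def by (intro sum.cong) auto
  then show "ev X (tn X \<phi>) w = \<phi> w" using klift_kten_field X by metis
qed

text \<open>The main tool for equations between tensors.\<close>

lemma tpow_ext:
  assumes "finite X" "S \<in> tpow H X" "T \<in> tpow H X" "\<And>w. ev X S w = ev X T w"
  shows "S = T"
proof
  fix b show "S b = T b"
    using assms by (cases "b \<in> multi_idx H X") (metis ev_basis, auto simp: tpow_def)
qed

lemma prod_ml:
  fixes X :: "'a set"
  assumes "finite X" "\<And>x. x \<in> X \<Longrightarrow> lin (\<alpha> x)"
  shows "ml X (\<lambda>w. \<Prod>x\<in>X. \<alpha> x (w x))"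
  unfolding ml_def
proof (intro conjI ballI allI impI)
  fix x w assume x: "x \<in> X"
  have "(\<Prod>y\<in>X. \<alpha> y ((w(x := a)) y)) = \<alpha> x a * (\<Prod>y\<in>X - {x}. \<alpha> y (w y))" for a
    using assms(1) x by (simp add: prod.remove)
  then show "lin (\<lambda>a. \<Prod>y\<in>X. \<alpha> y ((w(x := a)) y))"
    using assms(2)[OF x] by (simp add: lin_def algebra_simps)
next
  fix w w' :: "'a \<Rightarrow> 'k" assume "\<forall>x\<in>X. w x = w' x"
  then show "(\<Prod>x\<in>X. \<alpha> x (w x)) = (\<Prod>x\<in>X. \<alpha> x (w' x))" by simp
qed

lemma dten_tn: "dten H X \<alpha> = tn X (\<lambda>w. \<Prod>x\<in>X. \<alpha> x (w x))"
  by (simp add: dten_def tn_def)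

lemma ev_dten:
  "finite X \<Longrightarrow> (\<And>x. x \<in> X \<Longrightarrow> lin (\<alpha> x)) \<Longrightarrow> ev X (dten H X \<alpha>) = (\<lambda>w. \<Prod>x\<in>X. \<alpha> x (w x))"
  unfolding dten_tn by (rule ev_tn) (simp_all add: prod_ml)

lemma dten_cong: "(\<And>x. x \<in> X \<Longrightarrow> \<alpha> x = \<beta> x) \<Longrightarrow> dten H X \<alpha> = dten H X \<beta>"
  by (auto simp: dten_def intro!: prod.cong)

lemma btens_dten:
  assumes "finite X" "b \<in> multi_idx H X"
  shows "btens b = dten H X (\<lambda>x. dual_basis H (b x))"
proof
  fix c
  have "dten H X (\<lambda>x. dual_basis H (b x)) c
      = (if c \<in> multi_idx H X then \<Prod>x\<in>X. coord H (c x) (b x) else 0)"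
    by (simp add: dten_def dual_basis_def)
  then show "btens b c = dten H X (\<lambda>x. dual_basis H (b x)) c"
    using assms prod_coord_basis[OF assms(1), of c b] by (auto simp: btens_def)
qed

lemma tensor_expand:
  assumes "finite X" "T \<in> tpow H X"
  shows "T = (\<Sum>b\<in>multi_idx H X. fscale (T b) (btens b))"
proof
  fix c
  have "(\<Sum>b\<in>multi_idx H X. fscale (T b) (btens b)) c = (\<Sum>b\<in>multi_idx H X. if c = b then T b else 0)"
    unfolding sum_fun_apply by (intro sum.cong) (auto simp: fscale_def btens_def)
  also have "\<dots> = T c"
    using assms by (auto simp: tpow_def)
  finally show "T c = (\<Sum>b\<in>multi_idx H X. fscale (T b) (btens b)) c" ..
qed

lemma fscale_zero: "fscale (0::'f) T = 0"
  by (simp add: fscale_def fun_eq_iff zero_fun_apply)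

lemma linear_on_zero: "linear_on (tpow H X) f \<Longrightarrow> f 0 = 0"
  unfolding linear_on_def using tpow_zero by (metis fscale_zero)

lemma linear_on_sum:
  assumes "linear_on (tpow H X) f" "\<And>i. i \<in> I \<Longrightarrow> g i \<in> tpow H X"
  shows "f (\<Sum>i\<in>I. g i) = (\<Sum>i\<in>I. f (g i))"
  using assms(2)
proof (induction I rule: infinite_finite_induct)
  case (insert i I)
  then have "(\<Sum>i\<in>I. g i) \<in> tpow H X" by (intro tpow_sum) auto
  with insert assms(1) show ?case by (simp add: linear_on_def)
qed (simp_all add: linear_on_zero[OF assms(1)])

lemma linear_on_expand:
  assumes "linear_on (tpow H X) f" "finite X" "T \<in> tpow H X"
  shows "f T = (\<Sum>b\<in>multi_idx H X. fscale (T b) (f (btens b)))"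
proof -
  have "f T = f (\<Sum>b\<in>multi_idx H X. fscale (T b) (btens b))"
    using tensor_expand[OF assms(2,3)] by simp
  also have "\<dots> = (\<Sum>b\<in>multi_idx H X. f (fscale (T b) (btens b)))"
    by (rule linear_on_sum[OF assms(1)]) (simp add: tpow_fscale btens_tpow)
  also have "\<dots> = (\<Sum>b\<in>multi_idx H X. fscale (T b) (f (btens b)))"
    using assms(1) by (intro sum.cong) (auto simp: linear_on_def btens_tpow)
  finally show ?thesis .
qed

lemma linear_on_ext:
  assumes "linear_on (tpow H X) f" "linear_on (tpow H X) g" "finite X" "T \<in> tpow H X"
    and "\<And>b. b \<in> multi_idx H X \<Longrightarrow> f (btens b) = g (btens b)"
  shows "f T = g T"
  using linear_on_expand[OF assms(1,3,4)] linear_on_expand[OF assms(2,3,4)] assms(5) by simp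

lemma bilinear_on_expand:
  assumes "bilinear_on (tpow H X) (tpow H Y) m" "finite X" "finite Y" "S \<in> tpow H X" "T \<in> tpow H Y"
  shows "m S T = (\<Sum>c\<in>multi_idx H X. \<Sum>d\<in>multi_idx H Y. fscale (S c * T d) (m (btens c) (btens d)))"
proof -
  have "m S T = (\<Sum>c\<in>multi_idx H X. fscale (S c) (m (btens c) T))"
    by (rule linear_on_expand) (use assms in \<open>auto simp: bilinear_on_def\<close>)
  also have "\<dots> = (\<Sum>c\<in>multi_idx H X. fscale (S c) (\<Sum>d\<in>multi_idx H Y. fscale (T d) (m (btens c) (btens d))))"
    using assms by (intro sum.cong refl arg_cong2[where f = fscale] linear_on_expand)
      (auto simp: bilinear_on_def btens_tpow)
  also have "\<dots> = (\<Sum>c\<in>multi_idx H X. \<Sum>d\<in>multi_idx H Y. fscale (S c * T d) (m (btens c) (btens d)))"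
    by (intro sum.cong refl) (simp add: fun_eq_iff fscale_def sum_fun_apply sum_distrib_left mult.assoc)
  finally show ?thesis .
qed

text \<open>A module algebra over \<open>K\<close> itself, with the coproduct of \<open>K\<close> expanded in the basis; \<open>right_module_algebra\<close> is the corresponding notion over a tensor power of \<open>K\<close>.\<close>

definition kmodule_algebra :: "'x set \<Rightarrow> (('x, 'k, 'f) tensor \<Rightarrow> ('x, 'k, 'f) tensor \<Rightarrow> ('x, 'k, 'f) tensor)
    \<Rightarrow> (('x, 'k, 'f) tensor \<Rightarrow> 'k \<Rightarrow> ('x, 'k, 'f) tensor) \<Rightarrow> bool" where
  "kmodule_algebra X m act \<longleftrightarrow> dual_algebra H X m \<and>
     (\<forall>S\<in>tpow H X. \<forall>h. act S h \<in> tpow H X) \<and>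
     (\<forall>h. linear_on (tpow H X) (\<lambda>S. act S h)) \<and>
     (\<forall>S\<in>tpow H X. \<forall>g h. act S (g + h) = act S g + act S h) \<and>
     (\<forall>S\<in>tpow H X. \<forall>c h. act S (smult H c h) = fscale c (act S h)) \<and>
     (\<forall>S\<in>tpow H X. \<forall>g h. act S (g * h) = act (act S g) h) \<and>
     (\<forall>S\<in>tpow H X. act S 1 = S) \<and>
     (\<forall>S\<in>tpow H X. \<forall>T\<in>tpow H X. \<forall>h. act (m S T) h =
        (\<Sum>b\<in>multi_idx H {1,2}. fscale (comult H h b) (m (act S (b 1)) (act T (b 2))))) \<and>
     (\<forall>h. act (dunit H X) h = fscale (counit H h) (dunit H X))"

end

context vertex
begin

text \<open>The convention \<open>0\<close> outside of the tensor power is the one of \<open>is_vertex_mult\<close>, which makes the multiplication unique as a total function.\<close>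

definition vmult :: "'x list \<Rightarrow> ('x, 'k, 'f) tensor \<Rightarrow> ('x, 'k, 'f) tensor \<Rightarrow> ('x, 'k, 'f) tensor" where
  "vmult es S T = (if S \<in> tpow H (set es) \<and> T \<in> tpow H (set es)
     then tn (set es) (vm es (ev (set es) S) (ev (set es) T)) else 0)"

definition vaction :: "'x list \<Rightarrow> ('x, 'k, 'f) tensor \<Rightarrow> 'k \<Rightarrow> ('x, 'k, 'f) tensor" where
  "vaction es S h = tn (set es) (vact es (ev (set es) S) h)"

lemma ev_dten_pf: "(\<And>x. x \<in> set es \<Longrightarrow> lin (\<alpha> x)) \<Longrightarrow> ev (set es) (dten H (set es) \<alpha>) = pf (set es) \<alpha>"
  by (simp add: ev_dten pf_def fun_eq_iff)

lemma dunit_tpow: "dunit H X \<in> tpow H X"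
  by (simp add: dunit_def dten_tpow)

lemma ev_dunit: "ev (set es) (dunit H (set es)) = pf (set es) (\<lambda>_. eps)"
  unfolding dunit_def by (rule ev_dten_pf) (rule lin_eps)

lemma vmult_tpow: "vmult es S T \<in> tpow H (set es)"
  by (simp add: vmult_def tn_tpow tpow_zero)

lemma vaction_tpow: "vaction es S h \<in> tpow H (set es)"
  by (simp add: vaction_def tn_tpow)

context
  fixes es :: "'x list"
  assumes es: "distinct es"
begin

lemma ev_vmult:
  "S \<in> tpow H (set es) \<Longrightarrow> T \<in> tpow H (set es) \<Longrightarrow> ev (set es) (vmult es S T) = vm es (ev (set es) S) (ev (set es) T)"
  by (simp add: vmult_def ev_tn vm_ml es ev_ml)

lemma ev_vaction: "ev (set es) (vaction es S h) = vact es (ev (set es) S) h"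
  by (simp add: vaction_def ev_tn vact_ml es ev_ml)

lemma vmult_bilinear: "bilinear_on (tpow H (set es)) (tpow H (set es)) (vmult es)"
  unfolding bilinear_on_def linear_on_def
  by (auto intro!: tpow_ext[of "set es"] simp: vmult_tpow tpow_add tpow_fscale ev_vmult ev_add ev_fscale
      vm_add_left vm_add_right vm_cmult_left vm_cmult_right)

lemma vmult_dual_algebra: "dual_algebra H (set es) (vmult es)"
  unfolding dual_algebra_def
proof (intro conjI ballI vmult_bilinear vmult_tpow)
  fix S T U assume t: "S \<in> tpow H (set es)" "T \<in> tpow H (set es)" "U \<in> tpow H (set es)"
  then show "vmult es (vmult es S T) U = vmult es S (vmult es T U)"
    by (intro tpow_ext[of "set es"]) (simp_all add: vmult_tpow ev_vmult vm_assoc[OF es] ev_ml)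
next
  fix S assume t: "S \<in> tpow H (set es)"
  show "vmult es (dunit H (set es)) S = S"
    using t by (intro tpow_ext[of "set es"]) (simp_all add: vmult_tpow ev_vmult dunit_tpow ev_dunit vm_unit_left[OF es] ev_ml)
  show "vmult es S (dunit H (set es)) = S"
    using t by (intro tpow_ext[of "set es"]) (simp_all add: vmult_tpow ev_vmult dunit_tpow ev_dunit vm_unit_right[OF es] ev_ml)
qed

lemma vertex_kmodule_algebra: "kmodule_algebra (set es) (vmult es) (vaction es)"
  unfolding kmodule_algebra_def
proof (intro conjI ballI allI vmult_dual_algebra vaction_tpow)
  show "linear_on (tpow H (set es)) (\<lambda>S. vaction es S h)" for h
    unfolding linear_on_def
    by (auto intro!: tpow_ext[of "set es"] simp: vaction_tpow tpow_add tpow_fscale ev_vaction ev_add ev_fscale vact_add vact_cmult)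
  fix S g h c assume S: "S \<in> tpow H (set es)"
  show "vaction es S (g + h) = vaction es S g + vaction es S h"
    by (intro tpow_ext[of "set es"]) (simp_all add: vaction_tpow tpow_add ev_vaction ev_add vact_add_arg)
  show "vaction es S (smult H c h) = fscale c (vaction es S h)"
    by (intro tpow_ext[of "set es"]) (simp_all add: vaction_tpow tpow_fscale ev_vaction ev_fscale vact_smult_arg)
  show "vaction es S (g * h) = vaction es (vaction es S g) h"
    by (intro tpow_ext[of "set es"]) (simp_all add: vaction_tpow ev_vaction vact_vact[OF es] ev_ml)
  show "vaction es S 1 = S"
    using S by (intro tpow_ext[of "set es"]) (simp_all add: vaction_tpow ev_vaction vact_one[OF es] ev_ml)
next
  fix S T h assume t: "S \<in> tpow H (set es)" "T \<in> tpow H (set es)"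
  show "vaction es (vmult es S T) h
      = (\<Sum>b\<in>multi_idx H {1,2}. fscale (comult H h b) (vmult es (vaction es S (b 1)) (vaction es T (b 2))))"
  proof (rule tpow_ext[of "set es"])
    show "ev (set es) (vaction es (vmult es S T) h) w
      = ev (set es) (\<Sum>b\<in>multi_idx H {1,2}. fscale (comult H h b) (vmult es (vaction es S (b 1)) (vaction es T (b 2)))) w" for w
      using t by (simp add: ev_sum ev_fscale ev_vaction ev_vmult vact_vm[OF es] ev_ml vaction_tpow) (simp add: sw2_sum)
  qed (auto intro!: tpow_sum tpow_fscale vmult_tpow vaction_tpow)
next
  fix h show "vaction es (dunit H (set es)) h = fscale (eps h) (dunit H (set es))"
    by (intro tpow_ext[of "set es"]) (simp_all add: vaction_tpow tpow_fscale dunit_tpow ev_vaction ev_fscale ev_dunit vact_unit[OF es])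
qed

lemma vmult_dten:
  assumes "\<And>x. x \<in> (set es) \<Longrightarrow> lin (\<alpha> x)" "\<And>x. x \<in> (set es) \<Longrightarrow> lin (\<beta> x)" "\<And>x. x \<in> (set es) \<Longrightarrow> lin (\<gamma> x)"
    and "\<And>w. vm es (pf (set es) \<alpha>) (pf (set es) \<beta>) w = pf (set es) \<gamma> w"
  shows "vmult es (dten H (set es) \<alpha>) (dten H (set es) \<beta>) = dten H (set es) \<gamma>"
  using assms by (intro tpow_ext[of "set es"]) (simp_all add: vmult_tpow dten_tpow ev_vmult ev_dten_pf)

lemma vmult_ordered:
  assumes "es = ys @ zs" "\<And>x. x \<in> set ys \<Longrightarrow> \<beta> x = eps" "\<And>x. x \<in> set zs \<Longrightarrow> \<alpha> x = eps"
    and "\<And>x. x \<in> (set es) \<Longrightarrow> lin (\<alpha> x)" "\<And>x. x \<in> (set es) \<Longrightarrow> lin (\<beta> x)"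
  shows "vmult es (dten H (set es) \<alpha>) (dten H (set es) \<beta>) = dten H (set es) (\<lambda>x. if x \<in> set ys then \<alpha> x else \<beta> x)"
proof (rule vmult_dten)
  show "vm es (pf (set es) \<alpha>) (pf (set es) \<beta>) w = pf (set es) (\<lambda>x. if x \<in> set ys then \<alpha> x else \<beta> x) w" for w
    using vm_ordered[of ys zs \<beta> \<alpha> w] es assms by simp
qed (use assms in auto)

end

end

section \<open>The defining relations of the vertex algebra\<close>

context hopf_algebra
begin

lemma demb1_tpow: "demb1 H X x \<alpha> \<in> tpow H X"
  by (simp add: demb1_def dten_tpow)

lemma ev_demb1:
  assumes "finite X" "x \<in> X" "lin \<alpha>"
  shows "ev X (demb1 H X x \<alpha>) w = \<alpha> (w x) * (\<Prod>z\<in>X - {x}. eps (w z))"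
proof -
  have "ev X (demb1 H X x \<alpha>) w = (\<Prod>z\<in>X. (if z = x then \<alpha> else eps) (w z))"
    unfolding demb1_def using assms by (simp add: ev_dten lin_eps)
  then show ?thesis using assms(1,2) by (simp add: prod.remove)
qed

lemma dmult_eq:
  assumes "lin \<alpha>" "lin \<beta>"
  shows "dmult H \<alpha> \<beta> h = cop h (\<lambda>a b. \<alpha> a * \<beta> b)"
  unfolding dmult_def pairing_def dten_def sw2_sum by (intro sum.cong) (simp_all add: mult_ac)

lemma pairing2_eq: "pairing2 H \<alpha> \<beta> T = sw2 T (\<lambda>a b. \<alpha> a * \<beta> b)"
  unfolding pairing2_def pairing_def dten_def sw2_sum by (intro sum.cong) (simp_all add: mult_ac)

lemma lin_dmult: "lin \<alpha> \<Longrightarrow> lin \<beta> \<Longrightarrow> lin (dmult H \<alpha> \<beta>)"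
  by (simp add: lin_def[of "dmult H \<alpha> \<beta>"] dmult_eq alg_lin)

lemma lin_dual_basis: "lin (dual_basis H b)"
  unfolding dual_basis_def by (rule lin_coord)

lemma ev_sweedler:
  "ev X (sweedler H F \<alpha>) w = (\<Sum>b\<in>multi_idx H {1,2}. \<alpha> (b 1 * b 2) * ev X (F (\<lambda>i. dual_basis H (b i))) w)"
  unfolding sweedler_def dlift_def dcomult_def ev_sum ev_fscale by (intro sum.cong) simp_all

text \<open>The sum over a dual basis that defines Sweedler notation in \<open>K\<^sup>*\<close> turns a product
  of evaluations \<open>a\<^sub>1(u) a\<^sub>2(v)\<close> into \<open>\<alpha>(u v)\<close>.\<close>

lemma sweedler_contract:
  assumes "lin \<alpha>"
  shows "(\<Sum>b\<in>multi_idx H {1,2}. \<alpha> (b 1 * b 2) * (dual_basis H (b 1) u * dual_basis H (b (2::nat)) v)) = \<alpha> (u * v)"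
proof -
  have B: "bil (\<lambda>a b. \<alpha> (a * b))" using assms by (simp add: bil_def lin_def alg_lin)
  have "\<alpha> (u * v) = sw2 (kten H {1,2} (legs [u, v])) (\<lambda>a b. \<alpha> (a * b))"
    by (simp add: sw2_kten[OF B])
  also have "\<dots> = (\<Sum>b\<in>multi_idx H {1,2}. \<alpha> (b 1 * b 2) * (dual_basis H (b 1) u * dual_basis H (b (2::nat)) v))"
    unfolding sw2_sum kten_def dten_def dual_basis_def by (intro sum.cong) (simp_all add: mult_ac)
  finally show ?thesis ..
qed

lemma sw2_prod: "sw2 S f * (sw2 T g * c) = sw2 S (\<lambda>r s. sw2 T (\<lambda>p q. f r s * (g p q * c)))"
  by simp

text \<open>Evaluates nested Sweedler sums in \<open>K\<^sup>*\<close>. The functional \<open>\<Lambda>\<close> stands for the sums over the legs of \<open>R\<close>-matrices and coproducts that occur in the pairing; it only has to commute with finite sums.\<close>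

lemma ev_sweedler2:
  assumes \<alpha>: "lin \<alpha>" and \<beta>: "lin \<beta>"
    and sum: "\<And>f. \<Lambda> (\<lambda>r s p q. \<Sum>i\<in>multi_idx H {1,2::nat}. f i r s p q) = (\<Sum>i\<in>multi_idx H {1,2}. \<Lambda> (f i))"
    and cmult: "\<And>c f. \<Lambda> (\<lambda>r s p q. c * f r s p q) = c * \<Lambda> f"
    and F: "\<And>a b. (\<And>i. lin (a i)) \<Longrightarrow> (\<And>i. lin (b i)) \<Longrightarrow> ev X (F a b) w
      = \<Lambda> (\<lambda>r s p q. (a 1 (A1 r s p q) * a 2 (A2 r s p q)) * (b 1 (B1 r s p q) * b 2 (B2 r s p q)) * c)"
  shows "ev X (sweedler H (\<lambda>a. sweedler H (F a) \<beta>) \<alpha>) w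
    = \<Lambda> (\<lambda>r s p q. \<alpha> (A1 r s p q * A2 r s p q) * \<beta> (B1 r s p q * B2 r s p q) * (c :: 'f))"
proof -
  let ?d = "\<lambda>b i. dual_basis H (b i)"
  have "ev X (sweedler H (\<lambda>a. sweedler H (F a) \<beta>) \<alpha>) w
    = (\<Sum>a\<in>multi_idx H {1,2::nat}. \<alpha> (a 1 * a 2) * (\<Sum>b\<in>multi_idx H {1,2::nat}. \<beta> (b 1 * b 2) *
        \<Lambda> (\<lambda>r s p q. (?d a 1 (A1 r s p q) * ?d a 2 (A2 r s p q)) * (?d b 1 (B1 r s p q) * ?d b 2 (B2 r s p q)) * c)))"
    unfolding ev_sweedler by (simp add: F lin_dual_basis)
  also have "\<dots> = \<Lambda> (\<lambda>r s p q. \<Sum>a\<in>multi_idx H {1,2::nat}. \<alpha> (a 1 * a 2) * (\<Sum>b\<in>multi_idx H {1,2::nat}. \<beta> (b 1 * b 2) *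
        ((?d a 1 (A1 r s p q) * ?d a 2 (A2 r s p q)) * (?d b 1 (B1 r s p q) * ?d b 2 (B2 r s p q)) * c)))"
    by (simp only: sum cmult)
  also have "(\<lambda>r s p q. \<Sum>a\<in>multi_idx H {1,2::nat}. \<alpha> (a 1 * a 2) * (\<Sum>b\<in>multi_idx H {1,2::nat}. \<beta> (b 1 * b 2) *
        ((?d a 1 (A1 r s p q) * ?d a 2 (A2 r s p q)) * (?d b 1 (B1 r s p q) * ?d b 2 (B2 r s p q)) * c)))
      = (\<lambda>r s p q. \<alpha> (A1 r s p q * A2 r s p q) * \<beta> (B1 r s p q * B2 r s p q) * c)"
  proof (intro ext)
    fix r s p q
    have "(\<Sum>a\<in>M. f a * (\<Sum>b\<in>N. g b * (f' a * g' b * c))) = (\<Sum>a\<in>M. f a * f' a) * (\<Sum>b\<in>N. g b * g' b) * c"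
      for f f' g g' :: "(nat \<Rightarrow> 'k) \<Rightarrow> 'f" and M N
    proof -
      have "(\<Sum>b\<in>N. g b * (f' a * g' b * c)) = f' a * ((\<Sum>b\<in>N. g b * g' b) * c)" for a
        by (simp add: sum_distrib_left sum_distrib_right mult_ac)
      moreover have "(\<Sum>a\<in>M. f a * (f' a * (K * c))) = (\<Sum>a\<in>M. f a * f' a) * K * c" for K
        by (simp add: sum_distrib_left sum_distrib_right mult_ac)
      ultimately show ?thesis by (simp only:)
    qed
    then show "(\<Sum>a\<in>multi_idx H {1,2::nat}. \<alpha> (a 1 * a 2) * (\<Sum>b\<in>multi_idx H {1,2::nat}. \<beta> (b 1 * b 2) *
        ((?d a 1 (A1 r s p q) * ?d a 2 (A2 r s p q)) * (?d b 1 (B1 r s p q) * ?d b 2 (B2 r s p q)) * c)))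
      = \<alpha> (A1 r s p q * A2 r s p q) * \<beta> (B1 r s p q * B2 r s p q) * c"
      by (simp only: sweedler_contract[OF \<alpha>] sweedler_contract[OF \<beta>])
  qed
  finally show ?thesis .
qed

lemma sweedler_tpow: "(\<And>a. F a \<in> tpow H X) \<Longrightarrow> sweedler H F \<alpha> \<in> tpow H X"
  unfolding sweedler_def dlift_def by (intro tpow_sum tpow_fscale)

lemma ev_dten2: "lin \<alpha> \<Longrightarrow> lin \<beta> \<Longrightarrow> ev {1,2} (dten H {1,2} (legs [\<alpha>, \<beta>])) w = \<alpha> (w 1) * \<beta> (w (2::nat))"
  by (subst ev_dten) auto

lemma ev_demb2:
  assumes "finite X" "x \<in> X" "y \<in> X" "x \<noteq> y"
  shows "ev X (demb2 H X x y T) w = ev {1,2} T (legs [w x, w y]) * (\<Prod>z\<in>X - {x, y}. eps (w z))"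
proof -
  have e: "ev X (dten H X (\<lambda>z. if z = x then dual_basis H (b 1) else if z = y then dual_basis H (b 2) else eps)) w
      = coord H (w x) (b 1) * coord H (w y) (b 2) * (\<Prod>z\<in>X - {x, y}. eps (w z))" for b :: "nat \<Rightarrow> 'k"
  proof -
    have X: "X = insert x (insert y (X - {x, y}))" using assms by auto
    have "(\<Prod>z\<in>X - {x, y}. (if z = x then dual_basis H (b 1) else if z = y then dual_basis H (b 2) else eps) (w z))
      = (\<Prod>z\<in>X - {x, y}. eps (w z))"
      by (rule prod.cong) auto
    moreover have "ev X (dten H X (\<lambda>z. if z = x then dual_basis H (b 1) else if z = y then dual_basis H (b 2) else eps)) w
      = (\<Prod>z\<in>X. (if z = x then dual_basis H (b 1) else if z = y then dual_basis H (b 2) else eps) (w z))"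
      using assms(1) by (subst ev_dten) (auto simp: lin_eps lin_dual_basis)
    ultimately show ?thesis
      using assms(1,4) by (subst (asm) X) (simp add: dual_basis_def mult.assoc)
  qed
  show ?thesis
    unfolding demb2_def dlift_def ev_sum ev_fscale e
    by (simp add: ev_def sum_distrib_right mult.assoc)
qed

lemma sw2_R_twist:
  assumes "bil f"
  shows "sw2 (R_twist H a b T) f = sw2 T (\<lambda>r s. f ((antipode H ^^ a) r) ((antipode H ^^ b) s))"
proof -
  show ?thesis unfolding R_twist_def sw2_klift using assms
    by (simp add: sw2_kten) (simp add: sw2_def)
qed

lemma demb2_tpow: "demb2 H X x y T \<in> tpow H X"
  unfolding demb2_def dlift_def by (intro tpow_sum tpow_fscale dten_tpow)

lemma demb2_dten:
  assumes "finite X" "x \<in> X" "y \<in> X" "x \<noteq> y" "lin \<alpha>" "lin \<beta>"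
  shows "demb2 H X x y (dten H {1,2} (legs [\<alpha>, \<beta>])) = dten H X (\<lambda>z. if z = x then \<alpha> else if z = y then \<beta> else eps)"
proof (rule tpow_ext[OF assms(1) demb2_tpow dten_tpow])
  fix w
  have X: "X = insert x (insert y (X - {x, y}))" using assms by auto
  have "(\<Prod>z\<in>X - {x, y}. (if z = x then \<alpha> else if z = y then \<beta> else eps) (w z)) = (\<Prod>z\<in>X - {x, y}. eps (w z))"
    by (rule prod.cong) auto
  then have "(\<Prod>z\<in>insert x (insert y (X - {x, y})). (if z = x then \<alpha> else if z = y then \<beta> else eps) (w z))
      = \<alpha> (w x) * \<beta> (w y) * (\<Prod>z\<in>X - {x, y}. eps (w z))"
    using assms by (simp add: mult.assoc)
  then have "(\<Prod>z\<in>X. (if z = x then \<alpha> else if z = y then \<beta> else eps) (w z))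
      = \<alpha> (w x) * \<beta> (w y) * (\<Prod>z\<in>X - {x, y}. eps (w z))"
    using X by simp
  then show "ev X (demb2 H X x y (dten H {1,2} (legs [\<alpha>, \<beta>]))) w = ev X (dten H X (\<lambda>z. if z = x then \<alpha> else if z = y then \<beta> else eps)) w"
    using assms by (simp add: ev_demb2 ev_dten2 ev_dten lin_eps)
qed

end

context vertex
begin

context
  fixes es :: "'x list" and \<tau> \<sigma> :: "'x \<Rightarrow> nat"
  assumes es: "distinct es"
    and tau: "\<And>x. \<tau> x = (if out x then 1 else 0)"
    and sigma: "\<And>x. sel x \<longleftrightarrow> \<sigma> x = 0"
begin

lemma vmult_foldr:
  assumes \<alpha>: "\<And>x. x \<in> set es \<Longrightarrow> lin (\<alpha> x)" and "es = ys @ zs"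
  shows "foldr (vmult es) (map (\<lambda>x. demb1 H (set es) x (\<alpha> x)) zs) (dunit H (set es))
    = dten H (set es) (\<lambda>x. if x \<in> set zs then \<alpha> x else eps)"
  using assms(2)
proof (induction zs arbitrary: ys)
  case Nil
  show ?case by (simp add: dunit_def)
next
  case (Cons z zs)
  have 1: "es = (ys @ [z]) @ zs" using Cons.prems by simp
  have d: "z \<notin> set zs" "z \<notin> set ys" "set ys \<inter> set zs = {}" using es Cons.prems by auto
  let ?a = "\<lambda>x. if x = z then \<alpha> z else eps" and ?b = "\<lambda>x. if x \<in> set zs then \<alpha> x else eps"
  have "foldr (vmult es) (map (\<lambda>x. demb1 H (set es) x (\<alpha> x)) (z # zs)) (dunit H (set es))
    = vmult es (dten H (set es) ?a) (dten H (set es) ?b)"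
    using Cons.IH[OF 1] by (simp add: demb1_def)
  also have "\<dots> = dten H (set es) (\<lambda>x. if x \<in> set (ys @ [z]) then ?a x else ?b x)"
    by (rule vmult_ordered[OF es 1]) (use d Cons.prems \<alpha> lin_eps in auto)
  also have "\<dots> = dten H (set es) (\<lambda>x. if x \<in> set (z # zs) then \<alpha> x else eps)"
    using d by (intro dten_cong) auto
  finally show ?case .
qed

lemma vmult_same:
  assumes "x \<in> set es" "lin \<alpha>" "lin \<beta>"
  shows "vmult es (demb1 H (set es) x \<alpha>) (demb1 H (set es) x \<beta>)
    = demb1 H (set es) x (\<lambda>p. sw2 (dl (out x) (sel x) p) (\<lambda>a b. \<alpha> a * \<beta> b))"
  unfolding demb1_def
proof (rule vmult_dten[OF es])
  let ?c = "\<lambda>z. if z = x then (\<lambda>p. sw2 (dl (out x) (sel x) p) (\<lambda>a b. \<alpha> a * \<beta> b)) else eps"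
  show "lin (?c z)" for z by (simp add: lin_eps) (simp add: lin_def)
  show "vm es (pf (set es) (\<lambda>z. if z = x then \<alpha> else eps)) (pf (set es) (\<lambda>z. if z = x then \<beta> else eps)) w
      = pf (set es) ?c w" for w
    using vm_same[OF es assms(1), of "\<lambda>z. if z = x then \<alpha> else eps" "\<lambda>z. if z = x then \<beta> else eps" w] assms by simp
qed (use assms lin_eps in auto)

lemma vmult_same_relation:
  assumes x: "x \<in> set es" and \<alpha>: "lin \<alpha>" and \<beta>: "lin \<beta>"
  shows "vmult es (demb1 H (set es) x \<alpha>) (demb1 H (set es) x \<beta>) =
    (if \<sigma> x = 0 \<and> \<tau> x = 0 then
       sweedler H (\<lambda>a. sweedler H (\<lambda>b.
         fscale (pairing2 H (b 1) (a 1) R) (demb1 H (set es) x (dmult H (b 2) (a 2)))) \<beta>) \<alpha>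
     else if \<sigma> x = 0 \<and> \<tau> x = 1 then
       sweedler H (\<lambda>a. sweedler H (\<lambda>b.
         fscale (pairing2 H (b 2) (a 2) R) (demb1 H (set es) x (dmult H (a 1) (b 1)))) \<beta>) \<alpha>
     else if \<tau> x = 0 then demb1 H (set es) x (dmult H \<alpha> \<beta>)
     else demb1 H (set es) x (dmult H \<beta> \<alpha>))"
proof -
  let ?X = "set es"
  let ?E = "\<lambda>w. \<Prod>z\<in>?X - {x}. eps (w z)"
  have bl: "bil (\<lambda>a b. \<alpha> a * \<beta> b)" using \<alpha> \<beta> by (simp add: bil_def lin_def algebra_simps)
  have "lin (\<lambda>p. sw2 (dl (out x) (sel x) p) (\<lambda>a b. \<alpha> a * \<beta> b))" by (simp add: lin_def)
  then have L: "ev ?X (vmult es (demb1 H ?X x \<alpha>) (demb1 H ?X x \<beta>)) w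
      = sw2 (dl (out x) (sel x) (w x)) (\<lambda>a b. \<alpha> a * \<beta> b) * ?E w" for w
    using x by (simp add: vmult_same[OF assms] ev_demb1)
  have d: "ev ?X (demb1 H ?X x (dmult H f g)) w = cop (w x) (\<lambda>p q. f p * g q) * ?E w"
    if "lin f" "lin g" for f g w
    using x that by (simp add: ev_demb1 lin_dmult dmult_eq)
  consider "\<sigma> x = 0" "\<tau> x = 0" | "\<sigma> x = 0" "\<tau> x = 1" | "\<sigma> x \<noteq> 0" "\<tau> x = 0" | "\<sigma> x \<noteq> 0" "\<tau> x = 1"
    using tau[of x] by (cases "out x") auto
  then show ?thesis
  proof cases
    case 1
    then have o: "\<not> out x" "sel x" using tau[of x] sigma by (auto split: if_splits)
    have "ev ?X (sweedler H (\<lambda>a. sweedler H (\<lambda>b.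
         fscale (pairing2 H (b 1) (a 1) R) (demb1 H ?X x (dmult H (b 2) (a 2)))) \<beta>) \<alpha>) w
      = rr (\<lambda>r s. cop (w x) (\<lambda>p q. \<alpha> (s * q) * \<beta> (r * p) * ?E w))" for w
    proof (rule ev_sweedler2[OF \<alpha> \<beta>, where \<Lambda> = "\<lambda>f. rr (\<lambda>r s. cop (w x) (f r s))"])
      fix a b :: "nat \<Rightarrow> 'k \<Rightarrow> 'f" assume ab: "\<And>i. lin (a i)" "\<And>i. lin (b i)"
      have "ev ?X (fscale (pairing2 H (b 1) (a 1) R) (demb1 H ?X x (dmult H (b 2) (a 2)))) w
        = rr (\<lambda>r s. b 1 r * a 1 s) * (cop (w x) (\<lambda>p q. b 2 p * a 2 q) * ?E w)"
        by (simp only: ev_fscale d[OF ab(2,1)] d[OF ab(1,2)] pairing2_eq)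
      also have "\<dots> = rr (\<lambda>r s. cop (w x) (\<lambda>p q. b 1 r * a 1 s * (b 2 p * a 2 q * ?E w)))"
        by (rule sw2_prod)
      finally show "ev ?X (fscale (pairing2 H (b 1) (a 1) R) (demb1 H ?X x (dmult H (b 2) (a 2)))) w
        = rr (\<lambda>r s. cop (w x) (\<lambda>p q. a 1 s * a 2 q * (b 1 r * b 2 p) * ?E w))"
        by (simp only: mult_ac)
    qed (simp_all only: sw2_setsum sw2_cmult)
    then show ?thesis using 1 bl o
      by (intro tpow_ext[of ?X]) (simp_all add: vmult_tpow sweedler_tpow tpow_fscale demb1_tpow L sw2_dl)
  next
    case 2
    then have o: "out x" "sel x" using tau[of x] sigma by (auto split: if_splits)
    have "ev ?X (sweedler H (\<lambda>a. sweedler H (\<lambda>b.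
         fscale (pairing2 H (b 2) (a 2) R) (demb1 H ?X x (dmult H (a 1) (b 1)))) \<beta>) \<alpha>) w
      = rr (\<lambda>r s. cop (w x) (\<lambda>p q. \<alpha> (p * s) * \<beta> (q * r) * ?E w))" for w
    proof (rule ev_sweedler2[OF \<alpha> \<beta>, where \<Lambda> = "\<lambda>f. rr (\<lambda>r s. cop (w x) (f r s))"])
      fix a b :: "nat \<Rightarrow> 'k \<Rightarrow> 'f" assume ab: "\<And>i. lin (a i)" "\<And>i. lin (b i)"
      have "ev ?X (fscale (pairing2 H (b 2) (a 2) R) (demb1 H ?X x (dmult H (a 1) (b 1)))) w
        = rr (\<lambda>r s. b 2 r * a 2 s) * (cop (w x) (\<lambda>p q. a 1 p * b 1 q) * ?E w)"
        by (simp only: ev_fscale d[OF ab(2,1)] d[OF ab(1,2)] pairing2_eq)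
      also have "\<dots> = rr (\<lambda>r s. cop (w x) (\<lambda>p q. b 2 r * a 2 s * (a 1 p * b 1 q * ?E w)))"
        by (rule sw2_prod)
      finally show "ev ?X (fscale (pairing2 H (b 2) (a 2) R) (demb1 H ?X x (dmult H (a 1) (b 1)))) w
        = rr (\<lambda>r s. cop (w x) (\<lambda>p q. a 1 p * a 2 s * (b 1 q * b 2 r) * ?E w))"
        by (simp only: mult_ac)
    qed (simp_all only: sw2_setsum sw2_cmult)
    then show ?thesis using 2 bl o
      by (intro tpow_ext[of ?X]) (simp_all add: vmult_tpow sweedler_tpow tpow_fscale demb1_tpow L sw2_dl)
  next
    case 3
    then have "\<not> out x" "\<not> sel x" using tau[of x] sigma by (auto split: if_splits)
    then show ?thesis using 3 bl \<alpha> \<beta> x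
      by (intro tpow_ext[of ?X]) (simp_all add: vmult_tpow demb1_tpow L sw2_dl ev_demb1 lin_dmult dmult_eq)
  next
    case 4
    then have "out x" "\<not> sel x" using tau[of x] sigma by (auto split: if_splits)
    then show ?thesis using 4 bl \<alpha> \<beta> x
      by (intro tpow_ext[of ?X]) (simp_all add: vmult_tpow demb1_tpow L sw2_dl ev_demb1 lin_dmult dmult_eq mult.commute)
  qed
qed

lemma vmult_before:
  assumes "i < length es" "j < length es" "i < j" "lin \<alpha>" "lin \<beta>"
  shows "vmult es (demb1 H (set es) (es ! i) \<alpha>) (demb1 H (set es) (es ! j) \<beta>)
    = dten H (set es) (\<lambda>z. if z = es ! i then \<alpha> else if z = es ! j then \<beta> else eps)"
proof -
  let ?ys = "take j es" and ?zs = "drop j es"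
  have split: "es = ?ys @ ?zs" by simp
  have i: "es ! i \<in> set ?ys" using assms(1-3) by (auto simp: in_set_conv_nth intro!: exI[of _ i])
  have j: "es ! j \<in> set ?zs" using assms(2) by (metis Cons_nth_drop_Suc list.set_intros(1))
  have disj: "set ?ys \<inter> set ?zs = {}" using es by (metis append_take_drop_id distinct_append)
  have "vmult es (demb1 H (set es) (es ! i) \<alpha>) (demb1 H (set es) (es ! j) \<beta>)
    = dten H (set es) (\<lambda>x. if x \<in> set ?ys then (if x = es ! i then \<alpha> else eps) else (if x = es ! j then \<beta> else eps))"
    unfolding demb1_def by (rule vmult_ordered[OF es split]) (use i j disj assms lin_eps in auto)
  also have "\<dots> = dten H (set es) (\<lambda>z. if z = es ! i then \<alpha> else if z = es ! j then \<beta> else eps)"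
    using i j disj by (intro dten_cong) auto
  finally show ?thesis .
qed

lemma vmult_after:
  assumes ij: "i < length es" "j < i" and \<alpha>: "lin \<alpha>" and \<beta>: "lin \<beta>"
  defines "x \<equiv> es ! i" and "y \<equiv> es ! j"
  shows "vmult es (demb1 H (set es) x \<alpha>) (demb1 H (set es) y \<beta>) =
     (\<Sum>b\<in>multi_idx H {1,2}. fscale (R b) (dten H (set es) (\<lambda>z. if z = y then (\<lambda>a. \<beta> (ac (out y) (b 1) a))
       else if z = x then (\<lambda>a. \<alpha> (ac (out x) (b 2) a)) else eps)))" (is ?after)
    and "ev (set es) (vmult es (demb1 H (set es) x \<alpha>) (demb1 H (set es) y \<beta>)) w
      = rr (\<lambda>r s. \<alpha> (ac (out x) s (w x)) * \<beta> (ac (out y) r (w y)) * (\<Prod>z\<in>set es - {x, y}. eps (w z)))" (is ?ev)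
proof -
  let ?X = "set es"
  let ?ys = "take j es" and ?zs = "drop (Suc j) es"
  let ?E = "\<lambda>w. \<Prod>z\<in>?X - {x, y}. eps (w z)"
  have split: "es = ?ys @ y # ?zs" using ij by (simp add: y_def id_take_nth_drop[symmetric])
  have x: "x \<in> set ?zs" using ij unfolding x_def
    by (auto simp: in_set_conv_nth intro!: exI[of _ "i - Suc j"])
  have xy: "x \<noteq> y" "x \<in> ?X" "y \<in> ?X" using es ij by (auto simp: x_def y_def nth_eq_iff_index_eq)
  let ?g = "\<lambda>r s z. if z = y then (\<lambda>a. \<beta> (ac (out y) r a)) else if z = x then (\<lambda>a. \<alpha> (ac (out x) s a)) else eps"
  let ?a = "\<lambda>z. if z = x then \<alpha> else eps" and ?b = "\<lambda>z. if z = y then \<beta> else eps"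
  have g: "pf ?X (?g r s) w = \<alpha> (ac (out x) s (w x)) * \<beta> (ac (out y) r (w y)) * ?E w" for r s w
  proof -
    have X: "?X = insert x (insert y (?X - {x, y}))" using xy by auto
    have "(\<Prod>z\<in>?X - {x, y}. ?g r s z (w z)) = ?E w" by (rule prod.cong) auto
    moreover have "pf ?X (?g r s) w = (\<Prod>z\<in>insert x (insert y (?X - {x, y})). ?g r s z (w z))"
      unfolding pf_def using X by simp
    ultimately show ?thesis using xy by (simp add: mult.assoc)
  qed
  have "vm es (pf ?X ?a) (pf ?X ?b) w = rr (\<lambda>r s. pf ?X (?g r s) w)" for w
    using vm_reversed[of ?ys y ?zs x ?a ?b w] es x xy \<alpha> \<beta> unfolding split[symmetric] by simp
  then have V: "ev ?X (vmult es (demb1 H ?X x \<alpha>) (demb1 H ?X y \<beta>)) w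
      = rr (\<lambda>r s. pf ?X (?g r s) w)" for w
    by (simp add: ev_vmult es demb1_tpow, simp add: demb1_def ev_dten_pf lin_eps \<alpha> \<beta>)
  then show ?ev unfolding g .
  have lg: "lin (?g r s z)" for r s z
    using \<alpha> \<beta> by (simp add: lin_eps, simp add: lin_def ac_lin)
  show ?after
    by (rule tpow_ext[of ?X])
      (auto intro!: vmult_tpow tpow_sum tpow_fscale dten_tpow simp: V ev_sum ev_fscale ev_dten_pf lg sw2_sum)
qed

lemma vmult_after_relation:
  assumes ij: "i < length es" "j < i" and \<alpha>: "lin \<alpha>" and \<beta>: "lin \<beta>"
  defines "x \<equiv> es ! i" and "y \<equiv> es ! j"
  shows "vmult es (demb1 H (set es) x \<alpha>) (demb1 H (set es) y \<beta>) =
     sweedler H (\<lambda>a. sweedler H (\<lambda>b.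
       fscale (pairing2 H (b (1 + \<tau> y)) (a (1 + \<tau> x)) (R_twist H (\<tau> y) (\<tau> x) R))
         (demb2 H (set es) x y (dten H {1,2} (legs [a (2 - \<tau> x), b (2 - \<tau> y)])))) \<beta>) \<alpha>"
proof -
  let ?X = "set es"
  let ?E = "\<lambda>w. \<Prod>z\<in>?X - {x, y}. eps (w z)"
  have xy: "x \<noteq> y" "x \<in> ?X" "y \<in> ?X" using es ij by (auto simp: x_def y_def nth_eq_iff_index_eq)
  note L = vmult_after(2)[OF ij \<alpha> \<beta>, folded x_def y_def]
  show ?thesis
  proof (rule tpow_ext[of ?X])
    fix w
    have bb: "bil (\<lambda>a b. f a * g b)" if "lin f" "lin g" for f g
      using that by (simp add: bil_def lin_def algebra_simps)
    have t: "(antipode H ^^ \<tau> z) h = (if out z then anti h else h)" for z h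
      by (simp add: tau One_nat_def)
    have e: "1 + \<tau> z = (if out z then 2 else 1)" "2 - \<tau> z = (if out z then 1 else 2)" for z
      by (simp_all add: tau)
    have "ev ?X (sweedler H (\<lambda>a. sweedler H (\<lambda>b.
       fscale (pairing2 H (b (1 + \<tau> y)) (a (1 + \<tau> x)) (R_twist H (\<tau> y) (\<tau> x) R))
         (demb2 H ?X x y (dten H {1,2} (legs [a (2 - \<tau> x), b (2 - \<tau> y)])))) \<beta>) \<alpha>) w
      = rr (\<lambda>r s. \<alpha> ((if out x then w x else s) * (if out x then anti s else w x))
          * \<beta> ((if out y then w y else r) * (if out y then anti r else w y)) * ?E w)"
    proof (rule ev_sweedler2[OF \<alpha> \<beta>, where \<Lambda> = "\<lambda>f. rr (\<lambda>r s. f r s 1 1)"])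
      fix a b :: "nat \<Rightarrow> 'k \<Rightarrow> 'f" assume ab: "\<And>i. lin (a i)" "\<And>i. lin (b i)"
      have "ev ?X (fscale (pairing2 H (b (1 + \<tau> y)) (a (1 + \<tau> x)) (R_twist H (\<tau> y) (\<tau> x) R))
         (demb2 H ?X x y (dten H {1,2} (legs [a (2 - \<tau> x), b (2 - \<tau> y)])))) w
        = rr (\<lambda>r s. b (1 + \<tau> y) (if out y then anti r else r) * a (1 + \<tau> x) (if out x then anti s else s))
           * (a (2 - \<tau> x) (w x) * b (2 - \<tau> y) (w y) * ?E w)"
        using xy ab by (simp only: ev_fscale pairing2_eq sw2_R_twist[OF bb[OF ab(2,1)]] ev_demb2[OF finite_set xy(2,3,1)] ev_dten2 t legs_simps)
      also have "\<dots> = rr (\<lambda>r s. b (1 + \<tau> y) (if out y then anti r else r) * a (1 + \<tau> x) (if out x then anti s else s)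
           * (a (2 - \<tau> x) (w x) * b (2 - \<tau> y) (w y) * ?E w))"
        by (rule sw2_cmult_right[symmetric])
      also have "\<dots> = rr (\<lambda>r s. a 1 (if out x then w x else s) * a 2 (if out x then anti s else w x) *
          (b 1 (if out y then w y else r) * b 2 (if out y then anti r else w y)) * ?E w)"
        by (cases "out x"; cases "out y") (simp_all only: e if_True if_False mult_ac)
      finally show "ev ?X (fscale (pairing2 H (b (1 + \<tau> y)) (a (1 + \<tau> x)) (R_twist H (\<tau> y) (\<tau> x) R))
         (demb2 H ?X x y (dten H {1,2} (legs [a (2 - \<tau> x), b (2 - \<tau> y)])))) w
        = rr (\<lambda>r s. a 1 (if out x then w x else s) * a 2 (if out x then anti s else w x) *
          (b 1 (if out y then w y else r) * b 2 (if out y then anti r else w y)) * ?E w)" .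
    qed (simp_all only: sw2_setsum sw2_cmult)
    then show "ev ?X (vmult es (demb1 H ?X x \<alpha>) (demb1 H ?X y \<beta>)) w = ev ?X (sweedler H (\<lambda>a. sweedler H (\<lambda>b.
       fscale (pairing2 H (b (1 + \<tau> y)) (a (1 + \<tau> x)) (R_twist H (\<tau> y) (\<tau> x) R))
         (demb2 H ?X x y (dten H {1,2} (legs [a (2 - \<tau> x), b (2 - \<tau> y)])))) \<beta>) \<alpha>) w"
      unfolding L by (cases "out x"; cases "out y") (simp_all add: ac_def om_def)
  qed (auto intro!: vmult_tpow sweedler_tpow tpow_fscale demb2_tpow)
qed

end

end

section \<open>Uniqueness of the vertex multiplication\<close>

context vertex
begin

context
  fixes es :: "'x list" and \<tau> \<sigma> :: "'x \<Rightarrow> nat"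
  assumes es: "distinct es"
    and tau: "\<And>x. \<tau> x = (if out x then 1 else 0)"
    and sigma: "\<And>x. sel x \<longleftrightarrow> \<sigma> x = 0"
begin

lemma vmult_is_vertex_mult: "is_vertex_mult H R es \<tau> \<sigma> (vmult es)"
  unfolding is_vertex_mult_def Let_def
proof (intro conjI allI ballI impI)
  show "dual_algebra H (set es) (vmult es)" by (rule vmult_dual_algebra[OF es])
  show "vmult es S T = 0" if "S \<notin> tpow H (set es) \<or> T \<notin> tpow H (set es)" for S T
    using that by (auto simp: vmult_def)
  show "dten H (set es) \<alpha> = foldr (vmult es) (map (\<lambda>x. demb1 H (set es) x (\<alpha> x)) es) (dunit H (set es))"
    if "\<forall>x\<in>set es. \<alpha> x \<in> dual_space H" for \<alpha>
  proof -
    have "foldr (vmult es) (map (\<lambda>x. demb1 H (set es) x (\<alpha> x)) es) (dunit H (set es))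
      = dten H (set es) (\<lambda>x. if x \<in> set es then \<alpha> x else eps)"
      using vmult_foldr[OF es tau sigma, where \<alpha> = \<alpha> and ys = "[]" and zs = es] that by (simp add: lin_dual)
    also have "\<dots> = dten H (set es) \<alpha>" by (rule dten_cong) simp
    finally show ?thesis ..
  qed
  fix \<alpha> \<beta> assume ab: "\<alpha> \<in> dual_space H" "\<beta> \<in> dual_space H"
  show "vmult es (demb1 H (set es) x \<alpha>) (demb1 H (set es) x \<beta>) =
           (if \<sigma> x = 0 \<and> \<tau> x = 0 then
              sweedler H (\<lambda>a. sweedler H (\<lambda>b.
                fscale (pairing2 H (b 1) (a 1) R) (demb1 H (set es) x (dmult H (b 2) (a 2)))) \<beta>) \<alpha>
            else if \<sigma> x = 0 \<and> \<tau> x = 1 then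
              sweedler H (\<lambda>a. sweedler H (\<lambda>b.
                fscale (pairing2 H (b 2) (a 2) R) (demb1 H (set es) x (dmult H (a 1) (b 1)))) \<beta>) \<alpha>
            else if \<tau> x = 0 then demb1 H (set es) x (dmult H \<alpha> \<beta>)
            else demb1 H (set es) x (dmult H \<beta> \<alpha>))" if "x \<in> set es" for x
    using vmult_same_relation[OF es tau sigma that] ab by (simp add: lin_dual)
  fix i j assume ij: "i < length es" "j < length es"
  show "vmult es (demb1 H (set es) (es ! i) \<alpha>) (demb1 H (set es) (es ! j) \<beta>)
      = demb2 H (set es) (es ! i) (es ! j) (dten H {1, 2} (legs [\<alpha>, \<beta>]))" if "i < j"
    using vmult_before[OF es tau sigma ij that] demb2_dten[of "set es" "es ! i" "es ! j" \<alpha> \<beta>] ab es ij that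
    by (simp add: lin_dual nth_eq_iff_index_eq)
  show "vmult es (demb1 H (set es) (es ! i) \<alpha>) (demb1 H (set es) (es ! j) \<beta>) =
              sweedler H (\<lambda>a. sweedler H (\<lambda>b.
                fscale (pairing2 H (b (1 + \<tau> (es ! j))) (a (1 + \<tau> (es ! i))) (R_twist H (\<tau> (es ! j)) (\<tau> (es ! i)) R))
                  (demb2 H (set es) (es ! i) (es ! j) (dten H {1,2} (legs [a (2 - \<tau> (es ! i)), b (2 - \<tau> (es ! j))])))) \<beta>) \<alpha>"
    if "j < i"
    using vmult_after_relation[OF es tau sigma ij(1) that] ab by (simp add: lin_dual)
qed

text \<open>The tensors that are trivial on the first \<open>k\<close> ends, as the span of pure tensors.\<close>

inductive_set suffix_span :: "nat \<Rightarrow> ('x, 'k, 'f) tensor set" for k where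
  zero: "0 \<in> suffix_span k"
| add: "(\<And>x. x \<in> set es \<Longrightarrow> lin (\<beta> x)) \<Longrightarrow> (\<And>x. x \<in> set (take k es) \<Longrightarrow> \<beta> x = eps) \<Longrightarrow>
    T \<in> suffix_span k \<Longrightarrow> fscale c (dten H (set es) \<beta>) + T \<in> suffix_span k"

lemma suffix_span_tpow: "T \<in> suffix_span k \<Longrightarrow> T \<in> tpow H (set es)"
  by (induction rule: suffix_span.induct) (auto intro: tpow_zero tpow_add tpow_fscale dten_tpow)

lemma suffix_span_plus: "S \<in> suffix_span k \<Longrightarrow> T \<in> suffix_span k \<Longrightarrow> S + T \<in> suffix_span k"
  by (induction rule: suffix_span.induct) (auto simp: add.assoc intro: suffix_span.intros)

lemma suffix_span_scale: "T \<in> suffix_span k \<Longrightarrow> fscale c T \<in> suffix_span k"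
proof (induction rule: suffix_span.induct)
  case zero
  have "fscale c 0 = (0 :: ('x, 'k, 'f) tensor)" by (simp add: fscale_def fun_eq_iff zero_fun_apply)
  then show ?case by (simp add: suffix_span.zero)
next
  case (add \<beta> T c')
  have "fscale c (fscale c' (dten H (set es) \<beta>) + T) = fscale (c * c') (dten H (set es) \<beta>) + fscale c T"
    by (simp add: fscale_def fun_eq_iff plus_fun_apply distrib_left mult.assoc)
  with add show ?case by (simp add: suffix_span.add)
qed

lemma suffix_span_dten:
  assumes "\<And>x. x \<in> set es \<Longrightarrow> lin (\<beta> x)" "\<And>x. x \<in> set (take k es) \<Longrightarrow> \<beta> x = eps"
  shows "dten H (set es) \<beta> \<in> suffix_span k"
proof -
  have "fscale 1 (dten H (set es) \<beta>) + 0 \<in> suffix_span k"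
    by (rule suffix_span.add) (use assms in \<open>auto intro: suffix_span.zero\<close>)
  then show ?thesis by (simp add: fscale_def)
qed

lemma suffix_span_sum: "(\<And>i. i \<in> I \<Longrightarrow> f i \<in> suffix_span k) \<Longrightarrow> (\<Sum>i\<in>I. f i) \<in> suffix_span k"
  by (induction I rule: infinite_finite_induct) (simp_all add: suffix_span.zero suffix_span_plus)

lemma suffix_span_0:
  assumes T: "T \<in> tpow H (set es)"
  shows "T \<in> suffix_span 0"
proof -
  have "btens b \<in> suffix_span 0" if "b \<in> multi_idx H (set es)" for b
    unfolding btens_dten[OF finite_set that] by (rule suffix_span_dten) (simp_all add: lin_dual_basis)
  then have "(\<Sum>b\<in>multi_idx H (set es). fscale (T b) (btens b)) \<in> suffix_span 0"
    by (intro suffix_span_sum suffix_span_scale)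
  then show ?thesis using tensor_expand[OF _ T] by simp
qed

lemma linear_on_suffix:
  assumes f: "linear_on (tpow H (set es)) f" and T: "T \<in> suffix_span k"
    and d: "\<And>\<beta>. (\<And>x. x \<in> set es \<Longrightarrow> lin (\<beta> x)) \<Longrightarrow> (\<And>x. x \<in> set (take k es) \<Longrightarrow> \<beta> x = eps) \<Longrightarrow>
      f (dten H (set es) \<beta>) \<in> suffix_span l"
  shows "f T \<in> suffix_span l"
  using T
proof (induction rule: suffix_span.induct)
  case zero
  show ?case using linear_on_zero[OF f] by (simp add: suffix_span.zero)
next
  case (add \<beta> T c)
  then have "f (fscale c (dten H (set es) \<beta>) + T) = fscale c (f (dten H (set es) \<beta>)) + f T"
    using f suffix_span_tpow[OF add(3)] by (simp add: linear_on_def tpow_fscale dten_tpow)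
  with add d show ?case by (simp add: suffix_span_plus suffix_span_scale)
qed

lemma linear_on_suffix_eq:
  assumes f: "linear_on (tpow H (set es)) f" and g: "linear_on (tpow H (set es)) g" and T: "T \<in> suffix_span k"
    and d: "\<And>\<beta>. (\<And>x. x \<in> set es \<Longrightarrow> lin (\<beta> x)) \<Longrightarrow> (\<And>x. x \<in> set (take k es) \<Longrightarrow> \<beta> x = eps) \<Longrightarrow>
      f (dten H (set es) \<beta>) = g (dten H (set es) \<beta>)"
  shows "f T = g T"
  using T
proof (induction rule: suffix_span.induct)
  case zero
  show ?case using linear_on_zero[OF f] linear_on_zero[OF g] by simp
next
  case (add \<beta> T c)
  then show ?case
    using f g suffix_span_tpow[OF add(3)] d by (simp add: linear_on_def tpow_fscale dten_tpow)
qed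

context
  fixes m :: "('x, 'k, 'f) tensor \<Rightarrow> ('x, 'k, 'f) tensor \<Rightarrow> ('x, 'k, 'f) tensor"
  assumes m: "is_vertex_mult H R es \<tau> \<sigma> m"
begin

lemma m_algebra: "dual_algebra H (set es) m"
  using m by (simp add: is_vertex_mult_def Let_def)

lemma m_tpow: "S \<in> tpow H (set es) \<Longrightarrow> T \<in> tpow H (set es) \<Longrightarrow> m S T \<in> tpow H (set es)"
  using m_algebra by (simp add: dual_algebra_def)

lemma m_assoc: "S \<in> tpow H (set es) \<Longrightarrow> T \<in> tpow H (set es) \<Longrightarrow> U \<in> tpow H (set es) \<Longrightarrow> m (m S T) U = m S (m T U)"
  using m_algebra by (simp add: dual_algebra_def)

lemma m_unit: "S \<in> tpow H (set es) \<Longrightarrow> m (dunit H (set es)) S = S"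
  using m_algebra by (simp add: dual_algebra_def)

lemma m_linear: "S \<in> tpow H (set es) \<Longrightarrow> linear_on (tpow H (set es)) (m S)"
  "S \<in> tpow H (set es) \<Longrightarrow> linear_on (tpow H (set es)) (\<lambda>T. m T S)"
  using m_algebra by (simp_all add: dual_algebra_def bilinear_on_def)

lemma m_foldr:
  assumes "\<And>x. x \<in> set es \<Longrightarrow> lin (\<alpha> x)"
  shows "foldr m (map (\<lambda>x. demb1 H (set es) x (\<alpha> x)) es) (dunit H (set es)) = dten H (set es) \<alpha>"
  using m assms by (simp add: is_vertex_mult_def Let_def lin_dual)

lemma m_foldr_tpow: "foldr m (map (\<lambda>x. demb1 H (set es) x (\<alpha> x)) zs) (dunit H (set es)) \<in> tpow H (set es)"
  by (induction zs) (simp_all add: dunit_tpow m_tpow demb1_tpow)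

lemma m_foldr_skip:
  "(\<And>x. x \<in> set ys \<Longrightarrow> \<alpha> x = eps) \<Longrightarrow>
    foldr m (map (\<lambda>x. demb1 H (set es) x (\<alpha> x)) (ys @ zs)) (dunit H (set es))
      = foldr m (map (\<lambda>x. demb1 H (set es) x (\<alpha> x)) zs) (dunit H (set es))"
proof (induction ys)
  case (Cons y ys)
  have "demb1 H (set es) y eps = dunit H (set es)" by (simp add: demb1_def dunit_def)
  then show ?case using Cons m_unit[OF m_foldr_tpow[of \<alpha> zs]] by simp
qed simp

text \<open>By the unit law and the formula for ordered products, multiplying by a generator from the left only fills in its factor if all factors up to that place are trivial.\<close>

lemma m_before:
  assumes i: "i < length es" and \<beta>: "\<And>x. x \<in> set es \<Longrightarrow> lin (\<beta> x)" "\<And>x. x \<in> set (take (Suc i) es) \<Longrightarrow> \<beta> x = eps"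
    and \<gamma>: "lin \<gamma>"
  shows "m (demb1 H (set es) (es ! i) \<gamma>) (dten H (set es) \<beta>) = dten H (set es) (\<beta>(es ! i := \<gamma>))"
proof -
  let ?x = "es ! i"
  have split: "es = take i es @ ?x # drop (Suc i) es" using i by (rule id_take_nth_drop)
  have t: "take (Suc i) es = take i es @ [?x]" using i by (rule take_Suc_conv_app_nth)
  have d: "?x \<notin> set (take i es)" "?x \<notin> set (drop (Suc i) es)"
    using es by (subst (asm) split, simp)+
  let ?F = "\<lambda>\<alpha> zs. foldr m (map (\<lambda>x. demb1 H (set es) x (\<alpha> x)) zs) (dunit H (set es))"
  have "dten H (set es) (\<beta>(?x := \<gamma>)) = ?F (\<beta>(?x := \<gamma>)) (take i es @ ?x # drop (Suc i) es)"
    using m_foldr[of "\<beta>(?x := \<gamma>)"] \<beta>(1) \<gamma> split by simp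
  also have "\<dots> = ?F (\<beta>(?x := \<gamma>)) (?x # drop (Suc i) es)"
    by (rule m_foldr_skip) (use d \<beta>(2) t in auto)
  also have "\<dots> = m (demb1 H (set es) ?x \<gamma>) (?F \<beta> (drop (Suc i) es))"
  proof -
    have "map (\<lambda>x. demb1 H (set es) x ((\<beta>(?x := \<gamma>)) x)) (drop (Suc i) es) = map (\<lambda>x. demb1 H (set es) x (\<beta> x)) (drop (Suc i) es)"
      by (rule map_cong[OF refl]) (use d in auto)
    then show ?thesis by (simp only: list.map foldr.simps comp_def fun_upd_same)
  qed
  also have "?F \<beta> (drop (Suc i) es) = ?F \<beta> (take (Suc i) es @ drop (Suc i) es)"
    by (rule m_foldr_skip[symmetric]) (use \<beta>(2) in auto)
  also have "\<dots> = dten H (set es) \<beta>"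
    using m_foldr[OF \<beta>(1)] by simp
  finally show ?thesis ..
qed

end

text \<open>The relations prescribe all products of two generators that are not in strictly increasing order.\<close>

lemma relation_eq:
  assumes m: "is_vertex_mult H R es \<tau> \<sigma> m" and ij: "i < length es" "j \<le> i" and ab: "lin \<alpha>" "lin \<beta>"
  shows "m (demb1 H (set es) (es ! i) \<alpha>) (demb1 H (set es) (es ! j) \<beta>)
    = vmult es (demb1 H (set es) (es ! i) \<alpha>) (demb1 H (set es) (es ! j) \<beta>)"
proof -
  have d: "\<alpha> \<in> dual_space H" "\<beta> \<in> dual_space H" "es ! i \<in> set es" "j < length es"
    using ab ij by (simp_all add: lin_dual)
  note rel = m[unfolded is_vertex_mult_def Let_def, THEN conjunct2, THEN conjunct2, THEN conjunct2]
  note rel' = vmult_is_vertex_mult[unfolded is_vertex_mult_def Let_def, THEN conjunct2, THEN conjunct2, THEN conjunct2]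
  show ?thesis
  proof (cases "i = j")
    case True
    show ?thesis unfolding True[symmetric]
      by (rule trans[OF rel[THEN conjunct1, THEN bspec, OF d(1), THEN bspec, OF d(2), THEN bspec, OF d(3)]
            rel'[THEN conjunct1, THEN bspec, OF d(1), THEN bspec, OF d(2), THEN bspec, OF d(3), symmetric]])
  next
    case False
    then have ji: "j < i" using ij by simp
    from rel[THEN conjunct2, THEN bspec, OF d(1), THEN bspec, OF d(2), THEN spec, THEN mp, OF ij(1),
        THEN spec, THEN mp, OF d(4), THEN conjunct2, THEN mp, OF ji]
      rel'[THEN conjunct2, THEN bspec, OF d(1), THEN bspec, OF d(2), THEN spec, THEN mp, OF ij(1),
        THEN spec, THEN mp, OF d(4), THEN conjunct2, THEN mp, OF ji]
    show ?thesis by (rule trans[OF _ sym])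
  qed
qed

lemma agree_before:
  assumes m: "is_vertex_mult H R es \<tau> \<sigma> m" and m': "is_vertex_mult H R es \<tau> \<sigma> m'"
    and i: "i < length es" and \<alpha>: "lin \<alpha>" and j: "Suc i \<le> j" and T: "T \<in> suffix_span j"
  shows "m (demb1 H (set es) (es ! i) \<alpha>) T = m' (demb1 H (set es) (es ! i) \<alpha>) T"
    and "m (demb1 H (set es) (es ! i) \<alpha>) T \<in> suffix_span i"
proof -
  have ni: "es ! i \<notin> set (take i es)"
    using es i by (auto simp: in_set_conv_nth nth_eq_iff_index_eq)
  have g: "m (demb1 H (set es) (es ! i) \<alpha>) (dten H (set es) \<beta>) = dten H (set es) (\<beta>(es ! i := \<alpha>))"
    "m' (demb1 H (set es) (es ! i) \<alpha>) (dten H (set es) \<beta>) = dten H (set es) (\<beta>(es ! i := \<alpha>))"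
    "dten H (set es) (\<beta>(es ! i := \<alpha>)) \<in> suffix_span i"
    if b: "\<And>x. x \<in> set es \<Longrightarrow> lin (\<beta> x)" "\<And>x. x \<in> set (take j es) \<Longrightarrow> \<beta> x = eps" for \<beta>
  proof -
    have z: "\<beta> x = eps" if "x \<in> set (take (Suc i) es)" for x
      using b(2) that set_take_subset_set_take[OF j, of es] by auto
    show "m (demb1 H (set es) (es ! i) \<alpha>) (dten H (set es) \<beta>) = dten H (set es) (\<beta>(es ! i := \<alpha>))"
      by (rule m_before[OF m i _ _ \<alpha>]) (fact b(1), fact z)
    show "m' (demb1 H (set es) (es ! i) \<alpha>) (dten H (set es) \<beta>) = dten H (set es) (\<beta>(es ! i := \<alpha>))"
      by (rule m_before[OF m' i _ _ \<alpha>]) (fact b(1), fact z)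
    have "\<beta> x = eps" if "x \<in> set (take i es)" for x
      using b(2) that j set_take_subset_set_take[of i j es] by auto
    then show "dten H (set es) (\<beta>(es ! i := \<alpha>)) \<in> suffix_span i"
      by (intro suffix_span_dten) (use b(1) \<alpha> ni in auto)
  qed
  show "m (demb1 H (set es) (es ! i) \<alpha>) T = m' (demb1 H (set es) (es ! i) \<alpha>) T"
    by (rule linear_on_suffix_eq[OF m_linear(1)[OF m demb1_tpow] m_linear(1)[OF m' demb1_tpow] T]) (simp add: g)
  show "m (demb1 H (set es) (es ! i) \<alpha>) T \<in> suffix_span i"
    by (rule linear_on_suffix[OF m_linear(1)[OF m demb1_tpow] T]) (simp add: g)
qed

text \<open>Downward induction on \<open>j\<close>: a tensor that is trivial on the first \<open>j\<close> ends is a sum of products of a generator at end \<open>j\<close> with a tensor that is trivial on one more end. A generator at \<open>i\<close> is moved past the one at \<open>j\<close> by the relations, and then the induction hypothesis applies.\<close>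

lemma agree_generator:
  assumes m: "is_vertex_mult H R es \<tau> \<sigma> m" and m': "is_vertex_mult H R es \<tau> \<sigma> m'"
    and j: "j \<le> length es"
  shows "i < length es \<Longrightarrow> lin \<alpha> \<Longrightarrow> T \<in> suffix_span j \<Longrightarrow>
    m (demb1 H (set es) (es ! i) \<alpha>) T = m' (demb1 H (set es) (es ! i) \<alpha>) T
    \<and> m (demb1 H (set es) (es ! i) \<alpha>) T \<in> suffix_span (min i j)"
  using j
proof (induction j arbitrary: i \<alpha> T rule: inc_induct)
  case base
  then show ?case using agree_before[OF m m' base(1,2) _ base(3)] by (simp add: min_def)
next
  case (step j)
  let ?g = "\<lambda>i \<alpha>. demb1 H (set es) (es ! i) \<alpha>"
  have g: "?g i \<alpha> \<in> tpow H (set es)" for i \<alpha> by (rule demb1_tpow)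
  have D: "m (?g i \<alpha>) (dten H (set es) \<beta>) = m' (?g i \<alpha>) (dten H (set es) \<beta>) \<and>
      m (?g i \<alpha>) (dten H (set es) \<beta>) \<in> suffix_span (min i j)"
    if b: "\<And>x. x \<in> set es \<Longrightarrow> lin (\<beta> x)" "\<And>x. x \<in> set (take j es) \<Longrightarrow> \<beta> x = eps" for \<beta>
  proof (cases "i < j")
    case True
    have "dten H (set es) \<beta> \<in> suffix_span j" by (rule suffix_span_dten) (fact b)+
    with True show ?thesis
      using agree_before[OF m m' step.prems(1,2), of j "dten H (set es) \<beta>"]
      by (metis Suc_leI less_imp_le min.absorb1)
  next
    case False
    let ?T = "dten H (set es) (\<beta>(es ! j := eps))"
    have lj: "lin (\<beta> (es ! j))" using b(1) step.hyps by simp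
    have jt: "take (Suc j) es = take j es @ [es ! j]" using step.hyps by (simp add: take_Suc_conv_app_nth)
    have z: "(\<beta>(es ! j := eps)) x = eps" if "x \<in> set (take (Suc j) es)" for x
      using b(2) that unfolding jt by auto
    have lz: "lin ((\<beta>(es ! j := eps)) x)" if "x \<in> set es" for x using b(1)[OF that] lin_eps by simp
    have T: "?T \<in> suffix_span (Suc j)" by (rule suffix_span_dten) (fact lz, fact z)
    have split: "dten H (set es) \<beta> = M (?g j (\<beta> (es ! j))) ?T" if M: "is_vertex_mult H R es \<tau> \<sigma> M" for M
    proof -
      have "M (?g j (\<beta> (es ! j))) ?T = dten H (set es) ((\<beta>(es ! j := eps))(es ! j := \<beta> (es ! j)))"
        by (rule m_before[OF M step.hyps(2) _ _ lj]) (fact lz, fact z)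
      then show ?thesis by simp
    qed
    have expand: "M (?g i \<alpha>) (dten H (set es) \<beta>) = M (vmult es (?g i \<alpha>) (?g j (\<beta> (es ! j)))) ?T"
      if M: "is_vertex_mult H R es \<tau> \<sigma> M" for M
      unfolding split[OF M] m_assoc[OF M g g dten_tpow, symmetric]
      using False by (subst relation_eq[OF M step.prems(1) _ step.prems(2) lj]) simp_all
    show ?thesis
    proof (cases "i = j")
      case True
      let ?c = "\<lambda>p. sw2 (dl (out (es ! j)) (sel (es ! j)) p) (\<lambda>a c. \<alpha> a * \<beta> (es ! j) c)"
      have lc: "lin ?c" by (simp add: lin_def)
      have Z: "vmult es (?g i \<alpha>) (?g j (\<beta> (es ! j))) = ?g j ?c"
        using True vmult_same[OF es tau sigma, of "es ! j" \<alpha> "\<beta> (es ! j)"] step.hyps step.prems lj by simp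
      note A = agree_before[OF m m' step.hyps(2) lc order_refl T]
      show ?thesis unfolding expand[OF m] expand[OF m'] Z using A True by simp
    next
      case neq: False
      then have ji: "j < i" using False by simp
      let ?b = "\<lambda>r a. \<beta> (es ! j) (ac (out (es ! j)) r a)" and ?a = "\<lambda>s a. \<alpha> (ac (out (es ! i)) s a)"
      have lb: "lin (?b r)" "lin (?a s)" for r s using lj step.prems by (simp_all add: lin_def ac_lin)
      have ne: "es ! i \<noteq> es ! j" using ji step.prems es by (simp add: nth_eq_iff_index_eq)
      have nt: "es ! i \<notin> set (take (Suc j) es)"
        using ji step.prems es by (auto simp: in_set_conv_nth nth_eq_iff_index_eq)
      have Z: "vmult es (?g i \<alpha>) (?g j (\<beta> (es ! j))) = (\<Sum>b\<in>multi_idx H {1,2}. fscale (R b) (M (?g j (?b (b 1))) (?g i (?a (b 2)))))"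
        if M: "is_vertex_mult H R es \<tau> \<sigma> M" for M
        unfolding vmult_after(1)[OF es tau sigma step.prems(1) ji step.prems(2) lj]
      proof (intro sum.cong refl arg_cong2[where f = fscale])
        fix b :: "nat \<Rightarrow> 'k"
        have "M (?g j (?b (b 1))) (dten H (set es) (\<lambda>z. if z = es ! i then ?a (b 2) else eps))
          = dten H (set es) ((\<lambda>z. if z = es ! i then ?a (b 2) else eps)(es ! j := ?b (b 1)))"
          by (rule m_before[OF M step.hyps(2)]) (use lb nt lin_eps in auto)
        also have "\<dots> = dten H (set es) (\<lambda>z. if z = es ! j then ?b (b 1) else if z = es ! i then ?a (b 2) else eps)"
          by (rule dten_cong) simp
        finally show "dten H (set es) (\<lambda>z. if z = es ! j then ?b (b 1) else if z = es ! i then ?a (b 2) else eps)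
          = M (?g j (?b (b 1))) (?g i (?a (b 2)))"
          by (simp add: demb1_def)
      qed
      have E: "M (?g i \<alpha>) (dten H (set es) \<beta>) = (\<Sum>b\<in>multi_idx H {1,2}. fscale (R b) (M (?g j (?b (b 1))) (M (?g i (?a (b 2))) ?T)))"
        if M: "is_vertex_mult H R es \<tau> \<sigma> M" for M
      proof -
        have "M (?g i \<alpha>) (dten H (set es) \<beta>) = (\<Sum>b\<in>multi_idx H {1,2}. M (fscale (R b) (M (?g j (?b (b 1))) (?g i (?a (b 2))))) ?T)"
          unfolding expand[OF M] Z[OF M]
          by (rule linear_on_sum[OF m_linear(2)[OF M dten_tpow]]) (intro tpow_fscale m_tpow[OF M] g)
        also have "\<dots> = (\<Sum>b\<in>multi_idx H {1,2}. fscale (R b) (M (M (?g j (?b (b 1))) (?g i (?a (b 2)))) ?T))"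
          using m_linear(2)[OF M dten_tpow] m_tpow[OF M g g] by (simp add: linear_on_def)
        finally show ?thesis by (simp add: m_assoc[OF M g g dten_tpow])
      qed
      have IH: "m (?g i (?a s)) ?T = m' (?g i (?a s)) ?T" "m (?g i (?a s)) ?T \<in> suffix_span (Suc j)" for s
      proof -
        have mn: "min i (Suc j) = Suc j" using ji by simp
        show "m (?g i (?a s)) ?T = m' (?g i (?a s)) ?T" "m (?g i (?a s)) ?T \<in> suffix_span (Suc j)"
          using step.IH[OF step.prems(1) lb(2)[of s] T] unfolding mn by blast+
      qed
      have "m (?g j (?b r)) (m (?g i (?a s)) ?T) = m' (?g j (?b r)) (m' (?g i (?a s)) ?T)"
        "m (?g j (?b r)) (m (?g i (?a s)) ?T) \<in> suffix_span j" for r s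
        using agree_before[OF m m' step.hyps(2) lb(1) order_refl IH(2)] IH(1) by simp_all
      then show ?thesis using ji
        by (simp add: E[OF m] E[OF m'] suffix_span_sum suffix_span_scale min_def)
    qed
  qed
  show ?case
  proof
    show "m (?g i \<alpha>) T = m' (?g i \<alpha>) T"
      by (rule linear_on_suffix_eq[OF m_linear(1)[OF m g] m_linear(1)[OF m' g] step.prems(3)]) (simp add: D)
    show "m (?g i \<alpha>) T \<in> suffix_span (min i j)"
      by (rule linear_on_suffix[OF m_linear(1)[OF m g] step.prems(3)]) (rule D[THEN conjunct2])
  qed
qed

text \<open>Pure tensors are ordered products of generators, so it suffices that left multiplications by generators agree.\<close>

lemma vertex_mult_unique:
  assumes m: "is_vertex_mult H R es \<tau> \<sigma> m" and m': "is_vertex_mult H R es \<tau> \<sigma> m'"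
  shows "m = m'"
proof (rule ext, rule ext)
  fix S T
  have z: "M S T = 0" if "is_vertex_mult H R es \<tau> \<sigma> M" "S \<notin> tpow H (set es) \<or> T \<notin> tpow H (set es)" for M
    using that unfolding is_vertex_mult_def Let_def by blast
  show "m S T = m' S T"
  proof (cases "S \<in> tpow H (set es) \<and> T \<in> tpow H (set es)")
    case False
    then show ?thesis using z[OF m] z[OF m'] by auto
  next
    case True
    then have S: "S \<in> tpow H (set es)" and T: "T \<in> tpow H (set es)" by auto
    have g: "m (demb1 H (set es) x \<alpha>) U = m' (demb1 H (set es) x \<alpha>) U"
      if "x \<in> set es" "lin \<alpha>" "U \<in> tpow H (set es)" for x \<alpha> U
      using agree_generator[OF m m', of 0] that suffix_span_0 by (auto simp: in_set_conv_nth)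
    let ?F = "\<lambda>M \<alpha> zs. foldr M (map (\<lambda>x. demb1 H (set es) x (\<alpha> x)) zs) (dunit H (set es))"
    have F: "?F m \<alpha> zs = ?F m' \<alpha> zs \<and> (\<forall>U\<in>tpow H (set es). m (?F m \<alpha> zs) U = m' (?F m \<alpha> zs) U)"
      if l: "\<And>x. x \<in> set es \<Longrightarrow> lin (\<alpha> x)" and "set zs \<subseteq> set es" for \<alpha> zs
      using that(2)
    proof (induction zs)
      case Nil
      then show ?case by (simp add: m_unit[OF m] m_unit[OF m'])
    next
      case (Cons z zs)
      have z: "z \<in> set es" "lin (\<alpha> z)" using Cons.prems l by auto
      have IH: "?F m \<alpha> zs = ?F m' \<alpha> zs" "\<And>U. U \<in> tpow H (set es) \<Longrightarrow> m (?F m \<alpha> zs) U = m' (?F m \<alpha> zs) U"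
        using Cons by auto
      have t: "?F m \<alpha> zs \<in> tpow H (set es)" by (rule m_foldr_tpow[OF m])
      have e: "?F m \<alpha> (z # zs) = m (demb1 H (set es) z (\<alpha> z)) (?F m \<alpha> zs)" by simp
      have e': "?F m' \<alpha> (z # zs) = m' (demb1 H (set es) z (\<alpha> z)) (?F m \<alpha> zs)" by (simp add: IH(1))
      have ee: "?F m \<alpha> (z # zs) = ?F m' \<alpha> (z # zs)" unfolding e e' by (rule g[OF z t])
      have "m (?F m \<alpha> (z # zs)) U = m' (?F m \<alpha> (z # zs)) U" if U: "U \<in> tpow H (set es)" for U
      proof -
        have "m (?F m \<alpha> (z # zs)) U = m (demb1 H (set es) z (\<alpha> z)) (m (?F m \<alpha> zs) U)"
          unfolding e by (rule m_assoc[OF m demb1_tpow t U])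
        also have "\<dots> = m' (demb1 H (set es) z (\<alpha> z)) (m' (?F m \<alpha> zs) U)"
          unfolding IH(2)[OF U] by (rule g[OF z m_tpow[OF m' t U]])
        also have "\<dots> = m' (?F m \<alpha> (z # zs)) U"
          unfolding ee e' by (rule m_assoc[OF m' demb1_tpow t U, symmetric])
        finally show ?thesis .
      qed
      with ee show ?case by blast
    qed
    have d: "m (dten H (set es) \<alpha>) T = m' (dten H (set es) \<alpha>) T" if l: "\<And>x. x \<in> set es \<Longrightarrow> lin (\<alpha> x)" for \<alpha>
    proof -
      have "?F m \<alpha> es = dten H (set es) \<alpha>" by (rule m_foldr[OF m]) (rule l)
      moreover have "?F m \<alpha> es = ?F m' \<alpha> es \<and> (\<forall>U\<in>tpow H (set es). m (?F m \<alpha> es) U = m' (?F m \<alpha> es) U)"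
        by (rule F) (auto intro: l)
      ultimately show ?thesis using T by metis
    qed
    show ?thesis
      by (rule linear_on_ext[OF m_linear(2)[OF m T] m_linear(2)[OF m' T] finite_set S])
        (simp only: btens_dten[OF finite_set] d lin_dual_basis)
  qed
qed

lemma vertex_mult_eq: "vertex_mult H R es \<tau> \<sigma> = vmult es"
  unfolding vertex_mult_def
proof (rule the_equality)
  show "is_vertex_mult H R es \<tau> \<sigma> (vmult es)" by (rule vmult_is_vertex_mult)
  show "m = vmult es" if "is_vertex_mult H R es \<tau> \<sigma> m" for m
    by (rule vertex_mult_unique[OF that vmult_is_vertex_mult])
qed

end

end

section \<open>The vertex action\<close>

context hopf_algebra
begin

lemma finite_basis [simp]: "finite (basis H)"
  by (rule finite_Basis)

lemma prod_sum_multi_idx: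
  fixes f :: "'x \<Rightarrow> 'k \<Rightarrow> 'f"
  assumes "finite X"
  shows "(\<Sum>p\<in>multi_idx H X. \<Prod>x\<in>X. f x (p x)) = (\<Prod>x\<in>X. \<Sum>a\<in>basis H. f x a)"
  unfolding multi_idx_def using assms by (simp add: prod_sum_PiE)

lemma prod_sum_multi_idx2:
  fixes f :: "'x \<Rightarrow> 'k \<Rightarrow> 'k \<Rightarrow> 'f"
  assumes "finite X"
  shows "(\<Sum>p\<in>multi_idx H X. \<Sum>q\<in>multi_idx H X. \<Prod>x\<in>X. f x (p x) (q x))
    = (\<Prod>x\<in>X. \<Sum>a\<in>basis H. \<Sum>b\<in>basis H. f x a b)"
proof -
  have "(\<Sum>p\<in>multi_idx H X. \<Sum>q\<in>multi_idx H X. \<Prod>x\<in>X. f x (p x) (q x))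
    = (\<Sum>p\<in>multi_idx H X. \<Prod>x\<in>X. \<Sum>b\<in>basis H. f x (p x) b)"
    by (intro sum.cong refl prod_sum_multi_idx assms)
  also have "\<dots> = (\<Prod>x\<in>X. \<Sum>a\<in>basis H. \<Sum>b\<in>basis H. f x a b)"
    by (rule prod_sum_multi_idx[OF assms])
  finally show ?thesis .
qed

lemma dcomult_restrict:
  "a \<in> basis H \<Longrightarrow> b \<in> basis H \<Longrightarrow> dcomult H \<alpha> (restrict (legs [a, b]) {1,2}) = \<alpha> (a * b)"
  by (auto simp: dcomult_def multi_idx_def)

text \<open>Resolution of the identity in both tensor factors: how the coproduct of \<open>K\<^sup>*\<close> is evaluated.\<close>

lemma lin_contract2:
  assumes "lin \<alpha>"
  shows "(\<Sum>a\<in>basis H. \<Sum>b\<in>basis H. \<alpha> (a * b) * (dual_basis H a u * dual_basis H b v)) = \<alpha> (u * v)"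
proof -
  have "\<alpha> (u * v) = (\<Sum>a\<in>basis H. coord H u a * \<alpha> (a * v))"
    using lin_expand[of "\<lambda>u. \<alpha> (u * v)" u] assms by (simp add: lin_mult)
  also have "\<dots> = (\<Sum>a\<in>basis H. coord H u a * (\<Sum>b\<in>basis H. coord H v b * \<alpha> (a * b)))"
    using assms by (intro sum.cong refl arg_cong2[where f = "(*)"] lin_expand lin_mult(2))
  finally show ?thesis by (simp add: sum_distrib_left dual_basis_def mult_ac)
qed

lemma ev_sweedler_family:
  assumes "finite Y"
  shows "ev X (sweedler_family H Y F \<alpha>) w = (\<Sum>p\<in>multi_idx H Y. \<Sum>q\<in>multi_idx H Y.
    (\<Prod>y\<in>Y. \<alpha> y (p y * q y)) * ev X (F (\<lambda>y. legs [dual_basis H (p y), dual_basis H (q y)])) w)"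
  unfolding sweedler_family_def ev_sum ev_fscale
  by (intro sum.cong refl arg_cong2[where f = "(*)"] prod.cong) (simp_all add: dcomult_restrict multi_idx_in)

primrec iter_cop :: "'x list \<Rightarrow> ('x \<Rightarrow> 'k \<Rightarrow> 'f) \<Rightarrow> 'k \<Rightarrow> 'f" where
  "iter_cop [] \<theta> h = eps h"
| "iter_cop (x # xs) \<theta> h = cop h (\<lambda>a b. \<theta> x a * iter_cop xs \<theta> b)"

lemma lin_iter_cop: "lin (iter_cop xs \<theta>)"
proof (cases xs)
  case Nil
  have "iter_cop [] \<theta> = eps" by (rule ext) simp
  then show ?thesis using Nil lin_eps by simp
qed (simp add: lin_def alg_lin)

lemma foldr_dmult:
  assumes "\<And>x. x \<in> set xs \<Longrightarrow> lin (\<theta> x)"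
  shows "foldr (dmult H) (map \<theta> xs) eps = iter_cop xs \<theta>"
  using assms
proof (induction xs)
  case (Cons x xs)
  then show ?case by (intro ext) (simp add: dmult_eq lin_iter_cop)
qed (simp add: fun_eq_iff)

text \<open>Makes the iterated coproduct a finite sum of pure tensors, without naming the coefficients.\<close>

lemma iter_cop_expand:
  fixes xs :: "'x list"
  assumes "distinct xs"
  shows "\<exists>L. \<forall>\<theta>. iter_cop xs \<theta> h = (\<Sum>(\<kappa>, g)\<leftarrow>L. \<kappa> * (\<Prod>x\<in>set xs. \<theta> x (g x)))"
  using assms
proof (induction xs arbitrary: h)
  case Nil
  show ?case by (intro exI[of _ "[(eps h, \<lambda>_. 0)]"]) simp
next
  case (Cons x xs)
  then have d: "distinct xs" "x \<notin> set xs" by simp_all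
  have "\<exists>L. \<forall>\<theta>. (\<Sum>b\<in>S. comult H h b * (\<theta> x (b 1) * iter_cop xs \<theta> (b 2)))
      = (\<Sum>(\<kappa>, g)\<leftarrow>L. \<kappa> * (\<Prod>x\<in>set (x # xs). \<theta> x (g x)))" if "finite S" for S
    using that
  proof (induction S rule: finite_induct)
    case empty
    show ?case by (intro exI[of _ "[]"]) simp
  next
    case (insert b S)
    then obtain L where L: "\<And>\<theta>. (\<Sum>b\<in>S. comult H h b * (\<theta> x (b 1) * iter_cop xs \<theta> (b 2)))
      = (\<Sum>(\<kappa>, g)\<leftarrow>L. \<kappa> * (\<Prod>x\<in>set (x # xs). \<theta> x (g x)))" by blast
    obtain K where K: "\<And>\<theta>. iter_cop xs \<theta> (b 2) = (\<Sum>(\<kappa>, g)\<leftarrow>K. \<kappa> * (\<Prod>x\<in>set xs. \<theta> x (g x)))"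
      using Cons.IH[OF d(1), of "b 2"] by blast
    have 1: "c * (\<Sum>i\<leftarrow>M. f i) = (\<Sum>i\<leftarrow>M. c * f i)" for c :: 'f and M and f :: "'f \<times> ('x \<Rightarrow> 'k) \<Rightarrow> 'f"
      by (induction M) (simp_all add: distrib_left)
    have 2: "(\<Prod>y\<in>set xs. \<theta> y (if y = x then b 1 else g y)) = (\<Prod>y\<in>set xs. \<theta> y (g y))"
      for \<theta> :: "'x \<Rightarrow> 'k \<Rightarrow> 'f" and g
      using d by (intro prod.cong) auto
    have "comult H h b * (\<theta> x (b 1) * iter_cop xs \<theta> (b 2))
      = (\<Sum>(\<kappa>, g)\<leftarrow>map (\<lambda>(\<kappa>, g). (comult H h b * \<kappa>, g(x := b 1))) K. \<kappa> * (\<Prod>x\<in>set (x # xs). \<theta> x (g x)))" for \<theta>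
      using d by (simp add: K 1 comp_def case_prod_unfold 2 mult_ac)
    then show ?case using insert.hyps L
      by (intro exI[of _ "map (\<lambda>(\<kappa>, g). (comult H h b * \<kappa>, g(x := b 1))) K @ L"]) simp
  qed
  from this[of "multi_idx H {1,2}"] show ?case by (simp add: sw2_sum)
qed

end

context vertex
begin

lemma vact_iter_cop:
  "distinct xs \<Longrightarrow> vact xs (pf (set xs) \<alpha>) h w = iter_cop xs (\<lambda>x a. \<alpha> x (ac (out x) a (w x))) h"
proof (induction xs arbitrary: h)
  case (Cons x xs)
  then have "distinct xs" by simp
  from Cons.IH[OF this] show ?case by (simp only: vact_pf_Cons[OF Cons.prems] iter_cop.simps)
qed (simp add: pf_def)

context
  fixes es :: "'x list" and \<tau> :: "'x \<Rightarrow> nat"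
  assumes es: "distinct es"
    and tau: "\<And>x. \<tau> x = (if out x then 1 else 0)"
begin

lemma vertex_action_btens:
  assumes b: "b \<in> multi_idx H (set es)"
  shows "vertex_action H es \<tau> (btens b) h = vaction es (btens b) h"
proof (rule tpow_ext[of "set es"])
  let ?X = "set es"
  let ?d = "\<lambda>x. dual_basis H (b x)"
  let ?F = "\<lambda>a. fscale (foldr (dmult H) (map (\<lambda>x. (dantipode H ^^ \<tau> x) (a x (1 + \<tau> x))) es) eps h)
         (dten H ?X (\<lambda>x. a x (2 - \<tau> x)))"
  have eq: "vertex_action H es \<tau> (btens b) h = sweedler_family H ?X ?F ?d"
  proof -
    have "vertex_action H es \<tau> (btens b) h
      = (\<Sum>c\<in>multi_idx H ?X. if c = b then sweedler_family H ?X ?F (\<lambda>x. dual_basis H (c x)) else 0)"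
      unfolding vertex_action_def dlift_def
      by (intro sum.cong refl) (auto simp: btens_def fscale_def fun_eq_iff zero_fun_apply)
    then show ?thesis using b by simp
  qed
  show "vertex_action H es \<tau> (btens b) h \<in> tpow H ?X"
    unfolding eq sweedler_family_def by (intro tpow_sum tpow_fscale dten_tpow)
  show "vaction es (btens b) h \<in> tpow H ?X" by (rule vaction_tpow)
  obtain L where L: "\<And>\<theta>. iter_cop es \<theta> h = (\<Sum>(\<kappa>, g)\<leftarrow>L. \<kappa> * (\<Prod>x\<in>?X. \<theta> x (g x)))"
    using iter_cop_expand[OF es, of h] by blast
  fix w
  let ?l = "\<lambda>p q x i. legs [dual_basis H p, dual_basis H q] i"
  let ?A = "\<lambda>x p q u. if out x then dual_basis H q (anti u) else dual_basis H p u"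
  let ?B = "\<lambda>x p q. if out x then dual_basis H p (w x) else dual_basis H q (w x)"
  have F: "ev ?X (?F (\<lambda>y. legs [dual_basis H (p y), dual_basis H (q y)])) w
    = (\<Sum>(\<kappa>, g)\<leftarrow>L. \<kappa> * (\<Prod>x\<in>?X. ?A x (p x) (q x) (g x) * ?B x (p x) (q x)))" for p q
  proof -
    let ?a = "\<lambda>y. legs [dual_basis H (p y), dual_basis H (q y)]"
    have a1: "(dantipode H ^^ \<tau> x) (?a x (1 + \<tau> x)) = ?A x (p x) (q x)" for x
      by (auto simp: tau dantipode_def fun_eq_iff One_nat_def numeral_2_eq_2[symmetric])
    have l1: "lin (?A x (p x) (q x))" for x
      by (cases "out x") (simp_all add: lin_dual_basis lin_mult(3)[OF lin_dual_basis])
    have a2: "?a x (2 - \<tau> x) = (if out x then dual_basis H (p x) else dual_basis H (q x))" for x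
      by (simp add: tau)
    have "ev ?X (dten H ?X (\<lambda>x. ?a x (2 - \<tau> x))) w = (\<Prod>x\<in>?X. ?B x (p x) (q x))"
      unfolding a2 by (subst ev_dten) (auto simp: lin_dual_basis intro!: prod.cong)
    then show ?thesis
      unfolding ev_fscale a1 foldr_dmult[of es "\<lambda>x. ?A x (p x) (q x)", OF l1] L
      by (simp add: prod.distrib case_prod_unfold sum_list_mult_const[symmetric] mult.assoc)
  qed
  have C: "(\<Sum>p\<in>basis H. \<Sum>q\<in>basis H. ?d x (p * q) * (?A x p q u * ?B x p q)) = ?d x (ac (out x) u (w x))" for x u
    using lin_contract2[OF lin_dual_basis, of "b x"]
    by (cases "out x") (simp_all add: ac_def om_def mult.commute[of "dual_basis H _ (anti u)"])
  have swap: "(\<Sum>p\<in>P. \<Sum>q\<in>Q. f p q * (\<Sum>i\<leftarrow>M. g i p q)) = (\<Sum>i\<leftarrow>M. \<Sum>p\<in>P. \<Sum>q\<in>Q. f p q * g i p q)"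
    for f :: "('x \<Rightarrow> 'k) \<Rightarrow> ('x \<Rightarrow> 'k) \<Rightarrow> 'f" and g :: "'f \<times> ('x \<Rightarrow> 'k) \<Rightarrow> ('x \<Rightarrow> 'k) \<Rightarrow> ('x \<Rightarrow> 'k) \<Rightarrow> 'f" and M P Q
    by (induction M) (simp_all add: distrib_left sum.distrib)
  have "ev ?X (vertex_action H es \<tau> (btens b) h) w
    = (\<Sum>(\<kappa>, g)\<leftarrow>L. \<Sum>p\<in>multi_idx H ?X. \<Sum>q\<in>multi_idx H ?X. (\<Prod>x\<in>?X. ?d x (p x * q x)) *
        (\<kappa> * (\<Prod>x\<in>?X. ?A x (p x) (q x) (g x) * ?B x (p x) (q x))))"
    unfolding eq ev_sweedler_family[OF finite_set] F case_prod_unfold by (rule swap)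
  also have "\<dots> = (\<Sum>(\<kappa>, g)\<leftarrow>L. \<kappa> * (\<Sum>p\<in>multi_idx H ?X. \<Sum>q\<in>multi_idx H ?X.
        \<Prod>x\<in>?X. ?d x (p x * q x) * (?A x (p x) (q x) (g x) * ?B x (p x) (q x))))"
    by (simp only: prod.distrib sum_distrib_left mult_ac)
  also have "\<dots> = (\<Sum>(\<kappa>, g)\<leftarrow>L. \<kappa> * (\<Prod>x\<in>?X. ?d x (ac (out x) (g x) (w x))))"
  proof -
    have "(\<Sum>p\<in>multi_idx H ?X. \<Sum>q\<in>multi_idx H ?X.
        \<Prod>x\<in>?X. ?d x (p x * q x) * (?A x (p x) (q x) (g x) * ?B x (p x) (q x)))
      = (\<Prod>x\<in>?X. ?d x (ac (out x) (g x) (w x)))" for g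
      by (subst prod_sum_multi_idx2[OF finite_set,
          where f = "\<lambda>x p q. ?d x (p * q) * (?A x p q (g x) * ?B x p q)"]) (simp only: C)
    then show ?thesis by (simp only:)
  qed
  also have "\<dots> = vact es (pf ?X ?d) h w"
    unfolding vact_iter_cop[OF es] L ..
  also have "\<dots> = ev ?X (vaction es (btens b) h) w"
    by (simp only: ev_vaction[OF es] btens_dten[OF finite_set b] ev_dten_pf lin_dual_basis)
  finally show "ev ?X (vertex_action H es \<tau> (btens b) h) w = ev ?X (vaction es (btens b) h) w" .
qed simp

text \<open>The Sweedler sums over dual bases in the definition of the action become the iterated coproduct of the acting element.\<close>

lemma vertex_action_eq:
  assumes "T \<in> tpow H (set es)"
  shows "vertex_action H es \<tau> T h = vaction es T h"
proof (rule linear_on_ext[OF _ _ finite_set assms])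
  show "linear_on (tpow H (set es)) (\<lambda>T. vertex_action H es \<tau> T h)"
    unfolding linear_on_def vertex_action_def dlift_def
    by (auto simp: fun_eq_iff plus_fun_apply sum_fun_apply fscale_def distrib_right sum.distrib sum_distrib_left mult.assoc)
  show "linear_on (tpow H (set es)) (\<lambda>T. vaction es T h)"
    using vertex_kmodule_algebra[OF es] by (simp add: kmodule_algebra_def)
qed (rule vertex_action_btens)

end

end

section \<open>Tensor products over a family of index sets\<close>

lemma family_tensor_cong: "(\<And>v. v \<in> V \<Longrightarrow> S v = T v) \<Longrightarrow> family_tensor H V P S = family_tensor H V P T"
  by (rule ext) (auto simp: family_tensor_def intro!: prod.cong)

context hopf_algebra
begin

lemma tpow_eqI: "S \<in> tpow H X \<Longrightarrow> T \<in> tpow H X \<Longrightarrow> (\<And>b. b \<in> multi_idx H X \<Longrightarrow> S b = T b) \<Longrightarrow> S = T"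
  by (rule ext) (metis (mono_tags, lifting) mem_Collect_eq tpow_def)

lemma btens_kten: "finite X \<Longrightarrow> b \<in> multi_idx H X \<Longrightarrow> btens b = kten H X b"
  unfolding kten_def dten_def btens_def by (rule ext) (auto simp: prod_coord_basis)

lemma kten_tpow: "kten H X w \<in> tpow H X"
  by (simp add: kten_def dten_tpow)

lemma klift_btens:
  assumes "finite X" "b \<in> multi_idx H X"
  shows "klift H X (*) F (btens b) = (F b :: 'f)"
proof -
  have "klift H X (*) F (btens b) = (\<Sum>c\<in>multi_idx H X. if c = b then F c else 0)"
    unfolding klift_def btens_def by (intro sum.cong) auto
  then show ?thesis using assms by simp
qed

lemma kmult_kten:
  assumes X: "finite X"
  shows "kmult H X (kten H X g) (kten H X h) = kten H X (\<lambda>x. g x * h x)"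
proof
  fix b
  have m: "ml X (\<lambda>t. kten H X (\<lambda>x. s x * t x) b)" "ml X (\<lambda>t. kten H X (\<lambda>x. t x * s x) b)" for s
  proof -
    have l: "lin (\<lambda>a. coord H (s x * a) (b x))" "lin (\<lambda>a. coord H (a * s x) (b x))" for x
      using lin_mult[OF lin_coord] by simp_all
    show "ml X (\<lambda>t. kten H X (\<lambda>x. s x * t x) b)" "ml X (\<lambda>t. kten H X (\<lambda>x. t x * s x) b)"
      using prod_ml[OF X l(1)] prod_ml[OF X l(2)]
      by (cases "b \<in> multi_idx H X"; simp add: kten_def dten_def ml_def lin_def)+
  qed
  have "kmult H X (kten H X g) (kten H X h) b
      = klift H X (*) (\<lambda>s. klift H X (*) (\<lambda>t. kten H X (\<lambda>x. s x * t x) b) (kten H X h)) (kten H X g)"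
    by (simp add: kmult_def klift_def sum_fun_apply fscale_def)
  then show "kmult H X (kten H X g) (kten H X h) b = kten H X (\<lambda>x. g x * h x) b"
    by (simp add: klift_kten_field[OF m(1) X] klift_kten_field[OF m(2) X])
qed

lemma kmult_tpow: "kmult H X S T \<in> tpow H X"
  unfolding kmult_def klift_def by (intro tpow_sum tpow_fscale kten_tpow)

lemma kmult_bilinear: "bilinear_on (tpow H X) (tpow H X) (kmult H X)"
  unfolding bilinear_on_def linear_on_def kmult_def klift_def
  by (auto simp: fun_eq_iff plus_fun_apply sum_fun_apply fscale_def distrib_right distrib_left sum.distrib
      sum_distrib_left mult_ac)

lemma sum_multi_idx12:
  "(\<Sum>b\<in>multi_idx H {1,2::nat}. f b) = (\<Sum>a\<in>basis H. \<Sum>c\<in>basis H. f (restrict (legs [a, c]) {1,2}))"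
proof -
  have "(\<Sum>b\<in>multi_idx H {1,2::nat}. f b) = (\<Sum>(a, c)\<in>basis H \<times> basis H. f (restrict (legs [a, c]) {1,2}))"
    by (rule sum.reindex_bij_witness[where j = "\<lambda>b. (b 1, b 2)" and i = "\<lambda>(a, c). restrict (legs [a, c]) {1,2}"])
      (auto simp: multi_idx_def PiE_iff extensional_def fun_eq_iff intro!: arg_cong[where f = f])
  then show ?thesis by (simp add: sum.cartesian_product)
qed

context
  fixes V :: "'v set" and P :: "'v \<Rightarrow> 'x set"
  assumes V: "finite V" and P: "\<And>v. v \<in> V \<Longrightarrow> finite (P v)"
    and disj: "\<And>v w. v \<in> V \<Longrightarrow> w \<in> V \<Longrightarrow> v \<noteq> w \<Longrightarrow> P v \<inter> P w = {}"
begin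

abbreviation "fam_set \<equiv> \<Union>v\<in>V. P v"
abbreviation "fam \<equiv> family_tensor H V P"

lemma finite_fam_set: "finite fam_set"
  using V P by blast

lemma restrict_multi_idx: "c \<in> multi_idx H fam_set \<Longrightarrow> v \<in> V \<Longrightarrow> restrict c (P v) \<in> multi_idx H (P v)"
  unfolding multi_idx_def by auto

text \<open>Since the sets \<open>P v\<close> are disjoint, a family of basis elements on their union is the same as one family for each \<open>v\<close>.\<close>

lemma sum_family:
  fixes f :: "'v \<Rightarrow> ('x \<Rightarrow> 'k) \<Rightarrow> 'f"
  shows "(\<Sum>c\<in>multi_idx H fam_set. \<Prod>v\<in>V. f v (restrict c (P v))) = (\<Prod>v\<in>V. \<Sum>c\<in>multi_idx H (P v). f v c)"
proof -
  define own where "own x = (THE v. v \<in> V \<and> x \<in> P v)" for x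
  have own: "own x = v" if "v \<in> V" "x \<in> P v" for x v
    unfolding own_def using that disj by (intro the_equality) auto
  have "(\<Sum>c\<in>multi_idx H fam_set. \<Prod>v\<in>V. f v (restrict c (P v)))
      = (\<Sum>g\<in>PiE V (\<lambda>v. multi_idx H (P v)). \<Prod>v\<in>V. f v (g v))"
  proof (rule sum.reindex_bij_witness[where j = "\<lambda>c. \<lambda>v\<in>V. restrict c (P v)" and i = "\<lambda>g. \<lambda>x\<in>fam_set. g (own x) x"])
    fix c assume c: "c \<in> multi_idx H fam_set"
    show "(\<lambda>x\<in>fam_set. (\<lambda>v\<in>V. restrict c (P v)) (own x) x) = c"
    proof
      fix x show "(\<lambda>x\<in>fam_set. (\<lambda>v\<in>V. restrict c (P v)) (own x) x) x = c x"
        using c by (cases "x \<in> fam_set") (auto simp: own multi_idx_out)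
    qed
    show "(\<lambda>v\<in>V. restrict c (P v)) \<in> PiE V (\<lambda>v. multi_idx H (P v))"
      using restrict_multi_idx[OF c] by auto
    show "(\<Prod>v\<in>V. f v ((\<lambda>v\<in>V. restrict c (P v)) v)) = (\<Prod>v\<in>V. f v (restrict c (P v)))" by simp
  next
    fix g assume g: "g \<in> PiE V (\<lambda>v. multi_idx H (P v))"
    show "(\<lambda>v\<in>V. restrict (\<lambda>x\<in>fam_set. g (own x) x) (P v)) = g"
    proof
      fix v show "(\<lambda>v\<in>V. restrict (\<lambda>x\<in>fam_set. g (own x) x) (P v)) v = g v"
      proof (cases "v \<in> V")
        case True
        then have "g v \<in> multi_idx H (P v)" using g by auto
        then have "restrict (\<lambda>x\<in>fam_set. g (own x) x) (P v) x = g v x" for x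
          using True own by (cases "x \<in> P v") (auto simp: multi_idx_out)
        then show ?thesis using True by auto
      next
        case False
        then show ?thesis using g by auto
      qed
    qed
    show "(\<lambda>x\<in>fam_set. g (own x) x) \<in> multi_idx H fam_set"
      unfolding multi_idx_def
    proof (rule restrict_PiE_iff[THEN iffD2], intro ballI)
      fix x assume "x \<in> fam_set"
      then obtain v where v: "v \<in> V" "x \<in> P v" by auto
      then show "g (own x) x \<in> basis H" using PiE_mem[OF g v(1)] own[OF v] by (simp add: multi_idx_in)
    qed
  qed
  also have "\<dots> = (\<Prod>v\<in>V. \<Sum>c\<in>multi_idx H (P v). f v c)"
    using V P by (intro prod_sum_PiE[symmetric]) auto
  finally show ?thesis .
qed

lemma sum_family2:
  fixes f :: "'v \<Rightarrow> ('x \<Rightarrow> 'k) \<Rightarrow> ('x \<Rightarrow> 'k) \<Rightarrow> 'f"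
  shows "(\<Sum>c\<in>multi_idx H fam_set. \<Sum>d\<in>multi_idx H fam_set. \<Prod>v\<in>V. f v (restrict c (P v)) (restrict d (P v)))
    = (\<Prod>v\<in>V. \<Sum>c\<in>multi_idx H (P v). \<Sum>d\<in>multi_idx H (P v). f v c d)"
proof -
  have "(\<Sum>c\<in>multi_idx H fam_set. \<Sum>d\<in>multi_idx H fam_set. \<Prod>v\<in>V. f v (restrict c (P v)) (restrict d (P v)))
    = (\<Sum>c\<in>multi_idx H fam_set. \<Prod>v\<in>V. \<Sum>d\<in>multi_idx H (P v). f v (restrict c (P v)) d)"
    by (intro sum.cong refl, subst sum_family) simp
  also have "\<dots> = (\<Prod>v\<in>V. \<Sum>c\<in>multi_idx H (P v). \<Sum>d\<in>multi_idx H (P v). f v c d)"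
    by (rule sum_family)
  finally show ?thesis .
qed

lemma sum_family_action:
  fixes f :: "'v \<Rightarrow> ('x \<Rightarrow> 'k) \<Rightarrow> 'k \<Rightarrow> 'f"
  shows "(\<Sum>c\<in>multi_idx H fam_set. \<Sum>g\<in>multi_idx H V. \<Prod>v\<in>V. f v (restrict c (P v)) (g v))
    = (\<Prod>v\<in>V. \<Sum>c\<in>multi_idx H (P v). \<Sum>a\<in>basis H. f v c a)"
proof -
  have "(\<Sum>c\<in>multi_idx H fam_set. \<Sum>g\<in>multi_idx H V. \<Prod>v\<in>V. f v (restrict c (P v)) (g v))
    = (\<Sum>c\<in>multi_idx H fam_set. \<Prod>v\<in>V. \<Sum>a\<in>basis H. f v (restrict c (P v)) a)"
    by (intro sum.cong refl prod_sum_multi_idx V)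
  also have "\<dots> = (\<Prod>v\<in>V. \<Sum>c\<in>multi_idx H (P v). \<Sum>a\<in>basis H. f v c a)"
    by (rule sum_family)
  finally show ?thesis .
qed

lemma fam_tpow: "fam T \<in> tpow H fam_set"
  by (simp add: family_tensor_def tpow_def)

lemma fam_eval: "c \<in> multi_idx H fam_set \<Longrightarrow> fam T c = (\<Prod>v\<in>V. T v (restrict c (P v)))"
  by (simp add: family_tensor_def)

lemma fam_dten: "fam (\<lambda>v. dten H (P v) \<alpha>) = dten H fam_set \<alpha>"
proof (rule tpow_eqI[OF fam_tpow dten_tpow])
  fix b assume b: "b \<in> multi_idx H fam_set"
  have "fam (\<lambda>v. dten H (P v) \<alpha>) b = (\<Prod>v\<in>V. \<Prod>x\<in>P v. \<alpha> x (b x))"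
    unfolding fam_eval[OF b] dten_def by (intro prod.cong refl) (simp add: restrict_multi_idx[OF b])
  also have "\<dots> = (\<Prod>x\<in>fam_set. \<alpha> x (b x))"
    using V P disj by (intro prod.UNION_disjoint[symmetric]) auto
  finally show "fam (\<lambda>v. dten H (P v) \<alpha>) b = dten H fam_set \<alpha> b" using b by (simp add: dten_def)
qed

lemma fam_btens:
  assumes c: "c \<in> multi_idx H fam_set"
  shows "fam (\<lambda>v. btens (restrict c (P v))) = btens c"
proof -
  have "fam (\<lambda>v. btens (restrict c (P v))) = fam (\<lambda>v. dten H (P v) (\<lambda>x. dual_basis H (c x)))"
  proof (rule family_tensor_cong)
    fix v assume v: "v \<in> V"
    have "btens (restrict c (P v)) = dten H (P v) (\<lambda>x. dual_basis H (restrict c (P v) x))"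
      by (rule btens_dten[OF P[OF v] restrict_multi_idx[OF c v]])
    then show "btens (restrict c (P v)) = dten H (P v) (\<lambda>x. dual_basis H (c x))"
      by (simp cong: dten_cong)
  qed
  then show ?thesis by (simp add: fam_dten btens_dten[OF finite_fam_set c])
qed

lemma fam_dunit: "fam (\<lambda>v. dunit H (P v)) = dunit H fam_set"
  unfolding dunit_def by (rule fam_dten)

lemma fam_fscale: "fam (\<lambda>v. fscale (c v) (T v)) = fscale (\<Prod>v\<in>V. c v) (fam T)"
  by (rule ext) (simp add: family_tensor_def fscale_def prod.distrib)

lemma family_mult_tpow: "family_mult H V P m S T \<in> tpow H fam_set"
  unfolding family_mult_def by (intro tpow_sum tpow_fscale fam_tpow)

lemma family_action_tpow: "family_action H V P act S h \<in> tpow H fam_set"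
  unfolding family_action_def by (intro tpow_sum tpow_fscale fam_tpow)

lemma family_mult_bilinear: "bilinear_on A B (family_mult H V P m)"
  unfolding bilinear_on_def linear_on_def family_mult_def
  by (auto simp: fun_eq_iff plus_fun_apply sum_fun_apply fscale_def distrib_right distrib_left sum.distrib
      sum_distrib_left mult_ac)

lemma family_action_bilinear: "bilinear_on A B (family_action H V P act)"
  unfolding bilinear_on_def linear_on_def family_action_def
  by (auto simp: fun_eq_iff plus_fun_apply sum_fun_apply fscale_def distrib_right distrib_left sum.distrib
      sum_distrib_left mult_ac)

text \<open>The definition of the product by structure constants is componentwise on tensor products; this gives all algebra laws on basis elements.\<close>

lemma family_mult_fam:
  assumes m: "\<And>v. v \<in> V \<Longrightarrow> bilinear_on (tpow H (P v)) (tpow H (P v)) (m v)"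
    and t: "\<And>v. v \<in> V \<Longrightarrow> S v \<in> tpow H (P v)" "\<And>v. v \<in> V \<Longrightarrow> T v \<in> tpow H (P v)"
  shows "family_mult H V P m (fam S) (fam T) = fam (\<lambda>v. m v (S v) (T v))"
proof (rule tpow_eqI[OF family_mult_tpow fam_tpow])
  fix b assume b: "b \<in> multi_idx H fam_set"
  let ?b = "\<lambda>v. restrict b (P v)"
  have "family_mult H V P m (fam S) (fam T) b
    = (\<Sum>c\<in>multi_idx H fam_set. \<Sum>d\<in>multi_idx H fam_set. \<Prod>v\<in>V.
        S v (restrict c (P v)) * T v (restrict d (P v)) * m v (btens (restrict c (P v))) (btens (restrict d (P v))) (?b v))"
    unfolding family_mult_def sum_fun_apply fscale_def
    by (intro sum.cong refl) (simp add: fam_eval b prod.distrib)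
  also have "\<dots> = (\<Prod>v\<in>V. \<Sum>c\<in>multi_idx H (P v). \<Sum>d\<in>multi_idx H (P v). S v c * T v d * m v (btens c) (btens d) (?b v))"
    by (rule sum_family2[where f = "\<lambda>v c d. S v c * T v d * m v (btens c) (btens d) (?b v)"])
  also have "\<dots> = (\<Prod>v\<in>V. m v (S v) (T v) (?b v))"
  proof (rule prod.cong[OF refl])
    fix v assume v: "v \<in> V"
    have "m v (S v) (T v) = (\<Sum>c\<in>multi_idx H (P v). \<Sum>d\<in>multi_idx H (P v). fscale (S v c * T v d) (m v (btens c) (btens d)))"
      by (rule bilinear_on_expand[OF m[OF v] P[OF v] P[OF v] t(1)[OF v] t(2)[OF v]])
    then show "(\<Sum>c\<in>multi_idx H (P v). \<Sum>d\<in>multi_idx H (P v). S v c * T v d * m v (btens c) (btens d) (?b v))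
      = m v (S v) (T v) (?b v)"
      by (simp add: sum_fun_apply fscale_def)
  qed
  finally show "family_mult H V P m (fam S) (fam T) b = fam (\<lambda>v. m v (S v) (T v)) b"
    by (simp add: fam_eval b)
qed

lemma action_expand:
  assumes X: "finite X" and act: "kmodule_algebra X m act" and S: "S \<in> tpow H X"
  shows "act S h = (\<Sum>c\<in>multi_idx H X. \<Sum>a\<in>basis H. fscale (S c * coord H h a) (act (btens c) a))"
proof -
  have lin: "linear_on (tpow H X) (\<lambda>S. act S h)" using act by (simp add: kmodule_algebra_def)
  have "act T h = (\<Sum>a\<in>basis H. fscale (coord H h a) (act T a))" if T: "T \<in> tpow H X" for T
  proof
    fix b
    have "lin (\<lambda>h. act T h b)"
      using act T by (simp add: kmodule_algebra_def lin_def fscale_def plus_fun_apply)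
    then show "act T h b = (\<Sum>a\<in>basis H. fscale (coord H h a) (act T a)) b"
      unfolding sum_fun_apply fscale_def by (rule lin_expand)
  qed
  then have "act S h = (\<Sum>c\<in>multi_idx H X. fscale (S c) (\<Sum>a\<in>basis H. fscale (coord H h a) (act (btens c) a)))"
    by (subst linear_on_expand[OF lin X S]) (simp add: btens_tpow)
  then show ?thesis
    by (simp add: fun_eq_iff sum_fun_apply fscale_def sum_distrib_left mult.assoc)
qed

context
  fixes m :: "'v \<Rightarrow> ('x, 'k, 'f) tensor \<Rightarrow> ('x, 'k, 'f) tensor \<Rightarrow> ('x, 'k, 'f) tensor"
    and act :: "'v \<Rightarrow> ('x, 'k, 'f) tensor \<Rightarrow> 'k \<Rightarrow> ('x, 'k, 'f) tensor"
  assumes alg: "\<And>v. v \<in> V \<Longrightarrow> kmodule_algebra (P v) (m v) (act v)"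
begin

lemma fam_dual_algebra: "v \<in> V \<Longrightarrow> dual_algebra H (P v) (m v)"
  using alg by (simp add: kmodule_algebra_def)

lemma fam_mult:
  assumes "\<And>v. v \<in> V \<Longrightarrow> S v \<in> tpow H (P v)" "\<And>v. v \<in> V \<Longrightarrow> T v \<in> tpow H (P v)"
  shows "family_mult H V P m (fam S) (fam T) = fam (\<lambda>v. m v (S v) (T v))"
  by (rule family_mult_fam) (use fam_dual_algebra assms in \<open>auto simp: dual_algebra_def\<close>)

lemma fam_action:
  assumes t: "\<And>v. v \<in> V \<Longrightarrow> S v \<in> tpow H (P v)"
  shows "family_action H V P act (fam S) (kten H V h) = fam (\<lambda>v. act v (S v) (h v))"
proof (rule tpow_eqI[OF family_action_tpow fam_tpow])
  fix b assume b: "b \<in> multi_idx H fam_set"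
  let ?b = "\<lambda>v. restrict b (P v)"
  have "family_action H V P act (fam S) (kten H V h) b
    = (\<Sum>c\<in>multi_idx H fam_set. \<Sum>g\<in>multi_idx H V. \<Prod>v\<in>V.
        S v (restrict c (P v)) * coord H (h v) (g v) * act v (btens (restrict c (P v))) (g v) (?b v))"
    unfolding family_action_def sum_fun_apply fscale_def
    by (intro sum.cong refl) (simp add: fam_eval b prod.distrib kten_def dten_def)
  also have "\<dots> = (\<Prod>v\<in>V. \<Sum>c\<in>multi_idx H (P v). \<Sum>a\<in>basis H. S v c * coord H (h v) a * act v (btens c) a (?b v))"
    by (rule sum_family_action[where f = "\<lambda>v c a. S v c * coord H (h v) a * act v (btens c) a (?b v)"])
  also have "\<dots> = (\<Prod>v\<in>V. act v (S v) (h v) (?b v))"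
  proof (rule prod.cong[OF refl])
    fix v assume v: "v \<in> V"
    show "(\<Sum>c\<in>multi_idx H (P v). \<Sum>a\<in>basis H. S v c * coord H (h v) a * act v (btens c) a (?b v)) = act v (S v) (h v) (?b v)"
      by (subst action_expand[OF P[OF v] alg[OF v] t[OF v]]) (simp add: sum_fun_apply fscale_def)
  qed
  finally show "family_action H V P act (fam S) (kten H V h) b = fam (\<lambda>v. act v (S v) (h v)) b"
    by (simp add: fam_eval b)
qed

lemma family_dual_algebra: "dual_algebra H fam_set (family_mult H V P m)"
  unfolding dual_algebra_def
proof (intro conjI ballI family_mult_tpow family_mult_bilinear)
  let ?M = "family_mult H V P m"
  have lin: "linear_on A (?M S)" "linear_on A (\<lambda>S. ?M S T)" for A S T
    using family_mult_bilinear[of UNIV A m] family_mult_bilinear[of A UNIV m] by (auto simp: bilinear_on_def)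
  have cl: "m v S T \<in> tpow H (P v)" if "v \<in> V" "S \<in> tpow H (P v)" "T \<in> tpow H (P v)" for v S T
    using fam_dual_algebra that by (simp add: dual_algebra_def)
  have B: "btens (restrict c (P v)) \<in> tpow H (P v)" if "c \<in> multi_idx H fam_set" "v \<in> V" for c v
    using that by (intro btens_tpow restrict_multi_idx)
  have basic: "?M (?M (btens c) (btens d)) (btens e) = ?M (btens c) (?M (btens d) (btens e))"
    if c: "c \<in> multi_idx H fam_set" and d: "d \<in> multi_idx H fam_set" and e: "e \<in> multi_idx H fam_set" for c d e
  proof -
    have "?M (?M (btens c) (btens d)) (btens e)
      = fam (\<lambda>v. m v (m v (btens (restrict c (P v))) (btens (restrict d (P v)))) (btens (restrict e (P v))))"
      by (subst (1 2 3) fam_btens[symmetric]) (simp_all add: c d e fam_mult B cl)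
    also have "\<dots> = fam (\<lambda>v. m v (btens (restrict c (P v))) (m v (btens (restrict d (P v))) (btens (restrict e (P v)))))"
      by (rule family_tensor_cong) (use fam_dual_algebra B c d e in \<open>auto simp: dual_algebra_def\<close>)
    also have "\<dots> = ?M (btens c) (?M (btens d) (btens e))"
      by (subst (4 5 6) fam_btens[symmetric]) (simp_all add: c d e fam_mult B cl)
    finally show ?thesis .
  qed
  have comp: "linear_on A f \<Longrightarrow> linear_on UNIV g \<Longrightarrow> linear_on A (\<lambda>S. g (f S))"
    for A :: "('x, 'k, 'f) tensor set" and f g :: "('x, 'k, 'f) tensor \<Rightarrow> ('x, 'k, 'f) tensor"
    by (simp add: linear_on_def)
  fix S T U assume "S \<in> tpow H fam_set" "T \<in> tpow H fam_set" "U \<in> tpow H fam_set"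
  have 1: "?M (?M S (btens d)) (btens e) = ?M S (?M (btens d) (btens e))"
    if "d \<in> multi_idx H fam_set" "e \<in> multi_idx H fam_set" "S \<in> tpow H fam_set" for d e S
    by (rule linear_on_ext[OF comp[OF lin(2) lin(2)] lin(2) finite_fam_set that(3)]) (rule basic[OF _ that(1,2)])
  have 2: "?M (?M S T) (btens e) = ?M S (?M T (btens e))"
    if "e \<in> multi_idx H fam_set" "S \<in> tpow H fam_set" "T \<in> tpow H fam_set" for e S T
    by (rule linear_on_ext[OF comp[OF lin(1) lin(2)] comp[OF lin(2) lin(1)] finite_fam_set that(3)]) (rule 1[OF _ that(1,2)])
  show "?M (?M S T) U = ?M S (?M T U)"
    by (rule linear_on_ext[OF lin(1) comp[OF lin(1) lin(1)] finite_fam_set \<open>U \<in> _\<close>]) (rule 2[OF _ \<open>S \<in> _\<close> \<open>T \<in> _\<close>])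
next
  let ?M = "family_mult H V P m"
  have lin: "linear_on A (?M S)" "linear_on A (\<lambda>S. ?M S T)" for A S T
    using family_mult_bilinear[of UNIV A m] family_mult_bilinear[of A UNIV m] by (auto simp: bilinear_on_def)
  have id: "linear_on A (\<lambda>S. S)" for A :: "('x, 'k, 'f) tensor set" by (simp add: linear_on_def)
  have B: "btens (restrict c (P v)) \<in> tpow H (P v)" if "c \<in> multi_idx H fam_set" "v \<in> V" for c v
    using that by (intro btens_tpow restrict_multi_idx)
  have du: "dunit H (P v) \<in> tpow H (P v)" for v by (simp add: dunit_def dten_tpow)
  fix S assume S: "S \<in> tpow H fam_set"
  show "?M (dunit H fam_set) S = S"
  proof (rule linear_on_ext[OF lin(1) id finite_fam_set S])
    fix c assume c: "c \<in> multi_idx H fam_set"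
    have "?M (dunit H fam_set) (btens c) = fam (\<lambda>v. m v (dunit H (P v)) (btens (restrict c (P v))))"
      by (subst fam_dunit[symmetric], subst (1) fam_btens[symmetric, OF c], rule fam_mult) (simp_all add: B c du)
    also have "\<dots> = fam (\<lambda>v. btens (restrict c (P v)))"
      by (rule family_tensor_cong) (use fam_dual_algebra B c in \<open>auto simp: dual_algebra_def\<close>)
    finally show "?M (dunit H fam_set) (btens c) = btens c" by (simp add: fam_btens c)
  qed
  show "?M S (dunit H fam_set) = S"
  proof (rule linear_on_ext[OF lin(2) id finite_fam_set S])
    fix c assume c: "c \<in> multi_idx H fam_set"
    have "?M (btens c) (dunit H fam_set) = fam (\<lambda>v. m v (btens (restrict c (P v))) (dunit H (P v)))"
      by (subst fam_dunit[symmetric], subst (1) fam_btens[symmetric, OF c], rule fam_mult) (simp_all add: B c du)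
    also have "\<dots> = fam (\<lambda>v. btens (restrict c (P v)))"
      by (rule family_tensor_cong) (use fam_dual_algebra B c in \<open>auto simp: dual_algebra_def\<close>)
    finally show "?M (btens c) (dunit H fam_set) = btens c" by (simp add: fam_btens c)
  qed
qed

lemma kcomult_coeff_btens:
  "g \<in> multi_idx H V \<Longrightarrow> kcomult_coeff H V (btens g) p q = (\<Prod>v\<in>V. comult H (g v) (restrict (legs [p v, q v]) {1,2}))"
  by (simp add: kcomult_coeff_def klift_btens V)

lemma kcounit_btens: "g \<in> multi_idx H V \<Longrightarrow> kcounit H V (btens g) = (\<Prod>v\<in>V. eps (g v))"
  by (simp add: kcounit_def klift_btens V)

text \<open>All axioms are multilinear, so they are checked on basis elements, where both operations are componentwise.\<close>

lemma family_right_module_algebra: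
  "right_module_algebra H V fam_set (family_mult H V P m) (family_action H V P act)"
  unfolding right_module_algebra_def right_module_def
proof (intro conjI ballI family_dual_algebra family_action_tpow family_action_bilinear)
  let ?M = "family_mult H V P m" and ?L = "family_action H V P act"
  have lM: "linear_on A (?M S)" "linear_on A (\<lambda>S. ?M S T)" for A S T
    using family_mult_bilinear[of UNIV A m] family_mult_bilinear[of A UNIV m] by (auto simp: bilinear_on_def)
  have lL: "linear_on A (?L S)" "linear_on B (\<lambda>S. ?L S h)" for A B S h
    using family_action_bilinear[of UNIV A act] family_action_bilinear[of B UNIV act] by (auto simp: bilinear_on_def)
  have lK: "linear_on (tpow H V) (kmult H V g)" "linear_on (tpow H V) (\<lambda>g. kmult H V g h)"
    if "g \<in> tpow H V" "h \<in> tpow H V" for g h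
    using kmult_bilinear that by (auto simp: bilinear_on_def)
  have comp: "linear_on A f \<Longrightarrow> linear_on UNIV g \<Longrightarrow> linear_on A (\<lambda>S. g (f S))"
    for A :: "('a \<Rightarrow> 'f) set" and f :: "('a \<Rightarrow> 'f) \<Rightarrow> ('b \<Rightarrow> 'f)" and g :: "('b \<Rightarrow> 'f) \<Rightarrow> ('c \<Rightarrow> 'f)"
    by (simp add: linear_on_def)
  have B: "btens (restrict c (P v)) \<in> tpow H (P v)" if "c \<in> multi_idx H fam_set" "v \<in> V" for c v
    using that by (intro btens_tpow restrict_multi_idx)
  have ca: "act v S h \<in> tpow H (P v)" if "v \<in> V" "S \<in> tpow H (P v)" for v S h
    using alg that by (simp add: kmodule_algebra_def)
  have cm: "m v S T \<in> tpow H (P v)" if "v \<in> V" "S \<in> tpow H (P v)" "T \<in> tpow H (P v)" for v S T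
    using fam_dual_algebra that by (simp add: dual_algebra_def)
  have Lb: "?L (fam S) (btens g) = fam (\<lambda>v. act v (S v) (g v))"
    if "g \<in> multi_idx H V" "\<And>v. v \<in> V \<Longrightarrow> S v \<in> tpow H (P v)" for g S
    unfolding btens_kten[OF V that(1)] by (rule fam_action) (rule that(2))
  {
    fix S g h assume S: "S \<in> tpow H fam_set" and g: "g \<in> tpow H V" and h: "h \<in> tpow H V"
    have basic: "?L (btens c) (kmult H V (btens a) (btens b)) = ?L (?L (btens c) (btens a)) (btens b)"
      if c: "c \<in> multi_idx H fam_set" and a: "a \<in> multi_idx H V" and b: "b \<in> multi_idx H V" for a b c
    proof -
      let ?S = "\<lambda>v. btens (restrict c (P v)) :: ('x, 'k, 'f) tensor"
      have "?L (fam ?S) (kmult H V (btens a) (btens b)) = fam (\<lambda>v. act v (?S v) (a v * b v))"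
        by (simp only: btens_kten[OF V a] btens_kten[OF V b] kmult_kten[OF V]) (rule fam_action, rule B[OF c])
      also have "\<dots> = fam (\<lambda>v. act v (act v (?S v) (a v)) (b v))"
        by (rule family_tensor_cong) (use alg B[OF c] in \<open>auto simp: kmodule_algebra_def\<close>)
      also have "\<dots> = ?L (?L (fam ?S) (btens a)) (btens b)"
        by (subst Lb[OF a B[OF c]], simp, subst Lb[OF b ca[OF _ B[OF c]]], simp_all)
      finally show ?thesis unfolding fam_btens[OF c] .
    qed
    have 1: "?L S (kmult H V (btens a) (btens b)) = ?L (?L S (btens a)) (btens b)"
      if a: "a \<in> multi_idx H V" and b: "b \<in> multi_idx H V" for a b
      by (rule linear_on_ext[OF lL(2) comp[OF lL(2) lL(2)] finite_fam_set S]) (rule basic[OF _ a b])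
    have 2: "?L S (kmult H V g (btens b)) = ?L (?L S g) (btens b)" if b: "b \<in> multi_idx H V" for b
      by (rule linear_on_ext[OF comp[OF lK(2)[OF g btens_tpow[OF b]] lL(1)] comp[OF lL(1) lL(2)] V g]) (rule 1[OF _ b])
    show "?L S (kmult H V g h) = ?L (?L S g) h"
      by (rule linear_on_ext[OF comp[OF lK(1)[OF g h] lL(1)] lL(1) V h]) (rule 2)
  }
  {
    fix S assume S: "S \<in> tpow H fam_set"
    have id: "linear_on A (\<lambda>S. S)" for A :: "('x, 'k, 'f) tensor set" by (simp add: linear_on_def)
    show "?L S (kunit H V) = S"
    proof (rule linear_on_ext[OF lL(2) id finite_fam_set S])
      fix c assume c: "c \<in> multi_idx H fam_set"
      have "?L (fam (\<lambda>v. btens (restrict c (P v)))) (kunit H V) = fam (\<lambda>v. act v (btens (restrict c (P v))) 1)"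
        unfolding kunit_def by (rule fam_action, rule B[OF c])
      also have "\<dots> = fam (\<lambda>v. btens (restrict c (P v)))"
        by (rule family_tensor_cong) (use alg B[OF c] in \<open>auto simp: kmodule_algebra_def\<close>)
      finally show "?L (btens c) (kunit H V) = btens c" unfolding fam_btens[OF c] .
    qed
  }
  {
    fix S T h assume S: "S \<in> tpow H fam_set" and T: "T \<in> tpow H fam_set" and h: "h \<in> tpow H V"
    let ?R = "\<lambda>S T h. \<Sum>p\<in>multi_idx H V. \<Sum>q\<in>multi_idx H V.
          fscale (kcomult_coeff H V h p q) (?M (?L S (btens p)) (?L T (btens q)))"
    have kc: "kcomult_coeff H V (g + h) p q = kcomult_coeff H V g p q + kcomult_coeff H V h p q"
      "kcomult_coeff H V (fscale c h) p q = c * kcomult_coeff H V h p q" for g h c p q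
      by (simp_all add: kcomult_coeff_def klift_field_add klift_field_fscale)
    have Madd: "?M (S + S') T = ?M S T + ?M S' T" "?M (fscale c S) T = fscale c (?M S T)"
      "?M T (S + S') = ?M T S + ?M T S'" "?M T (fscale c S) = fscale c (?M T S)" for S S' T c
      using lM(2)[of UNIV T] lM(1)[of UNIV T] by (simp_all add: linear_on_def)
    have Ladd: "?L (S + S') h = ?L S h + ?L S' h" "?L (fscale c S) h = fscale c (?L S h)" for S S' h c
      using lL(2)[of UNIV h] by (simp_all add: linear_on_def)
    have lR1: "linear_on A (\<lambda>S. ?R S T h)" for A T h
      unfolding linear_on_def by (intro conjI ballI allI ext, simp_all only: Madd Ladd kc, simp_all add: plus_fun_apply
          sum_fun_apply fscale_def distrib_left distrib_right sum.distrib sum_distrib_left mult_ac)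
    have lR2: "linear_on A (\<lambda>T. ?R S T h)" for A S h
      unfolding linear_on_def by (intro conjI ballI allI ext, simp_all only: Madd Ladd kc, simp_all add: plus_fun_apply
          sum_fun_apply fscale_def distrib_left distrib_right sum.distrib sum_distrib_left mult_ac)
    have lR3: "linear_on C (\<lambda>h. ?R S T h)" for C S T
      unfolding linear_on_def by (intro conjI ballI allI ext, simp_all only: Madd Ladd kc, simp_all add: plus_fun_apply
          sum_fun_apply fscale_def distrib_left distrib_right sum.distrib sum_distrib_left mult_ac)
    note lR = lR1 lR2 lR3
    have basic: "?L (?M (btens c) (btens d)) (btens g) = ?R (btens c) (btens d) (btens g)"
      if c: "c \<in> multi_idx H fam_set" and d: "d \<in> multi_idx H fam_set" and g: "g \<in> multi_idx H V" for c d g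
    proof (rule tpow_eqI)
      let ?S = "\<lambda>v. btens (restrict c (P v)) :: ('x, 'k, 'f) tensor"
      let ?T = "\<lambda>v. btens (restrict d (P v)) :: ('x, 'k, 'f) tensor"
      show "?L (?M (btens c) (btens d)) (btens g) \<in> tpow H fam_set" by (rule family_action_tpow)
      show "?R (btens c) (btens d) (btens g) \<in> tpow H fam_set" by (intro tpow_sum tpow_fscale family_mult_tpow)
      fix b assume b: "b \<in> multi_idx H fam_set"
      let ?b = "\<lambda>v. restrict b (P v)"
      let ?f = "\<lambda>v p q. comult H (g v) (restrict (legs [p, q]) {1,2}) * m v (act v (?S v) p) (act v (?T v) q) (?b v)"
      have "?L (?M (fam ?S) (fam ?T)) (btens g) = fam (\<lambda>v. act v (m v (?S v) (?T v)) (g v))"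
      proof -
        have "?M (fam ?S) (fam ?T) = fam (\<lambda>v. m v (?S v) (?T v))"
          by (rule fam_mult) (use B c d in auto)
        then show ?thesis using Lb[OF g, of "\<lambda>v. m v (?S v) (?T v)"] cm B c d by simp
      qed
      then have "?L (?M (btens c) (btens d)) (btens g) b = (\<Prod>v\<in>V. act v (m v (?S v) (?T v)) (g v) (?b v))"
        unfolding fam_btens[OF c] fam_btens[OF d] by (simp add: fam_eval[OF b])
      also have "\<dots> = (\<Prod>v\<in>V. \<Sum>p\<in>basis H. \<Sum>q\<in>basis H. ?f v p q)"
      proof (rule prod.cong[OF refl])
        fix v assume v: "v \<in> V"
        have "act v (m v (?S v) (?T v)) (g v) = (\<Sum>b\<in>multi_idx H {1,2}. fscale (comult H (g v) b) (m v (act v (?S v) (b 1)) (act v (?T v) (b 2))))"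
          using alg[OF v] B[OF c v] B[OF d v] by (simp add: kmodule_algebra_def)
        then show "act v (m v (?S v) (?T v)) (g v) (?b v) = (\<Sum>p\<in>basis H. \<Sum>q\<in>basis H. ?f v p q)"
          by (simp add: sum_fun_apply fscale_def sum_multi_idx12)
      qed
      also have "\<dots> = (\<Sum>p\<in>multi_idx H V. \<Sum>q\<in>multi_idx H V. \<Prod>v\<in>V. ?f v (p v) (q v))"
        by (rule prod_sum_multi_idx2[OF V, symmetric])
      also have "\<dots> = ?R (fam ?S) (fam ?T) (btens g) b"
        unfolding sum_fun_apply fscale_def
      proof (intro sum.cong refl)
        fix p q assume p: "p \<in> multi_idx H V" and q: "q \<in> multi_idx H V"
        have "?M (?L (fam ?S) (btens p)) (?L (fam ?T) (btens q)) = fam (\<lambda>v. m v (act v (?S v) (p v)) (act v (?T v) (q v)))"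
        proof -
          have "?L (fam ?S) (btens p) = fam (\<lambda>v. act v (?S v) (p v))" by (rule Lb[OF p]) (rule B[OF c])
          moreover have "?L (fam ?T) (btens q) = fam (\<lambda>v. act v (?T v) (q v))" by (rule Lb[OF q]) (rule B[OF d])
          moreover have "?M (fam (\<lambda>v. act v (?S v) (p v))) (fam (\<lambda>v. act v (?T v) (q v)))
              = fam (\<lambda>v. m v (act v (?S v) (p v)) (act v (?T v) (q v)))"
            by (rule fam_mult) (simp_all add: ca B c d)
          ultimately show ?thesis by (simp only:)
        qed
        then show "(\<Prod>v\<in>V. ?f v (p v) (q v)) = kcomult_coeff H V (btens g) p q * ?M (?L (fam ?S) (btens p)) (?L (fam ?T) (btens q)) b"
          by (simp add: fam_eval[OF b] kcomult_coeff_btens[OF g] prod.distrib)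
      qed
      finally show "?L (?M (btens c) (btens d)) (btens g) b = ?R (btens c) (btens d) (btens g) b"
        unfolding fam_btens[OF c] fam_btens[OF d] .
    qed
    have 1: "?L (?M S (btens d)) (btens g) = ?R S (btens d) (btens g)"
      if d: "d \<in> multi_idx H fam_set" and g: "g \<in> multi_idx H V" for d g
      by (rule linear_on_ext[OF comp[OF lM(2) lL(2)] lR(1) finite_fam_set S]) (rule basic[OF _ d g])
    have 2: "?L (?M S T) (btens g) = ?R S T (btens g)" if g: "g \<in> multi_idx H V" for g
      by (rule linear_on_ext[OF comp[OF lM(1) lL(2)] lR(2) finite_fam_set T]) (rule 1[OF _ g])
    show "?L (?M S T) h = ?R S T h"
      by (rule linear_on_ext[OF lL(1) lR(3) V h]) (rule 2)
  }
  fix h assume h: "h \<in> tpow H V"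
  have du: "dunit H (P v) \<in> tpow H (P v)" for v by (simp add: dunit_def dten_tpow)
  show "?L (dunit H fam_set) h = fscale (kcounit H V h) (dunit H fam_set)"
  proof (rule linear_on_ext[OF lL(1) _ V h])
    show "linear_on (tpow H V) (\<lambda>h. fscale (kcounit H V h) (dunit H fam_set))"
      unfolding linear_on_def kcounit_def
      by (intro conjI ballI allI ext, simp_all only: klift_field_add klift_field_fscale,
          simp_all add: fscale_def plus_fun_apply distrib_right mult.assoc)
    fix g assume g: "g \<in> multi_idx H V"
    have "?L (fam (\<lambda>v. dunit H (P v))) (btens g) = fam (\<lambda>v. act v (dunit H (P v)) (g v))"
      by (rule Lb[OF g du])
    also have "\<dots> = fam (\<lambda>v. fscale (eps (g v)) (dunit H (P v)))"
      by (rule family_tensor_cong) (use alg in \<open>auto simp: kmodule_algebra_def\<close>)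
    finally show "?L (dunit H fam_set) (btens g) = fscale (kcounit H V (btens g)) (dunit H fam_set)"
      by (simp add: fam_fscale fam_dunit kcounit_btens g)
  qed
qed

end

end

end

section \<open>Transposed and pulled back module algebras\<close>

context hopf_algebra
begin

lemma pairing_kten: "pairing H X S (kten H X w) = ev X S w"
  unfolding pairing_def ev_def kten_def dten_def by (intro sum.cong) auto

lemma pairing_btens:
  assumes "finite X" "b \<in> multi_idx H X"
  shows "pairing H X S (btens b) = S b"
  using assms by (simp add: btens_kten pairing_kten ev_basis)

lemma pairing_sum_left: "pairing H X (\<Sum>i\<in>I. fscale (c i) (f i)) T = (\<Sum>i\<in>I. c i * pairing H X (f i) T)"
  unfolding pairing_def sum_fun_apply fscale_def sum_distrib_right sum_distrib_left
  by (subst sum.swap) (simp add: mult.assoc)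

text \<open>The left module structure on the tensor power of \<open>K\<close> whose dual is the given right module structure.\<close>

definition transpose_action :: "'x set \<Rightarrow> (('x, 'k, 'f) tensor \<Rightarrow> ('v, 'k, 'f) tensor \<Rightarrow> ('x, 'k, 'f) tensor)
    \<Rightarrow> ('v, 'k, 'f) tensor \<Rightarrow> ('x, 'k, 'f) tensor \<Rightarrow> ('x, 'k, 'f) tensor" where
  "transpose_action X act h k = (\<lambda>b. if b \<in> multi_idx H X then pairing H X (act (btens b) h) k else 0)"

context
  fixes X :: "'x set" and U :: "'v set"
    and act :: "('x, 'k, 'f) tensor \<Rightarrow> ('v, 'k, 'f) tensor \<Rightarrow> ('x, 'k, 'f) tensor"
  assumes X: "finite X" and U: "finite U" and act: "right_module H U X act"
begin

lemma transpose_tpow: "transpose_action X act h k \<in> tpow H X"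
  by (simp add: transpose_action_def tpow_def)

lemma pairing_transpose:
  assumes S: "S \<in> tpow H X" and h: "h \<in> tpow H U"
  shows "pairing H X S (transpose_action X act h k) = pairing H X (act S h) k"
proof -
  have "linear_on (tpow H X) (\<lambda>S. act S h)"
    using act h by (simp add: right_module_def bilinear_on_def)
  then have "act S h = (\<Sum>b\<in>multi_idx H X. fscale (S b) (act (btens b) h))"
    by (rule linear_on_expand[OF _ X S])
  then have "pairing H X (act S h) k = (\<Sum>b\<in>multi_idx H X. S b * pairing H X (act (btens b) h) k)"
    by (simp only: pairing_sum_left)
  also have "\<dots> = pairing H X S (transpose_action X act h k)"
    unfolding pairing_def[of H X S] transpose_action_def by (intro sum.cong) auto
  finally show ?thesis ..
qed

lemma dual_transpose:
  assumes S: "S \<in> tpow H X" and h: "h \<in> tpow H U"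
  shows "dual_action H X (transpose_action X act) S h = act S h"
proof (rule tpow_eqI)
  show "act S h \<in> tpow H X" using act S h by (simp add: right_module_def)
  show "dual_action H X (transpose_action X act) S h \<in> tpow H X" by (simp add: dual_action_def tpow_def)
  fix b assume b: "b \<in> multi_idx H X"
  then show "dual_action H X (transpose_action X act) S h b = act S h b"
    by (simp add: dual_action_def pairing_transpose[OF S h] pairing_btens[OF X])
qed

lemma transpose_left_module: "left_module H U X (transpose_action X act)"
  unfolding left_module_def
proof (intro conjI ballI transpose_tpow)
  have pl: "pairing H X (S + T) k = pairing H X S k + pairing H X T k"
    "pairing H X (fscale c S) k = c * pairing H X S k"
    "pairing H X S (k + l) = pairing H X S k + pairing H X S l"
    "pairing H X S (fscale c k) = c * pairing H X S k" for S T k l c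
    by (simp_all add: pairing_def plus_fun_apply fscale_def distrib_left distrib_right sum.distrib sum_distrib_left mult_ac)
  have l: "linear_on (tpow H U) (act (btens b))" if "b \<in> multi_idx H X" for b
    using act btens_tpow[OF that] by (simp add: right_module_def bilinear_on_def)
  show "bilinear_on (tpow H U) (tpow H X) (transpose_action X act)"
    unfolding bilinear_on_def
  proof (intro conjI ballI)
    show "linear_on (tpow H X) (transpose_action X act h)" for h
      unfolding linear_on_def
      by (intro conjI ballI allI ext) (simp_all add: transpose_action_def pl plus_fun_apply, simp_all add: fscale_def)
    show "linear_on (tpow H U) (\<lambda>h. transpose_action X act h k)" for k
      unfolding linear_on_def
    proof (intro conjI ballI allI ext)
      fix g h b assume gh: "g \<in> tpow H U" "h \<in> tpow H U"
      show "transpose_action X act (g + h) k b = (transpose_action X act g k + transpose_action X act h k) b"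
        using l[of b] gh by (simp add: transpose_action_def plus_fun_apply linear_on_def pl)
    next
      fix c h b assume h: "h \<in> tpow H U"
      show "transpose_action X act (fscale c h) k b = fscale c (transpose_action X act h k) b"
      proof (cases "b \<in> multi_idx H X")
        case True
        then have "act (btens b) (fscale c h) = fscale c (act (btens b) h)"
          using l[OF True] h by (simp add: linear_on_def)
        then show ?thesis using True
          unfolding fscale_def[of c "transpose_action X act h k"] by (simp add: transpose_action_def pl)
      qed (simp add: transpose_action_def fscale_def)
    qed
  qed
  fix g h k assume g: "g \<in> tpow H U" and h: "h \<in> tpow H U"
  show "transpose_action X act (kmult H U g h) k = transpose_action X act g (transpose_action X act h k)"
  proof
    fix b
    show "transpose_action X act (kmult H U g h) k b = transpose_action X act g (transpose_action X act h k) b"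
    proof (cases "b \<in> multi_idx H X")
      case True
      then have "act (btens b) (kmult H U g h) = act (act (btens b) g) h" "act (btens b) g \<in> tpow H X"
        using act g h btens_tpow[OF True] by (simp_all add: right_module_def)
      then show ?thesis using True
        by (simp add: transpose_action_def[of X act g] transpose_action_def[of X act "kmult H U g h"] pairing_transpose[OF _ h])
    qed (simp add: transpose_action_def)
  qed
next
  fix k assume k: "k \<in> tpow H X"
  show "transpose_action X act (kunit H U) k = k"
  proof (rule tpow_eqI[OF transpose_tpow k])
    fix b assume b: "b \<in> multi_idx H X"
    then have "act (btens b) (kunit H U) = btens b" using act btens_tpow[OF b] by (simp add: right_module_def)
    then have "transpose_action X act (kunit H U) k b = pairing H X (btens b) k"
      using b by (simp add: transpose_action_def)
    also have "\<dots> = pairing H X k (btens b)" by (simp add: pairing_def mult.commute)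
    finally show "transpose_action X act (kunit H U) k b = k b" by (simp add: pairing_btens[OF X b])
  qed
qed

end

lemma linear_on_cong: "(\<And>S. S \<in> A \<Longrightarrow> f S = g S) \<Longrightarrow> (\<And>S T. S \<in> A \<Longrightarrow> T \<in> A \<Longrightarrow> S + T \<in> A) \<Longrightarrow>
    (\<And>c S. S \<in> A \<Longrightarrow> fscale c S \<in> A) \<Longrightarrow> linear_on A f \<longleftrightarrow> linear_on A g"
  unfolding linear_on_def by auto

lemma dual_algebra_cong:
  assumes "\<And>S T. S \<in> tpow H X \<Longrightarrow> T \<in> tpow H X \<Longrightarrow> m S T = m' S T" "dual_algebra H X m"
  shows "dual_algebra H X m'"
proof -
  have "linear_on (tpow H X) (m' S) = linear_on (tpow H X) (m S)"
    "linear_on (tpow H X) (\<lambda>T. m' T S) = linear_on (tpow H X) (\<lambda>T. m T S)" if "S \<in> tpow H X" for S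
    by (rule linear_on_cong; simp add: assms(1) that tpow_add tpow_fscale)+
  note lin = this
  have du: "dunit H X \<in> tpow H X" by (simp add: dunit_def dten_tpow)
  have cl: "m S T \<in> tpow H X" if "S \<in> tpow H X" "T \<in> tpow H X" for S T
    using assms(2) that by (simp add: dual_algebra_def)
  show ?thesis
    unfolding dual_algebra_def bilinear_on_def
  proof (intro conjI ballI)
    fix S T U assume t: "S \<in> tpow H X" "T \<in> tpow H X" "U \<in> tpow H X"
    have "m (m S T) U = m S (m T U)" using assms(2) t by (simp add: dual_algebra_def)
    then show "m' (m' S T) U = m' S (m' T U)"
      by (simp add: assms(1)[symmetric] t cl)
  qed (use assms(2) du in \<open>simp_all add: lin assms(1)[symmetric] cl, simp_all add: dual_algebra_def bilinear_on_def\<close>)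
qed

lemma right_module_cong:
  assumes "\<And>S h. S \<in> tpow H X \<Longrightarrow> h \<in> tpow H U \<Longrightarrow> act S h = act' S h" "right_module H U X act"
  shows "right_module H U X act'"
proof -
  have "linear_on (tpow H U) (act' S) = linear_on (tpow H U) (act S)" if "S \<in> tpow H X" for S
    by (rule linear_on_cong; simp add: assms(1) that tpow_add tpow_fscale)
  moreover have "linear_on (tpow H X) (\<lambda>T. act' T h) = linear_on (tpow H X) (\<lambda>T. act T h)" if "h \<in> tpow H U" for h
    by (rule linear_on_cong; simp add: assms(1) that tpow_add tpow_fscale)
  moreover have "kunit H U \<in> tpow H U" by (simp add: kunit_def kten_tpow)
  ultimately show ?thesis
    using assms kmult_tpow unfolding right_module_def bilinear_on_def by (simp add: kmult_tpow)
qed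

lemma right_module_algebra_cong:
  assumes X: "finite U"
    and m: "\<And>S T. S \<in> tpow H X \<Longrightarrow> T \<in> tpow H X \<Longrightarrow> m S T = m' S T"
    and act: "\<And>S h. S \<in> tpow H X \<Longrightarrow> h \<in> tpow H U \<Longrightarrow> act S h = act' S h"
    and r: "right_module_algebra H U X m act"
  shows "right_module_algebra H U X m' act'"
proof -
  have d: "dual_algebra H X m" "right_module H U X act" using r by (simp_all add: right_module_algebra_def)
  have cl: "m S T \<in> tpow H X" "act S h \<in> tpow H X" if "S \<in> tpow H X" "T \<in> tpow H X" "h \<in> tpow H U" for S T h
    using d that by (simp_all add: dual_algebra_def right_module_def)
  have du: "dunit H X \<in> tpow H X" by (simp add: dunit_def dten_tpow)
  show ?thesis
    unfolding right_module_algebra_def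
  proof (intro conjI ballI)
    show "dual_algebra H X m'" by (rule dual_algebra_cong[OF m d(1)])
    show "right_module H U X act'" by (rule right_module_cong[OF act d(2)])
  next
    fix S T h assume t: "S \<in> tpow H X" "T \<in> tpow H X" "h \<in> tpow H U"
    have "act' (m' S T) h = act (m S T) h" using m[OF t(1,2)] act[OF cl(1)[OF t] t(3)] by simp
    also have "\<dots> = (\<Sum>p\<in>multi_idx H U. \<Sum>q\<in>multi_idx H U. fscale (kcomult_coeff H U h p q) (m (act S (btens p)) (act T (btens q))))"
      using r t by (simp add: right_module_algebra_def)
    also have "\<dots> = (\<Sum>p\<in>multi_idx H U. \<Sum>q\<in>multi_idx H U. fscale (kcomult_coeff H U h p q) (m' (act' S (btens p)) (act' T (btens q))))"
      using t by (intro sum.cong refl) (simp add: act[symmetric] m[symmetric] cl btens_tpow)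
    finally show "act' (m' S T) h = \<dots>" .
  next
    fix h assume h: "h \<in> tpow H U"
    show "act' (dunit H X) h = fscale (kcounit H U h) (dunit H X)"
      using r h act[OF du h] by (simp add: right_module_algebra_def)
  qed
qed

text \<open>All axioms are equations, so they may be checked after applying the injective map \<open>F\<close>.\<close>

lemma pullback_right_module_algebra:
  fixes F :: "('y, 'k, 'f) tensor \<Rightarrow> ('x, 'k, 'f) tensor"
  assumes F: "linear_on (tpow H Y) F" "\<And>S. S \<in> tpow H Y \<Longrightarrow> F S \<in> tpow H X" "inj_on F (tpow H Y)"
    and unit: "F (dunit H Y) = dunit H X"
    and m: "\<And>S T. S \<in> tpow H Y \<Longrightarrow> T \<in> tpow H Y \<Longrightarrow> m S T \<in> tpow H Y \<and> F (m S T) = M (F S) (F T)"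
    and act: "\<And>S h. S \<in> tpow H Y \<Longrightarrow> h \<in> tpow H U \<Longrightarrow> act S h \<in> tpow H Y \<and> F (act S h) = L (F S) h"
    and r: "right_module_algebra H U X M L"
  shows "right_module_algebra H U Y m act"
proof -
  note inj = inj_onD[OF F(3)]
  have M: "dual_algebra H X M" "right_module H U X L" using r by (simp_all add: right_module_algebra_def)
  have Fa: "F (S + T) = F S + F T" if "S \<in> tpow H Y" "T \<in> tpow H Y" for S T
    using F(1) that by (simp add: linear_on_def)
  have Fc: "F (fscale c S) = fscale c (F S)" if "S \<in> tpow H Y" for S c
    using F(1) that by (simp add: linear_on_def)
  note cl = tpow_add tpow_fscale m[THEN conjunct1] act[THEN conjunct1]
  have Ma: "M (S + S') T = M S T + M S' T" "M T (S + S') = M T S + M T S'"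
    if "S \<in> tpow H X" "S' \<in> tpow H X" "T \<in> tpow H X" for S S' T
    using M(1) that by (simp_all add: dual_algebra_def bilinear_on_def linear_on_def)
  have Mc: "M (fscale c S) T = fscale c (M S T)" "M T (fscale c S) = fscale c (M T S)"
    if "S \<in> tpow H X" "T \<in> tpow H X" for S T c
    using M(1) that by (simp_all add: dual_algebra_def bilinear_on_def linear_on_def)
  have La: "L (S + S') h = L S h + L S' h"
    if "S \<in> tpow H X" "S' \<in> tpow H X" "h \<in> tpow H U" for S S' h
    using M(2) that by (simp_all add: right_module_def bilinear_on_def linear_on_def)
  have Lh: "L S (h + h') = L S h + L S h'"
    if "S \<in> tpow H X" "h \<in> tpow H U" "h' \<in> tpow H U" for S h h'
    using M(2) that by (simp_all add: right_module_def bilinear_on_def linear_on_def)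
  have Lc: "L (fscale c S) h = fscale c (L S h)" "L S (fscale c h) = fscale c (L S h)"
    if "S \<in> tpow H X" "h \<in> tpow H U" for S h c
    using M(2) that by (simp_all add: right_module_def bilinear_on_def linear_on_def)
  have du: "dunit H Y \<in> tpow H Y" by (simp add: dunit_def dten_tpow)
  have ku: "kunit H U \<in> tpow H U" by (simp add: kunit_def kten_tpow)
  show ?thesis
    unfolding right_module_algebra_def
  proof (intro conjI ballI)
    show "dual_algebra H Y m"
      unfolding dual_algebra_def bilinear_on_def linear_on_def
    proof (intro conjI ballI allI)
      fix S T U assume t: "S \<in> tpow H Y" "T \<in> tpow H Y" "U \<in> tpow H Y"
      show "m (m S T) U = m S (m T U)"
        using t M(1) F(2) by (intro inj) (auto simp: m dual_algebra_def)
    next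
      fix S assume S: "S \<in> tpow H Y"
      show "m (dunit H Y) S = S" "m S (dunit H Y) = S"
        using S M(1) F(2) du by (auto intro!: inj simp: m unit dual_algebra_def)
    qed (auto intro!: inj cl simp: Fa Fc cl m Ma Mc F(2))
    show "right_module H U Y act"
      unfolding right_module_def bilinear_on_def linear_on_def
    proof (intro conjI ballI allI)
      fix S g h assume t: "S \<in> tpow H Y" "g \<in> tpow H U" "h \<in> tpow H U"
      show "act S (kmult H U g h) = act (act S g) h"
        using t M(2) F(2) by (intro inj) (simp_all add: act kmult_tpow right_module_def)
    next
      fix S assume S: "S \<in> tpow H Y"
      show "act S (kunit H U) = S"
        using S M(2) F(2) ku by (auto intro!: inj simp: act right_module_def)
    qed (auto intro!: inj cl simp: Fa Fc cl act La Lh Lc F(2))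
  next
    fix S T h assume t: "S \<in> tpow H Y" "T \<in> tpow H Y" "h \<in> tpow H U"
    let ?I = "multi_idx H U"
    show "act (m S T) h = (\<Sum>p\<in>?I. \<Sum>q\<in>?I. fscale (kcomult_coeff H U h p q) (m (act S (btens p)) (act T (btens q))))"
    proof (rule inj)
      have s: "fscale c (m (act S (btens p)) (act T (btens q))) \<in> tpow H Y" if "p \<in> ?I" "q \<in> ?I" for c p q
        using that t by (intro cl btens_tpow)
      have "F (\<Sum>p\<in>?I. \<Sum>q\<in>?I. fscale (kcomult_coeff H U h p q) (m (act S (btens p)) (act T (btens q))))
        = (\<Sum>p\<in>?I. \<Sum>q\<in>?I. F (fscale (kcomult_coeff H U h p q) (m (act S (btens p)) (act T (btens q)))))"
        using s by (subst linear_on_sum[OF F(1)], intro tpow_sum) (auto intro!: sum.cong linear_on_sum[OF F(1)])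
      also have "\<dots> = (\<Sum>p\<in>?I. \<Sum>q\<in>?I. fscale (kcomult_coeff H U h p q) (M (L (F S) (btens p)) (L (F T) (btens q))))"
        using t by (intro sum.cong refl) (simp add: Fc cl btens_tpow m act)
      also have "\<dots> = F (act (m S T) h)"
        using r t F(2) by (simp add: act m cl right_module_algebra_def)
      finally show "F (act (m S T) h) = F (\<Sum>p\<in>?I. \<Sum>q\<in>?I. fscale (kcomult_coeff H U h p q) (m (act S (btens p)) (act T (btens q))))" ..
      show "act (m S T) h \<in> tpow H Y" using t by (intro cl)
      show "(\<Sum>p\<in>?I. \<Sum>q\<in>?I. fscale (kcomult_coeff H U h p q) (m (act S (btens p)) (act T (btens q)))) \<in> tpow H Y"
        using s by (intro tpow_sum)
    qed
  next
    fix h assume h: "h \<in> tpow H U"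
    show "act (dunit H Y) h = fscale (kcounit H U h) (dunit H Y)"
      using r h du by (intro inj cl) (simp_all add: act Fc unit right_module_algebra_def)
  qed
qed

end

section \<open>The map G*\<close>

context hopf_algebra
begin

lemma ev_fam:
  fixes V :: "'v set" and P :: "'v \<Rightarrow> 'x set"
  assumes V: "finite V" and P: "\<And>v. v \<in> V \<Longrightarrow> finite (P v)"
    and disj: "\<And>v w. v \<in> V \<Longrightarrow> w \<in> V \<Longrightarrow> v \<noteq> w \<Longrightarrow> P v \<inter> P w = {}"
  shows "ev (\<Union>v\<in>V. P v) (family_tensor H V P T) w = (\<Prod>v\<in>V. ev (P v) (T v) w)"
proof -
  have "family_tensor H V P T b * (\<Prod>x\<in>(\<Union>v\<in>V. P v). coord H (w x) (b x))
      = (\<Prod>v\<in>V. T v (restrict b (P v)) * (\<Prod>x\<in>P v. coord H (w x) (restrict b (P v) x)))"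
    if "b \<in> multi_idx H (\<Union>v\<in>V. P v)" for b
  proof -
    have "(\<Prod>x\<in>(\<Union>v\<in>V. P v). coord H (w x) (b x)) = (\<Prod>v\<in>V. \<Prod>x\<in>P v. coord H (w x) (b x))"
      using V P disj by (intro prod.UNION_disjoint) auto
    also have "\<dots> = (\<Prod>v\<in>V. \<Prod>x\<in>P v. coord H (w x) (restrict b (P v) x))" by (intro prod.cong refl) simp
    finally have 1: "(\<Prod>x\<in>(\<Union>v\<in>V. P v). coord H (w x) (b x)) = \<dots>" .
    have "family_tensor H V P T b = (\<Prod>v\<in>V. T v (restrict b (P v)))"
      using that by (simp add: family_tensor_def)
    then show ?thesis unfolding prod.distrib 1 by (rule arg_cong)
  qed
  then have "ev (\<Union>v\<in>V. P v) (family_tensor H V P T) w = (\<Sum>b\<in>multi_idx H (\<Union>v\<in>V. P v).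
      \<Prod>v\<in>V. T v (restrict b (P v)) * (\<Prod>x\<in>P v. coord H (w x) (restrict b (P v) x)))"
    unfolding ev_def by (intro sum.cong refl)
  also have "\<dots> = (\<Prod>v\<in>V. ev (P v) (T v) w)"
    unfolding ev_def
    by (rule sum_family[where f = "\<lambda>v c. T v c * (\<Prod>x\<in>P v. coord H (w x) (c x))"]) (use V P disj in auto)
  finally show ?thesis .
qed

lemma sum_swap3:
  "(\<Sum>p\<in>A. \<Sum>q\<in>B. \<Sum>r\<in>C. f p q r) = (\<Sum>r\<in>C. \<Sum>p\<in>A. \<Sum>q\<in>B. f p q r)" for f :: "_ \<Rightarrow> _ \<Rightarrow> _ \<Rightarrow> 'f"
proof -
  have "(\<Sum>p\<in>A. \<Sum>q\<in>B. \<Sum>r\<in>C. f p q r) = (\<Sum>p\<in>A. \<Sum>r\<in>C. \<Sum>q\<in>B. f p q r)"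
    by (intro sum.cong refl sum.swap)
  also have "\<dots> = (\<Sum>r\<in>C. \<Sum>p\<in>A. \<Sum>q\<in>B. f p q r)" by (rule sum.swap)
  finally show ?thesis .
qed

text \<open>The contraction over dual bases takes place inside of two Sweedler sums.\<close>

lemma contract_sw2:
  assumes "lin \<beta>"
  shows "(\<Sum>a\<in>basis H. \<Sum>b\<in>basis H. \<beta> (a * b) * sw2 S (\<lambda>r s. sw2 T (\<lambda>r' s'.
      f r s r' s' * (dual_basis H a (p r s r' s') * dual_basis H b (q r s r' s')))))
    = sw2 S (\<lambda>r s. sw2 T (\<lambda>r' s'. f r s r' s' * \<beta> (p r s r' s' * q r s r' s')))"
proof -
  have "(\<Sum>a\<in>basis H. \<Sum>b\<in>basis H. \<beta> (a * b) * (c * (dual_basis H a u * dual_basis H b v))) = c * \<beta> (u * v)" for c u v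
  proof -
    have "(\<Sum>a\<in>basis H. \<Sum>b\<in>basis H. \<beta> (a * b) * (c * (dual_basis H a u * dual_basis H b v)))
        = c * (\<Sum>a\<in>basis H. \<Sum>b\<in>basis H. \<beta> (a * b) * (dual_basis H a u * dual_basis H b v))"
      by (simp only: sum_distrib_left mult.left_commute)
    then show ?thesis by (simp only: lin_contract2[OF assms])
  qed
  note 1 = this
  show ?thesis by (simp only: sw2_cmult[symmetric] sw2_setsum[symmetric] 1)
qed

lemma flip_mult:
  assumes "bil f"
  shows "sw2 (flip fl (u * v)) f = sw2 (flip fl u) (\<lambda>r s. sw2 (flip fl v) (\<lambda>r' s'. f (r * r') (s * s')))"
proof -
  have b: "bil (\<lambda>a b. f b a)" "bil (\<lambda>a b. if fl then f b a else f a b)"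
    "bil (\<lambda>r s. sw2 (flip fl v) (\<lambda>r' s'. f (r * r') (s * s')))" "\<And>r s. bil (\<lambda>r' s'. f (r * r') (s * s'))"
    by (simp_all add: bil_def lin_def alg_lin bil_eqs[OF assms])
  show ?thesis
    by (simp only: sw2_flip[OF assms] cop_mult[OF b(2)] sw2_flip[OF b(3)], simp only: sw2_flip[OF b(4)]) (cases fl; simp)
qed

text \<open>The step that makes the image of \<open>G\<^sup>*\<close> closed. The left side is the contribution of one edge to the product of two elements of the image, with the same flip \<open>fl\<close> at the target end \<open>u\<close> and at the starting end \<open>v\<close>. Multiplicativity of the coproduct, or of its opposite, makes it a function of \<open>u v\<close> only.\<close>

lemma edge_contract:
  assumes \<alpha>: "lin \<alpha>" and \<beta>: "lin \<beta>"
  shows "(\<Sum>a\<in>basis H. \<Sum>b\<in>basis H. \<alpha> (a * b) * (\<Sum>a'\<in>basis H. \<Sum>b'\<in>basis H. \<beta> (a' * b') *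
      (sw2 (flip fl u) (\<lambda>r s. dual_basis H a (g * r) * dual_basis H a' (k * s))
        * sw2 (flip fl v) (\<lambda>r s. dual_basis H b (r * g') * dual_basis H b' (s * k')))))
    = sw2 (flip fl (u * v)) (\<lambda>r s. \<alpha> (g * (r * g')) * \<beta> (k * (s * k')))"
proof -
  have 1: "sw2 S F * sw2 T F' = sw2 S (\<lambda>r s. sw2 T (\<lambda>r' s'. F r s * F' r' s'))" for S T F F'
    using sw2_prod[of S F T F' 1] by simp
  have 2: "(\<Sum>a'\<in>basis H. \<Sum>b'\<in>basis H. \<beta> (a' * b') *
      (sw2 (flip fl u) (\<lambda>r s. dual_basis H a (g * r) * dual_basis H a' (k * s))
        * sw2 (flip fl v) (\<lambda>r s. dual_basis H b (r * g') * dual_basis H b' (s * k'))))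
    = sw2 (flip fl u) (\<lambda>r s. sw2 (flip fl v) (\<lambda>r' s'.
        (dual_basis H a (g * r) * dual_basis H b (r' * g')) * \<beta> ((k * s) * (s' * k'))))" for a b
    by (subst contract_sw2[OF \<beta>, symmetric]) (simp only: 1 mult_ac)
  have "bil (\<lambda>r s. \<alpha> (g * (r * g')) * \<beta> (k * (s * k')))"
    by (simp add: bil_def lin_def alg_lin lin_eqs[OF \<alpha>] lin_eqs[OF \<beta>] mult_ac)
  then have "sw2 (flip fl (u * v)) (\<lambda>r s. \<alpha> (g * (r * g')) * \<beta> (k * (s * k')))
    = sw2 (flip fl u) (\<lambda>r s. sw2 (flip fl v) (\<lambda>r' s'. \<beta> ((k * s) * (s' * k')) * \<alpha> ((g * r) * (r' * g'))))"
    by (subst flip_mult, assumption) (simp only: mult.assoc mult.commute)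
  also have "\<dots> = (\<Sum>a\<in>basis H. \<Sum>b\<in>basis H. \<alpha> (a * b) * sw2 (flip fl u) (\<lambda>r s. sw2 (flip fl v) (\<lambda>r' s'.
        \<beta> ((k * s) * (s' * k')) * (dual_basis H a (g * r) * dual_basis H b (r' * g')))))"
    by (rule contract_sw2[OF \<alpha>, symmetric])
  finally show ?thesis unfolding 2 by (simp only: mult.commute)
qed

end

locale ribbon_graph = hopf_algebra H for H :: "('f::field_char_0, 'k::ring_1) hopf_data" +
  fixes G :: "('v, 'e) pre_digraph"
  assumes graph: "fin_digraph G"
begin

abbreviation "E \<equiv> arcs G"
abbreviation "V \<equiv> verts G"
abbreviation "U \<equiv> all_ends G"
abbreviation "P \<equiv> ends_at G"

lemma finite_E: "finite E" and finite_V: "finite V"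
  and tail_V: "e \<in> E \<Longrightarrow> tail G e \<in> V" and head_V: "e \<in> E \<Longrightarrow> head G e \<in> V"
  using graph by (simp_all add: fin_digraph_def fin_digraph_axioms_def wf_digraph_def)

lemma all_ends_eq: "U = Tgt ` E \<union> Src ` E"
  unfolding all_ends_def ends_at_def using tail_V head_V by auto

lemma finite_U: "finite U"
  by (simp add: all_ends_eq finite_E)

lemma U_union: "(\<Union>v\<in>V. P v) = U"
  by (simp add: all_ends_def)

lemma finite_P: "v \<in> V \<Longrightarrow> finite (P v)"
  using finite_U U_union by (metis UN_upper finite_subset)

lemma P_disjoint: "v \<noteq> w \<Longrightarrow> P v \<inter> P w = {}"
  unfolding ends_at_def by auto

lemma prod_U: "(\<Prod>x\<in>U. f x) = (\<Prod>e\<in>E. f (Tgt e) * f (Src e))" for f :: "'e edge_end \<Rightarrow> 'f"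
  unfolding all_ends_eq using finite_E
  by (subst prod.union_disjoint) (auto simp: prod.reindex inj_on_def prod.distrib)

definition ends_dual :: "('e \<Rightarrow> 'k) \<Rightarrow> ('e \<Rightarrow> 'k) \<Rightarrow> 'e edge_end \<Rightarrow> 'k \<Rightarrow> 'f" where
  "ends_dual p q x = (case x of Tgt e \<Rightarrow> dual_basis H (p e) | Src e \<Rightarrow> dual_basis H (q e))"

lemma ends_dual_simps [simp]:
  "ends_dual p q (Tgt e) = dual_basis H (p e)" "ends_dual p q (Src e) = dual_basis H (q e)"
  by (simp_all add: ends_dual_def)

lemma lin_ends_dual: "lin (ends_dual p q x)"
  by (cases x) (simp_all add: lin_dual_basis)

lemma ev_dten_ends: "ev U (dten H U (ends_dual p q)) w
    = (\<Prod>e\<in>E. dual_basis H (p e) (w (Tgt e)) * dual_basis H (q e) (w (Src e)))"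
  by (simp add: ev_dten finite_U lin_ends_dual prod_U)

text \<open>The product of the two ends of each edge, on which \<open>G\<^sup>*\<close> pulls back forms.\<close>

definition merge :: "('e edge_end \<Rightarrow> 'k) \<Rightarrow> 'e \<Rightarrow> 'k" where
  "merge w e = w (Tgt e) * w (Src e)"

lemma ends_contract:
  "(\<Sum>p\<in>multi_idx H E. \<Sum>q\<in>multi_idx H E. (\<Prod>e\<in>E. \<alpha> e (p e * q e))
      * (\<Prod>e\<in>E. t e (dual_basis H (p e)) (dual_basis H (q e))))
    = (\<Prod>e\<in>E. \<Sum>a\<in>basis H. \<Sum>b\<in>basis H. \<alpha> e (a * b) * (t e (dual_basis H a) (dual_basis H b) :: 'f))"
  unfolding prod.distrib[symmetric]
  by (rule prod_sum_multi_idx2[OF finite_E, where f = "\<lambda>e a b. \<alpha> e (a * b) * t e (dual_basis H a) (dual_basis H b)"])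

text \<open>\<open>G\<^sup>*\<close> is dual to the map that multiplies the two ends of each edge.\<close>

lemma ev_Gstar: "ev U (Gstar H G T) w = ev E T (merge w)"
proof -
  have "ev U (sweedler_family H E (\<lambda>a. dten H U (\<lambda>x. case x of Tgt e \<Rightarrow> a e 1 | Src e \<Rightarrow> a e 2))
        (\<lambda>e. dual_basis H (b e))) w = (\<Prod>e\<in>E. coord H (merge w e) (b e))" for b :: "'e \<Rightarrow> 'k"
  proof -
    have "(\<lambda>x. case x of Tgt e \<Rightarrow> legs [dual_basis H (p e), dual_basis H (q e)] 1
        | Src e \<Rightarrow> legs [dual_basis H (p e), dual_basis H (q e)] 2) = ends_dual p q" for p q :: "'e \<Rightarrow> 'k"
      by (rule ext) (simp add: ends_dual_def split: edge_end.split)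
    then have "ev U (sweedler_family H E (\<lambda>a. dten H U (\<lambda>x. case x of Tgt e \<Rightarrow> a e 1 | Src e \<Rightarrow> a e 2))
        (\<lambda>e. dual_basis H (b e))) w = (\<Prod>e\<in>E. \<Sum>p\<in>basis H. \<Sum>q\<in>basis H. dual_basis H (b e) (p * q) *
          (dual_basis H p (w (Tgt e)) * dual_basis H q (w (Src e))))"
      unfolding ev_sweedler_family[OF finite_E]
      by (simp only: ev_dten_ends
          ends_contract[where \<alpha> = "\<lambda>e. dual_basis H (b e)" and t = "\<lambda>e x y. x (w (Tgt e)) * y (w (Src e))"])
    then show ?thesis
      by (simp only: lin_contract2[OF lin_dual_basis]) (simp add: dual_basis_def merge_def)
  qed
  then show ?thesis
    unfolding Gstar_def dlift_def ev_sum ev_fscale by (simp add: ev_def)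
qed

lemma Gstar_tpow: "Gstar H G T \<in> tpow H U"
  unfolding Gstar_def dlift_def sweedler_family_def by (intro tpow_sum tpow_fscale dten_tpow)

lemma Gstar_linear: "linear_on (tpow H E) (Gstar H G)"
  unfolding linear_on_def
  by (intro conjI ballI allI; rule tpow_ext[OF finite_U])
    (simp_all only: Gstar_tpow tpow_add tpow_fscale ev_Gstar ev_add ev_fscale)

text \<open>The map \<open>merge\<close> has a section that puts the unit at all starting ends.\<close>

lemma Gstar_inj: "inj_on (Gstar H G) (tpow H E)"
proof (rule inj_onI)
  fix S T assume t: "S \<in> tpow H E" "T \<in> tpow H E" "Gstar H G S = Gstar H G T"
  show "S = T"
  proof (rule tpow_ext[OF finite_E t(1,2)])
    fix w
    have "merge (\<lambda>x. case x of Tgt e \<Rightarrow> w e | Src e \<Rightarrow> 1) = w" by (simp add: merge_def fun_eq_iff)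
    then show "ev E S w = ev E T w" using t(3) ev_Gstar by metis
  qed
qed

lemma Gstar_dunit: "Gstar H G (dunit H E) = dunit H U"
  by (rule tpow_ext[OF finite_U Gstar_tpow])
    (simp_all add: dunit_def dten_tpow ev_Gstar ev_dten finite_E finite_U lin_eps prod_U merge_def counit_mult)

lemma Gstar_dten:
  assumes "\<And>e. e \<in> E \<Longrightarrow> lin (\<alpha> e)"
  shows "Gstar H G (dten H E \<alpha>) = (\<Sum>p\<in>multi_idx H E. \<Sum>q\<in>multi_idx H E.
    fscale (\<Prod>e\<in>E. \<alpha> e (p e * q e)) (dten H U (ends_dual p q)))"
proof (rule tpow_ext[OF finite_U Gstar_tpow])
  fix w
  have "ev U (Gstar H G (dten H E \<alpha>)) w = (\<Prod>e\<in>E. \<alpha> e (w (Tgt e) * w (Src e)))"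
    by (simp add: ev_Gstar ev_dten finite_E assms merge_def)
  also have "\<dots> = (\<Prod>e\<in>E. \<Sum>a\<in>basis H. \<Sum>b\<in>basis H. \<alpha> e (a * b) *
          (dual_basis H a (w (Tgt e)) * dual_basis H b (w (Src e))))"
    by (intro prod.cong refl lin_contract2[symmetric] assms)
  also have "\<dots> = ev U (\<Sum>p\<in>multi_idx H E. \<Sum>q\<in>multi_idx H E.
    fscale (\<Prod>e\<in>E. \<alpha> e (p e * q e)) (dten H U (ends_dual p q))) w"
    unfolding ev_sum ev_fscale ev_dten_ends
    by (rule ends_contract[where \<alpha> = \<alpha> and t = "\<lambda>e x y. x (w (Tgt e)) * y (w (Src e))", symmetric])
  finally show "ev U (Gstar H G (dten H E \<alpha>)) w = \<dots>" .
qed (intro tpow_sum tpow_fscale dten_tpow)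

text \<open>Extends a formula for pure tensors at the edge ends to elements of the image of \<open>G\<^sup>*\<close>, in which the two ends of each edge are coupled by the coproduct of \<open>K\<^sup>*\<close>. The coupling can be contracted edge by edge because the formula is a product over the edges.\<close>

lemma Gstar_functional:
  assumes F: "linear_on (tpow H U) F"
    and pure: "\<And>\<alpha>'. (\<And>x. x \<in> U \<Longrightarrow> lin (\<alpha>' x)) \<Longrightarrow> ev U (F (dten H U \<alpha>')) w
      = (\<Sum>J\<in>I. K J * (\<Prod>e\<in>E. t J e (\<alpha>' (Tgt e)) (\<alpha>' (Src e))))"
    and \<alpha>: "\<And>e. e \<in> E \<Longrightarrow> lin (\<alpha> e)"
  shows "ev U (F (Gstar H G (dten H E \<alpha>))) w
    = (\<Sum>J\<in>I. K J * (\<Prod>e\<in>E. \<Sum>a\<in>basis H. \<Sum>b\<in>basis H. \<alpha> e (a * b) * t J e (dual_basis H a) (dual_basis H b)))"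
proof -
  let ?I = "multi_idx H E" and ?c = "\<lambda>p q. \<Prod>e\<in>E. \<alpha> e (p e * q e)"
  have tp: "fscale c (dten H U (ends_dual p q)) \<in> tpow H U" for c p q
    by (intro tpow_fscale dten_tpow)
  have Fc: "F (fscale c (dten H U \<alpha>')) = fscale c (F (dten H U \<alpha>'))" for c \<alpha>'
    using F dten_tpow[of U \<alpha>'] by (simp add: linear_on_def)
  have "F (Gstar H G (dten H E \<alpha>)) = (\<Sum>p\<in>?I. \<Sum>q\<in>?I. F (fscale (?c p q) (dten H U (ends_dual p q))))"
  proof -
    have "F (Gstar H G (dten H E \<alpha>)) = (\<Sum>p\<in>?I. F (\<Sum>q\<in>?I. fscale (?c p q) (dten H U (ends_dual p q))))"
      by (subst Gstar_dten[OF \<alpha>], assumption) (rule linear_on_sum[OF F], intro tpow_sum tp)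
    also have "\<dots> = (\<Sum>p\<in>?I. \<Sum>q\<in>?I. F (fscale (?c p q) (dten H U (ends_dual p q))))"
      by (intro sum.cong refl linear_on_sum[OF F] tp)
    finally show ?thesis .
  qed
  then have "ev U (F (Gstar H G (dten H E \<alpha>))) w
      = (\<Sum>p\<in>?I. \<Sum>q\<in>?I. ?c p q * (\<Sum>J\<in>I. K J * (\<Prod>e\<in>E. t J e (dual_basis H (p e)) (dual_basis H (q e)))))"
    by (simp add: ev_sum Fc ev_fscale pure lin_ends_dual)
  also have "\<dots> = (\<Sum>p\<in>?I. \<Sum>q\<in>?I. \<Sum>J\<in>I. K J * (?c p q * (\<Prod>e\<in>E. t J e (dual_basis H (p e)) (dual_basis H (q e)))))"
    by (simp add: sum_distrib_left mult_ac)
  also have "\<dots> = (\<Sum>J\<in>I. \<Sum>p\<in>?I. \<Sum>q\<in>?I. K J * (?c p q * (\<Prod>e\<in>E. t J e (dual_basis H (p e)) (dual_basis H (q e)))))"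
    by (rule sum_swap3)
  also have "\<dots> = (\<Sum>J\<in>I. K J * (\<Prod>e\<in>E. \<Sum>a\<in>basis H. \<Sum>b\<in>basis H. \<alpha> e (a * b) * t J e (dual_basis H a) (dual_basis H b)))"
    by (simp only: sum_distrib_left[symmetric] ends_contract)
  finally show ?thesis .
qed

end


locale gauge_graph = ribbon_graph H G
  for H :: "('f::field_char_0, 'k::ring_1) hopf_data" and G :: "('v, 'e) pre_digraph" +
  fixes cil :: "'v \<Rightarrow> 'e edge_end list" and R :: "'v \<Rightarrow> (nat, 'k, 'f) tensor" and \<rho> :: "'e \<Rightarrow> 'e edge_end"
  assumes distinct_cil: "v \<in> V \<Longrightarrow> distinct (cil v)" and set_cil: "v \<in> V \<Longrightarrow> set (cil v) = P v"
    and R: "v \<in> V \<Longrightarrow> R_matrix H (R v)" and \<rho>: "e \<in> E \<Longrightarrow> \<rho> e = Src e \<or> \<rho> e = Tgt e"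
begin

definition is_out :: "'e edge_end \<Rightarrow> bool" where
  "is_out x = (case x of Src e \<Rightarrow> True | Tgt e \<Rightarrow> False)"

definition is_sel :: "'e edge_end \<Rightarrow> bool" where
  "is_sel x \<longleftrightarrow> x \<in> \<rho> ` E"

lemma is_out_simps [simp]: "is_out (Src e)" "\<not> is_out (Tgt e)"
  by (simp_all add: is_out_def)

lemma vertex: "v \<in> V \<Longrightarrow> vertex H (R v)"
  by (simp add: vertex_def quasitriangular_def quasitriangular_axioms_def R hopf_algebra_axioms)

lemma tau: "end_tau x = (if is_out x then 1 else 0)"
  by (cases x) simp_all

lemma sigma: "is_sel x \<longleftrightarrow> end_sigma G \<rho> x = 0"
  by (simp add: is_sel_def end_sigma_def)

text \<open>Because \<open>\<rho>\<close> selects exactly one end of each edge, both ends lead to the same flip.\<close>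

lemma flip_ends: "e \<in> E \<Longrightarrow> (is_out (Tgt e) \<noteq> is_sel (Tgt e)) = (\<rho> e = Tgt e)"
  "e \<in> E \<Longrightarrow> (is_out (Src e) \<noteq> is_sel (Src e)) = (\<rho> e = Tgt e)"
  using \<rho> by (force simp: is_sel_def)+

abbreviation "amult v \<equiv> vertex.vmult H (R v) is_out is_sel (cil v)"
abbreviation "aact v \<equiv> vertex.vaction H is_out (cil v)"

lemma amult_eq: "v \<in> V \<Longrightarrow> vertex_mult H (R v) (cil v) end_tau (end_sigma G \<rho>) = amult v"
  by (rule vertex.vertex_mult_eq[OF vertex]) (simp_all add: distinct_cil tau sigma)

lemma aact_eq: "v \<in> V \<Longrightarrow> T \<in> tpow H (P v) \<Longrightarrow> vertex_action H (cil v) end_tau T h = aact v T h"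
  by (rule vertex.vertex_action_eq[OF vertex]) (simp_all add: distinct_cil tau set_cil)

end

section \<open>Products of pure tensors in the tensor product over all vertices\<close>

context gauge_graph
begin

abbreviation "M \<equiv> family_mult H V P amult"
abbreviation "L \<equiv> family_action H V P aact"

lemma kmodule: "v \<in> V \<Longrightarrow> kmodule_algebra (P v) (amult v) (aact v)"
  using vertex.vertex_kmodule_algebra[OF vertex distinct_cil] by (simp add: set_cil)

lemma right_module_algebra_U: "right_module_algebra H V U M L"
proof -
  have "right_module_algebra H V (\<Union>v\<in>V. P v) M L"
    by (rule family_right_module_algebra) (use finite_V finite_P P_disjoint kmodule in auto)
  then show ?thesis by (simp only: U_union)
qed

lemma M_fam:
  assumes "\<And>v. v \<in> V \<Longrightarrow> S v \<in> tpow H (P v)" "\<And>v. v \<in> V \<Longrightarrow> T v \<in> tpow H (P v)"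
  shows "M (family_tensor H V P S) (family_tensor H V P T) = family_tensor H V P (\<lambda>v. amult v (S v) (T v))"
  by (rule fam_mult) (use finite_V finite_P P_disjoint kmodule assms in auto)

lemma L_fam:
  assumes "\<And>v. v \<in> V \<Longrightarrow> S v \<in> tpow H (P v)"
  shows "L (family_tensor H V P S) (kten H V h) = family_tensor H V P (\<lambda>v. aact v (S v) (h v))"
  by (rule fam_action) (use finite_V finite_P P_disjoint kmodule assms in auto)

lemma dten_fam: "dten H U \<alpha> = family_tensor H V P (\<lambda>v. dten H (P v) \<alpha>)"
  unfolding U_union[symmetric] by (rule fam_dten[symmetric]) (use finite_V finite_P P_disjoint in auto)

lemma ev_fam_U: "ev U (family_tensor H V P T) w = (\<Prod>v\<in>V. ev (P v) (T v) w)"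
  unfolding U_union[symmetric] by (rule ev_fam) (use finite_V finite_P P_disjoint in auto)

lemma M_dten: "M (dten H U \<alpha>) (dten H U \<beta>) = family_tensor H V P (\<lambda>v. amult v (dten H (P v) \<alpha>) (dten H (P v) \<beta>))"
  unfolding dten_fam by (rule M_fam) (rule dten_tpow)+

lemma L_dten: "L (dten H U \<alpha>) (kten H V h) = family_tensor H V P (\<lambda>v. aact v (dten H (P v) \<alpha>) (h v))"
  unfolding dten_fam by (rule L_fam) (rule dten_tpow)

lemma ev_amult:
  assumes "v \<in> V" "\<And>x. x \<in> P v \<Longrightarrow> lin (\<alpha> x)" "\<And>x. x \<in> P v \<Longrightarrow> lin (\<beta> x)"
  shows "ev (P v) (amult v (dten H (P v) \<alpha>) (dten H (P v) \<beta>)) w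
    = vertex.vm H (R v) is_out is_sel (cil v) (vertex.pf (P v) \<alpha>) (vertex.pf (P v) \<beta>) w"
  using vertex.ev_vmult[OF vertex distinct_cil, OF assms(1,1), where S = "dten H (P v) \<alpha>" and T = "dten H (P v) \<beta>"]
    vertex.ev_dten_pf[OF vertex[OF assms(1)], where es = "cil v" and \<alpha> = \<alpha>]
    vertex.ev_dten_pf[OF vertex[OF assms(1)], where es = "cil v" and \<alpha> = \<beta>]
  by (simp add: set_cil assms dten_tpow)

lemma ev_aact:
  assumes "v \<in> V" "\<And>x. x \<in> P v \<Longrightarrow> lin (\<alpha> x)"
  shows "ev (P v) (aact v (dten H (P v) \<alpha>) h) w = vertex.vact H is_out (cil v) (vertex.pf (P v) \<alpha>) h w"
  using vertex.ev_vaction[OF vertex distinct_cil, OF assms(1,1), where S = "dten H (P v) \<alpha>"]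
    vertex.ev_dten_pf[OF vertex[OF assms(1)], where es = "cil v" and \<alpha> = \<alpha>]
  by (simp add: set_cil assms dten_tpow)

lemma sum_list_index: "(\<Sum>x\<leftarrow>xs. f x) = (\<Sum>j<length xs. f (xs ! j))" for f :: "_ \<Rightarrow> 'f"
  by (simp add: sum_list_sum_nth atLeast0LessThan)

lemma amult_expand:
  assumes v: "v \<in> V"
  shows "\<exists>L. \<forall>\<alpha> \<beta> w. (\<forall>x\<in>P v. lin (\<alpha> x) \<and> lin (\<beta> x)) \<longrightarrow>
    ev (P v) (amult v (dten H (P v) \<alpha>) (dten H (P v) \<beta>)) w = (\<Sum>j<length L. fst (L ! j) * (\<Prod>x\<in>P v.
      sw2 (flip (is_out x \<noteq> is_sel x) (w x))
        (\<lambda>a b. \<alpha> x (om (is_out x) (fst (snd (L ! j)) x) a) * \<beta> x (om (is_out x) (snd (snd (L ! j)) x) b))))"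
proof -
  have "vertex.span2 H is_out is_sel (P v) (\<lambda>\<alpha> \<beta>. vertex.vm H (R v) is_out is_sel (cil v) (vertex.pf (P v) \<alpha>) (vertex.pf (P v) \<beta>))"
    using vertex.vm_span2[OF vertex distinct_cil, OF v v] by (simp only: set_cil[OF v])
  then obtain L where L: "\<And>\<alpha> \<beta> w. (\<forall>x\<in>P v. lin (\<alpha> x) \<and> lin (\<beta> x)) \<Longrightarrow>
     vertex.vm H (R v) is_out is_sel (cil v) (vertex.pf (P v) \<alpha>) (vertex.pf (P v) \<beta>) w
      = (\<Sum>(\<kappa>, g, k)\<leftarrow>L. \<kappa> * vertex.base2 H is_out is_sel (P v) (vertex.twist is_out g \<alpha>) (vertex.twist is_out k \<beta>) w)"
    unfolding vertex.span2_def[OF vertex[OF v]] by blast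
  show ?thesis
    by (intro exI[of _ L] allI impI)
      (simp add: ev_amult v L sum_list_index case_prod_unfold vertex.base2_def[OF vertex[OF v]] vertex.twist_def[OF vertex[OF v]])
qed

lemma aact_expand:
  assumes v: "v \<in> V"
  shows "\<exists>L. \<forall>\<alpha> w. (\<forall>x\<in>P v. lin (\<alpha> x)) \<longrightarrow>
    ev (P v) (aact v (dten H (P v) \<alpha>) h) w
      = (\<Sum>j<length L. fst (L ! j) * (\<Prod>x\<in>P v. \<alpha> x (om (is_out x) (snd (L ! j) x) (w x))))"
proof -
  have "vertex.span1 H is_out (P v) (\<lambda>\<alpha>. vertex.vact H is_out (cil v) (vertex.pf (P v) \<alpha>) h)"
    using vertex.vact_span1[OF vertex distinct_cil, OF v v] by (simp only: set_cil[OF v])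
  then obtain L where L: "\<And>\<alpha> w. (\<forall>x\<in>P v. lin (\<alpha> x)) \<Longrightarrow>
     vertex.vact H is_out (cil v) (vertex.pf (P v) \<alpha>) h w
      = (\<Sum>(\<kappa>, g)\<leftarrow>L. \<kappa> * vertex.pf (P v) (vertex.twist is_out g \<alpha>) w)"
    unfolding vertex.span1_def[OF vertex[OF v]] by blast
  show ?thesis
    by (intro exI[of _ L] allI impI)
      (simp add: ev_aact v L sum_list_index case_prod_unfold vertex.pf_def[OF vertex[OF v]] vertex.twist_def[OF vertex[OF v]])
qed

definition end_vertex :: "'e edge_end \<Rightarrow> 'v" where
  "end_vertex x = (case x of Src e \<Rightarrow> tail G e | Tgt e \<Rightarrow> head G e)"

lemma end_vertex: "x \<in> P v \<Longrightarrow> end_vertex x = v"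
  by (auto simp: ends_at_def end_vertex_def)

text \<open>A product of finite sums, one for each vertex, is a sum over choice functions \<open>J\<close>; each end belongs to exactly one vertex, which gives one product over all ends.\<close>

lemma prod_sum_ends:
  fixes s :: "'v \<Rightarrow> nat \<Rightarrow> 'e edge_end \<Rightarrow> 'f"
  shows "(\<Prod>v\<in>V. \<Sum>j<n v. \<kappa> v j * (\<Prod>x\<in>P v. s v j x))
    = (\<Sum>J\<in>PiE V (\<lambda>v. {..<n v}). (\<Prod>v\<in>V. \<kappa> v (J v)) * (\<Prod>x\<in>U. s (end_vertex x) (J (end_vertex x)) x))"
proof -
  have "(\<Prod>x\<in>U. s (end_vertex x) (J (end_vertex x)) x) = (\<Prod>v\<in>V. \<Prod>x\<in>P v. s v (J v) x)" for J
  proof -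
    have "(\<Prod>x\<in>U. s (end_vertex x) (J (end_vertex x)) x) = (\<Prod>v\<in>V. \<Prod>x\<in>P v. s (end_vertex x) (J (end_vertex x)) x)"
      unfolding U_union[symmetric] using finite_V finite_P P_disjoint by (intro prod.UNION_disjoint) auto
    then show ?thesis by (simp add: end_vertex cong: prod.cong)
  qed
  then show ?thesis
    by (subst prod_sum_PiE[OF finite_V]) (simp_all add: prod.distrib)
qed

text \<open>The products at the vertices are sums of twisted products, by \<open>vm_span2\<close>, and so is their tensor product.\<close>

lemma M_expand:
  "\<exists>(I :: ('v \<Rightarrow> nat) set) K g k. finite I \<and> (\<forall>\<alpha> \<beta> w. (\<forall>x\<in>U. lin (\<alpha> x) \<and> lin (\<beta> x)) \<longrightarrow>
    ev U (M (dten H U \<alpha>) (dten H U \<beta>)) w = (\<Sum>J\<in>I. K J * (\<Prod>x\<in>U.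
      sw2 (flip (is_out x \<noteq> is_sel x) (w x)) (\<lambda>a b. \<alpha> x (om (is_out x) (g J x) a) * \<beta> x (om (is_out x) (k J x) b)))))"
proof -
  obtain \<L> where *: "\<forall>v\<in>V. \<forall>\<alpha> \<beta> w. (\<forall>x\<in>P v. lin (\<alpha> x) \<and> lin (\<beta> x)) \<longrightarrow>
    ev (P v) (amult v (dten H (P v) \<alpha>) (dten H (P v) \<beta>)) w = (\<Sum>j<length (\<L> v). fst (\<L> v ! j) * (\<Prod>x\<in>P v.
      sw2 (flip (is_out x \<noteq> is_sel x) (w x))
        (\<lambda>a b. \<alpha> x (om (is_out x) (fst (snd (\<L> v ! j)) x) a) * \<beta> x (om (is_out x) (snd (snd (\<L> v ! j)) x) b))))"
    using bchoice[OF ballI[OF amult_expand]] by (rule exE)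
  define n where "n v = length (\<L> v)" for v
  define \<kappa> where "\<kappa> v j = fst (\<L> v ! j)" for v j
  define g where "g v j = fst (snd (\<L> v ! j))" for v j
  define k where "k v j = snd (snd (\<L> v ! j))" for v j
  note * = *[rule_format, folded n_def \<kappa>_def g_def k_def]
  show ?thesis
  proof (intro exI conjI allI impI)
    show "finite (PiE V (\<lambda>v. {..<n v}))" using finite_V by (intro finite_PiE) auto
    fix \<alpha> \<beta> w assume l: "\<forall>x\<in>U. lin (\<alpha> x) \<and> lin (\<beta> x)"
    have "ev U (M (dten H U \<alpha>) (dten H U \<beta>)) w = (\<Prod>v\<in>V. ev (P v) (amult v (dten H (P v) \<alpha>) (dten H (P v) \<beta>)) w)"
      unfolding M_dten by (rule ev_fam_U)
    also have "\<dots> = (\<Prod>v\<in>V. \<Sum>j<n v. \<kappa> v j * (\<Prod>x\<in>P v.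
      sw2 (flip (is_out x \<noteq> is_sel x) (w x)) (\<lambda>a b. \<alpha> x (om (is_out x) (g v j x) a) * \<beta> x (om (is_out x) (k v j x) b))))"
      using l U_union by (intro prod.cong refl *) auto
    also note prod_sum_ends[where s = "\<lambda>v j x. sw2 (flip (is_out x \<noteq> is_sel x) (w x))
      (\<lambda>a b. \<alpha> x (om (is_out x) (g v j x) a) * \<beta> x (om (is_out x) (k v j x) b))"]
    finally show "ev U (M (dten H U \<alpha>) (dten H U \<beta>)) w =
      (\<Sum>J\<in>PiE V (\<lambda>v. {..<n v}). (\<Prod>v\<in>V. \<kappa> v (J v)) * (\<Prod>x\<in>U. sw2 (flip (is_out x \<noteq> is_sel x) (w x))
        (\<lambda>a b. \<alpha> x (om (is_out x) (g (end_vertex x) (J (end_vertex x)) x) a)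
          * \<beta> x (om (is_out x) (k (end_vertex x) (J (end_vertex x)) x) b))))" .
  qed
qed

lemma L_expand:
  "\<exists>(I :: ('v \<Rightarrow> nat) set) K g. finite I \<and> (\<forall>\<alpha> w. (\<forall>x\<in>U. lin (\<alpha> x)) \<longrightarrow>
    ev U (L (dten H U \<alpha>) (kten H V h)) w = (\<Sum>J\<in>I. K J * (\<Prod>x\<in>U. \<alpha> x (om (is_out x) (g J x) (w x)))))"
proof -
  obtain \<L> where *: "\<forall>v\<in>V. \<forall>\<alpha> w. (\<forall>x\<in>P v. lin (\<alpha> x)) \<longrightarrow>
    ev (P v) (aact v (dten H (P v) \<alpha>) (h v)) w
      = (\<Sum>j<length (\<L> v). fst (\<L> v ! j) * (\<Prod>x\<in>P v. \<alpha> x (om (is_out x) (snd (\<L> v ! j) x) (w x))))"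
    using bchoice[OF ballI[OF aact_expand[where h = "h _"]]] by (rule exE)
  define n where "n v = length (\<L> v)" for v
  define \<kappa> where "\<kappa> v j = fst (\<L> v ! j)" for v j
  define g where "g v j = snd (\<L> v ! j)" for v j
  note * = *[rule_format, folded n_def \<kappa>_def g_def]
  show ?thesis
  proof (intro exI conjI allI impI)
    show "finite (PiE V (\<lambda>v. {..<n v}))" using finite_V by (intro finite_PiE) auto
    fix \<alpha> w assume l: "\<forall>x\<in>U. lin (\<alpha> x)"
    have "ev U (L (dten H U \<alpha>) (kten H V h)) w = (\<Prod>v\<in>V. ev (P v) (aact v (dten H (P v) \<alpha>) (h v)) w)"
      unfolding L_dten by (rule ev_fam_U)
    also have "\<dots> = (\<Prod>v\<in>V. \<Sum>j<n v. \<kappa> v j * (\<Prod>x\<in>P v. \<alpha> x (om (is_out x) (g v j x) (w x))))"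
      using l U_union by (intro prod.cong refl *) auto
    also note prod_sum_ends[where s = "\<lambda>v j x. \<alpha> x (om (is_out x) (g v j x) (w x))"]
    finally show "ev U (L (dten H U \<alpha>) (kten H V h)) w =
      (\<Sum>J\<in>PiE V (\<lambda>v. {..<n v}). (\<Prod>v\<in>V. \<kappa> v (J v)) * (\<Prod>x\<in>U.
        \<alpha> x (om (is_out x) (g (end_vertex x) (J (end_vertex x)) x) (w x))))" .
  qed
qed

end

section \<open>The image of G*\<close>

context hopf_algebra
begin

lemma flip_lin: "lin (\<lambda>p. sw2 (flip fl p) f)"
proof -
  have "flip fl (a + b) = flip fl a + flip fl b" "flip fl (smult H c a) = fscale c (flip fl a)" for a b c
    by (simp_all add: flip_def kemb2_def klift_def comult_add comult_smult fun_eq_iff sum_fun_apply plus_fun_apply fscale_def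
        sum.distrib distrib_right sum_distrib_left mult.assoc)
  then show ?thesis by (simp add: lin_def)
qed

end

context gauge_graph
begin

lemma M_linear: "linear_on A (M S)" "linear_on A (\<lambda>S. M S T)"
proof -
  have "bilinear_on A B M" for A B
    by (rule family_mult_bilinear) (use finite_V finite_P P_disjoint in auto)
  from this[of UNIV A] this[of A UNIV] show "linear_on A (M S)" "linear_on A (\<lambda>S. M S T)"
    by (auto simp: bilinear_on_def)
qed

lemma L_linear: "linear_on A (L S)" "linear_on B (\<lambda>S. L S h)"
proof -
  have "bilinear_on B A L" for A B
    by (rule family_action_bilinear) (use finite_V finite_P P_disjoint in auto)
  from this[of UNIV A] this[of B UNIV] show "linear_on A (L S)" "linear_on B (\<lambda>S. L S h)"
    by (auto simp: bilinear_on_def)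
qed

lemma M_tpow: "M S T \<in> tpow H U"
  unfolding U_union[symmetric] by (rule family_mult_tpow) (use finite_V finite_P P_disjoint in auto)

lemma L_tpow: "L S h \<in> tpow H U"
  unfolding U_union[symmetric] by (rule family_action_tpow) (use finite_V finite_P P_disjoint in auto)

text \<open>The factor at the edge \<open>e\<close> in one summand of the product of two pure tensors; the elements \<open>g\<close> and \<open>k\<close> come from the legs of the \<open>R\<close>-matrices at both ends of \<open>e\<close>.\<close>

definition edge_prod :: "('e edge_end \<Rightarrow> 'k) \<Rightarrow> ('e edge_end \<Rightarrow> 'k) \<Rightarrow> ('e \<Rightarrow> 'k \<Rightarrow> 'f) \<Rightarrow> ('e \<Rightarrow> 'k \<Rightarrow> 'f) \<Rightarrow> 'e \<Rightarrow> 'k \<Rightarrow> 'f" where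
  "edge_prod g k \<alpha> \<beta> e p = sw2 (flip (\<rho> e = Tgt e) p)
     (\<lambda>r s. \<alpha> e (g (Tgt e) * (r * g (Src e))) * \<beta> e (k (Tgt e) * (s * k (Src e))))"

definition edge_act :: "('e edge_end \<Rightarrow> 'k) \<Rightarrow> ('e \<Rightarrow> 'k \<Rightarrow> 'f) \<Rightarrow> 'e \<Rightarrow> 'k \<Rightarrow> 'f" where
  "edge_act g \<alpha> e p = \<alpha> e (g (Tgt e) * (p * g (Src e)))"

lemma lin_edge_prod: "lin (edge_prod g k \<alpha> \<beta> e)"
  unfolding edge_prod_def by (rule flip_lin)

lemma lin_edge_act: "lin (\<alpha> e) \<Longrightarrow> lin (edge_act g \<alpha> e)"
  unfolding edge_act_def by (simp add: lin_def alg_lin)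

lemma ev_Gstar_dten: "(\<And>e. e \<in> E \<Longrightarrow> lin (\<gamma> e)) \<Longrightarrow> ev U (Gstar H G (dten H E \<gamma>)) w = (\<Prod>e\<in>E. \<gamma> e (merge w e))"
  by (simp add: ev_Gstar ev_dten finite_E)

text \<open>\<open>edge_contract\<close> is applied to every edge, which requires expanding both factors with \<open>Gstar_functional\<close>.\<close>

lemma M_Gstar:
  "\<exists>(I :: ('v \<Rightarrow> nat) set) K g k. finite I \<and> (\<forall>\<alpha> \<beta>. (\<forall>e\<in>E. lin (\<alpha> e) \<and> lin (\<beta> e)) \<longrightarrow>
    M (Gstar H G (dten H E \<alpha>)) (Gstar H G (dten H E \<beta>))
      = (\<Sum>J\<in>I. fscale (K J) (Gstar H G (dten H E (edge_prod (g J) (k J) \<alpha> \<beta>)))))"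
proof -
  obtain I :: "('v \<Rightarrow> nat) set" and K g k where I: "finite I" and
    pure: "\<And>\<alpha> \<beta> w. (\<forall>x\<in>U. lin (\<alpha> x) \<and> lin (\<beta> x)) \<Longrightarrow> ev U (M (dten H U \<alpha>) (dten H U \<beta>)) w = (\<Sum>J\<in>I. K J * (\<Prod>x\<in>U.
      sw2 (flip (is_out x \<noteq> is_sel x) (w x)) (\<lambda>a b. \<alpha> x (om (is_out x) (g J x) a) * \<beta> x (om (is_out x) (k J x) b))))"
    using M_expand by blast
  have "M (Gstar H G (dten H E \<alpha>)) (Gstar H G (dten H E \<beta>))
      = (\<Sum>J\<in>I. fscale (K J) (Gstar H G (dten H E (edge_prod (g J) (k J) \<alpha> \<beta>))))"
    if l: "\<forall>e\<in>E. lin (\<alpha> e) \<and> lin (\<beta> e)" for \<alpha> \<beta>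
  proof (rule tpow_ext[OF finite_U])
    show "M (Gstar H G (dten H E \<alpha>)) (Gstar H G (dten H E \<beta>)) \<in> tpow H U"
      by (rule M_tpow)
    show "(\<Sum>J\<in>I. fscale (K J) (Gstar H G (dten H E (edge_prod (g J) (k J) \<alpha> \<beta>)))) \<in> tpow H U"
      by (intro tpow_sum tpow_fscale Gstar_tpow)
    fix w
    define s where "s J x \<alpha> \<beta> = sw2 (flip (is_out x \<noteq> is_sel x) (w x))
      (\<lambda>a b. \<alpha> (om (is_out x) (g J x) a) * \<beta> (om (is_out x) (k J x) b))" for J x and \<alpha> \<beta> :: "'k \<Rightarrow> 'f"
    have right: "ev U (M (dten H U \<alpha>') (Gstar H G (dten H E \<beta>))) w = (\<Sum>J\<in>I. K J * (\<Prod>e\<in>E.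
        \<Sum>a\<in>basis H. \<Sum>b\<in>basis H. \<beta> e (a * b) *
          (s J (Tgt e) (\<alpha>' (Tgt e)) (dual_basis H a) * s J (Src e) (\<alpha>' (Src e)) (dual_basis H b))))"
      if l': "\<And>x. x \<in> U \<Longrightarrow> lin (\<alpha>' x)" for \<alpha>'
    proof (rule Gstar_functional[OF M_linear(1), where t = "\<lambda>J e x y. s J (Tgt e) (\<alpha>' (Tgt e)) x * s J (Src e) (\<alpha>' (Src e)) y"])
      show "lin (\<beta> e)" if "e \<in> E" for e using l that by blast
      fix \<beta>' assume "\<And>x. x \<in> U \<Longrightarrow> lin (\<beta>' x)"
      then have "\<forall>x\<in>U. lin (\<alpha>' x) \<and> lin (\<beta>' x)" using l' by blast
      from pure[OF this] show "ev U (M (dten H U \<alpha>') (dten H U \<beta>')) w = (\<Sum>J\<in>I. K J * (\<Prod>e\<in>E.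
          s J (Tgt e) (\<alpha>' (Tgt e)) (\<beta>' (Tgt e)) * s J (Src e) (\<alpha>' (Src e)) (\<beta>' (Src e))))"
        by (simp only: s_def prod_U)
    qed
    have "ev U (M (Gstar H G (dten H E \<alpha>)) (Gstar H G (dten H E \<beta>))) w = (\<Sum>J\<in>I. K J * (\<Prod>e\<in>E.
        \<Sum>a\<in>basis H. \<Sum>b\<in>basis H. \<alpha> e (a * b) * (\<Sum>a'\<in>basis H. \<Sum>b'\<in>basis H. \<beta> e (a' * b') *
          (s J (Tgt e) (dual_basis H a) (dual_basis H a') * s J (Src e) (dual_basis H b) (dual_basis H b')))))"
      by (rule Gstar_functional[OF M_linear(2), where t = "\<lambda>J e x y. \<Sum>a'\<in>basis H. \<Sum>b'\<in>basis H. \<beta> e (a' * b') *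
          (s J (Tgt e) x (dual_basis H a') * s J (Src e) y (dual_basis H b'))"], rule right, assumption)
        (use l in blast)
    also have "\<dots> = (\<Sum>J\<in>I. K J * (\<Prod>e\<in>E. edge_prod (g J) (k J) \<alpha> \<beta> e (merge w e)))"
    proof (intro sum.cong prod.cong refl arg_cong2[where f = "(*)"])
      fix J e assume e: "e \<in> E"
      have "lin (\<alpha> e)" "lin (\<beta> e)" using l e by auto
      note * = edge_contract[OF this, of "\<rho> e = Tgt e" "w (Tgt e)" "g J (Tgt e)" "k J (Tgt e)" "w (Src e)" "g J (Src e)" "k J (Src e)"]
      show "(\<Sum>a\<in>basis H. \<Sum>b\<in>basis H. \<alpha> e (a * b) * (\<Sum>a'\<in>basis H. \<Sum>b'\<in>basis H. \<beta> e (a' * b') *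
          (s J (Tgt e) (dual_basis H a) (dual_basis H a') * s J (Src e) (dual_basis H b) (dual_basis H b'))))
        = edge_prod (g J) (k J) \<alpha> \<beta> e (merge w e)"
        unfolding s_def flip_ends[OF e] edge_prod_def merge_def *[symmetric] by (simp only: om_def is_out_simps if_True if_False)
    qed
    also have "\<dots> = ev U (\<Sum>J\<in>I. fscale (K J) (Gstar H G (dten H E (edge_prod (g J) (k J) \<alpha> \<beta>)))) w"
      by (simp only: ev_sum ev_fscale ev_Gstar_dten lin_edge_prod)
    finally show "ev U (M (Gstar H G (dten H E \<alpha>)) (Gstar H G (dten H E \<beta>))) w = \<dots>" .
  qed
  with I show ?thesis by blast
qed

lemma L_Gstar:
  "\<exists>(I :: ('v \<Rightarrow> nat) set) K g. finite I \<and> (\<forall>\<alpha>. (\<forall>e\<in>E. lin (\<alpha> e)) \<longrightarrow>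
    L (Gstar H G (dten H E \<alpha>)) (kten H V h) = (\<Sum>J\<in>I. fscale (K J) (Gstar H G (dten H E (edge_act (g J) \<alpha>)))))"
proof -
  obtain I :: "('v \<Rightarrow> nat) set" and K g where I: "finite I" and
    pure: "\<And>\<alpha> w. (\<forall>x\<in>U. lin (\<alpha> x)) \<Longrightarrow> ev U (L (dten H U \<alpha>) (kten H V h)) w
      = (\<Sum>J\<in>I. K J * (\<Prod>x\<in>U. \<alpha> x (om (is_out x) (g J x) (w x))))"
    using L_expand[of h] by blast
  have "L (Gstar H G (dten H E \<alpha>)) (kten H V h) = (\<Sum>J\<in>I. fscale (K J) (Gstar H G (dten H E (edge_act (g J) \<alpha>))))"
    if l: "\<forall>e\<in>E. lin (\<alpha> e)" for \<alpha>
  proof (rule tpow_ext[OF finite_U])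
    show "L (Gstar H G (dten H E \<alpha>)) (kten H V h) \<in> tpow H U"
      by (rule L_tpow)
    show "(\<Sum>J\<in>I. fscale (K J) (Gstar H G (dten H E (edge_act (g J) \<alpha>)))) \<in> tpow H U"
      by (intro tpow_sum tpow_fscale Gstar_tpow)
    fix w
    have "ev U (L (Gstar H G (dten H E \<alpha>)) (kten H V h)) w = (\<Sum>J\<in>I. K J * (\<Prod>e\<in>E.
        \<Sum>a\<in>basis H. \<Sum>b\<in>basis H. \<alpha> e (a * b) * (dual_basis H a (g J (Tgt e) * w (Tgt e)) * dual_basis H b (w (Src e) * g J (Src e)))))"
    proof (rule Gstar_functional[OF L_linear(2), where t = "\<lambda>J e x y. x (g J (Tgt e) * w (Tgt e)) * y (w (Src e) * g J (Src e))"])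
      show "lin (\<alpha> e)" if "e \<in> E" for e using l that by blast
      fix \<alpha>' assume "\<And>x. x \<in> U \<Longrightarrow> lin (\<alpha>' x)"
      then have "\<forall>x\<in>U. lin (\<alpha>' x)" by blast
      from pure[OF this] show "ev U (L (dten H U \<alpha>') (kten H V h)) w = (\<Sum>J\<in>I. K J * (\<Prod>e\<in>E.
          \<alpha>' (Tgt e) (g J (Tgt e) * w (Tgt e)) * \<alpha>' (Src e) (w (Src e) * g J (Src e))))"
        by (simp only: prod_U om_def is_out_simps if_True if_False)
    qed
    also have "\<dots> = (\<Sum>J\<in>I. K J * (\<Prod>e\<in>E. edge_act (g J) \<alpha> e (merge w e)))"
      by (intro sum.cong prod.cong refl arg_cong2[where f = "(*)"], subst lin_contract2)
        (use l in \<open>simp_all add: edge_act_def merge_def mult.assoc\<close>)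
    also have "\<dots> = ev U (\<Sum>J\<in>I. fscale (K J) (Gstar H G (dten H E (edge_act (g J) \<alpha>)))) w"
      using l by (simp add: ev_sum ev_fscale ev_Gstar_dten lin_edge_act)
    finally show "ev U (L (Gstar H G (dten H E \<alpha>)) (kten H V h)) w = \<dots>" .
  qed
  with I show ?thesis by blast
qed

abbreviation "Img \<equiv> Gstar H G ` tpow H E"

lemma Img_fscale: "S \<in> Img \<Longrightarrow> fscale c S \<in> Img"
proof -
  assume "S \<in> Img"
  then obtain S' where S': "S' \<in> tpow H E" "S = Gstar H G S'" by blast
  then have "fscale c S = Gstar H G (fscale c S')" using Gstar_linear by (simp add: linear_on_def)
  then show ?thesis using tpow_fscale[OF S'(1)] by blast
qed

lemma Img_sum: "(\<And>i. i \<in> I \<Longrightarrow> f i \<in> Img) \<Longrightarrow> sum f I \<in> Img"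
proof -
  assume "\<And>i. i \<in> I \<Longrightarrow> f i \<in> Img"
  then have "\<forall>i\<in>I. \<exists>S. S \<in> tpow H E \<and> f i = Gstar H G S" by blast
  from bchoice[OF this] obtain S where S: "\<And>i. i \<in> I \<Longrightarrow> S i \<in> tpow H E \<and> f i = Gstar H G (S i)" by blast
  then have "sum f I = Gstar H G (\<Sum>i\<in>I. S i)" by (subst linear_on_sum[OF Gstar_linear]) auto
  then show ?thesis using tpow_sum[of I S] S by blast
qed

lemma btens_E: "b \<in> multi_idx H E \<Longrightarrow> btens b = dten H E (\<lambda>e. dual_basis H (b e))"
  by (rule btens_dten[OF finite_E])

lemma linear_on_comp_Gstar: "linear_on (tpow H U) f \<Longrightarrow> linear_on (tpow H E) (\<lambda>S. f (Gstar H G S))"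
  using Gstar_linear by (simp add: linear_on_def Gstar_tpow)

lemma M_Img:
  assumes "S \<in> Img" "T \<in> Img"
  shows "M S T \<in> Img"
proof -
  obtain S' T' where S': "S' \<in> tpow H E" "S = Gstar H G S'" and T': "T' \<in> tpow H E" "T = Gstar H G T'"
    using assms by blast
  have "bilinear_on (tpow H E) (tpow H E) (\<lambda>S T. M (Gstar H G S) (Gstar H G T))"
    unfolding bilinear_on_def by (intro conjI ballI linear_on_comp_Gstar M_linear)
  then have *: "M S T = (\<Sum>c\<in>multi_idx H E. \<Sum>d\<in>multi_idx H E. fscale (S' c * T' d) (M (Gstar H G (btens c)) (Gstar H G (btens d))))"
    using bilinear_on_expand[OF _ finite_E finite_E S'(1) T'(1), of "\<lambda>S T. M (Gstar H G S) (Gstar H G T)"]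
    unfolding S'(2) T'(2) by simp
  have "M (Gstar H G (btens c)) (Gstar H G (btens d)) \<in> Img" if "c \<in> multi_idx H E" "d \<in> multi_idx H E" for c d
  proof -
    obtain I :: "('v \<Rightarrow> nat) set" and K g k where
      "\<forall>\<alpha> \<beta>. (\<forall>e\<in>E. lin (\<alpha> e) \<and> lin (\<beta> e)) \<longrightarrow> M (Gstar H G (dten H E \<alpha>)) (Gstar H G (dten H E \<beta>))
        = (\<Sum>J\<in>I. fscale (K J) (Gstar H G (dten H E (edge_prod (g J) (k J) \<alpha> \<beta>))))"
      using M_Gstar by blast
    then have "M (Gstar H G (btens c)) (Gstar H G (btens d))
        = (\<Sum>J\<in>I. fscale (K J) (Gstar H G (dten H E (edge_prod (g J) (k J) (\<lambda>e. dual_basis H (c e)) (\<lambda>e. dual_basis H (d e))))))"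
      unfolding btens_E[OF that(1)] btens_E[OF that(2)] by (simp add: lin_dual_basis)
    then show ?thesis by (rule ssubst) (intro Img_sum Img_fscale imageI dten_tpow)
  qed
  then show ?thesis unfolding * by (intro Img_sum Img_fscale)
qed

lemma L_Img:
  assumes "S \<in> Img" "h \<in> tpow H V"
  shows "L S h \<in> Img"
proof -
  obtain S' where S': "S' \<in> tpow H E" "S = Gstar H G S'" using assms by blast
  have "bilinear_on (tpow H E) (tpow H V) (\<lambda>S h. L (Gstar H G S) h)"
    unfolding bilinear_on_def by (intro conjI ballI linear_on_comp_Gstar L_linear)
  then have *: "L S h = (\<Sum>c\<in>multi_idx H E. \<Sum>d\<in>multi_idx H V. fscale (S' c * h d) (L (Gstar H G (btens c)) (btens d)))"
    using bilinear_on_expand[OF _ finite_E finite_V S'(1) assms(2), of "\<lambda>S h. L (Gstar H G S) h"]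
    unfolding S'(2) by simp
  have "L (Gstar H G (btens c)) (btens d) \<in> Img" if "c \<in> multi_idx H E" "d \<in> multi_idx H V" for c d
  proof -
    obtain I :: "('v \<Rightarrow> nat) set" and K g where
      "\<forall>\<alpha>. (\<forall>e\<in>E. lin (\<alpha> e)) \<longrightarrow> L (Gstar H G (dten H E \<alpha>)) (kten H V d)
        = (\<Sum>J\<in>I. fscale (K J) (Gstar H G (dten H E (edge_act (g J) \<alpha>))))"
      using L_Gstar[of d] by blast
    then have "L (Gstar H G (btens c)) (btens d)
        = (\<Sum>J\<in>I. fscale (K J) (Gstar H G (dten H E (edge_act (g J) (\<lambda>e. dual_basis H (c e))))))"
      unfolding btens_E[OF that(1)] btens_kten[OF finite_V that(2)] by (simp add: lin_dual_basis)
    then show ?thesis by (rule ssubst) (intro Img_sum Img_fscale imageI dten_tpow)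
  qed
  then show ?thesis unfolding * by (intro Img_sum Img_fscale)
qed

abbreviation "pM \<equiv> pullback_mult H G M"
abbreviation "pL \<equiv> pullback_action H G L"

lemma Gstar_pM:
  assumes "S \<in> tpow H E" "T \<in> tpow H E"
  shows "pM S T \<in> tpow H E \<and> Gstar H G (pM S T) = M (Gstar H G S) (Gstar H G T)"
  unfolding pullback_mult_def
  using the_inv_into_into[OF Gstar_inj M_Img subset_refl] f_the_inv_into_f[OF Gstar_inj M_Img] assms by blast

lemma Gstar_pL:
  assumes "S \<in> tpow H E" "h \<in> tpow H V"
  shows "pL S h \<in> tpow H E \<and> Gstar H G (pL S h) = L (Gstar H G S) h"
  unfolding pullback_action_def
  using the_inv_into_into[OF Gstar_inj L_Img subset_refl] f_the_inv_into_f[OF Gstar_inj L_Img] assms by blast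

lemma right_module_algebra_E: "right_module_algebra H V E pM pL"
  by (rule pullback_right_module_algebra[OF Gstar_linear Gstar_tpow Gstar_inj Gstar_dunit Gstar_pM Gstar_pL right_module_algebra_U])

lemma pM_eqI: "S \<in> tpow H E \<Longrightarrow> T \<in> tpow H E \<Longrightarrow> Z \<in> tpow H E \<Longrightarrow> M (Gstar H G S) (Gstar H G T) = Gstar H G Z \<Longrightarrow> pM S T = Z"
  using Gstar_pM[of S T] by (intro inj_onD[OF Gstar_inj]) simp_all

end

section \<open>The gauge theory on the graph\<close>

context hopf_algebra
begin

lemma kproj_pairing:
  assumes X: "finite X" and x: "x \<in> X" and \<alpha>: "lin \<alpha>"
  shows "\<alpha> (kproj H X x T) = pairing H X (demb1 H X x \<alpha>) T"
proof -
  have "\<alpha> (kproj H X x T) = (\<Sum>b\<in>multi_idx H X. \<alpha> (smult H (T b) (smult H (\<Prod>y\<in>X - {x}. eps (b y)) (b x))))"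
    unfolding kproj_def klift_def by (rule lin_sum[OF \<alpha>]) (simp add: X)
  also have "\<dots> = (\<Sum>b\<in>multi_idx H X. demb1 H X x \<alpha> b * T b)"
  proof (rule sum.cong[OF refl])
    fix b assume "b \<in> multi_idx H X"
    then have "demb1 H X x \<alpha> b = \<alpha> (b x) * (\<Prod>y\<in>X - {x}. eps (b y))"
      using X x by (simp add: demb1_def dten_def prod.remove)
    then show "\<alpha> (smult H (T b) (smult H (\<Prod>y\<in>X - {x}. eps (b y)) (b x))) = demb1 H X x \<alpha> b * T b"
      by (simp add: lin_eqs[OF \<alpha>] mult_ac)
  qed
  finally show ?thesis by (simp add: pairing_def)
qed

text \<open>The projection to one factor is dual to the inclusion of generators, so the conditions on the action on \<open>K\<^sup>\<otimes>\<^sup>X\<close> become conditions on the dual action on generators.\<close>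

lemma kproj_transpose:
  fixes X :: "'x set" and Y :: "'v set"
  assumes X: "finite X" and Y: "finite Y" and act: "right_module H Y X act" and x: "x \<in> X"
    and eq: "\<And>\<alpha>. lin \<alpha> \<Longrightarrow> ev X (act (demb1 H X x \<alpha>) (kten H Y h)) w = \<alpha> a"
  shows "kproj H X x (transpose_action X act (kten H Y h) (kten H X w)) = a"
proof (rule lin_ext_K)
  fix \<alpha> assume \<alpha>: "lin \<alpha>"
  then show "\<alpha> (kproj H X x (transpose_action X act (kten H Y h) (kten H X w))) = \<alpha> a"
    by (simp add: kproj_pairing[OF X x \<alpha>] pairing_transpose[OF X Y act demb1_tpow kten_tpow] pairing_kten eq)
qed

lemma linear_on_sum2:
  assumes F: "linear_on (tpow H X) F" and T: "\<And>a b. T a b \<in> tpow H X"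
  shows "F (\<Sum>a\<in>A. \<Sum>b\<in>B. fscale (c a b) (T a b)) = (\<Sum>a\<in>A. \<Sum>b\<in>B. fscale (c a b) (F (T a b)))"
proof -
  have "F (\<Sum>a\<in>A. \<Sum>b\<in>B. fscale (c a b) (T a b)) = (\<Sum>a\<in>A. F (\<Sum>b\<in>B. fscale (c a b) (T a b)))"
    by (rule linear_on_sum[OF F]) (intro tpow_sum tpow_fscale T)
  also have "\<dots> = (\<Sum>a\<in>A. \<Sum>b\<in>B. F (fscale (c a b) (T a b)))"
    by (intro sum.cong refl linear_on_sum[OF F] tpow_fscale T)
  also have "\<dots> = (\<Sum>a\<in>A. \<Sum>b\<in>B. fscale (c a b) (F (T a b)))"
    using F T by (simp add: linear_on_def)
  finally show ?thesis .
qed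

end

context ribbon_graph
begin

text \<open>Pure tensors that are trivial at all ends except for those of the edge \<open>e\<close>.\<close>

definition on_edge :: "'e \<Rightarrow> ('k \<Rightarrow> 'f) \<Rightarrow> ('k \<Rightarrow> 'f) \<Rightarrow> 'e edge_end \<Rightarrow> 'k \<Rightarrow> 'f" where
  "on_edge e A B x = (if x = Tgt e then A else if x = Src e then B else eps)"

lemma lin_on_edge: "lin A \<Longrightarrow> lin B \<Longrightarrow> lin (on_edge e A B x)"
  by (simp add: on_edge_def lin_eps)

lemma ev_on_edge:
  assumes "e \<in> E" "lin A" "lin B"
  shows "ev U (dten H U (on_edge e A B)) w = A (w (Tgt e)) * B (w (Src e)) * (\<Prod>f\<in>E - {e}. eps (merge w f))"
proof -
  have "ev U (dten H U (on_edge e A B)) w = (\<Prod>f\<in>E. on_edge e A B (Tgt f) (w (Tgt f)) * on_edge e A B (Src f) (w (Src f)))"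
    using assms by (simp add: ev_dten finite_U lin_on_edge prod_U)
  also have "\<dots> = A (w (Tgt e)) * B (w (Src e)) * (\<Prod>f\<in>E - {e}. on_edge e A B (Tgt f) (w (Tgt f)) * on_edge e A B (Src f) (w (Src f)))"
    using assms(1) finite_E by (subst prod.remove[of _ e]) (simp_all add: on_edge_def)
  also have "(\<Prod>f\<in>E - {e}. on_edge e A B (Tgt f) (w (Tgt f)) * on_edge e A B (Src f) (w (Src f))) = (\<Prod>f\<in>E - {e}. eps (merge w f))"
    by (intro prod.cong refl) (simp add: on_edge_def merge_def counit_mult)
  finally show ?thesis .
qed

lemma ev_Gstar_demb1:
  "e \<in> E \<Longrightarrow> lin \<alpha> \<Longrightarrow> ev U (Gstar H G (demb1 H E e \<alpha>)) w = \<alpha> (merge w e) * (\<Prod>f\<in>E - {e}. eps (merge w f))"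
  by (simp add: ev_Gstar ev_demb1 finite_E)

lemma Gstar_demb1:
  assumes e: "e \<in> E" and \<alpha>: "lin \<alpha>"
  shows "Gstar H G (demb1 H E e \<alpha>) = (\<Sum>a\<in>basis H. \<Sum>b\<in>basis H.
    fscale (\<alpha> (a * b)) (dten H U (on_edge e (dual_basis H a) (dual_basis H b))))"
proof (rule tpow_ext[OF finite_U Gstar_tpow])
  fix w
  have "ev U (Gstar H G (demb1 H E e \<alpha>)) w = (\<Sum>a\<in>basis H. \<Sum>b\<in>basis H. \<alpha> (a * b) *
      (dual_basis H a (w (Tgt e)) * dual_basis H b (w (Src e)))) * (\<Prod>f\<in>E - {e}. eps (merge w f))"
    unfolding lin_contract2[OF \<alpha>] using e \<alpha> by (simp add: ev_Gstar_demb1 merge_def)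
  then show "ev U (Gstar H G (demb1 H E e \<alpha>)) w = ev U (\<Sum>a\<in>basis H. \<Sum>b\<in>basis H.
    fscale (\<alpha> (a * b)) (dten H U (on_edge e (dual_basis H a) (dual_basis H b)))) w"
    using e by (simp add: ev_sum ev_fscale ev_on_edge lin_dual_basis sum_distrib_right mult.assoc)
qed (intro tpow_sum tpow_fscale dten_tpow)

end

context gauge_graph
begin

text \<open>At edges where both factors are trivial only counits remain, hence a multiple of the unit of \<open>K\<^sup>*\<close>.\<close>

lemma edge_prod_eps:
  assumes "\<alpha> f = eps" "\<beta> f = eps"
  shows "edge_prod g k \<alpha> \<beta> f = (\<lambda>p. eps (g (Tgt f)) * eps (g (Src f)) * eps (k (Tgt f)) * eps (k (Src f)) * eps p)"
proof
  fix p
  have b: "bil (\<lambda>r s. eps r * eps s)" by (simp add: bil_def lin_def lin_eqs[OF lin_eps] distrib_left distrib_right mult_ac)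
  have "edge_prod g k \<alpha> \<beta> f p = sw2 (flip (\<rho> f = Tgt f) p)
      (\<lambda>r s. (eps (g (Tgt f)) * eps (g (Src f)) * eps (k (Tgt f)) * eps (k (Src f))) * (eps r * eps s))"
    unfolding edge_prod_def assms by (simp only: counit_mult mult_ac)
  also have "\<dots> = eps (g (Tgt f)) * eps (g (Src f)) * eps (k (Tgt f)) * eps (k (Src f)) * sw2 (flip (\<rho> f = Tgt f) p) (\<lambda>r s. eps r * eps s)"
    by (rule sw2_cmult)
  also have "sw2 (flip (\<rho> f = Tgt f) p) (\<lambda>r s. eps r * eps s) = eps p"
    unfolding sw2_flip[OF b] by (cases "\<rho> f = Tgt f") (simp_all add: counit_cop[OF lin_eps])
  finally show "edge_prod g k \<alpha> \<beta> f p = eps (g (Tgt f)) * eps (g (Src f)) * eps (k (Tgt f)) * eps (k (Src f)) * eps p" .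
qed

lemma M_Gstar_demb1:
  assumes \<alpha>: "lin \<alpha>" and \<beta>: "lin \<beta>"
  shows "\<exists>(I :: ('v \<Rightarrow> nat) set) K \<gamma>. (\<forall>J\<in>I. \<forall>z. lin (\<gamma> J z)) \<and> (\<forall>w. ev U (M (Gstar H G (demb1 H E e \<alpha>)) (Gstar H G (demb1 H E f \<beta>))) w
      = (\<Sum>J\<in>I. K J * ((\<Prod>z\<in>E \<inter> {e, f}. \<gamma> J z (merge w z)) * (\<Prod>z\<in>E - {e, f}. eps (merge w z)))))"
proof -
  obtain I :: "('v \<Rightarrow> nat) set" and K g k where *:
    "\<forall>\<alpha> \<beta>. (\<forall>e\<in>E. lin (\<alpha> e) \<and> lin (\<beta> e)) \<longrightarrow> M (Gstar H G (dten H E \<alpha>)) (Gstar H G (dten H E \<beta>))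
      = (\<Sum>J\<in>I. fscale (K J) (Gstar H G (dten H E (edge_prod (g J) (k J) \<alpha> \<beta>))))"
    using M_Gstar by blast
  let ?\<alpha> = "\<lambda>z. if z = e then \<alpha> else eps" and ?\<beta> = "\<lambda>z. if z = f then \<beta> else eps"
  let ?\<gamma> = "\<lambda>J. edge_prod (g J) (k J) ?\<alpha> ?\<beta>"
  let ?c = "\<lambda>J z. eps (g J (Tgt z)) * eps (g J (Src z)) * eps (k J (Tgt z)) * eps (k J (Src z))"
  have "ev U (M (Gstar H G (demb1 H E e \<alpha>)) (Gstar H G (demb1 H E f \<beta>))) w
      = (\<Sum>J\<in>I. (K J * (\<Prod>z\<in>E - {e, f}. ?c J z)) * ((\<Prod>z\<in>E \<inter> {e, f}. ?\<gamma> J z (merge w z)) * (\<Prod>z\<in>E - {e, f}. eps (merge w z))))" for w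
  proof -
    have "M (Gstar H G (demb1 H E e \<alpha>)) (Gstar H G (demb1 H E f \<beta>)) = (\<Sum>J\<in>I. fscale (K J) (Gstar H G (dten H E (?\<gamma> J))))"
      unfolding demb1_def using *[rule_format, of ?\<alpha> ?\<beta>] \<alpha> \<beta> by (simp add: lin_eps)
    then have "ev U (M (Gstar H G (demb1 H E e \<alpha>)) (Gstar H G (demb1 H E f \<beta>))) w = (\<Sum>J\<in>I. K J * (\<Prod>z\<in>E. ?\<gamma> J z (merge w z)))"
      by (simp only: ev_sum ev_fscale ev_Gstar_dten lin_edge_prod)
    also have "\<dots> = (\<Sum>J\<in>I. (K J * (\<Prod>z\<in>E - {e, f}. ?c J z)) * ((\<Prod>z\<in>E \<inter> {e, f}. ?\<gamma> J z (merge w z)) * (\<Prod>z\<in>E - {e, f}. eps (merge w z))))"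
    proof (rule sum.cong[OF refl])
      fix J
      have "(\<Prod>z\<in>E. ?\<gamma> J z (merge w z)) = (\<Prod>z\<in>E \<inter> {e, f}. ?\<gamma> J z (merge w z)) * (\<Prod>z\<in>E - {e, f}. ?\<gamma> J z (merge w z))"
        by (rule prod.Int_Diff[OF finite_E])
      also have "(\<Prod>z\<in>E - {e, f}. ?\<gamma> J z (merge w z)) = (\<Prod>z\<in>E - {e, f}. ?c J z * eps (merge w z))"
        by (intro prod.cong refl) (subst edge_prod_eps, simp_all)
      finally show "K J * (\<Prod>z\<in>E. ?\<gamma> J z (merge w z))
        = (K J * (\<Prod>z\<in>E - {e, f}. ?c J z)) * ((\<Prod>z\<in>E \<inter> {e, f}. ?\<gamma> J z (merge w z)) * (\<Prod>z\<in>E - {e, f}. eps (merge w z)))"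
        by (simp only: prod.distrib mult_ac)
    qed
    finally show ?thesis .
  qed
  note ev = this
  show ?thesis
    by (intro exI[of _ I] exI[of _ "\<lambda>J. K J * (\<Prod>z\<in>E - {e, f}. ?c J z)"] exI[of _ ?\<gamma>] conjI ballI allI)
      (rule lin_edge_prod, rule ev)
qed

lemma pM_same_edge:
  assumes e: "e \<in> E" and \<alpha>: "lin \<alpha>" and \<beta>: "lin \<beta>"
  shows "pM (demb1 H E e \<alpha>) (demb1 H E e \<beta>) \<in> demb1 H E e ` dual_space H"
proof -
  obtain I :: "('v \<Rightarrow> nat) set" and K \<gamma> where \<gamma>: "\<forall>J\<in>I. \<forall>z. lin (\<gamma> J z)" and
    eq: "\<forall>w. ev U (M (Gstar H G (demb1 H E e \<alpha>)) (Gstar H G (demb1 H E e \<beta>))) w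
      = (\<Sum>J\<in>I. K J * ((\<Prod>z\<in>E \<inter> {e, e}. \<gamma> J z (merge w z)) * (\<Prod>z\<in>E - {e, e}. eps (merge w z))))"
    using M_Gstar_demb1[OF \<alpha> \<beta>, of e e] by (elim exE conjE)
  let ?\<delta> = "\<lambda>p. \<Sum>J\<in>I. K J * \<gamma> J e p"
  have l: "lin ?\<delta>" using \<gamma> by (simp add: lin_def sum.distrib distrib_left sum_distrib_left mult_ac)
  have "pM (demb1 H E e \<alpha>) (demb1 H E e \<beta>) = demb1 H E e ?\<delta>"
  proof (rule pM_eqI[OF demb1_tpow demb1_tpow demb1_tpow], rule tpow_ext[OF finite_U M_tpow Gstar_tpow])
    fix w
    have "E \<inter> {e} = {e}" using e by blast
    then show "ev U (M (Gstar H G (demb1 H E e \<alpha>)) (Gstar H G (demb1 H E e \<beta>))) w = ev U (Gstar H G (demb1 H E e ?\<delta>)) w"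
      by (simp add: eq ev_Gstar_demb1 e l sum_distrib_right mult.assoc)
  qed
  then show ?thesis using l by (simp add: lin_dual)
qed

lemma ev_Gstar_demb2:
  assumes "e \<in> E" "f \<in> E" "e \<noteq> f"
  shows "ev U (Gstar H G (demb2 H E e f T)) w = ev {1,2} T (legs [merge w e, merge w f]) * (\<Prod>z\<in>E - {e, f}. eps (merge w z))"
  using assms by (simp add: ev_Gstar ev_demb2 finite_E)

lemma pM_two_edges:
  assumes e: "e \<in> E" "f \<in> E" "e \<noteq> f" and \<alpha>: "lin \<alpha>" and \<beta>: "lin \<beta>"
  shows "pM (demb1 H E e \<alpha>) (demb1 H E f \<beta>) \<in> demb2 H E e f ` tpow H {1,2}"
proof -
  obtain I :: "('v \<Rightarrow> nat) set" and K \<gamma> where \<gamma>: "\<forall>J\<in>I. \<forall>z. lin (\<gamma> J z)" and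
    eq: "\<forall>w. ev U (M (Gstar H G (demb1 H E e \<alpha>)) (Gstar H G (demb1 H E f \<beta>))) w
      = (\<Sum>J\<in>I. K J * ((\<Prod>z\<in>E \<inter> {e, f}. \<gamma> J z (merge w z)) * (\<Prod>z\<in>E - {e, f}. eps (merge w z))))"
    using M_Gstar_demb1[OF \<alpha> \<beta>, of e f] by (elim exE conjE)
  let ?T = "\<Sum>J\<in>I. fscale (K J) (dten H {1,2} (legs [\<gamma> J e, \<gamma> J f])) :: (nat, 'k, 'f) tensor"
  have T: "?T \<in> tpow H {1,2}" by (intro tpow_sum tpow_fscale dten_tpow)
  have "pM (demb1 H E e \<alpha>) (demb1 H E f \<beta>) = demb2 H E e f ?T"
  proof (rule pM_eqI[OF demb1_tpow demb1_tpow demb2_tpow], rule tpow_ext[OF finite_U M_tpow Gstar_tpow])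
    fix w
    have "E \<inter> {e, f} = {e, f}" using e by blast
    then show "ev U (M (Gstar H G (demb1 H E e \<alpha>)) (Gstar H G (demb1 H E f \<beta>))) w = ev U (Gstar H G (demb2 H E e f ?T)) w"
      using \<gamma> e(3) by (simp add: eq ev_Gstar_demb2 e ev_sum ev_fscale ev_dten2 sum_distrib_right mult.assoc)
  qed
  then show ?thesis using T by blast
qed

text \<open>If at each vertex one of the two factors is trivial, then no \<open>R\<close>-matrix contributes, by the unit law at the vertices.\<close>

lemma M_disjoint:
  assumes l: "\<And>x. x \<in> U \<Longrightarrow> lin (\<alpha> x)" "\<And>x. x \<in> U \<Longrightarrow> lin (\<beta> x)"
    and V: "\<And>v. v \<in> V \<Longrightarrow> (\<forall>x\<in>P v. \<alpha> x = eps) \<or> (\<forall>x\<in>P v. \<beta> x = eps)"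
  shows "M (dten H U \<alpha>) (dten H U \<beta>) = dten H U (\<lambda>x. if \<alpha> x = eps then \<beta> x else \<alpha> x)"
  unfolding M_dten unfolding dten_fam
proof (rule family_tensor_cong)
  fix v assume v: "v \<in> V"
  have alg: "dual_algebra H (P v) (amult v)" using kmodule[OF v] by (simp add: kmodule_algebra_def)
  show "amult v (dten H (P v) \<alpha>) (dten H (P v) \<beta>) = dten H (P v) (\<lambda>x. if \<alpha> x = eps then \<beta> x else \<alpha> x)"
    using V[OF v]
  proof
    assume a: "\<forall>x\<in>P v. \<alpha> x = eps"
    then have "dten H (P v) \<alpha> = dunit H (P v)" unfolding dunit_def by (intro dten_cong) simp
    moreover have "dten H (P v) (\<lambda>x. if \<alpha> x = eps then \<beta> x else \<alpha> x) = dten H (P v) \<beta>"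
      using a by (intro dten_cong) simp
    ultimately show ?thesis using alg dten_tpow[of "P v" \<beta>] by (simp add: dual_algebra_def)
  next
    assume b: "\<forall>x\<in>P v. \<beta> x = eps"
    then have "dten H (P v) \<beta> = dunit H (P v)" unfolding dunit_def by (intro dten_cong) simp
    moreover have "dten H (P v) (\<lambda>x. if \<alpha> x = eps then \<beta> x else \<alpha> x) = dten H (P v) \<alpha>"
      using b by (intro dten_cong) simp
    ultimately show ?thesis using alg dten_tpow[of "P v" \<alpha>] by (simp add: dual_algebra_def)
  qed
qed

lemma pM_disjoint:
  assumes e: "e \<in> E" "f \<in> E" "e \<noteq> f" and \<alpha>: "lin \<alpha>" and \<beta>: "lin \<beta>"
    and disj: "{tail G e, head G e} \<inter> {tail G f, head G f} = {}"
  shows "pM (demb1 H E e \<alpha>) (demb1 H E f \<beta>) = demb2 H E e f (dten H {1,2} (legs [\<alpha>, \<beta>]))"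
proof (rule pM_eqI[OF demb1_tpow demb1_tpow demb2_tpow], rule tpow_ext[OF finite_U M_tpow Gstar_tpow])
  fix w
  let ?d = "dual_basis H" and ?B = "basis H"
  let ?r = "\<Prod>z\<in>E - {e, f}. eps (merge w z)"
  have *: "ev U (M (dten H U (on_edge e (?d a) (?d b))) (dten H U (on_edge f (?d a') (?d b')))) w
      = (?d a (w (Tgt e)) * ?d b (w (Src e))) * (?d a' (w (Tgt f)) * ?d b' (w (Src f))) * ?r" for a b a' b'
  proof -
    define \<gamma> where "\<gamma> x = (if x \<in> {Tgt e, Src e} then on_edge e (?d a) (?d b) x else on_edge f (?d a') (?d b') x)" for x
    have l: "lin (on_edge z (?d a) (?d b) x)" for z a b x by (simp add: lin_on_edge lin_dual_basis)
    then have l\<gamma>: "lin (\<gamma> x)" for x by (simp add: \<gamma>_def)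
    have \<gamma>: "\<gamma> (Tgt e) = ?d a" "\<gamma> (Src e) = ?d b" "\<gamma> (Tgt f) = ?d a'" "\<gamma> (Src f) = ?d b'"
      "z \<notin> {e, f} \<Longrightarrow> \<gamma> (Tgt z) = eps" "z \<notin> {e, f} \<Longrightarrow> \<gamma> (Src z) = eps" for z
      using e(3) by (auto simp: \<gamma>_def on_edge_def)
    have "M (dten H U (on_edge e (?d a) (?d b))) (dten H U (on_edge f (?d a') (?d b')))
      = dten H U (\<lambda>x. if on_edge e (?d a) (?d b) x = eps then on_edge f (?d a') (?d b') x else on_edge e (?d a) (?d b) x)"
      by (rule M_disjoint[OF l l]) (use disj in \<open>auto simp: on_edge_def ends_at_def\<close>)
    also have "\<dots> = dten H U \<gamma>"
      by (rule arg_cong[where f = "dten H U"], rule ext) (use e(3) in \<open>auto simp: \<gamma>_def on_edge_def\<close>)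
    finally have M: "M (dten H U (on_edge e (?d a) (?d b))) (dten H U (on_edge f (?d a') (?d b'))) = dten H U \<gamma>" .
    have "ev U (dten H U \<gamma>) w = (\<Prod>z\<in>E. \<gamma> (Tgt z) (w (Tgt z)) * \<gamma> (Src z) (w (Src z)))"
      by (simp only: ev_dten[OF finite_U l\<gamma>] prod_U)
    also have "\<dots> = (\<Prod>z\<in>E \<inter> {e, f}. \<gamma> (Tgt z) (w (Tgt z)) * \<gamma> (Src z) (w (Src z)))
        * (\<Prod>z\<in>E - {e, f}. \<gamma> (Tgt z) (w (Tgt z)) * \<gamma> (Src z) (w (Src z)))"
      by (rule prod.Int_Diff[OF finite_E])
    also have "(\<Prod>z\<in>E - {e, f}. \<gamma> (Tgt z) (w (Tgt z)) * \<gamma> (Src z) (w (Src z))) = ?r"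
      by (intro prod.cong refl) (simp add: \<gamma> merge_def counit_mult)
    also have "E \<inter> {e, f} = {e, f}" using e by blast
    also have "(\<Prod>z\<in>{e, f}. \<gamma> (Tgt z) (w (Tgt z)) * \<gamma> (Src z) (w (Src z)))
        = (?d a (w (Tgt e)) * ?d b (w (Src e))) * (?d a' (w (Tgt f)) * ?d b' (w (Src f)))"
      using e(3) by (simp add: \<gamma>)
    finally show ?thesis unfolding M .
  qed
  have 1: "M (Gstar H G (demb1 H E e \<alpha>)) T
      = (\<Sum>a\<in>?B. \<Sum>b\<in>?B. fscale (\<alpha> (a * b)) (M (dten H U (on_edge e (?d a) (?d b))) T))" for T
    unfolding Gstar_demb1[OF e(1) \<alpha>] by (rule linear_on_sum2[OF M_linear(2)]) (rule dten_tpow)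
  have 2: "M S (Gstar H G (demb1 H E f \<beta>))
      = (\<Sum>a\<in>?B. \<Sum>b\<in>?B. fscale (\<beta> (a * b)) (M S (dten H U (on_edge f (?d a) (?d b)))))" for S
    unfolding Gstar_demb1[OF e(2) \<beta>] by (rule linear_on_sum2[OF M_linear(1)]) (rule dten_tpow)
  have "ev U (M (Gstar H G (demb1 H E e \<alpha>)) (Gstar H G (demb1 H E f \<beta>))) w
    = (\<Sum>a\<in>?B. \<Sum>b\<in>?B. \<alpha> (a * b) * (\<Sum>a'\<in>?B. \<Sum>b'\<in>?B. \<beta> (a' * b') *
        ((?d a (w (Tgt e)) * ?d b (w (Src e))) * (?d a' (w (Tgt f)) * ?d b' (w (Src f))) * ?r)))"
    by (subst 1) (simp only: 2 ev_sum ev_fscale *)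
  also have "\<dots> = (\<Sum>a\<in>?B. \<Sum>b\<in>?B. \<alpha> (a * b) * (?d a (w (Tgt e)) * ?d b (w (Src e)))) * (\<beta> (merge w f) * ?r)"
  proof -
    have "(\<Sum>a'\<in>?B. \<Sum>b'\<in>?B. \<beta> (a' * b') * (X * (?d a' (w (Tgt f)) * ?d b' (w (Src f))) * ?r))
      = X * (\<Sum>a'\<in>?B. \<Sum>b'\<in>?B. \<beta> (a' * b') * (?d a' (w (Tgt f)) * ?d b' (w (Src f)))) * ?r" for X
      by (simp only: sum_distrib_left sum_distrib_right mult_ac)
    note inner = this
    show ?thesis
      unfolding inner lin_contract2[OF \<beta>] by (simp only: merge_def sum_distrib_right mult.assoc)
  qed
  also have "\<dots> = \<alpha> (merge w e) * \<beta> (merge w f) * ?r"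
    by (simp only: lin_contract2[OF \<alpha>] merge_def mult.assoc)
  also have "\<dots> = ev U (Gstar H G (demb2 H E e f (dten H {1,2} (legs [\<alpha>, \<beta>])))) w"
    by (simp add: ev_Gstar_demb2 e ev_dten2 \<alpha> \<beta>)
  finally show "ev U (M (Gstar H G (demb1 H E e \<alpha>)) (Gstar H G (demb1 H E f \<beta>))) w = \<dots>" .
qed

lemma pM_commute:
  assumes e: "e \<in> E" "f \<in> E" "e \<noteq> f" and \<alpha>: "lin \<alpha>" and \<beta>: "lin \<beta>"
    and disj: "{tail G e, head G e} \<inter> {tail G f, head G f} = {}"
  shows "pM (demb1 H E e \<alpha>) (demb1 H E f \<beta>) = pM (demb1 H E f \<beta>) (demb1 H E e \<alpha>)"
proof -
  have "demb2 H E e f (dten H {1,2} (legs [\<alpha>, \<beta>])) = demb2 H E f e (dten H {1,2} (legs [\<beta>, \<alpha>]))"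
    by (rule tpow_ext[OF finite_E demb2_tpow demb2_tpow])
      (use e \<alpha> \<beta> in \<open>simp add: ev_demb2 finite_E ev_dten2 insert_commute\<close>)
  then show ?thesis using assms by (simp add: pM_disjoint Int_commute)
qed

lemma ev_aact_single:
  assumes v: "v \<in> V" and y: "y \<in> P v" and eps: "\<And>x. x \<in> P v \<Longrightarrow> x \<noteq> y \<Longrightarrow> \<alpha> x = eps" and l: "lin (\<alpha> y)"
  shows "ev (P v) (aact v (dten H (P v) \<alpha>) h) w
    = (\<Prod>x\<in>P v. (\<alpha>(y := \<lambda>a. \<alpha> y (ac (is_out y) h a))) x (w x))"
proof -
  have "lin (\<alpha> x)" if "x \<in> P v" for x
    using eps[OF that] l lin_eps by (cases "x = y") auto
  then have "ev (P v) (aact v (dten H (P v) \<alpha>) h) w = vertex.vact H is_out (cil v) (vertex.pf (P v) \<alpha>) h w"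
    by (rule ev_aact[OF v])
  also have "\<dots> = vertex.pf (P v) (\<alpha>(y := \<lambda>a. \<alpha> y (ac (is_out y) h a))) w"
    unfolding set_cil[OF v, symmetric]
    by (rule vertex.vact_single[OF vertex[OF v] distinct_cil[OF v]]) (use y eps l in \<open>simp_all add: set_cil[OF v]\<close>)
  finally show ?thesis unfolding vertex.pf_def[OF vertex[OF v]] .
qed

lemma ev_aact_unit:
  assumes v: "v \<in> V" and eps: "\<And>x. x \<in> P v \<Longrightarrow> \<alpha> x = eps"
  shows "ev (P v) (aact v (dten H (P v) \<alpha>) h) w = eps h * (\<Prod>x\<in>P v. \<alpha> x (w x))"
proof -
  have "ev (P v) (aact v (dten H (P v) \<alpha>) h) w = vertex.vact H is_out (cil v) (vertex.pf (P v) \<alpha>) h w"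
    by (rule ev_aact[OF v]) (simp add: eps lin_eps)
  also have "\<dots> = eps h * vertex.pf (P v) \<alpha> w"
    unfolding set_cil[OF v, symmetric]
    by (subst vertex.vact_unit[OF vertex[OF v] distinct_cil[OF v]]) (simp_all add: set_cil[OF v] eps)
  finally show ?thesis unfolding vertex.pf_def[OF vertex[OF v]] .
qed

text \<open>For an edge that is not a loop each vertex sees at most one nontrivial end, so the action is computed end by end.\<close>

lemma pL_nonloop:
  assumes e: "e \<in> E" "tail G e \<noteq> head G e" and \<alpha>: "lin \<alpha>"
  shows "ev E (pL (demb1 H E e \<alpha>) (kten H V h)) (\<lambda>z. if z = e then k else 1)
    = \<alpha> (h (head G e) * k * anti (h (tail G e))) * (\<Prod>v\<in>V - {tail G e, head G e}. eps (h v))"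
proof -
  let ?r = "\<Prod>v\<in>V - {tail G e, head G e}. eps (h v)"
  let ?w = "\<lambda>x. case x of Tgt z \<Rightarrow> if z = e then k else 1 | Src z \<Rightarrow> 1"
  let ?d = "dual_basis H" and ?B = "basis H"
  have w: "merge ?w = (\<lambda>z. if z = e then k else 1)" by (rule ext) (simp add: merge_def)
  have *: "ev U (L (dten H U (on_edge e A B)) (kten H V h)) ?w = A (h (head G e) * k) * B (anti (h (tail G e))) * ?r"
    if A: "lin A" and B: "lin B" for A B
  proof -
    let ?A = "\<lambda>a. A (h (head G e) * a)" and ?B = "\<lambda>a. B (a * anti (h (tail G e)))"
    have l: "lin ?A" "lin ?B" using A B by (simp_all add: lin_mult)
    have "ev (P v) (aact v (dten H (P v) (on_edge e A B)) (h v)) ?w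
        = (if v \<in> {tail G e, head G e} then 1 else eps (h v)) * ev (P v) (dten H (P v) (on_edge e ?A ?B)) ?w"
      if v: "v \<in> V" for v
    proof -
      have ev: "ev (P v) (dten H (P v) (on_edge e ?A ?B)) ?w = (\<Prod>x\<in>P v. on_edge e ?A ?B x (?w x))"
        by (simp only: ev_dten[OF finite_P[OF v] lin_on_edge[OF l]])
      consider "v = head G e" | "v = tail G e" | "v \<noteq> head G e" "v \<noteq> tail G e" by blast
      then show ?thesis
      proof cases
        case 1
        then have n: "Tgt e \<in> P v" "Src e \<notin> P v" using e by (auto simp: ends_at_def)
        have "ev (P v) (aact v (dten H (P v) (on_edge e A B)) (h v)) ?w = (\<Prod>x\<in>P v.
            ((on_edge e A B)(Tgt e := \<lambda>a. on_edge e A B (Tgt e) (ac (is_out (Tgt e)) (h v) a))) x (?w x))"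
          by (rule ev_aact_single[OF v n(1)]) (use n A in \<open>auto simp: on_edge_def\<close>)
        also have "\<dots> = (\<Prod>x\<in>P v. on_edge e ?A ?B x (?w x))"
          using n(2) 1 by (intro prod.cong refl) (auto simp: on_edge_def ac_def om_def)
        finally show ?thesis unfolding ev using 1 by simp
      next
        case 2
        then have n: "Src e \<in> P v" "Tgt e \<notin> P v" using e by (auto simp: ends_at_def)
        have "ev (P v) (aact v (dten H (P v) (on_edge e A B)) (h v)) ?w = (\<Prod>x\<in>P v.
            ((on_edge e A B)(Src e := \<lambda>a. on_edge e A B (Src e) (ac (is_out (Src e)) (h v) a))) x (?w x))"
          by (rule ev_aact_single[OF v n(1)]) (use n B in \<open>auto simp: on_edge_def\<close>)
        also have "\<dots> = (\<Prod>x\<in>P v. on_edge e ?A ?B x (?w x))"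
          using n(2) 2 by (intro prod.cong refl) (auto simp: on_edge_def ac_def om_def)
        finally show ?thesis unfolding ev using 2 by simp
      next
        case 3
        then have n: "Tgt e \<notin> P v" "Src e \<notin> P v" by (auto simp: ends_at_def)
        have "ev (P v) (aact v (dten H (P v) (on_edge e A B)) (h v)) ?w = eps (h v) * (\<Prod>x\<in>P v. on_edge e A B x (?w x))"
          by (rule ev_aact_unit[OF v]) (use n in \<open>auto simp: on_edge_def\<close>)
        also have "(\<Prod>x\<in>P v. on_edge e A B x (?w x)) = (\<Prod>x\<in>P v. on_edge e ?A ?B x (?w x))"
          using n by (intro prod.cong refl) (auto simp: on_edge_def)
        finally show ?thesis unfolding ev using 3 by simp
      qed
    qed
    then have "ev U (L (dten H U (on_edge e A B)) (kten H V h)) ?w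
        = (\<Prod>v\<in>V. if v \<in> {tail G e, head G e} then 1 else eps (h v)) * ev U (dten H U (on_edge e ?A ?B)) ?w"
      unfolding L_dten dten_fam[of "on_edge e ?A ?B"] ev_fam_U by (simp add: prod.distrib)
    also have "(\<Prod>v\<in>V. if v \<in> {tail G e, head G e} then 1 else eps (h v)) = ?r"
      using finite_V by (intro prod.mono_neutral_cong_right) auto
    also have "ev U (dten H U (on_edge e ?A ?B)) ?w = A (h (head G e) * k) * B (anti (h (tail G e)))"
      unfolding ev_on_edge[OF e(1) l] w by (simp add: counit_one)
    finally show ?thesis by (simp only: mult.commute)
  qed
  have "L (Gstar H G (demb1 H E e \<alpha>)) (kten H V h)
      = (\<Sum>a\<in>?B. \<Sum>b\<in>?B. fscale (\<alpha> (a * b)) (L (dten H U (on_edge e (?d a) (?d b))) (kten H V h)))"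
    unfolding Gstar_demb1[OF e(1) \<alpha>] by (rule linear_on_sum2[OF L_linear(2)]) (rule dten_tpow)
  then have "ev U (L (Gstar H G (demb1 H E e \<alpha>)) (kten H V h)) ?w
      = (\<Sum>a\<in>?B. \<Sum>b\<in>?B. \<alpha> (a * b) * (?d a (h (head G e) * k) * ?d b (anti (h (tail G e))) * ?r))"
    by (simp only: ev_sum ev_fscale *[OF lin_dual_basis lin_dual_basis])
  also have "\<dots> = (\<Sum>a\<in>?B. \<Sum>b\<in>?B. \<alpha> (a * b) * (?d a (h (head G e) * k) * ?d b (anti (h (tail G e))))) * ?r"
    by (simp only: sum_distrib_right mult.assoc)
  also have "\<dots> = \<alpha> (h (head G e) * k * anti (h (tail G e))) * ?r"
    by (simp only: lin_contract2[OF \<alpha>])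
  finally show ?thesis
    using Gstar_pL[OF demb1_tpow kten_tpow, of e \<alpha> h] ev_Gstar[of "pL (demb1 H E e \<alpha>) (kten H V h)" ?w] w by simp
qed

end

section \<open>The gauge theories on the vertex neighbourhoods\<close>

context hopf_algebra
begin

lemma demb2_sum:
  assumes "finite X" "x \<in> X" "y \<in> X" "x \<noteq> y"
  shows "demb2 H X x y (\<Sum>i\<in>I. fscale (c i) (T i)) = (\<Sum>i\<in>I. fscale (c i) (demb2 H X x y (T i)))"
  by (rule tpow_ext[OF assms(1) demb2_tpow])
    (intro tpow_sum tpow_fscale demb2_tpow, simp only: ev_demb2[OF assms] ev_sum ev_fscale sum_distrib_right mult.assoc)

lemma family_tensor_singleton:
  assumes "T \<in> tpow H X" shows "family_tensor H {i} (\<lambda>_. X) (\<lambda>_. T) = T"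
proof (rule tpow_eqI[OF _ assms])
  show "family_tensor H {i} (\<lambda>_. X) (\<lambda>_. T) \<in> tpow H X" by (simp add: family_tensor_def tpow_def)
  fix b assume b: "b \<in> multi_idx H X"
  then have "restrict b X = b" by (auto simp: multi_idx_def extensional_restrict)
  with b show "family_tensor H {i} (\<lambda>_. X) (\<lambda>_. T) b = T b" by (simp add: family_tensor_def)
qed

context
  fixes X :: "'x set" and i :: "'v" and m act
  assumes X: "finite X" and alg: "kmodule_algebra X m act"
begin

text \<open>A tensor product over one index is the single factor. This turns the \<open>K\<close>-module algebra at a vertex into a module algebra over the tensor power of \<open>K\<close> that belongs to one vertex.\<close>

lemma family_action_singleton:
  assumes S: "S \<in> tpow H X"
  shows "family_action H {i} (\<lambda>_. X) (\<lambda>_. act) S (kten H {i} h) = act S (h i)"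
proof -
  have "family_action H {i} (\<lambda>_. X) (\<lambda>_. act) (family_tensor H {i} (\<lambda>_. X) (\<lambda>_. S)) (kten H {i} h)
    = family_tensor H {i} (\<lambda>_. X) (\<lambda>v. act S (h v))"
    by (rule fam_action[where m = "\<lambda>_. m"]) (use X alg S in auto)
  also have "\<dots> = family_tensor H {i} (\<lambda>_. X) (\<lambda>_. act S (h i))" by (auto simp: family_tensor_def)
  also have "\<dots> = act S (h i)" using alg S by (intro family_tensor_singleton) (simp add: kmodule_algebra_def)
  finally show ?thesis by (simp only: family_tensor_singleton[OF S])
qed

lemma family_mult_singleton:
  assumes S: "S \<in> tpow H X" and T: "T \<in> tpow H X"
  shows "family_mult H {i} (\<lambda>_. X) (\<lambda>_. m) S T = m S T"
proof -
  have "family_mult H {i} (\<lambda>_. X) (\<lambda>_. m) (family_tensor H {i} (\<lambda>_. X) (\<lambda>_. S)) (family_tensor H {i} (\<lambda>_. X) (\<lambda>_. T))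
    = family_tensor H {i} (\<lambda>_. X) (\<lambda>_. m S T)"
    by (rule fam_mult[where act = "\<lambda>_. act"]) (use X alg S T in auto)
  also have "\<dots> = m S T" using alg S T by (intro family_tensor_singleton) (simp add: kmodule_algebra_def dual_algebra_def)
  finally show ?thesis by (simp only: family_tensor_singleton[OF S] family_tensor_singleton[OF T])
qed

lemma right_module_algebra_singleton:
  "right_module_algebra H {i} X m (family_action H {i} (\<lambda>_. X) (\<lambda>_. act))"
proof (rule right_module_algebra_cong)
  have "right_module_algebra H {i} (\<Union>v\<in>{i}. X) (family_mult H {i} (\<lambda>_. X) (\<lambda>_. m)) (family_action H {i} (\<lambda>_. X) (\<lambda>_. act))"
    by (rule family_right_module_algebra) (use X alg in auto)
  then show "right_module_algebra H {i} X (family_mult H {i} (\<lambda>_. X) (\<lambda>_. m)) (family_action H {i} (\<lambda>_. X) (\<lambda>_. act))"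
    by simp
qed (simp_all add: family_mult_singleton)

end

end

context gauge_graph
begin

lemma right_module_E: "right_module H V E pL" and dual_algebra_E: "dual_algebra H E pM"
  using right_module_algebra_E by (simp_all add: right_module_algebra_def)

lemma gauge_theory: "hopf_gauge_theory H G V pM (transpose_action E pL)"
  unfolding hopf_gauge_theory_def Let_def
proof (intro conjI ballI allI impI)
  show "dual_algebra H E pM" by (rule dual_algebra_E)
  show "left_module H V E (transpose_action E pL)"
    by (rule transpose_left_module[OF finite_E finite_V right_module_E])
  show "right_module_algebra H V E pM (dual_action H E (transpose_action E pL))"
    by (rule right_module_algebra_cong[OF finite_V refl _ right_module_algebra_E])
      (rule dual_transpose[OF finite_E finite_V right_module_E, symmetric])
next
  fix \<alpha> \<beta> e assume "\<alpha> \<in> dual_space H" "\<beta> \<in> dual_space H" "e \<in> E"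
  then show "pM (demb1 H E e \<alpha>) (demb1 H E e \<beta>) \<in> demb1 H E e ` dual_space H"
    by (intro pM_same_edge) (simp_all add: lin_dual)
next
  fix \<alpha> \<beta> e f assume a: "\<alpha> \<in> dual_space H" "\<beta> \<in> dual_space H" and e: "e \<in> E" "f \<in> E" "e \<noteq> f"
  have l: "lin \<alpha>" "lin \<beta>" using a by (simp_all add: lin_dual)
  show "pM (demb1 H E e \<alpha>) (demb1 H E f \<beta>) \<in> demb2 H E e f ` tpow H {1,2}"
    by (rule pM_two_edges[OF e l])
  assume d: "{tail G e, head G e} \<inter> {tail G f, head G f} = {}"
  show "pM (demb1 H E e \<alpha>) (demb1 H E f \<beta>) = pM (demb1 H E f \<beta>) (demb1 H E e \<alpha>)"
    by (rule pM_commute[OF e l d])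
  show "pM (demb1 H E e \<alpha>) (demb1 H E f \<beta>) = demb2 H E e f (dten H {1,2} (legs [\<alpha>, \<beta>]))"
    by (rule pM_disjoint[OF e l d])
next
  fix e h k
  assume e: "e \<in> E" "tail G e \<noteq> head G e"
  note proj = kproj_transpose[OF finite_E finite_V right_module_E e(1), folded kemb1_def]
  have ev: "ev E (pL (demb1 H E e \<alpha>) (kemb1 H V v h)) (\<lambda>z. if z = e then k else 1)
      = \<alpha> ((if head G e = v then h else 1) * k * anti (if tail G e = v then h else 1))
        * (\<Prod>u\<in>V - {tail G e, head G e}. eps (if u = v then h else 1))" if "lin \<alpha>" for \<alpha> v
    unfolding kemb1_def by (rule pL_nonloop[OF e that])
  {
    fix v assume v: "v \<in> V - {tail G e, head G e}"
    have "(\<Prod>u\<in>V - {tail G e, head G e}. eps (if u = v then h else 1)) = eps h"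
      using v finite_V by (subst prod.remove[of _ v]) (simp_all add: counit_one)
    then show "kproj H E e (transpose_action E pL (kemb1 H V v h) (kemb1 H E e k)) = smult H (eps h) k"
      using v unfolding kemb1_def[of H E e k] kemb1_def[of H V v h]
      by (intro kproj_transpose[OF finite_E finite_V right_module_E e(1)])
        (subst ev[unfolded kemb1_def], assumption, auto simp: anti_one lin_eqs)
  }
  show "kproj H E e (transpose_action E pL (kemb1 H V (head G e) h) (kemb1 H E e k)) = h * k"
    unfolding kemb1_def[of H E e k] kemb1_def[of H V "head G e" h]
    by (intro kproj_transpose[OF finite_E finite_V right_module_E e(1)])
      (subst ev[unfolded kemb1_def], assumption, use e in \<open>auto simp: anti_one counit_one intro!: prod.neutral\<close>)
  show "kproj H E e (transpose_action E pL (kemb1 H V (tail G e) h) (kemb1 H E e k)) = k * anti h"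
    unfolding kemb1_def[of H E e k] kemb1_def[of H V "tail G e" h]
    by (intro kproj_transpose[OF finite_E finite_V right_module_E e(1)])
      (subst ev[unfolded kemb1_def], assumption, use e in \<open>auto simp: counit_one intro!: prod.neutral\<close>)
qed

lemma amult_same_end:
  assumes "v \<in> V" "x \<in> P v" "lin \<alpha>" "lin \<beta>"
  shows "amult v (demb1 H (P v) x \<alpha>) (demb1 H (P v) x \<beta>) \<in> demb1 H (P v) x ` dual_space H"
proof -
  let ?\<gamma> = "\<lambda>p. sw2 (quasitriangular.dl H (R v) (is_out x) (is_sel x) p) (\<lambda>a b. \<alpha> a * \<beta> b)"
  have "lin ?\<gamma>" using quasitriangular.dl_lin[OF vertex[OF assms(1), unfolded vertex_def]] by (simp add: lin_def)
  moreover have "amult v (demb1 H (P v) x \<alpha>) (demb1 H (P v) x \<beta>) = demb1 H (P v) x ?\<gamma>"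
    unfolding set_cil[OF assms(1), symmetric]
    by (rule vertex.vmult_same[OF vertex[OF assms(1)] distinct_cil[OF assms(1)] tau sigma])
      (use assms in \<open>simp_all add: set_cil\<close>)
  ultimately show ?thesis by (simp add: lin_dual)
qed

text \<open>The relations give the product explicitly. For ends in decreasing order it is a sum over the legs of \<open>R\<close>, whose terms are all supported at the two ends.\<close>

lemma amult_two_ends:
  assumes v: "v \<in> V" and x: "x \<in> P v" and y: "y \<in> P v" and xy: "x \<noteq> y" and \<alpha>: "lin \<alpha>" and \<beta>: "lin \<beta>"
  shows "amult v (demb1 H (P v) x \<alpha>) (demb1 H (P v) y \<beta>) \<in> demb2 H (P v) x y ` tpow H {1,2}"
proof -
  obtain i j where i: "i < length (cil v)" "cil v ! i = x" and j: "j < length (cil v)" "cil v ! j = y"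
    using x y set_cil[OF v] by (metis in_set_conv_nth)
  note fP = finite_P[OF v]
  have d2: "demb2 H (P v) x y (dten H {1,2} (legs [\<gamma>, \<delta>])) = dten H (P v) (\<lambda>z. if z = x then \<gamma> else if z = y then \<delta> else eps)"
    if "lin \<gamma>" "lin \<delta>" for \<gamma> \<delta>
    by (rule demb2_dten) (use fP x y xy that in auto)
  consider "i < j" | "j < i" using i j xy by (metis nat_neq_iff)
  then show ?thesis
  proof cases
    case 1
    have "amult v (demb1 H (P v) x \<alpha>) (demb1 H (P v) y \<beta>) = dten H (P v) (\<lambda>z. if z = x then \<alpha> else if z = y then \<beta> else eps)"
      unfolding set_cil[OF v, symmetric] i(2)[symmetric] j(2)[symmetric]
      by (rule vertex.vmult_before[OF vertex[OF v] distinct_cil[OF v]], rule tau, rule sigma) (fact i(1) j(1) 1 \<alpha> \<beta>)+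
    also have "\<dots> = demb2 H (P v) x y (dten H {1,2} (legs [\<alpha>, \<beta>]))" by (rule d2[OF \<alpha> \<beta>, symmetric])
    finally show ?thesis using dten_tpow by blast
  next
    case 2
    let ?\<alpha> = "\<lambda>b a. \<alpha> (ac (is_out x) (b 2) a)" and ?\<beta> = "\<lambda>b a. \<beta> (ac (is_out y) (b 1) a)"
    let ?T = "\<Sum>b\<in>multi_idx H {1,2::nat}. fscale (R v b) (dten H {1,2} (legs [?\<alpha> b, ?\<beta> b])) :: (nat, 'k, 'f) tensor"
    have l: "lin (?\<alpha> b)" "lin (?\<beta> b)" for b :: "nat \<Rightarrow> 'k"
      using \<alpha> \<beta> by (simp_all add: lin_def ac_lin)
    have "amult v (demb1 H (P v) x \<alpha>) (demb1 H (P v) y \<beta>) = (\<Sum>b\<in>multi_idx H {1,2}. fscale (R v b)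
        (dten H (P v) (\<lambda>z. if z = y then ?\<beta> b else if z = x then ?\<alpha> b else eps)))"
      unfolding set_cil[OF v, symmetric] i(2)[symmetric] j(2)[symmetric]
      by (rule vertex.vmult_after(1)[OF vertex[OF v] distinct_cil[OF v]], rule tau, rule sigma) (fact i(1) 2 \<alpha> \<beta>)+
    also have "\<dots> = (\<Sum>b\<in>multi_idx H {1,2}. fscale (R v b) (demb2 H (P v) x y (dten H {1,2} (legs [?\<alpha> b, ?\<beta> b]))))"
      unfolding d2[OF l] using xy by (intro sum.cong refl arg_cong[where f = "fscale _"] dten_cong) simp
    also have "\<dots> = demb2 H (P v) x y ?T"
      by (rule demb2_sum[OF fP x y xy, symmetric])
    moreover have "?T \<in> tpow H {1,2}" by (intro tpow_sum tpow_fscale dten_tpow)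
    ultimately show ?thesis by simp
  qed
qed

abbreviation "nact v \<equiv> family_action H {None :: 'e edge_end option} (\<lambda>_. P v) (\<lambda>_. aact v)"

lemma right_module_algebra_nbhd: "v \<in> V \<Longrightarrow> right_module_algebra H {None} (P v) (amult v) (nact v)"
  by (rule right_module_algebra_singleton[OF finite_P kmodule])

lemma nact_kten: "v \<in> V \<Longrightarrow> S \<in> tpow H (P v) \<Longrightarrow> nact v S (kten H {None} h) = aact v S (h None)"
  by (rule family_action_singleton[OF finite_P kmodule])

text \<open>All edges of a vertex neighbourhood meet the central vertex, so the condition on edges without a common vertex is empty, and no edge is a loop.\<close>

lemma vertex_gauge_theory:
  assumes v: "v \<in> V"
  shows "hopf_gauge_theory H (vertex_nbhd G v) {None} (amult v) (transpose_action (P v) (nact v))"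
proof -
  have r: "right_module H {None} (P v) (nact v)" and d: "dual_algebra H (P v) (amult v)"
    using right_module_algebra_nbhd[OF v] by (simp_all add: right_module_algebra_def)
  have None: "finite {None :: 'e edge_end option}" by simp
  note fP = finite_P[OF v]
  have N: "arcs (vertex_nbhd G v) = P v" "tail (vertex_nbhd G v) (Src e) = None" "tail (vertex_nbhd G v) (Tgt e) = Some (Tgt e)"
    "head (vertex_nbhd G v) (Src e) = Some (Src e)" "head (vertex_nbhd G v) (Tgt e) = None" for e
    by (simp_all add: vertex_nbhd_def)
  have Nc: "None \<in> {tail (vertex_nbhd G v) x, head (vertex_nbhd G v) x}" for x by (cases x) (simp_all add: N)
  have proj: "kproj H (P v) x (transpose_action (P v) (nact v) (kemb1 H {None} None h) (kemb1 H (P v) x k)) = ac (is_out x) h k"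
    if x: "x \<in> P v" for x h k
    unfolding kemb1_def
  proof (rule kproj_transpose[OF fP None r x])
    fix \<alpha> assume \<alpha>: "lin \<alpha>"
    let ?\<alpha> = "\<lambda>z. if z = x then \<alpha> else eps"
    have "ev (P v) (nact v (demb1 H (P v) x \<alpha>) (kten H {None} (\<lambda>z. if z = None then h else 1))) (\<lambda>z. if z = x then k else 1)
      = ev (P v) (aact v (dten H (P v) ?\<alpha>) h) (\<lambda>z. if z = x then k else 1)"
      by (simp add: nact_kten[OF v demb1_tpow]) (simp add: demb1_def)
    also have "\<dots> = (\<Prod>y\<in>P v. (?\<alpha>(x := \<lambda>a. ?\<alpha> x (ac (is_out x) h a))) y (if y = x then k else 1))"
      by (rule ev_aact_single[OF v x]) (use \<alpha> in auto)
    also have "\<dots> = \<alpha> (ac (is_out x) h k)"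
      using fP x by (subst prod.remove[of _ x]) (simp_all add: counit_one)
    finally show "ev (P v) (nact v (demb1 H (P v) x \<alpha>) (kten H {None} (\<lambda>z. if z = None then h else 1))) (\<lambda>z. if z = x then k else 1)
      = \<alpha> (ac (is_out x) h k)" .
  qed
  show ?thesis
    unfolding hopf_gauge_theory_def Let_def N(1)
  proof (intro conjI ballI allI impI)
    show "dual_algebra H (P v) (amult v)" by (rule d)
    show "left_module H {None} (P v) (transpose_action (P v) (nact v))"
      by (rule transpose_left_module[OF fP None r])
    show "right_module_algebra H {None} (P v) (amult v) (dual_action H (P v) (transpose_action (P v) (nact v)))"
      by (rule right_module_algebra_cong[OF None refl _ right_module_algebra_nbhd[OF v]])
        (rule dual_transpose[OF fP None r, symmetric])
  next
    fix \<alpha> \<beta> x assume "\<alpha> \<in> dual_space H" "\<beta> \<in> dual_space H" "x \<in> P v"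
    then show "amult v (demb1 H (P v) x \<alpha>) (demb1 H (P v) x \<beta>) \<in> demb1 H (P v) x ` dual_space H"
      by (intro amult_same_end[OF v]) (simp_all add: lin_dual)
  next
    fix \<alpha> \<beta> x y assume "\<alpha> \<in> dual_space H" "\<beta> \<in> dual_space H" "x \<in> P v" "y \<in> P v" "x \<noteq> y"
    then show "amult v (demb1 H (P v) x \<alpha>) (demb1 H (P v) y \<beta>) \<in> demb2 H (P v) x y ` tpow H {1,2}"
      by (intro amult_two_ends[OF v]) (simp_all add: lin_dual)
    assume "{tail (vertex_nbhd G v) x, head (vertex_nbhd G v) x} \<inter> {tail (vertex_nbhd G v) y, head (vertex_nbhd G v) y} = {}"
    then have False using Nc by blast
    then show "amult v (demb1 H (P v) x \<alpha>) (demb1 H (P v) y \<beta>) = amult v (demb1 H (P v) y \<beta>) (demb1 H (P v) x \<alpha>)"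
      "amult v (demb1 H (P v) x \<alpha>) (demb1 H (P v) y \<beta>) = demb2 H (P v) x y (dten H {1,2} (legs [\<alpha>, \<beta>]))" by simp_all
  next
    fix x h k u assume "u \<in> {None} - {tail (vertex_nbhd G v) x, head (vertex_nbhd G v) x}"
    then have False using Nc by blast
    then show "kproj H (P v) x (transpose_action (P v) (nact v) (kemb1 H {None} u h) (kemb1 H (P v) x k)) = smult H (eps h) k" by simp
  next
    fix x h k assume x: "x \<in> P v" and "head (vertex_nbhd G v) x \<in> {None}"
    then have "head (vertex_nbhd G v) x = None" "\<not> is_out x" by (cases x; simp add: N)+
    then show "kproj H (P v) x (transpose_action (P v) (nact v) (kemb1 H {None} (head (vertex_nbhd G v) x) h) (kemb1 H (P v) x k)) = h * k"
      by (simp only: proj[OF x]) (simp add: ac_def om_def)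
  next
    fix x h k assume x: "x \<in> P v" and "tail (vertex_nbhd G v) x \<in> {None}"
    then have "tail (vertex_nbhd G v) x = None" "is_out x" by (cases x; simp add: N)+
    then show "kproj H (P v) x (transpose_action (P v) (nact v) (kemb1 H {None} (tail (vertex_nbhd G v) x) h) (kemb1 H (P v) x k)) = k * anti h"
      by (simp only: proj[OF x]) (simp add: ac_def om_def)
  qed
qed

lemma local: "local_wrt H G pM (transpose_action E pL) amult aact"
  unfolding local_wrt_def
proof (intro conjI ballI)
  fix v assume v: "v \<in> V"
  have r: "right_module H {None} (P v) (nact v)"
    using right_module_algebra_nbhd[OF v] by (simp add: right_module_algebra_def)
  have "dual_action H (P v) (transpose_action (P v) (nact v)) S (kemb1 H {None} None h) = aact v S h"
    if S: "S \<in> tpow H (P v)" for S h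
    unfolding kemb1_def
    by (subst dual_transpose[OF finite_P[OF v] _ r S kten_tpow]) (simp_all add: nact_kten[OF v S])
  then show "\<exists>rhdv. hopf_gauge_theory H (vertex_nbhd G v) {None} (amult v) rhdv \<and>
      (\<forall>S\<in>tpow H (P v). \<forall>h. dual_action H (P v) rhdv S (kemb1 H {None} None h) = aact v S h)"
    using vertex_gauge_theory[OF v] by blast
next
  show "Gstar H G (dunit H E) = dunit H U" by (rule Gstar_dunit)
next
  fix S T assume "S \<in> tpow H E" "T \<in> tpow H E"
  then show "Gstar H G (pM S T) = M (Gstar H G S) (Gstar H G T)" using Gstar_pM by blast
next
  fix S h assume t: "S \<in> tpow H E" "h \<in> tpow H V"
  then show "Gstar H G (dual_action H E (transpose_action E pL) S h) = L (Gstar H G S) h"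
    using Gstar_pL by (simp add: dual_transpose[OF finite_E finite_V right_module_E])
qed

end

lemma family_mult_cong:
  assumes "\<And>v. v \<in> V \<Longrightarrow> m v = m' v"
  shows "family_mult H V P m = family_mult H V P m'"
  unfolding family_mult_def
  by (rule ext, rule ext, intro sum.cong refl arg_cong[where f = "fscale _"] family_tensor_cong) (simp add: assms)

lemma family_action_cong:
  assumes "\<And>v S h. v \<in> V \<Longrightarrow> S \<in> tpow H (P v) \<Longrightarrow> act v S h = act' v S h"
  shows "family_action H V P act = family_action H V P act'"
  unfolding family_action_def
proof (rule ext, rule ext, intro sum.cong refl arg_cong[where f = "fscale _"] family_tensor_cong assms)
  fix c v assume "c \<in> multi_idx H (\<Union>v\<in>V. P v)" "v \<in> V"
  then show "btens (restrict c (P v)) \<in> tpow H (P v)" by (auto simp: tpow_def btens_def multi_idx_def)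
qed

text \<open>The vertex multiplication and action are characterised on the tensor powers only, and locality uses them only there.\<close>

lemma local_wrt_cong:
  assumes "\<And>v. v \<in> verts G \<Longrightarrow> A v = A' v"
    and "\<And>v S h. v \<in> verts G \<Longrightarrow> S \<in> tpow H (ends_at G v) \<Longrightarrow> act v S h = act' v S h"
    and "local_wrt H G m rhd A' act'"
  shows "local_wrt H G m rhd A act"
  using assms family_mult_cong[of "verts G" A A' H "ends_at G"] family_action_cong[of "verts G" H "ends_at G" act act']
  by (simp add: local_wrt_def)

theorem theorem2:
  fixes H :: "('f::field_char_0, 'k::ring_1) hopf_data"
    and G :: "('v, 'e) pre_digraph"
    and cil :: "'v \<Rightarrow> 'e edge_end list"
    and R :: "'v \<Rightarrow> (nat, 'k, 'f) tensor"
    and \<rho> :: "'e \<Rightarrow> 'e edge_end"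
    and A :: "'v \<Rightarrow> ('e edge_end, 'k, 'f) tensor \<Rightarrow> ('e edge_end, 'k, 'f) tensor \<Rightarrow> ('e edge_end, 'k, 'f) tensor"
    and act :: "'v \<Rightarrow> ('e edge_end, 'k, 'f) tensor \<Rightarrow> 'k \<Rightarrow> ('e edge_end, 'k, 'f) tensor"
    and M :: "('e edge_end, 'k, 'f) tensor \<Rightarrow> ('e edge_end, 'k, 'f) tensor \<Rightarrow> ('e edge_end, 'k, 'f) tensor"
    and L :: "('e edge_end, 'k, 'f) tensor \<Rightarrow> ('v, 'k, 'f) tensor \<Rightarrow> ('e edge_end, 'k, 'f) tensor"
  assumes "ribbon_hopf_algebra H"
    and "ciliated_ribbon_graph G cil"
    and "\<And>v. v \<in> verts G \<Longrightarrow> R_matrix H (R v)"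
    and "\<And>e. e \<in> arcs G \<Longrightarrow> \<rho> e = Src e \<or> \<rho> e = Tgt e"
  defines "A \<equiv> \<lambda>v. vertex_mult H (R v) (cil v) end_tau (end_sigma G \<rho>)"
    and "act \<equiv> \<lambda>v. vertex_action H (cil v) end_tau"
    and "M \<equiv> family_mult H (verts G) (ends_at G) A"
    and "L \<equiv> family_action H (verts G) (ends_at G) act"
  shows "linear_on (tpow H (arcs G)) (Gstar H G)
    \<and> Gstar H G ` tpow H (arcs G) \<subseteq> tpow H (all_ends G)
    \<and> inj_on (Gstar H G) (tpow H (arcs G))
    \<and> dunit H (all_ends G) \<in> Gstar H G ` tpow H (arcs G)
    \<and> (\<forall>S \<in> Gstar H G ` tpow H (arcs G). \<forall>T \<in> Gstar H G ` tpow H (arcs G).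
         M S T \<in> Gstar H G ` tpow H (arcs G))
    \<and> (\<forall>S \<in> Gstar H G ` tpow H (arcs G). \<forall>h \<in> tpow H (verts G).
         L S h \<in> Gstar H G ` tpow H (arcs G))
    \<and> (\<exists>rhd.
         (\<forall>S \<in> tpow H (arcs G). \<forall>h \<in> tpow H (verts G).
            dual_action H (arcs G) rhd S h = pullback_action H G L S h)
         \<and> local_hopf_gauge_theory H G (pullback_mult H G M) rhd
         \<and> local_wrt H G (pullback_mult H G M) rhd A act)"
proof -
  interpret hopf_algebra H using assms(1) by (simp add: ribbon_hopf_algebra_def)
  interpret g: gauge_graph H G cil R \<rho>
    by (intro gauge_graph.intro ribbon_graph.intro ribbon_graph_axioms.intro gauge_graph_axioms.intro hopf_algebra_axioms)
      (use assms(2-4) in \<open>auto simp: ciliated_ribbon_graph_def\<close>)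
  have A: "A v = g.amult v" if "v \<in> verts G" for v
    unfolding A_def by (rule g.amult_eq[OF that])
  have act: "act v S h = g.aact v S h" if "v \<in> verts G" "S \<in> tpow H (ends_at G v)" for v S h
    unfolding act_def by (rule g.aact_eq[OF that])
  have M: "M = g.M" unfolding M_def by (rule family_mult_cong) (rule A)
  have L: "L = g.L" unfolding L_def by (rule family_action_cong) (rule act)
  let ?rhd = "transpose_action (arcs G) g.pL"
  have loc: "local_wrt H G g.pM ?rhd A act"
    by (rule local_wrt_cong[OF A act g.local])
  then have "local_hopf_gauge_theory H G g.pM ?rhd"
    using g.gauge_theory unfolding local_hopf_gauge_theory_def by blast
  moreover have "dunit H (all_ends G) \<in> Gstar H G ` tpow H (arcs G)"
    using g.Gstar_dunit[symmetric] dten_tpow unfolding dunit_def by blast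
  moreover have "\<forall>S \<in> tpow H (arcs G). \<forall>h \<in> tpow H (verts G). dual_action H (arcs G) ?rhd S h = g.pL S h"
    using dual_transpose[OF g.finite_E g.finite_V g.right_module_E] by blast
  ultimately show ?thesis
    unfolding M L using loc g.Gstar_linear g.Gstar_tpow g.Gstar_inj g.M_Img g.L_Img by blast
qed

end
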